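(* Let $A$ be a commutative or graded-commutative $\mathcal{K}_2$-algebra and let $g\in A_d$ be a regular homogeneous element of degree $d>1$. Then $A/gA$ is $\mathcal{K}_2$. In particular, any graded complete intersection is $\mathcal{K}_2$.
   Context: Conventions. $K$ is a field. A "graded algebra" is a connected $\mathbb{N}$-graded $K$-algebra of the form $A=T(V)/I$, where $V$ is a finite-dimensional $K$-vector space placed in degree 1, $T(V)$ is its tensor algebra, and $I$ is an ideal generated by a (minimal) finite set of homogeneous elements of degree at least 2 (not necessarily all of the same degree). The field $K$ is identified with the trivial $A$-module $A/A_+$. The bigraded Yoneda algebra is $E(A)=\bigoplus_{n,m} E^{n,m}(A)$ with $E^{n,m}(A)=\mathrm{Ext}_A^{n}(K,K)_{-m}$ ($n$ is the cohomological degree, $-m$ the internal degree; Ext is computed in the category of $\mathbb{Z}$-graded locally finite $A$-modules with graded Hom spaces), with the Yoneda (cup) product; $E^n(A)=\bigoplus_m E^{n,m}(A)$. The graded algebra $A$ is called $\mathcal{K}_2$ (a $\mathcal{K}_2$-algebra) if $E(A)$ is generated as an algebra by $E^1(A)$ and $E^2(A)$. Regular means not a zero divisor (on either side). Graded-commutative means $ab=(-1)^{|a||b|}ba$ for homogeneous $a,b$. A graded complete intersection is a quotient $K[x_1,\dots,x_n]/(f_1,\dots,f_m)$ of a polynomial ring with generators in degree 1 by a regular sequence of homogeneous elements $f_1,\dots,f_m$ of degree at least 2 (e.g. the homogeneous coordinate ring of a projective complete intersection). *)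

theory Defs
  imports "HOL-Library.Multiset" "HOL-Algebra.QuotRing" "HOL-Algebra.Module"
begin

section \<open>Graded algebras and graded modules\<close>

text \<open>The same record serves for graded \<open>K\<close>-algebras and for graded left modules over a graded
  algebra; in the latter case \<open>mult\<close> and \<open>one\<close> are not used. Gradings are indexed by the
  integers, so being \<open>\<nat>\<close>-graded means having no negative components.\<close>

record ('a, 'b) graded = "('a, 'b) module" +
  part :: "int \<Rightarrow> 'b set"

definition grading :: "('k, 'z) ring_scheme \<Rightarrow> ('k, 'a) graded \<Rightarrow> bool" where
  "grading K A \<longleftrightarrow>
     (\<forall>m. submodule (part A m) K A) \<and>
     (\<forall>a \<in> carrier A. \<exists>!c. (\<forall>m. c m \<in> part A m) \<and> finite {m. c m \<noteq> \<zero>\<^bsub>A\<^esub>} \<and>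
        a = (\<Oplus>\<^bsub>A\<^esub>m \<in> {m. c m \<noteq> \<zero>\<^bsub>A\<^esub>}. c m))"

definition connected_graded_algebra :: "('k, 'z) ring_scheme \<Rightarrow> ('k, 'a) graded \<Rightarrow> bool" where
  "connected_graded_algebra K A \<longleftrightarrow>
     field K \<and> ring A \<and> module K A \<and>
     (\<forall>c \<in> carrier K. \<forall>a \<in> carrier A. \<forall>b \<in> carrier A.
        (c \<odot>\<^bsub>A\<^esub> a) \<otimes>\<^bsub>A\<^esub> b = c \<odot>\<^bsub>A\<^esub> (a \<otimes>\<^bsub>A\<^esub> b) \<and>
        a \<otimes>\<^bsub>A\<^esub> (c \<odot>\<^bsub>A\<^esub> b) = c \<odot>\<^bsub>A\<^esub> (a \<otimes>\<^bsub>A\<^esub> b)) \<and>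
     grading K A \<and>
     (\<forall>i j. \<forall>a \<in> part A i. \<forall>b \<in> part A j. a \<otimes>\<^bsub>A\<^esub> b \<in> part A (i + j)) \<and>
     (\<forall>m < 0. part A m = {\<zero>\<^bsub>A\<^esub>}) \<and>
     \<one>\<^bsub>A\<^esub> \<noteq> \<zero>\<^bsub>A\<^esub> \<and> part A 0 = {c \<odot>\<^bsub>A\<^esub> \<one>\<^bsub>A\<^esub> | c. c \<in> carrier K}"

definition quot_smult :: "('k, 'm, 'z) module_scheme \<Rightarrow> 'm set \<Rightarrow> 'k \<Rightarrow> 'm set \<Rightarrow> 'm set" where
  "quot_smult M I c X = (\<Union>x \<in> X. I +>\<^bsub>M\<^esub> (c \<odot>\<^bsub>M\<^esub> x))"

definition quotient_algebra :: "('k, 'a) graded \<Rightarrow> 'a set \<Rightarrow> ('k, 'a set) graded" where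
  "quotient_algebra A I =
     \<lparr>carrier = carrier (A Quot I), monoid.mult = monoid.mult (A Quot I), one = one (A Quot I),
      zero = zero (A Quot I), add = add (A Quot I), smult = quot_smult A I,
      part = (\<lambda>m. (\<lambda>a. I +>\<^bsub>A\<^esub> a) ` part A m)\<rparr>"

definition graded_algebra_iso ::
    "('k, 'z) ring_scheme \<Rightarrow> ('k, 'a) graded \<Rightarrow> ('k, 'b) graded \<Rightarrow> ('a \<Rightarrow> 'b) set" where
  "graded_algebra_iso K A B =
     {h \<in> ring_iso A B. (\<forall>c \<in> carrier K. \<forall>a \<in> carrier A. h (c \<odot>\<^bsub>A\<^esub> a) = c \<odot>\<^bsub>B\<^esub> h a) \<and>
        (\<forall>m. h ` part A m = part B m)}"

definition finsupp :: "('r, 'z) ring_scheme \<Rightarrow> 'i set \<Rightarrow> ('i \<Rightarrow> 'r) set" where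
  "finsupp R X = {f. (\<forall>i. f i \<in> carrier R) \<and> finite {i. f i \<noteq> \<zero>\<^bsub>R\<^esub>} \<and> (\<forall>i. i \<notin> X \<longrightarrow> f i = \<zero>\<^bsub>R\<^esub>)}"

text \<open>\<open>T(V)\<close> for \<open>V\<close> with basis \<open>x\<^sub>0, \<dots>, x\<^sub>N\<^sub>-\<^sub>1\<close>: a tensor is its family of
  coefficients with respect to the words in the \<open>x\<^sub>i\<close>.\<close>

definition tensor_algebra :: "('k, 'z) ring_scheme \<Rightarrow> nat \<Rightarrow> ('k, nat list \<Rightarrow> 'k) graded" where
  "tensor_algebra K N =
     \<lparr>carrier = finsupp K (lists {..<N}),
      monoid.mult = (\<lambda>f g w. \<Oplus>\<^bsub>K\<^esub>k \<in> {..length w}. f (take k w) \<otimes>\<^bsub>K\<^esub> g (drop k w)),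
      one = (\<lambda>w. if w = [] then \<one>\<^bsub>K\<^esub> else \<zero>\<^bsub>K\<^esub>),
      zero = (\<lambda>w. \<zero>\<^bsub>K\<^esub>),
      add = (\<lambda>f g w. f w \<oplus>\<^bsub>K\<^esub> g w),
      smult = (\<lambda>c f w. c \<otimes>\<^bsub>K\<^esub> f w),
      part = (\<lambda>m. finsupp K {w \<in> lists {..<N}. int (length w) = m})\<rparr>"

text \<open>The polynomial ring \<open>K[x\<^sub>0, \<dots>, x\<^sub>n\<^sub>-\<^sub>1]\<close>; monomials are multisets of variables.\<close>

definition polynomial_algebra :: "('k, 'z) ring_scheme \<Rightarrow> nat \<Rightarrow> ('k, nat multiset \<Rightarrow> 'k) graded" where
  "polynomial_algebra K n =
     \<lparr>carrier = finsupp K {u. set_mset u \<subseteq> {..<n}},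
      monoid.mult = (\<lambda>f g u. \<Oplus>\<^bsub>K\<^esub>v \<in> {v. v \<subseteq># u}. f v \<otimes>\<^bsub>K\<^esub> g (u - v)),
      one = (\<lambda>u. if u = {#} then \<one>\<^bsub>K\<^esub> else \<zero>\<^bsub>K\<^esub>),
      zero = (\<lambda>u. \<zero>\<^bsub>K\<^esub>),
      add = (\<lambda>f g u. f u \<oplus>\<^bsub>K\<^esub> g u),
      smult = (\<lambda>c f u. c \<otimes>\<^bsub>K\<^esub> f u),
      part = (\<lambda>m. finsupp K {u. set_mset u \<subseteq> {..<n} \<and> int (size u) = m})\<rparr>"

text \<open>Graded algebras in the sense used here: \<open>A = T(V)/I\<close> (up to isomorphism of graded algebras)
  with \<open>V\<close> finite-dimensional and \<open>I\<close> generated by a minimal finite set of homogeneous elements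
  of degree at least 2.\<close>

definition graded_algebra :: "('k, 'z) ring_scheme \<Rightarrow> ('k, 'a) graded \<Rightarrow> bool" where
  "graded_algebra K A \<longleftrightarrow> connected_graded_algebra K A \<and>
     (\<exists>N R. finite R \<and> (\<forall>r \<in> R. \<exists>m \<ge> 2. r \<in> part (tensor_algebra K N) m) \<and>
        (\<forall>S. S \<subset> R \<longrightarrow> Idl\<^bsub>tensor_algebra K N\<^esub> S \<noteq> Idl\<^bsub>tensor_algebra K N\<^esub> R) \<and>
        graded_algebra_iso K A
          (quotient_algebra (tensor_algebra K N) (Idl\<^bsub>tensor_algebra K N\<^esub> R)) \<noteq> {})"

definition commutative_algebra :: "('k, 'a) graded \<Rightarrow> bool" where
  "commutative_algebra A \<longleftrightarrow> (\<forall>a \<in> carrier A. \<forall>b \<in> carrier A. a \<otimes>\<^bsub>A\<^esub> b = b \<otimes>\<^bsub>A\<^esub> a)"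

definition graded_commutative_algebra :: "('k, 'a) graded \<Rightarrow> bool" where
  "graded_commutative_algebra A \<longleftrightarrow>
     (\<forall>i j. \<forall>a \<in> part A i. \<forall>b \<in> part A j.
        a \<otimes>\<^bsub>A\<^esub> b = (if even (i * j) then b \<otimes>\<^bsub>A\<^esub> a else \<ominus>\<^bsub>A\<^esub> (b \<otimes>\<^bsub>A\<^esub> a)))"

definition regular :: "('k, 'a) graded \<Rightarrow> 'a \<Rightarrow> bool" where
  "regular A g \<longleftrightarrow>
     (\<forall>a \<in> carrier A. (g \<otimes>\<^bsub>A\<^esub> a = \<zero>\<^bsub>A\<^esub> \<longrightarrow> a = \<zero>\<^bsub>A\<^esub>) \<and> (a \<otimes>\<^bsub>A\<^esub> g = \<zero>\<^bsub>A\<^esub> \<longrightarrow> a = \<zero>\<^bsub>A\<^esub>))"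

definition regular_sequence :: "('k, 'a) graded \<Rightarrow> 'a list \<Rightarrow> bool" where
  "regular_sequence S fs \<longleftrightarrow> set fs \<subseteq> carrier S \<and> Idl\<^bsub>S\<^esub> (set fs) \<noteq> carrier S \<and>
     (\<forall>i < length fs. let I = Idl\<^bsub>S\<^esub> (set (take i fs)) in
        regular (quotient_algebra S I) (I +>\<^bsub>S\<^esub> (fs ! i)))"


section \<open>Graded Hom spaces and graded free resolutions of the trivial module\<close>

definition graded_hom ::
    "('k, 'a) graded \<Rightarrow> ('a, 'm) graded \<Rightarrow> ('a, 'n) graded \<Rightarrow> int \<Rightarrow> ('m \<Rightarrow> 'n) set" where
  "graded_hom A M N e =
     {f \<in> carrier M \<rightarrow>\<^sub>E carrier N.
        (\<forall>x \<in> carrier M. \<forall>y \<in> carrier M. f (x \<oplus>\<^bsub>M\<^esub> y) = f x \<oplus>\<^bsub>N\<^esub> f y) \<and>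
        (\<forall>a \<in> carrier A. \<forall>x \<in> carrier M. f (a \<odot>\<^bsub>M\<^esub> x) = a \<odot>\<^bsub>N\<^esub> f x) \<and>
        (\<forall>i. f ` part M i \<subseteq> part N (i + e))}"

definition positive_part :: "('k, 'a) graded \<Rightarrow> 'a set" where
  "positive_part A =
     {(\<Oplus>\<^bsub>A\<^esub>i \<in> F. c i) | c F. finite F \<and> (\<forall>i \<in> F. i > 0 \<and> c i \<in> part A i)}"

text \<open>\<open>A = K \<sqdot> 1 \<oplus> A\<^sub>+\<close>; the augmentation is the first projection.\<close>

definition augmentation :: "('k, 'z) ring_scheme \<Rightarrow> ('k, 'a) graded \<Rightarrow> 'a \<Rightarrow> 'k" where
  "augmentation K A a =
     (THE c. c \<in> carrier K \<and> (\<exists>b \<in> positive_part A. a = (c \<odot>\<^bsub>A\<^esub> \<one>\<^bsub>A\<^esub>) \<oplus>\<^bsub>A\<^esub> b))"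

definition trivial_module :: "('k, 'z) ring_scheme \<Rightarrow> ('k, 'a) graded \<Rightarrow> ('a, 'k) graded" where
  "trivial_module K A =
     \<lparr>carrier = carrier K, monoid.mult = monoid.mult K, one = one K, zero = zero K, add = add K,
      smult = (\<lambda>a c. augmentation K A a \<otimes>\<^bsub>K\<^esub> c),
      part = (\<lambda>i. if i = 0 then carrier K else {\<zero>\<^bsub>K\<^esub>})\<rparr>"

text \<open>The graded free left module with basis \<open>X\<close>, the basis element \<open>i\<close> having degree \<open>w i\<close>,
  that is \<open>\<Oplus>\<^sub>i\<^sub>\<in>\<^sub>X A(-w i)\<close>.\<close>

definition free_module ::
    "('k, 'a) graded \<Rightarrow> 'i set \<Rightarrow> ('i \<Rightarrow> int) \<Rightarrow> ('a, 'i \<Rightarrow> 'a) graded" where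
  "free_module A X w =
     \<lparr>carrier = finsupp A X, monoid.mult = undefined, one = undefined,
      zero = (\<lambda>i. \<zero>\<^bsub>A\<^esub>),
      add = (\<lambda>u v i. u i \<oplus>\<^bsub>A\<^esub> v i),
      smult = (\<lambda>a v i. a \<otimes>\<^bsub>A\<^esub> v i),
      part = (\<lambda>m. {v \<in> finsupp A X. \<forall>i. v i \<in> part A (m - w i)})\<rparr>"

text \<open>Complexes \<open>\<dots> \<rightarrow> P\<^sub>2 \<rightarrow> P\<^sub>1 \<rightarrow> P\<^sub>0 \<rightarrow> K\<close>, with \<open>rdiff P n : P\<^sub>n\<^sub>+\<^sub>1 \<rightarrow> P\<^sub>n\<close>.\<close>

record ('k, 'a, 'm) augmented_complex =
  rmod :: "nat \<Rightarrow> ('a, 'm) graded"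
  rdiff :: "nat \<Rightarrow> 'm \<Rightarrow> 'm"
  raug :: "'m \<Rightarrow> 'k"

text \<open>Finiteness of \<open>{i \<in> X. w i \<le> m}\<close> for all \<open>m\<close> makes each \<open>P\<^sub>n\<close> locally finite. Bases are then
  countable, so subsets of \<open>nat\<close> suffice, and every graded algebra has such a resolution.\<close>

definition free_resolution ::
    "('k, 'z) ring_scheme \<Rightarrow> ('k, 'a) graded \<Rightarrow> ('k, 'a, nat \<Rightarrow> 'a) augmented_complex \<Rightarrow> bool" where
  "free_resolution K A P \<longleftrightarrow>
     (\<forall>n. \<exists>X w. (\<forall>m. finite {i \<in> X. w i \<le> m}) \<and> rmod P n = free_module A X w) \<and>
     raug P \<in> graded_hom A (rmod P 0) (trivial_module K A) 0 \<and>
     (\<forall>n. rdiff P n \<in> graded_hom A (rmod P (Suc n)) (rmod P n) 0) \<and>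
     raug P ` carrier (rmod P 0) = carrier K \<and>
     {x \<in> carrier (rmod P 0). raug P x = \<zero>\<^bsub>K\<^esub>} = rdiff P 0 ` carrier (rmod P 1) \<and>
     (\<forall>n. {x \<in> carrier (rmod P (Suc n)). rdiff P n x = \<zero>\<^bsub>rmod P n\<^esub>} =
          rdiff P (Suc n) ` carrier (rmod P (Suc (Suc n))))"


section \<open>The bigraded Yoneda algebra\<close>

text \<open>\<open>cochains K A P n m\<close> is the space of degree \<open>-m\<close> homomorphisms \<open>P\<^sub>n \<rightarrow> K\<close>, and
  \<open>Ext K A P n m\<close> is \<open>E\<^sup>n\<^sup>,\<^sup>m = Ext\<^sup>n(K, K)\<^sub>-\<^sub>m\<close>, computed from the resolution \<open>P\<close>.\<close>

definition cochains ::
    "('k, 'z) ring_scheme \<Rightarrow> ('k, 'a) graded \<Rightarrow> ('k, 'a, 'm) augmented_complex \<Rightarrow> nat \<Rightarrow> int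
       \<Rightarrow> ('k, 'm \<Rightarrow> 'k) module" where
  "cochains K A P n m =
     \<lparr>carrier = graded_hom A (rmod P n) (trivial_module K A) (- m),
      monoid.mult = undefined, one = undefined,
      zero = (\<lambda>x \<in> carrier (rmod P n). \<zero>\<^bsub>K\<^esub>),
      add = (\<lambda>f g. \<lambda>x \<in> carrier (rmod P n). f x \<oplus>\<^bsub>K\<^esub> g x),
      smult = (\<lambda>c f. \<lambda>x \<in> carrier (rmod P n). c \<otimes>\<^bsub>K\<^esub> f x)\<rparr>"

definition cocycles ::
    "('k, 'z) ring_scheme \<Rightarrow> ('k, 'a) graded \<Rightarrow> ('k, 'a, 'm) augmented_complex \<Rightarrow> nat \<Rightarrow> int
       \<Rightarrow> ('m \<Rightarrow> 'k) set" where
  "cocycles K A P n m =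
     {f \<in> carrier (cochains K A P n m). \<forall>x \<in> carrier (rmod P (Suc n)). f (rdiff P n x) = \<zero>\<^bsub>K\<^esub>}"

fun coboundaries ::
    "('k, 'z) ring_scheme \<Rightarrow> ('k, 'a) graded \<Rightarrow> ('k, 'a, 'm) augmented_complex \<Rightarrow> nat \<Rightarrow> int
       \<Rightarrow> ('m \<Rightarrow> 'k) set" where
  "coboundaries K A P 0 m = {\<zero>\<^bsub>cochains K A P 0 m\<^esub>}"
| "coboundaries K A P (Suc n) m =
     (\<lambda>f. compose (carrier (rmod P (Suc n))) f (rdiff P n)) ` carrier (cochains K A P n m)"

definition ext_class ::
    "('k, 'z) ring_scheme \<Rightarrow> ('k, 'a) graded \<Rightarrow> ('k, 'a, 'm) augmented_complex \<Rightarrow> nat \<Rightarrow> int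
       \<Rightarrow> ('m \<Rightarrow> 'k) \<Rightarrow> ('m \<Rightarrow> 'k) set" where
  "ext_class K A P n m f = coboundaries K A P n m +>\<^bsub>cochains K A P n m\<^esub> f"

definition Ext ::
    "('k, 'z) ring_scheme \<Rightarrow> ('k, 'a) graded \<Rightarrow> ('k, 'a, 'm) augmented_complex \<Rightarrow> nat \<Rightarrow> int
       \<Rightarrow> ('k, ('m \<Rightarrow> 'k) set) module" where
  "Ext K A P n m =
     \<lparr>carrier = ext_class K A P n m ` cocycles K A P n m,
      monoid.mult = undefined, one = undefined,
      zero = coboundaries K A P n m,
      add = set_add (cochains K A P n m),
      smult = quot_smult (cochains K A P n m) (coboundaries K A P n m)\<rparr>"

text \<open>\<open>F\<close> is a chain map \<open>P\<^sub>q\<^sub>+\<^sub>\<bullet> \<rightarrow> P\<^sub>\<bullet>\<close> of internal degree \<open>-s\<close> lifting the cocycle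
  \<open>h : P\<^sub>q \<rightarrow> K\<close>.\<close>

definition lifts ::
    "('k, 'a) graded \<Rightarrow> ('k, 'a, 'm) augmented_complex \<Rightarrow> nat \<Rightarrow> int
       \<Rightarrow> ('m \<Rightarrow> 'k) \<Rightarrow> (nat \<Rightarrow> 'm \<Rightarrow> 'm) \<Rightarrow> bool" where
  "lifts A P q s h F \<longleftrightarrow>
     (\<forall>i. F i \<in> graded_hom A (rmod P (q + i)) (rmod P i) (- s)) \<and>
     (\<forall>x \<in> carrier (rmod P q). raug P (F 0 x) = h x) \<and>
     (\<forall>i. \<forall>x \<in> carrier (rmod P (q + Suc i)). rdiff P i (F (Suc i) x) = F i (rdiff P (q + i) x))"

text \<open>The Yoneda product of \<open>X \<in> E\<^sup>p\<^sup>,\<^sup>r\<close> and \<open>Y \<in> E\<^sup>q\<^sup>,\<^sup>s\<close>: the class of \<open>f \<circ> F\<^sub>p\<close>, where \<open>f\<close>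
  represents \<open>X\<close> and the chain map \<open>F\<close> lifts a representative of \<open>Y\<close>. The class does not depend
  on the choices made, so the union over all of them is that class.\<close>

definition yoneda_product ::
    "('k, 'z) ring_scheme \<Rightarrow> ('k, 'a) graded \<Rightarrow> ('k, 'a, 'm) augmented_complex
       \<Rightarrow> nat \<Rightarrow> int \<Rightarrow> nat \<Rightarrow> int \<Rightarrow> ('m \<Rightarrow> 'k) set \<Rightarrow> ('m \<Rightarrow> 'k) set \<Rightarrow> ('m \<Rightarrow> 'k) set" where
  "yoneda_product K A P p r q s X Y =
     \<Union>{ext_class K A P (q + p) (r + s) (compose (carrier (rmod P (q + p))) f (F p)) | f h F.
         f \<in> X \<and> h \<in> Y \<and> lifts A P q s h F}"

text \<open>\<open>E(A) = \<Oplus>\<^sub>n\<^sub>,\<^sub>m E\<^sup>n\<^sup>,\<^sup>m\<close>; its unit is the class of the augmentation \<open>P\<^sub>0 \<rightarrow> K\<close> in \<open>E\<^sup>0\<^sup>,\<^sup>0\<close>.\<close>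

definition yoneda_algebra ::
    "('k, 'z) ring_scheme \<Rightarrow> ('k, 'a) graded \<Rightarrow> ('k, 'a, 'm) augmented_complex
       \<Rightarrow> ('k, nat \<Rightarrow> int \<Rightarrow> ('m \<Rightarrow> 'k) set) module" where
  "yoneda_algebra K A P =
     \<lparr>carrier = {\<xi>. (\<forall>n m. \<xi> n m \<in> carrier (Ext K A P n m)) \<and>
                     finite {(n, m). \<xi> n m \<noteq> \<zero>\<^bsub>Ext K A P n m\<^esub>}},
      monoid.mult = (\<lambda>\<xi> \<eta> n m.
        finsum (Ext K A P n m)
          (\<lambda>(p, r). yoneda_product K A P p r (n - p) (m - r) (\<xi> p r) (\<eta> (n - p) (m - r)))
          {(p, r). p \<le> n \<and> \<xi> p r \<noteq> \<zero>\<^bsub>Ext K A P p r\<^esub>}),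
      one = (\<lambda>n m. if n = 0 \<and> m = 0 then ext_class K A P 0 0 (raug P) else \<zero>\<^bsub>Ext K A P n m\<^esub>),
      zero = (\<lambda>n m. \<zero>\<^bsub>Ext K A P n m\<^esub>),
      add = (\<lambda>\<xi> \<eta> n m. \<xi> n m \<oplus>\<^bsub>Ext K A P n m\<^esub> \<eta> n m),
      smult = (\<lambda>c \<xi> n m. c \<odot>\<^bsub>Ext K A P n m\<^esub> \<xi> n m)\<rparr>"

definition yoneda_component ::
    "('k, 'z) ring_scheme \<Rightarrow> ('k, 'a) graded \<Rightarrow> ('k, 'a, 'm) augmented_complex \<Rightarrow> nat
       \<Rightarrow> (nat \<Rightarrow> int \<Rightarrow> ('m \<Rightarrow> 'k) set) set" where
  "yoneda_component K A P n =
     {\<xi> \<in> carrier (yoneda_algebra K A P). \<forall>p m. p \<noteq> n \<longrightarrow> \<xi> p m = \<zero>\<^bsub>Ext K A P p m\<^esub>}"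

inductive_set generated_subalgebra ::
    "('k, 'z) ring_scheme \<Rightarrow> ('k, 'e) module \<Rightarrow> 'e set \<Rightarrow> 'e set"
  for K :: "('k, 'z) ring_scheme" and E :: "('k, 'e) module" and S :: "'e set" where
  one: "\<one>\<^bsub>E\<^esub> \<in> generated_subalgebra K E S"
| incl: "x \<in> S \<Longrightarrow> x \<in> generated_subalgebra K E S"
| smult: "c \<in> carrier K \<Longrightarrow> x \<in> generated_subalgebra K E S \<Longrightarrow> c \<odot>\<^bsub>E\<^esub> x \<in> generated_subalgebra K E S"
| add: "x \<in> generated_subalgebra K E S \<Longrightarrow> y \<in> generated_subalgebra K E S
    \<Longrightarrow> x \<oplus>\<^bsub>E\<^esub> y \<in> generated_subalgebra K E S"
| mult: "x \<in> generated_subalgebra K E S \<Longrightarrow> y \<in> generated_subalgebra K E S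
    \<Longrightarrow> x \<otimes>\<^bsub>E\<^esub> y \<in> generated_subalgebra K E S"

text \<open>\<open>E(A)\<close> is independent of the resolution up to isomorphism of bigraded algebras, so it does not
  matter which resolution is used.\<close>

definition K2_algebra :: "('k, 'z) ring_scheme \<Rightarrow> ('k, 'a) graded \<Rightarrow> bool" where
  "K2_algebra K A \<longleftrightarrow> graded_algebra K A \<and>
     (\<exists>P. free_resolution K A P \<and>
        generated_subalgebra K (yoneda_algebra K A P)
          (yoneda_component K A P 1 \<union> yoneda_component K A P 2) = carrier (yoneda_algebra K A P))"

end

theory Submission
  imports Defs "HOL-Library.Nat_Bijection"
begin

text \<open>
  Let \<open>B = A/gA\<close>. Reduction modulo \<open>g\<close> of a free resolution \<open>P\<close> of \<open>K\<close> over \<open>A\<close> gives a complex of free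
  \<open>B\<close>-modules with homology \<open>Tor\<^sup>A(B, K)\<close>. Since \<open>g\<close> is regular, this is \<open>K\<close> in degrees 0 and 1 only. The
  class in degree 1 is represented by a null homotopy of multiplication by \<open>g\<close> on \<open>P\<close>, and gluing in
  shifted copies of the complex along this homotopy gives a free resolution \<open>Q\<close> of \<open>K\<close> over \<open>B\<close>
  (\<open>PQ_resolution\<close>). The reduced complex is a subcomplex of \<open>Q\<close>, and the quotient is \<open>Q\<close> itself shifted
  by 2 in homological and by \<open>d\<close> in internal degree.

  Restriction to the subcomplex is a homomorphism \<open>E(B) \<rightarrow> E(A)\<close> (\<open>pull_mult\<close>). A cocycle of degree at
  least 2 that vanishes on the subcomplex factors through the quotient, so its class is a multiple of
  the class \<open>chi \<in> E\<^sup>2\<^sup>,\<^sup>d(B)\<close> of the projection (\<open>vanishing_cocycle\<close>). If moreover the classes of degree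
  1 and 2 in \<open>E(A)\<close> come from \<open>E(B)\<close> and generate \<open>E(A)\<close>, then induction on the degree shows that
  \<open>E(B)\<close> is generated in degrees 1 and 2 (\<open>generated\<close>).

  That these classes come from \<open>E(B)\<close> is where \<open>d > 1\<close> and commutativity enter. A cocycle on \<open>P\<close>,
  extended by zero, is a cocycle on \<open>Q\<close> if it kills the homotopy (\<open>extend_cocycle\<close>), which holds if
  the homotopy is minimal. As \<open>A\<close> is generated in degree 1 and \<open>d > 1\<close>, \<open>g\<close> is a sum of products
  \<open>a b\<close> of elements of positive degree. If \<open>\<tau>\<close> is a homotopy for \<open>b\<close>, then \<open>a \<tau>\<close> is one for \<open>a b\<close>, and
  it is minimal (\<open>min_homotopy_mult\<close>); it is \<open>A\<close>-linear because \<open>a\<close> is central. Two degrees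
  suffice, since only classes of degree 1 and 2 have to be extended.

  A graded-commutative algebra with a regular element of positive degree is commutative: in
  characteristic other than 2 its generators square to zero, and a product of
  generators that cannot be prolonged without becoming zero is annihilated by all elements of positive degree (\<open>regular_commutative\<close>).

  A complete intersection is reached from a polynomial algebra by finitely many such quotients
  (\<open>K2_adjoin\<close>). For the polynomial algebra itself the resolution is the Koszul complex. Its exactness
  is shown by a contracting homotopy, and contractions with coordinate forms exhibit \<open>E\<close> as generated
  in degree 1 (\<open>K2\<close> in the locale \<open>koszul\<close>).
\<close>

section \<open>Graded algebras and their homogeneous components\<close>

lemma (in abelian_group) add_minus_zeroD:
  "x \<in> carrier G \<Longrightarrow> y \<in> carrier G \<Longrightarrow> x \<oplus> \<ominus> y = \<zero> \<Longrightarrow> x = y"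
  using minus_equality[of x "\<ominus> y"] by simp

inductive_set additive_span :: "('a, 'z) ring_scheme \<Rightarrow> 'a set \<Rightarrow> 'a set"
  for A :: "('a, 'z) ring_scheme" and H :: "'a set" where
  zero: "\<zero>\<^bsub>A\<^esub> \<in> additive_span A H"
| incl: "x \<in> H \<Longrightarrow> x \<in> additive_span A H"
| add: "x \<in> additive_span A H \<Longrightarrow> y \<in> additive_span A H \<Longrightarrow> x \<oplus>\<^bsub>A\<^esub> y \<in> additive_span A H"

lemma (in abelian_group) additive_span_closed:
  assumes "H \<subseteq> carrier G" "x \<in> additive_span G H"
  shows "x \<in> carrier G"
  using assms(2,1) by induction auto

lemma (in abelian_group) additive_span_finsum:
  assumes "finite S" "\<And>i. i \<in> S \<Longrightarrow> c i \<in> additive_span G H" "H \<subseteq> carrier G"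
  shows "(\<Oplus>i\<in>S. c i) \<in> additive_span G H"
  using assms(1,2)
proof (induction S)
  case empty
  then show ?case by (simp add: additive_span.zero)
next
  case (insert x F)
  have "c \<in> F \<rightarrow> carrier G" "c x \<in> carrier G"
    using insert.prems additive_span_closed[OF assms(3)] by auto
  then show ?case
    using insert by (simp add: additive_span.add)
qed

definition decomposes :: "('k, 'a) graded \<Rightarrow> (int \<Rightarrow> 'a) \<Rightarrow> 'a \<Rightarrow> bool" where
  "decomposes A c a \<longleftrightarrow> (\<forall>m. c m \<in> part A m) \<and> finite {m. c m \<noteq> \<zero>\<^bsub>A\<^esub>} \<and>
     a = (\<Oplus>\<^bsub>A\<^esub>m \<in> {m. c m \<noteq> \<zero>\<^bsub>A\<^esub>}. c m)"

definition hcomp :: "('k, 'a) graded \<Rightarrow> int \<Rightarrow> 'a \<Rightarrow> 'a" where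
  "hcomp A m a = (THE c. decomposes A c a) m"

lemma decomposes_add:
  fixes A (structure)
  assumes "abelian_group A" and sub: "\<And>m. part A m \<subseteq> carrier A"
    and clo: "\<And>m x y. x \<in> part A m \<Longrightarrow> y \<in> part A m \<Longrightarrow> x \<oplus> y \<in> part A m"
    and c: "decomposes A c a" and d: "decomposes A d b"
  shows "decomposes A (\<lambda>m. c m \<oplus> d m) (a \<oplus> b)"
proof -
  interpret abelian_group A by fact
  let ?S = "{m. c m \<noteq> \<zero>} \<union> {m. d m \<noteq> \<zero>}"
  have cc: "c m \<in> carrier A" "d m \<in> carrier A" for m
    using c d sub unfolding decomposes_def by blast+
  have fin: "finite ?S" using c d unfolding decomposes_def by auto
  have ext: "(\<Oplus>m\<in>{m. f m \<noteq> \<zero>}. f m) = (\<Oplus>m\<in>?S. f m)"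
    if "{m. f m \<noteq> \<zero>} \<subseteq> ?S" "\<And>m. f m \<in> carrier A" for f
    by (rule add.finprod_mono_neutral_cong_left) (use that fin in auto)
  have "a \<oplus> b = (\<Oplus>m\<in>?S. c m) \<oplus> (\<Oplus>m\<in>?S. d m)"
    using c d ext[of c] ext[of d] cc unfolding decomposes_def by auto
  also have "\<dots> = (\<Oplus>m\<in>?S. c m \<oplus> d m)"
    using finsum_addf[of c ?S d] cc by auto
  also have "\<dots> = (\<Oplus>m\<in>{m. c m \<oplus> d m \<noteq> \<zero>}. c m \<oplus> d m)"
    by (rule ext[symmetric]) (use cc in auto)
  finally show ?thesis
    using c d clo fin cc unfolding decomposes_def
    by (auto intro: finite_subset[OF _ fin])
qed

lemma decomposes_homogeneous:
  fixes A (structure)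
  assumes "abelian_group A" "part A i \<subseteq> carrier A" "\<And>m. \<zero> \<in> part A m" "x \<in> part A i"
  shows "decomposes A (\<lambda>m. if m = i then x else \<zero>) x"
proof -
  interpret abelian_group A by fact
  show ?thesis
  proof (cases "x = \<zero>")
    case True
    then show ?thesis using assms by (simp add: decomposes_def)
  next
    case False
    then have "{m. (if m = i then x else \<zero>) \<noteq> \<zero>} = {i}" by auto
    then show ?thesis using assms by (auto simp: decomposes_def)
  qed
qed

lemma projection_finsum:
  fixes A (structure)
  assumes "abelian_group A" and sub: "\<And>m. part A m \<subseteq> carrier A"
    and z: "\<And>m. \<zero> \<in> part A m"
    and p_closed: "\<And>m x. x \<in> carrier A \<Longrightarrow> p m x \<in> carrier A"
    and p_add: "\<And>m x y. x \<in> carrier A \<Longrightarrow> y \<in> carrier A \<Longrightarrow> p m (x \<oplus> y) = p m x \<oplus> p m y"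
    and p_part: "\<And>m i x. x \<in> part A i \<Longrightarrow> p m x = (if m = i then x else \<zero>)"
    and "finite S" "\<And>i. i \<in> S \<Longrightarrow> c i \<in> part A i"
  shows "p m (\<Oplus>i\<in>S. c i) = (if m \<in> S then c m else \<zero>)"
  using assms(7,8)
proof (induction S)
  interpret abelian_group A by fact
  case empty
  then show ?case using p_part[of \<zero> "m + 1" m] z by simp
next
  interpret abelian_group A by fact
  case (insert x F)
  have cl: "c \<in> F \<rightarrow> carrier A" "c x \<in> carrier A" using insert.prems sub by auto
  then have "p m (\<Oplus>i\<in>insert x F. c i) = p m (c x) \<oplus> p m (\<Oplus>i\<in>F. c i)"
    using insert by (simp add: p_add)
  also have "p m (c x) = (if m = x then c x else \<zero>)" using insert.prems by (simp add: p_part)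
  also have "p m (\<Oplus>i\<in>F. c i) = (if m \<in> F then c m else \<zero>)" using insert by simp
  finally show ?case using insert cl funcset_mem[OF cl(1), of m] by (auto split: if_splits)
qed

text \<open>To establish a grading it is enough to exhibit additive projections onto its parts: they
  force any decomposition into homogeneous components to be the expected one.\<close>

lemma gradingI:
  fixes A (structure)
  assumes "abelian_group A" and subm: "\<And>m. submodule (part A m) K A"
    and span: "carrier A \<subseteq> additive_span A (\<Union>m. part A m)"
    and p_closed: "\<And>m x. x \<in> carrier A \<Longrightarrow> p m x \<in> carrier A"
    and p_add: "\<And>m x y. x \<in> carrier A \<Longrightarrow> y \<in> carrier A \<Longrightarrow> p m (x \<oplus> y) = p m x \<oplus> p m y"
    and p_part: "\<And>m i x. x \<in> part A i \<Longrightarrow> p m x = (if m = i then x else \<zero>)"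
  shows "grading K A"
proof -
  interpret abelian_group A by fact
  have sub: "part A m \<subseteq> carrier A" for m
    using subgroup.subset[OF submodule.axioms(1)[OF subm]] by simp
  have clo: "x \<oplus> y \<in> part A m" if "x \<in> part A m" "y \<in> part A m" for m x y
    using subgroup.m_closed[OF submodule.axioms(1)[OF subm]] that by simp
  have z: "\<zero> \<in> part A m" for m
    using subgroup.one_closed[OF submodule.axioms(1)[OF subm]] by simp
  have ex: "\<exists>c. decomposes A c a" if "a \<in> additive_span A (\<Union>m. part A m)" for a
    using that
  proof induction
    case zero
    show ?case using decomposes_homogeneous[OF assms(1) sub z z] by blast
  next
    case (incl x)
    then show ?case using decomposes_homogeneous[OF assms(1) sub z] by blast
  next
    case (add x y)
    then show ?case using decomposes_add[OF assms(1) sub clo] by blast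
  qed
  have un: "c m = p m a" if "decomposes A c a" for c a m
  proof -
    have "p m a = p m (\<Oplus>m \<in> {m. c m \<noteq> \<zero>}. c m)" using that by (simp add: decomposes_def)
    also have "\<dots> = (if m \<in> {m. c m \<noteq> \<zero>} then c m else \<zero>)"
      by (rule projection_finsum[OF assms(1) sub z p_closed p_add p_part])
         (use that in \<open>auto simp: decomposes_def\<close>)
    finally show ?thesis by auto
  qed
  have "\<exists>!c. decomposes A c a" if "a \<in> carrier A" for a
  proof (rule ex_ex1I)
    show "\<exists>c. decomposes A c a" using ex span that by blast
  next
    fix c d assume "decomposes A c a" "decomposes A d a"
    then show "c = d" using un by (metis ext)
  qed
  then show ?thesis using subm unfolding grading_def decomposes_def by blast
qed

locale graded_alg =
  fixes K :: "('k, 'z) ring_scheme" and A :: "('k, 'a) graded" (structure)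
  assumes connected: "connected_graded_algebra K A"
begin

sublocale ring A using connected by (simp add: connected_graded_algebra_def)
sublocale K: field K using connected by (simp add: connected_graded_algebra_def)
sublocale KA: module K A using connected by (simp add: connected_graded_algebra_def)

lemma grad: "grading K A" using connected by (simp add: connected_graded_algebra_def)
lemma subm: "submodule (part A m) K A" using grad by (simp add: grading_def)

lemma part_carrier: "a \<in> part A m \<Longrightarrow> a \<in> carrier A"
  using subgroup.subset[OF submodule.axioms(1)[OF subm]] by auto
lemma part_zero [simp, intro]: "\<zero> \<in> part A m"
  using subgroup.one_closed[OF submodule.axioms(1)[OF subm]] by simp
lemma part_add [intro]: "a \<in> part A m \<Longrightarrow> b \<in> part A m \<Longrightarrow> a \<oplus> b \<in> part A m"
  using subgroup.m_closed[OF submodule.axioms(1)[OF subm]] by simp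
lemma part_smult [intro]: "c \<in> carrier K \<Longrightarrow> a \<in> part A m \<Longrightarrow> c \<odot> a \<in> part A m"
  using submodule.smult_closed[OF subm] by simp
lemma part_mult [intro]: "a \<in> part A i \<Longrightarrow> b \<in> part A j \<Longrightarrow> a \<otimes> b \<in> part A (i + j)"
  using connected by (simp add: connected_graded_algebra_def)
lemma part_negative: "m < 0 \<Longrightarrow> part A m = {\<zero>}"
  using connected by (simp add: connected_graded_algebra_def)
lemma part_0: "part A 0 = {c \<odot> \<one> | c. c \<in> carrier K}"
  using connected unfolding connected_graded_algebra_def by blast
lemma one_neq_zero: "\<one> \<noteq> \<zero>"
  using connected unfolding connected_graded_algebra_def by blast
lemma smult_mult: "c \<in> carrier K \<Longrightarrow> a \<in> carrier A \<Longrightarrow> b \<in> carrier A \<Longrightarrow> (c \<odot> a) \<otimes> b = c \<odot> (a \<otimes> b)"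
  using connected unfolding connected_graded_algebra_def by blast
lemma mult_smult: "c \<in> carrier K \<Longrightarrow> a \<in> carrier A \<Longrightarrow> b \<in> carrier A \<Longrightarrow> a \<otimes> (c \<odot> b) = c \<odot> (a \<otimes> b)"
  using connected unfolding connected_graded_algebra_def by blast
lemma smult_one_mult: "c \<in> carrier K \<Longrightarrow> a \<in> carrier A \<Longrightarrow> (c \<odot> \<one>) \<otimes> a = c \<odot> a"
  by (simp add: smult_mult)

lemma one_part: "\<one> \<in> part A 0"
  using part_0 KA.smult_one[of \<one>] K.one_closed by (metis (mono_tags, lifting) mem_Collect_eq one_closed)
lemma part_minus [intro]: "a \<in> part A m \<Longrightarrow> \<ominus> a \<in> part A m"
  using subgroup.m_inv_closed[OF submodule.axioms(1)[OF subm]] by (simp add: a_inv_def)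

lemma ex1: "a \<in> carrier A \<Longrightarrow> \<exists>!c. decomposes A c a"
  using grad unfolding grading_def decomposes_def by blast

lemma hcomp_decomposes: "a \<in> carrier A \<Longrightarrow> decomposes A (\<lambda>m. hcomp A m a) a"
  unfolding hcomp_def using theI'[OF ex1] by simp

lemma decomposes_hcomp: "a \<in> carrier A \<Longrightarrow> decomposes A c a \<Longrightarrow> hcomp A m a = c m"
  using ex1 hcomp_decomposes by metis

lemma hcomp_part [intro]: "a \<in> carrier A \<Longrightarrow> hcomp A m a \<in> part A m"
  using hcomp_decomposes by (simp add: decomposes_def)
lemma hcomp_closed [simp, intro]: "a \<in> carrier A \<Longrightarrow> hcomp A m a \<in> carrier A"
  using hcomp_part part_carrier by blast

lemma hcomp_add: "a \<in> carrier A \<Longrightarrow> b \<in> carrier A \<Longrightarrow> hcomp A m (a \<oplus> b) = hcomp A m a \<oplus> hcomp A m b"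
  using decomposes_hcomp[OF _ decomposes_add[OF abelian_group_axioms _ _ hcomp_decomposes hcomp_decomposes]]
  by (simp add: part_add part_carrier subsetI)

lemma hcomp_homogeneous: "a \<in> part A i \<Longrightarrow> hcomp A m a = (if m = i then a else \<zero>)"
  using decomposes_hcomp[OF part_carrier decomposes_homogeneous[OF abelian_group_axioms]]
  by (simp add: part_carrier subsetI)

lemma hcomp_zero [simp]: "hcomp A m \<zero> = \<zero>" using hcomp_homogeneous[OF part_zero] by simp

lemma carrier_span: "a \<in> carrier A \<Longrightarrow> a \<in> additive_span A (\<Union>m. part A m)"
proof -
  assume a: "a \<in> carrier A"
  have "(\<Oplus>m \<in> {m. hcomp A m a \<noteq> \<zero>}. hcomp A m a) \<in> additive_span A (\<Union>m. part A m)"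
    using hcomp_decomposes[OF a] a part_carrier
    by (intro additive_span_finsum) (auto simp: decomposes_def intro!: additive_span.incl)
  then show ?thesis using hcomp_decomposes[OF a] by (simp add: decomposes_def)
qed

lemma homogeneous_induct [consumes 1, case_names zero add homogeneous]:
  assumes "a \<in> carrier A" "P \<zero>"
    "\<And>a b. a \<in> carrier A \<Longrightarrow> b \<in> carrier A \<Longrightarrow> P a \<Longrightarrow> P b \<Longrightarrow> P (a \<oplus> b)"
    "\<And>a i. a \<in> part A i \<Longrightarrow> P a"
  shows "P a"
  using carrier_span[OF assms(1)]
proof (induction rule: additive_span.induct)
  case zero then show ?case using assms by simp
next
  case (incl x) then show ?case using assms by blast
next
  case (add x y)
  then show ?case using assms(3) additive_span_closed[of "\<Union>m. part A m"] part_carrier by blast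
qed

lemma hcomp_mult_right: "a \<in> carrier A \<Longrightarrow> b \<in> part A j \<Longrightarrow> hcomp A m (a \<otimes> b) = hcomp A (m - j) a \<otimes> b"
proof (induction rule: homogeneous_induct)
  case zero then show ?case by (simp add: part_carrier)
next
  case (add a a') then show ?case by (simp add: hcomp_add part_carrier l_distr)
next
  case (homogeneous a i)
  then show ?case using part_mult[of a i b j] by (auto simp: hcomp_homogeneous part_carrier)
qed

lemma hcomp_mult_left: "a \<in> carrier A \<Longrightarrow> b \<in> part A j \<Longrightarrow> hcomp A m (b \<otimes> a) = b \<otimes> hcomp A (m - j) a"
proof (induction rule: homogeneous_induct)
  case zero then show ?case by (simp add: part_carrier)
next
  case (add a a') then show ?case by (simp add: hcomp_add part_carrier r_distr)
next
  case (homogeneous a i)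
  then show ?case using part_mult[of b j a i] by (auto simp: hcomp_homogeneous part_carrier)
qed

lemma hcomp_mult_0: 
  assumes "a \<in> carrier A" "b \<in> carrier A" 
  shows "hcomp A 0 (a \<otimes> b) = hcomp A 0 a \<otimes> hcomp A 0 b"
  using assms(2)
proof (induction rule: homogeneous_induct)
  case zero then show ?case using assms by simp
next
  case (add b b') then show ?case using assms by (simp add: hcomp_add r_distr)
next
  case (homogeneous b j)
  have neg: "hcomp A m a = \<zero>" if "m < 0" for m using part_negative[OF that] hcomp_part[OF assms(1)] by auto
  have "j < 0 \<Longrightarrow> b = \<zero>" using part_negative homogeneous by auto
  then consider "b = \<zero>" | "j > 0" | "j = 0" by linarith
  then show ?case
  proof cases
    case 2
    then show ?thesis using homogeneous assms
      by (simp add: hcomp_mult_right hcomp_homogeneous neg part_carrier)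
  qed (use homogeneous assms in \<open>auto simp: hcomp_mult_right hcomp_homogeneous part_carrier\<close>)
qed

subsection \<open>The augmentation\<close>

abbreviation "aug \<equiv> augmentation K A"

lemma positive_part_iff: "b \<in> positive_part A \<longleftrightarrow> b \<in> carrier A \<and> hcomp A 0 b = \<zero>"
proof
  assume "b \<in> positive_part A"
  then obtain c F where F: "b = (\<Oplus>i \<in> F. c i)" "finite F" "\<forall>i \<in> F. i > 0 \<and> c i \<in> part A i"
    unfolding positive_part_def by blast
  have "hcomp A 0 b = (if 0 \<in> F then c 0 else \<zero>)" unfolding F(1)
    using part_carrier F
    by (intro projection_finsum[OF abelian_group_axioms]) (auto simp: hcomp_add hcomp_homogeneous)
  then show "b \<in> carrier A \<and> hcomp A 0 b = \<zero>"
    using F part_carrier by (auto intro!: finsum_closed)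
next
  assume b: "b \<in> carrier A \<and> hcomp A 0 b = \<zero>"
  then have d: "decomposes A (\<lambda>m. hcomp A m b) b" using hcomp_decomposes by blast
  have neg: "hcomp A m b = \<zero>" if "m < 0" for m using part_negative[OF that] hcomp_part b by auto
  have "i > 0" if "hcomp A i b \<noteq> \<zero>" for i using that neg b by (metis linorder_neqE_linordered_idom)
  then show "b \<in> positive_part A" unfolding positive_part_def using d unfolding decomposes_def
    by (auto intro!: exI[of _ "\<lambda>m. hcomp A m b"] exI[of _ "{m. hcomp A m b \<noteq> \<zero>}"])
qed

lemma smult_one_inj: "c \<in> carrier K \<Longrightarrow> c \<odot> \<one> = \<zero> \<Longrightarrow> c = \<zero>\<^bsub>K\<^esub>"
proof (rule ccontr)
  assume c: "c \<in> carrier K" "c \<odot> \<one> = \<zero>" "c \<noteq> \<zero>\<^bsub>K\<^esub>"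
  then have u: "c \<in> Units K" by (simp add: K.field_Units)
  then have "\<one> = (inv\<^bsub>K\<^esub> c \<otimes>\<^bsub>K\<^esub> c) \<odot> \<one>" by simp
  also have "\<dots> = inv\<^bsub>K\<^esub> c \<odot> (c \<odot> \<one>)" using c u by (simp only: KA.smult_assoc1 K.Units_inv_closed one_closed)
  finally show False using c u one_neq_zero by simp
qed

lemma smult_one_eq: "c \<in> carrier K \<Longrightarrow> c' \<in> carrier K \<Longrightarrow> c \<odot> \<one> = c' \<odot> \<one> \<Longrightarrow> c = c'"
proof -
  assume h: "c \<in> carrier K" "c' \<in> carrier K" "c \<odot> \<one> = c' \<odot> \<one>"
  then have "(c \<ominus>\<^bsub>K\<^esub> c') \<odot> \<one> = \<zero>"
    by (simp add: K.minus_eq KA.smult_l_distr KA.smult_l_minus r_neg)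
  then show "c = c'" using smult_one_inj[of "c \<ominus>\<^bsub>K\<^esub> c'"] h K.add_minus_zeroD[of c c'] by (simp add: K.minus_eq)
qed

lemma augmentation_spec:
  assumes a: "a \<in> carrier A"
  shows "aug a \<in> carrier K \<and> hcomp A 0 a = aug a \<odot> \<one>"
proof -
  have *: "c \<in> carrier K \<and> (\<exists>b \<in> positive_part A. a = (c \<odot> \<one>) \<oplus> b) \<longleftrightarrow> c \<in> carrier K \<and> hcomp A 0 a = c \<odot> \<one>" for c
  proof safe
    fix b assume c: "c \<in> carrier K" and b: "b \<in> positive_part A" "a = (c \<odot> \<one>) \<oplus> b"
    have "c \<odot> \<one> \<in> part A 0" using c part_0 by blast
    then show "hcomp A 0 (c \<odot> \<one> \<oplus> b) = c \<odot> \<one>" 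
      using b c by (auto simp: positive_part_iff hcomp_add hcomp_homogeneous[of _ 0])
  next
    assume c: "c \<in> carrier K" "hcomp A 0 a = c \<odot> \<one>"
    have p: "c \<odot> \<one> \<in> part A 0" using c part_0 by blast
    then have "hcomp A 0 (\<ominus> (c \<odot> \<one>)) = \<ominus> (c \<odot> \<one>)" using hcomp_homogeneous[of _ 0] part_minus by fastforce
    then have "a \<oplus> \<ominus> (c \<odot> \<one>) \<in> positive_part A" 
      using p c a by (simp add: positive_part_iff hcomp_add part_carrier r_neg)
    moreover have "a = (c \<odot> \<one>) \<oplus> (a \<oplus> \<ominus> (c \<odot> \<one>))"
      using p c a by (metis KA.smult_closed a_ac(2) add.inv_solve_right' a_minus_def minus_closed one_closed r_neg)
    ultimately show "\<exists>b\<in>positive_part A. a = c \<odot> \<one> \<oplus> b" by blast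
  qed
  have "\<exists>!c. c \<in> carrier K \<and> hcomp A 0 a = c \<odot> \<one>"
    using hcomp_part[OF a, of 0] smult_one_eq unfolding part_0 by auto
  then show ?thesis unfolding augmentation_def * by (rule theI')
qed

lemma aug_closed [simp, intro]: "a \<in> carrier A \<Longrightarrow> aug a \<in> carrier K" using augmentation_spec by blast

lemma augI: "a \<in> carrier A \<Longrightarrow> c \<in> carrier K \<Longrightarrow> hcomp A 0 a = c \<odot> \<one> \<Longrightarrow> aug a = c"
  using augmentation_spec smult_one_eq by metis

lemma aug_add: "a \<in> carrier A \<Longrightarrow> b \<in> carrier A \<Longrightarrow> aug (a \<oplus> b) = aug a \<oplus>\<^bsub>K\<^esub> aug b"
  by (rule augI) (auto simp: hcomp_add augmentation_spec KA.smult_l_distr)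

lemma aug_mult:
  assumes "a \<in> carrier A" "b \<in> carrier A"
  shows "aug (a \<otimes> b) = aug a \<otimes>\<^bsub>K\<^esub> aug b"
proof (rule augI)
  have "hcomp A 0 (a \<otimes> b) = (aug a \<odot> \<one>) \<otimes> (aug b \<odot> \<one>)"
    using assms augmentation_spec[of a] augmentation_spec[of b] by (simp only: hcomp_mult_0)
  also have "\<dots> = aug a \<odot> (aug b \<odot> \<one>)" using assms by (intro smult_one_mult) auto
  also have "\<dots> = (aug a \<otimes>\<^bsub>K\<^esub> aug b) \<odot> \<one>" using assms by (intro KA.smult_assoc1[symmetric]) auto
  finally show "hcomp A 0 (a \<otimes> b) = (aug a \<otimes>\<^bsub>K\<^esub> aug b) \<odot> \<one>" .
qed (use assms in auto)

lemma aug_const: "c \<in> carrier K \<Longrightarrow> aug (c \<odot> \<one>) = c"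
  
  by (rule augI) (use part_0 hcomp_homogeneous[of "c \<odot> \<one>" 0 0] in auto)

lemma aug_one [simp]: "aug \<one> = \<one>\<^bsub>K\<^esub>" using aug_const[of "\<one>\<^bsub>K\<^esub>"] by simp

lemma aug_homogeneous: "a \<in> part A i \<Longrightarrow> i \<noteq> 0 \<Longrightarrow> aug a = \<zero>\<^bsub>K\<^esub>"
  by (intro augI) (auto simp: part_carrier hcomp_homogeneous)

lemma aug_zero [simp]: "aug \<zero> = \<zero>\<^bsub>K\<^esub>" using aug_homogeneous[OF part_zero, of 1] by simp

lemma aug_unique:
  assumes "\<And>a b. a \<in> carrier A \<Longrightarrow> b \<in> carrier A \<Longrightarrow> h (a \<oplus> b) = h a \<oplus>\<^bsub>K\<^esub> h b"
    and "\<And>a i. a \<in> part A i \<Longrightarrow> i \<noteq> 0 \<Longrightarrow> h a = \<zero>\<^bsub>K\<^esub>"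
    and "\<And>c. c \<in> carrier K \<Longrightarrow> h (c \<odot> \<one>) = c" and "a \<in> carrier A"
  shows "h a = aug a"
  using assms(4)
proof (induction rule: homogeneous_induct)
  case zero
  then show ?case using assms(2)[OF part_zero, of 1] by simp
next
  case (add a b)
  then show ?case by (simp add: assms aug_add)
next
  case (homogeneous a i)
  then show ?case using assms(2,3) aug_homogeneous aug_const part_0
    by (cases "i = 0") auto
qed

end

locale comm_graded_alg = graded_alg +
  assumes commutative: "commutative_algebra A"
begin

sublocale cring A
  using commutative by unfold_locales (simp add: commutative_algebra_def)

end

section \<open>Graded modules, graded maps and projectivity of free modules\<close>

locale graded_mod = module A M for A :: "('k, 'a) graded" and M :: "('a, 'm) graded" +
  assumes mpart_carrier: "\<And>i x. x \<in> part M i \<Longrightarrow> x \<in> carrier M"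
    and mpart_zero [simp, intro]: "\<And>i. \<zero>\<^bsub>M\<^esub> \<in> part M i"
    and mpart_add [intro]: "\<And>i x y. x \<in> part M i \<Longrightarrow> y \<in> part M i \<Longrightarrow> x \<oplus>\<^bsub>M\<^esub> y \<in> part M i"
    and mpart_smult [intro]:
      "\<And>i j a x. a \<in> part A i \<Longrightarrow> x \<in> part M j \<Longrightarrow> a \<odot>\<^bsub>M\<^esub> x \<in> part M (i + j)"
begin

lemma mpart_finsum: "finite S \<Longrightarrow> (\<And>i. i \<in> S \<Longrightarrow> c i \<in> part M m) \<Longrightarrow> finsum M c S \<in> part M m"
proof (induction S rule: finite_induct)
  case empty then show ?case by simp
next
  case (insert x F)
  then have "c \<in> F \<rightarrow> carrier M" "c x \<in> carrier M" using mpart_carrier by blast+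
  then show ?case using insert by (simp add: mpart_add)
qed

lemma uminus_smult: "\<lbrakk>\<one>\<^bsub>A\<^esub> \<in> carrier A; x \<in> carrier M\<rbrakk> \<Longrightarrow> (\<ominus>\<^bsub>A\<^esub> \<one>\<^bsub>A\<^esub>) \<odot>\<^bsub>M\<^esub> x = \<ominus>\<^bsub>M\<^esub> x"
  by (simp add: smult_l_minus)

end

lemma ghom_closed: "f \<in> graded_hom A M N e \<Longrightarrow> x \<in> carrier M \<Longrightarrow> f x \<in> carrier N"
  by (auto simp: graded_hom_def)
lemma ghom_add: "f \<in> graded_hom A M N e \<Longrightarrow> x \<in> carrier M \<Longrightarrow> y \<in> carrier M \<Longrightarrow> f (x \<oplus>\<^bsub>M\<^esub> y) = f x \<oplus>\<^bsub>N\<^esub> f y"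
  by (simp add: graded_hom_def)
lemma ghom_smult: "f \<in> graded_hom A M N e \<Longrightarrow> a \<in> carrier A \<Longrightarrow> x \<in> carrier M \<Longrightarrow> f (a \<odot>\<^bsub>M\<^esub> x) = a \<odot>\<^bsub>N\<^esub> f x"
  by (simp add: graded_hom_def)
lemma ghom_part: "f \<in> graded_hom A M N e \<Longrightarrow> x \<in> part M i \<Longrightarrow> f x \<in> part N (i + e)"
  unfolding graded_hom_def by (metis (no_types, lifting) image_subset_iff mem_Collect_eq)
lemma ghom_part0: "f \<in> graded_hom A M N 0 \<Longrightarrow> x \<in> part M i \<Longrightarrow> f x \<in> part N i"
  using ghom_part by fastforce
lemma ghom_ext: "f \<in> graded_hom A M N e \<Longrightarrow> g \<in> graded_hom A M N' e' \<Longrightarrow> (\<And>x. x \<in> carrier M \<Longrightarrow> f x = g x) \<Longrightarrow> f = g"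
  by (rule extensionalityI[of f "carrier M"]) (simp_all add: graded_hom_def PiE_def)

lemma ghom_zero:
  assumes "abelian_group M" "abelian_group N" "f \<in> graded_hom A M N e"
  shows "f \<zero>\<^bsub>M\<^esub> = \<zero>\<^bsub>N\<^esub>"
proof -
  interpret M: abelian_group M by fact
  interpret N: abelian_group N by fact
  have "f \<zero>\<^bsub>M\<^esub> = f \<zero>\<^bsub>M\<^esub> \<oplus>\<^bsub>N\<^esub> f \<zero>\<^bsub>M\<^esub>"
    using ghom_add[OF assms(3), of "\<zero>\<^bsub>M\<^esub>" "\<zero>\<^bsub>M\<^esub>"] by simp
  then show ?thesis using ghom_closed[OF assms(3), of "\<zero>\<^bsub>M\<^esub>"] by simp
qed

lemma ghom_minus:
  assumes "abelian_group M" "abelian_group N" "f \<in> graded_hom A M N e" "x \<in> carrier M"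
  shows "f (\<ominus>\<^bsub>M\<^esub> x) = \<ominus>\<^bsub>N\<^esub> f x"
proof -
  interpret M: abelian_group M by fact
  interpret N: abelian_group N by fact
  have "f (\<ominus>\<^bsub>M\<^esub> x) \<oplus>\<^bsub>N\<^esub> f x = \<zero>\<^bsub>N\<^esub>"
    using ghom_add[OF assms(3), of "\<ominus>\<^bsub>M\<^esub> x" x] assms(4) ghom_zero[OF assms(1-3)] by (simp add: M.l_neg)
  then show ?thesis using ghom_closed[OF assms(3)] assms(4) N.minus_equality by (metis M.a_inv_closed)
qed

lemma ghomI:
  assumes "graded_mod A M"
    and "\<And>x. x \<in> carrier M \<Longrightarrow> F x \<in> carrier N"
    and "\<And>x y. x \<in> carrier M \<Longrightarrow> y \<in> carrier M \<Longrightarrow> F (x \<oplus>\<^bsub>M\<^esub> y) = F x \<oplus>\<^bsub>N\<^esub> F y"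
    and "\<And>a x. a \<in> carrier A \<Longrightarrow> x \<in> carrier M \<Longrightarrow> F (a \<odot>\<^bsub>M\<^esub> x) = a \<odot>\<^bsub>N\<^esub> F x"
    and "\<And>i x. x \<in> part M i \<Longrightarrow> F x \<in> part N (i + e)"
  shows "restrict F (carrier M) \<in> graded_hom A M N e"
proof -
  interpret graded_mod A M by fact
  show ?thesis unfolding graded_hom_def using assms(2-5) mpart_carrier by (auto simp: image_subset_iff)
qed

lemma ghom_comp:
  assumes "graded_mod A M" "f \<in> graded_hom A M N e" "g \<in> graded_hom A N L e'"
  shows "(\<lambda>x\<in>carrier M. g (f x)) \<in> graded_hom A M L (e + e')"
proof (rule ghomI[OF assms(1)])
  fix i x assume "x \<in> part M i"
  then show "g (f x) \<in> part L (i + (e + e'))"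
    using ghom_part[OF assms(3) ghom_part[OF assms(2)]] by (simp add: add.assoc)
qed (use assms(2,3) in \<open>simp_all add: ghom_closed ghom_add ghom_smult\<close>)

lemma ghom_comp0:
  assumes "graded_mod A M" "f \<in> graded_hom A M N 0" "g \<in> graded_hom A N L e"
  shows "(\<lambda>x\<in>carrier M. g (f x)) \<in> graded_hom A M L e"
  using ghom_comp[OF assms] by simp

lemma ghom_comp0':
  assumes "graded_mod A M" "f \<in> graded_hom A M N e" "g \<in> graded_hom A N L 0"
  shows "(\<lambda>x\<in>carrier M. g (f x)) \<in> graded_hom A M L e"
  using ghom_comp[OF assms] by simp

lemma ghom_plus:
  assumes "graded_mod A M" "graded_mod A N" "f \<in> graded_hom A M N e" "g \<in> graded_hom A M N e"
  shows "(\<lambda>x\<in>carrier M. f x \<oplus>\<^bsub>N\<^esub> g x) \<in> graded_hom A M N e"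
proof (rule ghomI[OF assms(1)])
  interpret N: graded_mod A N by fact
  note h = ghom_closed[OF assms(3)] ghom_closed[OF assms(4)] 
  show "f x \<oplus>\<^bsub>N\<^esub> g x \<in> carrier N" if "x \<in> carrier M" for x using that h by simp
  show "f (x \<oplus>\<^bsub>M\<^esub> y) \<oplus>\<^bsub>N\<^esub> g (x \<oplus>\<^bsub>M\<^esub> y) = (f x \<oplus>\<^bsub>N\<^esub> g x) \<oplus>\<^bsub>N\<^esub> (f y \<oplus>\<^bsub>N\<^esub> g y)"
    if "x \<in> carrier M" "y \<in> carrier M" for x y
    using that h by (simp add: ghom_add[OF assms(3)] ghom_add[OF assms(4)] N.M.a_ac)
  show "f (a \<odot>\<^bsub>M\<^esub> x) \<oplus>\<^bsub>N\<^esub> g (a \<odot>\<^bsub>M\<^esub> x) = a \<odot>\<^bsub>N\<^esub> (f x \<oplus>\<^bsub>N\<^esub> g x)"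
    if "a \<in> carrier A" "x \<in> carrier M" for a x
    using that h by (simp add: ghom_smult[OF assms(3)] ghom_smult[OF assms(4)] N.smult_r_distr)
  show "f x \<oplus>\<^bsub>N\<^esub> g x \<in> part N (i + e)" if "x \<in> part M i" for i x
    using that ghom_part[OF assms(3)] ghom_part[OF assms(4)] by auto
qed

lemma ghom_act:
  assumes "graded_mod A M" "graded_mod A N" "f \<in> graded_hom A M N e" "a \<in> part A j" "a \<in> carrier A"
  shows "(\<lambda>x\<in>carrier M. a \<odot>\<^bsub>N\<^esub> f x) \<in> graded_hom A M N (e + j)"
proof (rule ghomI[OF assms(1)])
  interpret N: graded_mod A N by fact
  note h = ghom_closed[OF assms(3)]
  show "a \<odot>\<^bsub>N\<^esub> f x \<in> carrier N" if "x \<in> carrier M" for x using that h assms by simp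
  show "a \<odot>\<^bsub>N\<^esub> f (x \<oplus>\<^bsub>M\<^esub> y) = a \<odot>\<^bsub>N\<^esub> f x \<oplus>\<^bsub>N\<^esub> a \<odot>\<^bsub>N\<^esub> f y"
    if "x \<in> carrier M" "y \<in> carrier M" for x y
    using that h assms by (simp add: ghom_add[OF assms(3)] N.smult_r_distr)
  show "a \<odot>\<^bsub>N\<^esub> f (b \<odot>\<^bsub>M\<^esub> x) = b \<odot>\<^bsub>N\<^esub> (a \<odot>\<^bsub>N\<^esub> f x)"
    if "b \<in> carrier A" "x \<in> carrier M" for b x
    using that h[OF that(2)] assms(5) by (simp add: ghom_smult[OF assms(3)] N.smult_assoc1[symmetric] N.m_comm)
  show "a \<odot>\<^bsub>N\<^esub> f x \<in> part N (i + (e + j))" if "x \<in> part M i" for i x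
    using N.mpart_smult[OF assms(4) ghom_part[OF assms(3) that]] by (simp add: algebra_simps)
qed

lemma ghom_null:
  assumes "graded_mod A M" "graded_mod A N"
  shows "(\<lambda>x\<in>carrier M. \<zero>\<^bsub>N\<^esub>) \<in> graded_hom A M N e"
proof -
  interpret N: graded_mod A N by fact
  show ?thesis by (rule ghomI[OF assms(1)]) auto
qed

context comm_graded_alg
begin

lemma ghom_uminus:
  assumes "graded_mod A M" "graded_mod A N" "f \<in> graded_hom A M N e"
  shows "(\<lambda>x\<in>carrier M. \<ominus>\<^bsub>N\<^esub> f x) \<in> graded_hom A M N e"
proof -
  interpret N: graded_mod A N by fact
  have "(\<lambda>x\<in>carrier M. (\<ominus> \<one>) \<odot>\<^bsub>N\<^esub> f x) \<in> graded_hom A M N (e + 0)"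
    by (rule ghom_act[OF assms]) (use one_part in auto)
  moreover have "(\<lambda>x\<in>carrier M. (\<ominus> \<one>) \<odot>\<^bsub>N\<^esub> f x) = (\<lambda>x\<in>carrier M. \<ominus>\<^bsub>N\<^esub> f x)"
    using ghom_closed[OF assms(3)] by (auto simp: N.uminus_smult)
  ultimately show ?thesis by simp
qed

lemma ghom_diff:
  assumes "graded_mod A M" "graded_mod A N" "f \<in> graded_hom A M N e" "g \<in> graded_hom A M N e"
  shows "(\<lambda>x\<in>carrier M. f x \<ominus>\<^bsub>N\<^esub> g x) \<in> graded_hom A M N e"
proof -
  interpret N: graded_mod A N by fact
  have "(\<lambda>x\<in>carrier M. f x \<oplus>\<^bsub>N\<^esub> (\<lambda>x\<in>carrier M. \<ominus>\<^bsub>N\<^esub> g x) x) \<in> graded_hom A M N e"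
    by (rule ghom_plus[OF assms(1-3) ghom_uminus[OF assms(1,2,4)]])
  moreover have "(\<lambda>x\<in>carrier M. f x \<oplus>\<^bsub>N\<^esub> (\<lambda>x\<in>carrier M. \<ominus>\<^bsub>N\<^esub> g x) x) = (\<lambda>x\<in>carrier M. f x \<ominus>\<^bsub>N\<^esub> g x)"
    by (auto simp: a_minus_def)
  ultimately show ?thesis by simp
qed

lemma trivial_graded_mod: "graded_mod A (trivial_module K A)"
proof -
  have ag: "abelian_group (trivial_module K A)"
  proof (rule abelian_groupI)
    fix x assume "x \<in> carrier (trivial_module K A)"
    then show "\<exists>y\<in>carrier (trivial_module K A). y \<oplus>\<^bsub>trivial_module K A\<^esub> x = \<zero>\<^bsub>trivial_module K A\<^esub>"
      by (intro bexI[of _ "\<ominus>\<^bsub>K\<^esub> x"]) (auto simp: trivial_module_def K.l_neg)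
  qed (auto simp: trivial_module_def K.a_ac)
  have md: "module A (trivial_module K A)"
    by (rule moduleI[OF is_cring ag])
       (auto simp: trivial_module_def aug_add aug_mult K.l_distr K.r_distr K.m_assoc)
  show ?thesis
    by (intro graded_mod.intro[OF md] graded_mod_axioms.intro)
       (auto simp: trivial_module_def part_carrier aug_homogeneous split: if_splits)
qed

end

definition single :: "('a, 'z) ring_scheme \<Rightarrow> 'i \<Rightarrow> 'a \<Rightarrow> 'i \<Rightarrow> 'a" where
  "single A i a = (\<lambda>j. if j = i then a else \<zero>\<^bsub>A\<^esub>)"

lemma free_module_simps [simp]:
  "carrier (free_module A X w) = finsupp A X"
  "zero (free_module A X w) = (\<lambda>i. \<zero>\<^bsub>A\<^esub>)"
  "add (free_module A X w) = (\<lambda>u v i. u i \<oplus>\<^bsub>A\<^esub> v i)"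
  "smult (free_module A X w) = (\<lambda>a v i. a \<otimes>\<^bsub>A\<^esub> v i)"
  "part (free_module A X w) = (\<lambda>m. {v \<in> finsupp A X. \<forall>i. v i \<in> part A (m - w i)})"
  by (simp_all add: free_module_def)

text \<open>Additive projections onto the parts; they make the homogeneous components of an element
  well defined.\<close>

definition separated :: "('a, 'm) graded \<Rightarrow> bool" where
  "separated N \<longleftrightarrow> (\<forall>j. \<exists>p. (\<forall>x \<in> carrier N. \<forall>y \<in> carrier N. p (x \<oplus>\<^bsub>N\<^esub> y) = p x \<oplus>\<^bsub>N\<^esub> p y) \<and>
     (\<forall>i. \<forall>x \<in> part N i. p x = (if i = j then x else \<zero>\<^bsub>N\<^esub>)))"

context abelian_group
begin

lemma finsuppI: "(\<And>i. v i \<in> carrier G) \<Longrightarrow> finite {i. v i \<noteq> \<zero>} \<Longrightarrow> (\<And>i. i \<notin> X \<Longrightarrow> v i = \<zero>) \<Longrightarrow> v \<in> finsupp G X"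
  by (simp add: finsupp_def)

lemma finsuppD:
  assumes "v \<in> finsupp G X"
  shows "v i \<in> carrier G" "finite {i. v i \<noteq> \<zero>}" "i \<notin> X \<Longrightarrow> v i = \<zero>"
  using assms by (simp_all add: finsupp_def)

lemma finsupp_zero: "(\<lambda>i. \<zero>) \<in> finsupp G X" by (simp add: finsupp_def)

lemma finsupp_add: "u \<in> finsupp G X \<Longrightarrow> v \<in> finsupp G X \<Longrightarrow> (\<lambda>i. u i \<oplus> v i) \<in> finsupp G X"
  by (auto simp: finsupp_def intro: finite_subset[of _ "{i. u i \<noteq> \<zero>} \<union> {i. v i \<noteq> \<zero>}"])

lemma finsupp_single: "a \<in> carrier G \<Longrightarrow> i \<in> X \<Longrightarrow> single G i a \<in> finsupp G X"
  by (auto simp: finsupp_def single_def intro: finite_subset[of _ "{i}"])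

lemma single_add: "a \<in> carrier G \<Longrightarrow> b \<in> carrier G \<Longrightarrow> single G i (a \<oplus> b) = (\<lambda>j. single G i a j \<oplus> single G i b j)"
  by (auto simp: single_def)

lemma finsupp_induct [consumes 1, case_names zero add single]:
  assumes "v \<in> finsupp G X" and z: "P (\<lambda>i. \<zero>)"
    and a: "\<And>u v. u \<in> finsupp G X \<Longrightarrow> v \<in> finsupp G X \<Longrightarrow> P u \<Longrightarrow> P v \<Longrightarrow> P (\<lambda>i. u i \<oplus> v i)"
    and sg: "\<And>i a. i \<in> X \<Longrightarrow> a \<in> carrier G \<Longrightarrow> P (single G i a)"
  shows "P v"
proof -
  have "\<forall>v \<in> finsupp G X. {i. v i \<noteq> \<zero>} \<subseteq> F \<longrightarrow> P v" if "finite F" for F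
    using that
  proof (induction F)
    case empty
    show ?case
    proof safe
      fix v assume "v \<in> finsupp G X" "{i. v i \<noteq> \<zero>} \<subseteq> {}"
      then have "v = (\<lambda>i. \<zero>)" by auto
      then show "P v" using z by simp
    qed
  next
    case (insert x F)
    show ?case
    proof (intro ballI impI)
      fix v assume v: "v \<in> finsupp G X" and sup: "{i. v i \<noteq> \<zero>} \<subseteq> insert x F"
      let ?v = "v(x := \<zero>)"
      have v': "?v \<in> finsupp G X" using v
        by (auto simp: finsupp_def intro: finite_subset[of _ "{i. v i \<noteq> \<zero>}"])
      have "{i. ?v i \<noteq> \<zero>} \<subseteq> F" using sup by auto
      then have "P ?v" using insert.IH v' by blast
      show "P v"
      proof (cases "x \<in> X")
        case True
        have "P (\<lambda>i. single G x (v x) i \<oplus> ?v i)"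
          using \<open>P ?v\<close> a[OF finsupp_single v'] sg True v by (simp add: finsuppD(1))
        moreover have "(\<lambda>i. single G x (v x) i \<oplus> ?v i) = v" 
          using finsuppD(1)[OF v] by (auto simp: single_def)
        ultimately show ?thesis by simp
      next
        case False
        then have "?v = v" using finsuppD(3)[OF v] by auto
        then show ?thesis using \<open>P ?v\<close> by simp
      qed
    qed
  qed
  then show ?thesis using assms(1) finsuppD(2)[OF assms(1)] by blast
qed

end

context comm_graded_alg
begin

lemma finsupp_smult: "a \<in> carrier A \<Longrightarrow> v \<in> finsupp A X \<Longrightarrow> (\<lambda>i. a \<otimes> v i) \<in> finsupp A X"
  by (auto simp: finsupp_def intro: finite_subset[of _ "{i. v i \<noteq> \<zero>}"])

lemma free_graded_mod: "graded_mod A (free_module A X w)"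
proof -
  have ag: "abelian_group (free_module A X w)"
  proof (rule abelian_groupI)
    fix v assume "v \<in> carrier (free_module A X w)"
    then have "v \<in> finsupp A X" by simp
    then have "(\<lambda>i. \<ominus> \<one> \<otimes> v i) \<in> finsupp A X" by (intro finsupp_smult) auto
    moreover have "\<forall>i. \<ominus> \<one> \<otimes> v i \<oplus> v i = \<zero>"
      using finsuppD(1)[OF \<open>v \<in> finsupp A X\<close>] by (simp add: l_minus l_neg)
    ultimately show "\<exists>y\<in>carrier (free_module A X w). y \<oplus>\<^bsub>free_module A X w\<^esub> v = \<zero>\<^bsub>free_module A X w\<^esub>"
      by (auto intro!: bexI[of _ "\<lambda>i. \<ominus> \<one> \<otimes> v i"])
  qed (auto simp: finsupp_zero finsupp_add finsuppD a_ac)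
  have md: "module A (free_module A X w)"
    by (rule moduleI[OF is_cring ag])
       (auto simp: finsupp_smult finsuppD(1) l_distr r_distr m_assoc)
  show ?thesis
  proof (intro graded_mod.intro[OF md] graded_mod_axioms.intro)
    fix i j a x
    assume a: "a \<in> part A i" and x: "x \<in> part (free_module A X w) j"
    have "a \<otimes> x k \<in> part A (i + j - w k)" for k
      using part_mult[OF a, of "x k" "j - w k"] x by (simp add: add_diff_eq)
    then show "a \<odot>\<^bsub>free_module A X w\<^esub> x \<in> part (free_module A X w) (i + j)"
      using x part_carrier[OF a] by (simp add: finsupp_smult)
  qed (auto simp: finsupp_zero finsupp_add)
qed

lemma free_module_module: "module A (free_module A X w)"
  using free_graded_mod graded_mod.axioms by blast

lemma free_abelian_group: "abelian_group (free_module A X w)"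
  using free_module_module module.axioms by blast

lemma free_induct [consumes 1, case_names zero add single]:
  assumes "v \<in> finsupp A X" and z: "P (\<lambda>i. \<zero>)"
    and a: "\<And>u v. u \<in> finsupp A X \<Longrightarrow> v \<in> finsupp A X \<Longrightarrow> P u \<Longrightarrow> P v \<Longrightarrow> P (\<lambda>i. u i \<oplus> v i)"
    and s: "\<And>i a m. i \<in> X \<Longrightarrow> a \<in> part A m \<Longrightarrow> P (single A i a)"
  shows "P v"
proof -
  have sg: "P (single A i a)" if "i \<in> X" "a \<in> carrier A" for i a
    using that(2)
  proof (induction rule: homogeneous_induct)
    case zero then show ?case using s[OF that(1) part_zero] z by (simp add: single_def)
  next
    case (add a b)
    then show ?case using assms(3)[OF finsupp_single finsupp_single] that(1) by (simp add: single_add)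
  qed (use s that in auto)
  show ?thesis using assms(1)
    by (induction rule: finsupp_induct) (use z a sg in auto)
qed

lemma single_smult: "a \<in> carrier A \<Longrightarrow> single A i a = a \<odot>\<^bsub>free_module A X w\<^esub> single A i \<one>"
  by (auto simp: single_def)

lemma single_part: "a \<in> part A m \<Longrightarrow> i \<in> X \<Longrightarrow> single A i a \<in> part (free_module A X w) (m + w i)"
  using finsupp_single[OF part_carrier, of a m i X] by (auto simp: single_def)

lemma basis_part: "i \<in> X \<Longrightarrow> single A i \<one> \<in> part (free_module A X w) (w i)"
  using single_part[OF one_part] by fastforce

lemma free_eqI:
  assumes "graded_mod A N" "f \<in> graded_hom A (free_module A X w) N e" "g \<in> graded_hom A (free_module A X w) N e'"
    and "\<And>i. i \<in> X \<Longrightarrow> f (single A i \<one>) = g (single A i \<one>)" and "v \<in> finsupp A X"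
  shows "f v = g v"
  using assms(5)
proof (induction rule: free_induct)
  interpret N: graded_mod A N by fact
  case zero
  show ?case using ghom_zero[OF free_abelian_group N.M.abelian_group_axioms assms(2)]
     ghom_zero[OF free_abelian_group N.M.abelian_group_axioms assms(3)] by simp
next
  case (add u v)
  then show ?case using ghom_add[OF assms(2)] ghom_add[OF assms(3)] by simp
next
  case (single i a m)
  then have "single A i a = a \<odot>\<^bsub>free_module A X w\<^esub> single A i \<one>" by (intro single_smult) (rule part_carrier)
  then show ?case 
    using ghom_smult[OF assms(2)] ghom_smult[OF assms(3)] single part_carrier[OF single(2)] assms(4)
      finsupp_single[of \<one> i X] by (simp del: free_module_simps(4))
qed

lemma linear_extension:
  assumes "graded_mod A M" and y: "\<And>i. i \<in> X \<Longrightarrow> y i \<in> part M (w i + e)"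
  shows "\<exists>F \<in> graded_hom A (free_module A X w) M e. \<forall>i \<in> X. F (single A i \<one>) = y i"
proof -
  interpret M: graded_mod A M by fact
  define F where "F v = (\<Oplus>\<^bsub>M\<^esub>i \<in> {i. v i \<noteq> \<zero>}. v i \<odot>\<^bsub>M\<^esub> y i)" for v
  have yc: "y i \<in> carrier M" if "i \<in> X" for i using y[OF that] M.mpart_carrier by blast
  have sup: "{i. v i \<noteq> \<zero>} \<subseteq> X" if "v \<in> finsupp A X" for v using that by (auto simp: finsupp_def)
  have F_eq: "F v = (\<Oplus>\<^bsub>M\<^esub>i \<in> S. v i \<odot>\<^bsub>M\<^esub> y i)" 
    if "v \<in> finsupp A X" "finite S" "{i. v i \<noteq> \<zero>} \<subseteq> S" "S \<subseteq> X" for v S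
    unfolding F_def 
  proof (rule M.add.finprod_mono_neutral_cong_left)
    show "(\<lambda>i. v i \<odot>\<^bsub>M\<^esub> y i) \<in> S \<rightarrow> carrier M" using that yc finsuppD(1)[OF that(1)] by blast
  qed (use that yc in auto)
  have "restrict F (carrier (free_module A X w)) \<in> graded_hom A (free_module A X w) M e"
  proof (rule ghomI[OF free_graded_mod])
    fix v assume "v \<in> carrier (free_module A X w)"
    then show "F v \<in> carrier M" unfolding F_def using sup[of v] yc
      by (auto intro!: M.finsum_closed M.smult_closed simp: finsuppD(1))
  next
    fix u v assume "u \<in> carrier (free_module A X w)" "v \<in> carrier (free_module A X w)"
    then have uv: "u \<in> finsupp A X" "v \<in> finsupp A X" by auto
    let ?S = "{i. u i \<noteq> \<zero>} \<union> {i. v i \<noteq> \<zero>}"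
    have S: "finite ?S" "?S \<subseteq> X" using uv sup finsuppD(2) by auto
    have "F (\<lambda>i. u i \<oplus> v i) = (\<Oplus>\<^bsub>M\<^esub>i \<in> ?S. (u i \<oplus> v i) \<odot>\<^bsub>M\<^esub> y i)"
      by (rule F_eq[OF finsupp_add]) (use uv S in auto)
    also have "\<dots> = (\<Oplus>\<^bsub>M\<^esub>i \<in> ?S. u i \<odot>\<^bsub>M\<^esub> y i \<oplus>\<^bsub>M\<^esub> v i \<odot>\<^bsub>M\<^esub> y i)"
      by (rule M.finsum_cong') (use uv S yc in \<open>auto simp: finsuppD(1) M.smult_l_distr\<close>)
    also have "\<dots> = (\<Oplus>\<^bsub>M\<^esub>i \<in> ?S. u i \<odot>\<^bsub>M\<^esub> y i) \<oplus>\<^bsub>M\<^esub> (\<Oplus>\<^bsub>M\<^esub>i \<in> ?S. v i \<odot>\<^bsub>M\<^esub> y i)"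
      by (rule M.finsum_addf) (use uv S yc in \<open>auto simp: finsuppD(1)\<close>)
    also have "\<dots> = F u \<oplus>\<^bsub>M\<^esub> F v" using F_eq[of u ?S] F_eq[of v ?S] uv S by auto
    finally show "F (u \<oplus>\<^bsub>free_module A X w\<^esub> v) = F u \<oplus>\<^bsub>M\<^esub> F v" by simp
  next
    fix a v assume a: "a \<in> carrier A" and "v \<in> carrier (free_module A X w)"
    then have v: "v \<in> finsupp A X" by simp
    have "F (\<lambda>i. a \<otimes> v i) = (\<Oplus>\<^bsub>M\<^esub>i \<in> {i. v i \<noteq> \<zero>}. (a \<otimes> v i) \<odot>\<^bsub>M\<^esub> y i)"
      by (rule F_eq[OF finsupp_smult]) (use v a sup finsuppD(2) in auto)
    also have "\<dots> = (\<Oplus>\<^bsub>M\<^esub>i \<in> {i. v i \<noteq> \<zero>}. a \<odot>\<^bsub>M\<^esub> (v i \<odot>\<^bsub>M\<^esub> y i))"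
      using subsetD[OF sup[OF v]] finsuppD(1)[OF v]
      by (intro M.finsum_cong') (use a yc in \<open>auto simp: M.smult_assoc1\<close>)
    also have "\<dots> = a \<odot>\<^bsub>M\<^esub> F v" unfolding F_def
      by (rule M.finsum_smult_ldistr[symmetric]) (use subsetD[OF sup[OF v]] a finsuppD(1)[OF v] finsuppD(2)[OF v] yc in auto)
    finally show "F (a \<odot>\<^bsub>free_module A X w\<^esub> v) = a \<odot>\<^bsub>M\<^esub> F v" by simp
  next
    fix i v assume "v \<in> part (free_module A X w) i"
    then have v: "v \<in> finsupp A X" "\<And>k. v k \<in> part A (i - w k)" by auto
    have "v k \<odot>\<^bsub>M\<^esub> y k \<in> part M (i + e)" if "v k \<noteq> \<zero>" for k
      using M.mpart_smult[OF v(2) y, of k k] that sup[OF v(1)] by (auto simp: algebra_simps)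
    then show "F v \<in> part M (i + e)" unfolding F_def using v(1)
      by (auto intro!: M.mpart_finsum simp: finsuppD(2))
  qed
  moreover have "F (single A i \<one>) = y i" if "i \<in> X" for i
  proof -
    have "F (single A i \<one>) = (\<Oplus>\<^bsub>M\<^esub>k \<in> {i}. single A i \<one> k \<odot>\<^bsub>M\<^esub> y k)"
      by (rule F_eq[OF finsupp_single]) (use that in \<open>auto simp: single_def\<close>)
    then show ?thesis using yc[OF that] by (simp add: single_def)
  qed
  ultimately show ?thesis 
    by (intro bexI[of _ "restrict F (carrier (free_module A X w))"]) (auto simp: finsupp_single)
qed

text \<open>Free modules are graded projective: lifts of the basis elements may be chosen homogeneous
  of the right degree.\<close>

lemma projective_lift:
  assumes "graded_mod A M" "graded_mod A N" "f \<in> graded_hom A (free_module A X w) N e"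
    "p \<in> graded_hom A M N 0"
    and "\<And>j x. x \<in> part (free_module A X w) j \<Longrightarrow> \<exists>y \<in> part M (j + e). p y = f x"
  shows "\<exists>F \<in> graded_hom A (free_module A X w) M e. \<forall>x \<in> finsupp A X. p (F x) = f x"
proof -
  have "\<forall>i \<in> X. \<exists>y. y \<in> part M (w i + e) \<and> p y = f (single A i \<one>)"
    using assms(5)[OF basis_part] by blast
  then obtain y where y: "\<And>i. i \<in> X \<Longrightarrow> y i \<in> part M (w i + e)" "\<And>i. i \<in> X \<Longrightarrow> p (y i) = f (single A i \<one>)"
    by metis
  obtain F where F: "F \<in> graded_hom A (free_module A X w) M e" "\<forall>i \<in> X. F (single A i \<one>) = y i"
    using linear_extension[where X = X and w = w, OF assms(1) y(1)] by blast
  note pF = ghom_comp0'[OF free_graded_mod F(1) assms(4)]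
  have "p (F x) = f x" if "x \<in> finsupp A X" for x
    using free_eqI[OF assms(2) pF assms(3) _ that] F y that by (simp add: finsupp_single)
  then show ?thesis using F by blast
qed

lemma free_separated: "separated (free_module A X w)"
proof -
  have h: "(\<lambda>i. hcomp A (j - w i) (x i)) = (if k = j then x else (\<lambda>i. \<zero>))"
    if "\<forall>i. x i \<in> part A (k - w i)" for j k x
    using hcomp_homogeneous[OF that[rule_format]] by auto
  have "(\<lambda>i. hcomp A (j - w i) (x i \<oplus> y i)) = (\<lambda>i. hcomp A (j - w i) (x i) \<oplus> hcomp A (j - w i) (y i))"
    if "x \<in> finsupp A X" "y \<in> finsupp A X" for j x y
    using finsuppD(1)[OF that(1)] finsuppD(1)[OF that(2)] by (simp add: hcomp_add)
  note h = h this
  show ?thesis unfolding separated_def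
  proof
    fix j
    show "\<exists>p. (\<forall>x \<in> carrier (free_module A X w). \<forall>y \<in> carrier (free_module A X w).
        p (x \<oplus>\<^bsub>free_module A X w\<^esub> y) = p x \<oplus>\<^bsub>free_module A X w\<^esub> p y) \<and>
     (\<forall>i. \<forall>x \<in> part (free_module A X w) i. p x = (if i = j then x else \<zero>\<^bsub>free_module A X w\<^esub>))"
    proof (intro exI[of _ "\<lambda>v i. hcomp A (j - w i) (v i)"] conjI allI ballI)
      fix i x assume "x \<in> part (free_module A X w) i"
      then have "\<forall>k. x k \<in> part A (i - w k)" by simp
      from h(1)[OF this, of j] 
      show "(\<lambda>i. hcomp A (j - w i) (x i)) = (if i = j then x else \<zero>\<^bsub>free_module A X w\<^esub>)" by simp
    qed (simp add: h(2))
  qed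
qed

lemma trivial_separated: "separated (trivial_module K A)"
  unfolding separated_def
proof
  fix j
  show "\<exists>p. (\<forall>x \<in> carrier (trivial_module K A). \<forall>y \<in> carrier (trivial_module K A).
        p (x \<oplus>\<^bsub>trivial_module K A\<^esub> y) = p x \<oplus>\<^bsub>trivial_module K A\<^esub> p y) \<and>
     (\<forall>i. \<forall>x \<in> part (trivial_module K A) i. p x = (if i = j then x else \<zero>\<^bsub>trivial_module K A\<^esub>))"
    by (intro exI[of _ "\<lambda>x. if j = 0 then x else \<zero>\<^bsub>K\<^esub>"]) (auto simp: trivial_module_def)
qed

text \<open>A resolution is required to be exact as a sequence of sets of elements. Exactness in each degree
  follows: the coordinatewise component of a preimage is again a preimage, since components in \<open>N\<close>
  are unique.\<close>

lemma homogeneous_preimage: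
  assumes "graded_mod A N" "separated N" "f \<in> graded_hom A (free_module A X w) N 0"
    "y \<in> finsupp A X" "f y \<in> part N j"
  shows "\<exists>y' \<in> part (free_module A X w) j. f y' = f y"
proof -
  interpret N: graded_mod A N by fact
  obtain p where p: "\<forall>x \<in> carrier N. \<forall>y \<in> carrier N. p (x \<oplus>\<^bsub>N\<^esub> y) = p x \<oplus>\<^bsub>N\<^esub> p y"
    "\<forall>i. \<forall>x \<in> part N i. p x = (if i = j then x else \<zero>\<^bsub>N\<^esub>)"
    using spec[OF assms(2)[unfolded separated_def], of j] by (elim exE conjE) (rule that)
  note p = p(1) p(2)[rule_format]
  let ?c = "\<lambda>v i. hcomp A (j - w i) (v i)"
  have c: "?c v \<in> finsupp A X" if "v \<in> finsupp A X" for v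
    using that by (auto simp: finsupp_def intro: finite_subset[of _ "{i. v i \<noteq> \<zero>}"])
  have f0: "f (\<lambda>i. \<zero>) = \<zero>\<^bsub>N\<^esub>" using ghom_zero[OF free_abelian_group N.M.abelian_group_axioms assms(3)] by simp
  have "f (?c y) = p (f y)" using assms(4)
  proof (induction rule: free_induct)
    case zero
    then show ?case using p(2)[of "\<zero>\<^bsub>N\<^esub>" j] by (simp add: f0)
  next
    case (add u v)
    then have "f (\<lambda>i. ?c u i \<oplus> ?c v i) = p (f (\<lambda>i. u i \<oplus> v i))"
      using ghom_add[OF assms(3), of "?c u" "?c v"] ghom_add[OF assms(3), of u v] c p(1)
        ghom_closed[OF assms(3)] by simp
    then show ?case using add by (simp add: hcomp_add finsuppD(1))
  next
    case (single i a m)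
    have *: "?c (single A i a) = (if m + w i = j then single A i a else (\<lambda>i. \<zero>))"
      using single by (auto simp: single_def hcomp_homogeneous)
    have "f (single A i a) \<in> part N (m + w i)" using ghom_part0[OF assms(3) single_part] single by blast
    then show ?case unfolding * using p(2) f0 by (auto split: if_splits)
  qed
  also have "\<dots> = f y" using p(2)[OF assms(5)] by simp
  finally show ?thesis using c[OF assms(4)] hcomp_part[OF finsuppD(1)[OF assms(4)]]
    by (intro bexI[of _ "?c y"]) auto
qed

end

subsection \<open>Restriction of scalars\<close>

definition restrict_scalars :: "('a \<Rightarrow> 'b) \<Rightarrow> ('b, 'm) graded \<Rightarrow> ('a, 'm) graded" where
  "restrict_scalars h M = \<lparr>carrier = carrier M, monoid.mult = monoid.mult M, one = one M,
     zero = zero M, add = add M, smult = (\<lambda>a x. h a \<odot>\<^bsub>M\<^esub> x), part = part M\<rparr>"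

lemma restrict_scalars_simps [simp]:
  "carrier (restrict_scalars h M) = carrier M"
  "zero (restrict_scalars h M) = zero M"
  "add (restrict_scalars h M) = add M"
  "smult (restrict_scalars h M) = (\<lambda>a x. h a \<odot>\<^bsub>M\<^esub> x)"
  "part (restrict_scalars h M) = part M"
  by (simp_all add: restrict_scalars_def)

lemma restrict_scalars_graded_mod:
  assumes "graded_mod B M" "cring A" "h \<in> ring_hom A B" "\<And>i a. a \<in> part A i \<Longrightarrow> h a \<in> part B i"
  shows "graded_mod A (restrict_scalars h M)"
proof -
  interpret M: graded_mod B M by fact
  have ag: "abelian_group (restrict_scalars h M)"
    by (rule abelian_groupI) (auto simp: M.M.a_ac intro: M.M.l_neg bexI[of _ "\<ominus>\<^bsub>M\<^esub> _"])
  have "module A (restrict_scalars h M)"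
    using ring_hom_memE[OF assms(3)]
    by (intro moduleI[OF assms(2) ag]) (auto simp: M.smult_l_distr M.smult_r_distr M.smult_assoc1)
  then show ?thesis
    by (intro graded_mod.intro graded_mod_axioms.intro) (auto intro: M.mpart_carrier assms(4))
qed

lemma restrict_scalars_ghom:
  "h \<in> ring_hom A B \<Longrightarrow> f \<in> graded_hom B M N e \<Longrightarrow>
     f \<in> graded_hom A (restrict_scalars h M) (restrict_scalars h N) e"
  by (auto simp: graded_hom_def dest: ring_hom_memE(1))

section \<open>Exact complexes and the comparison theorem\<close>

context comm_graded_alg
begin

abbreviation "triv \<equiv> trivial_module K A"

lemma triv_simps [simp]:
  "carrier triv = carrier K" "zero triv = \<zero>\<^bsub>K\<^esub>" "add triv = add K"
  "smult triv = (\<lambda>a c. aug a \<otimes>\<^bsub>K\<^esub> c)"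
  "part triv = (\<lambda>i. if i = 0 then carrier K else {\<zero>\<^bsub>K\<^esub>})"
  by (simp_all add: trivial_module_def)

lemma triv_minus [simp]: "x \<in> carrier K \<Longrightarrow> \<ominus>\<^bsub>triv\<^esub> x = \<ominus>\<^bsub>K\<^esub> x"
proof -
  assume x: "x \<in> carrier K"
  interpret T: graded_mod A triv by (rule trivial_graded_mod)
  show ?thesis using T.M.minus_equality[of "\<ominus>\<^bsub>K\<^esub> x" x] x by (simp add: K.l_neg)
qed

lemma triv_diff [simp]: "x \<in> carrier K \<Longrightarrow> y \<in> carrier K \<Longrightarrow> x \<ominus>\<^bsub>triv\<^esub> y = x \<ominus>\<^bsub>K\<^esub> y"
  by (simp add: a_minus_def)

lemma triv_group: "abelian_group triv"
  using trivial_graded_mod graded_mod.axioms module.axioms by blast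

end

definition is_free_complex :: "('k, 'a) graded \<Rightarrow> (nat \<Rightarrow> ('a, 'i \<Rightarrow> 'a) graded) \<Rightarrow> (nat \<Rightarrow> ('i \<Rightarrow> 'a) \<Rightarrow> 'i \<Rightarrow> 'a) \<Rightarrow> bool" where
  "is_free_complex A S dS \<longleftrightarrow> (\<forall>n. \<exists>X w. S n = free_module A X w) \<and>
     (\<forall>n. dS n \<in> graded_hom A (S (Suc n)) (S n) 0) \<and>
     (\<forall>n. \<forall>x \<in> carrier (S (Suc (Suc n))). dS n (dS (Suc n) x) = \<zero>\<^bsub>S n\<^esub>)"

text \<open>The maps of degree \<open>e\<close> into the trivial module that factor through the incoming
  differential; in degree 0 only the zero map does.\<close>

definition is_coboundary ::
  "('k, 'z) ring_scheme \<Rightarrow> ('k, 'a) graded \<Rightarrow> (nat \<Rightarrow> ('a, 'm) graded) \<Rightarrow> (nat \<Rightarrow> 'm \<Rightarrow> 'm) \<Rightarrow> nat \<Rightarrow> int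
     \<Rightarrow> ('m \<Rightarrow> 'k) \<Rightarrow> bool" where
  "is_coboundary K A S dS n e f \<longleftrightarrow> (case n of
     0 \<Rightarrow> \<forall>x \<in> carrier (S 0). f x = \<zero>\<^bsub>K\<^esub>
   | Suc r \<Rightarrow> \<exists>k \<in> graded_hom A (S r) (trivial_module K A) e. \<forall>x \<in> carrier (S (Suc r)). f x = k (dS r x))"

text \<open>The target of the comparison theorem. Its terms may be arbitrary graded modules, so that a
  resolution over a quotient of \<open>A\<close> is an instance; this is why exactness is stated degree by
  degree.\<close>

locale exact_augmented = comm_graded_alg K A
  for K :: "('k, 'z) ring_scheme" and A :: "('k, 'a) graded" +
  fixes D :: "nat \<Rightarrow> ('a, 'm) graded" and dd :: "nat \<Rightarrow> 'm \<Rightarrow> 'm" and eps :: "'m \<Rightarrow> 'k"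
  assumes D_mod: "\<And>n. graded_mod A (D n)"
    and dd_hom: "\<And>n. dd n \<in> graded_hom A (D (Suc n)) (D n) 0"
    and eps_hom: "eps \<in> graded_hom A (D 0) triv 0"
    and eps_onto: "\<And>c j. c \<in> part triv j \<Longrightarrow> \<exists>y \<in> part (D 0) j. eps y = c"
    and exact_0: "\<And>x j. x \<in> part (D 0) j \<Longrightarrow> eps x = \<zero>\<^bsub>K\<^esub> \<Longrightarrow> \<exists>y \<in> part (D 1) j. dd 0 y = x"
    and exact_Suc: "\<And>n x j. x \<in> part (D (Suc n)) j \<Longrightarrow> dd n x = \<zero>\<^bsub>D n\<^esub> \<Longrightarrow>
           \<exists>y \<in> part (D (Suc (Suc n))) j. dd (Suc n) y = x"
    and eps_dd: "\<And>y. y \<in> carrier (D 1) \<Longrightarrow> eps (dd 0 y) = \<zero>\<^bsub>K\<^esub>"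
    and dd_dd: "\<And>n y. y \<in> carrier (D (Suc (Suc n))) \<Longrightarrow> dd n (dd (Suc n) y) = \<zero>\<^bsub>D n\<^esub>"
begin

lemma D_group: "abelian_group (D n)" using D_mod graded_mod.axioms module.axioms by blast

definition is_cycle :: "nat \<Rightarrow> 'm \<Rightarrow> bool" where
  "is_cycle n x \<longleftrightarrow> (case n of 0 \<Rightarrow> eps x = \<zero>\<^bsub>K\<^esub> | Suc k \<Rightarrow> dd k x = \<zero>\<^bsub>D k\<^esub>)"

lemma cycle_boundary: "x \<in> part (D n) j \<Longrightarrow> is_cycle n x \<Longrightarrow> \<exists>y \<in> part (D (Suc n)) j. dd n y = x"
  unfolding is_cycle_def using exact_0 exact_Suc by (cases n) auto

lemma lift_cycle:
  assumes E: "E \<in> graded_hom A (free_module A X w) (D i) e"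
    and cyc: "\<And>x. x \<in> finsupp A X \<Longrightarrow> is_cycle i (E x)"
  shows "\<exists>H \<in> graded_hom A (free_module A X w) (D (Suc i)) e. \<forall>x \<in> finsupp A X. dd i (H x) = E x"
proof -
  have "\<exists>y \<in> part (D (Suc i)) (j + e). dd i y = E x" if "x \<in> part (free_module A X w) j" for x j
    using cycle_boundary[OF ghom_part[OF E that] cyc] that by simp
  then show ?thesis by (rule projective_lift[OF D_mod D_mod E dd_hom])
qed

lemma lift_aug:
  assumes h: "h \<in> graded_hom A (free_module A X w) triv e"
  shows "\<exists>H \<in> graded_hom A (free_module A X w) (D 0) e. \<forall>x \<in> finsupp A X. eps (H x) = h x"
proof -
  have "\<exists>y \<in> part (D 0) (j + e). eps y = h x" if "x \<in> part (free_module A X w) j" for x j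
    by (rule eps_onto[OF ghom_part[OF h that]])
  then show ?thesis by (rule projective_lift[OF D_mod trivial_graded_mod h eps_hom])
qed

text \<open>The lift is chosen one degree at a time. The invariant \<open>Pr\<close> says that composing the current
  component with the differential gives cycles, which then bound in the target.\<close>

theorem lift_exists:
  assumes S: "is_free_complex A S dS" and h: "h \<in> graded_hom A (S 0) triv e"
    and hd: "\<And>x. x \<in> carrier (S 1) \<Longrightarrow> h (dS 0 x) = \<zero>\<^bsub>K\<^esub>"
  shows "\<exists>F. (\<forall>i. F i \<in> graded_hom A (S i) (D i) e) \<and> (\<forall>x \<in> carrier (S 0). eps (F 0 x) = h x) \<and>
     (\<forall>i. \<forall>x \<in> carrier (S (Suc i)). dd i (F (Suc i) x) = F i (dS i x))"
proof -
  have Sfree: "\<exists>X w. S n = free_module A X w" for n using S by (simp add: is_free_complex_def)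
  have Smod: "graded_mod A (S n)" for n using Sfree[of n] free_graded_mod by auto
  have dS: "dS n \<in> graded_hom A (S (Suc n)) (S n) 0" for n using S by (simp add: is_free_complex_def)
  have dSdS: "dS n (dS (Suc n) x) = \<zero>\<^bsub>S n\<^esub>" if "x \<in> carrier (S (Suc (Suc n)))" for n x
    using S that by (simp add: is_free_complex_def)
  define Pr where "Pr n F \<longleftrightarrow> F \<in> graded_hom A (S n) (D n) e \<and>
     (\<forall>x \<in> carrier (S (Suc n)). is_cycle n (F (dS n x))) \<and> (n = 0 \<longrightarrow> (\<forall>x \<in> carrier (S 0). eps (F x) = h x))" for n F
  define Qr where "Qr n F F' \<longleftrightarrow> (\<forall>x \<in> carrier (S (Suc n)). dd n (F' x) = F (dS n x))" for n F F'
  have "\<exists>F. \<forall>n. Pr n (F n) \<and> Qr n (F n) (F (Suc n))"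
  proof (rule dependent_nat_choice)
    obtain X w where X: "S 0 = free_module A X w" using Sfree by blast
    obtain F where F: "F \<in> graded_hom A (S 0) (D 0) e" "\<forall>x \<in> carrier (S 0). eps (F x) = h x"
      using lift_aug[of h X w e] h X by auto
    then show "\<exists>F. Pr 0 F" unfolding Pr_def is_cycle_def using hd ghom_closed[OF dS[of 0]] by auto
  next
    fix F n assume P: "Pr n F"
    then have F: "F \<in> graded_hom A (S n) (D n) e" 
      and cyc: "\<And>x. x \<in> carrier (S (Suc n)) \<Longrightarrow> is_cycle n (F (dS n x))" by (auto simp: Pr_def)
    obtain X w where X: "S (Suc n) = free_module A X w" using Sfree by blast
    interpret Sn: graded_mod A "S (Suc n)" by (rule Smod)
    note FdS = ghom_comp0[OF Smod dS F]
    obtain F' where F': "F' \<in> graded_hom A (S (Suc n)) (D (Suc n)) e"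
       "\<forall>x \<in> carrier (S (Suc n)). dd n (F' x) = (\<lambda>x\<in>carrier (S (Suc n)). F (dS n x)) x"
      using lift_cycle[of _ X w n e, OF FdS[unfolded X]] cyc X by auto
    have "is_cycle (Suc n) (F' (dS (Suc n) x))" if "x \<in> carrier (S (Suc (Suc n)))" for x
    proof -
      have "dd n (F' (dS (Suc n) x)) = F (dS n (dS (Suc n) x))" 
        using F'(2) ghom_closed[OF dS that] by simp
      also have "\<dots> = \<zero>\<^bsub>D n\<^esub>" using dSdS[OF that] ghom_zero[OF _ D_group F] Smod
        by (metis graded_mod.axioms(1) module.axioms(2))
      finally show ?thesis by (simp add: is_cycle_def)
    qed
    then show "\<exists>F'. Pr (Suc n) F' \<and> Qr n F F'" unfolding Pr_def Qr_def using F' by auto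
  qed
  then obtain F where "\<forall>n. Pr n (F n) \<and> Qr n (F n) (F (Suc n))" by (elim exE)
  then show ?thesis by (intro exI[of _ F]) (simp add: Pr_def Qr_def)
qed

text \<open>Two lifts of cohomologous cocycles are homotopic. Only the consequence for Ext classes is
  recorded: the difference \<open>\<Delta>\<close> of two such lifts, followed by a cocycle, is a
  coboundary.\<close>

theorem lift_unique:
  assumes S: "is_free_complex A S dS" 
    and \<Delta>: "\<And>i. \<Delta> i \<in> graded_hom A (S (q + i)) (D i) e"
    and chain: "\<And>i x. x \<in> carrier (S (q + Suc i)) \<Longrightarrow> dd i (\<Delta> (Suc i) x) = \<Delta> i (dS (q + i) x)"
    and cob: "is_coboundary K A S dS q e (\<lambda>x. eps (\<Delta> 0 x))"
    and f: "f \<in> graded_hom A (D p) triv e'" and fd: "\<And>y. y \<in> carrier (D (Suc p)) \<Longrightarrow> f (dd p y) = \<zero>\<^bsub>K\<^esub>"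
  shows "is_coboundary K A S dS (q + p) (e + e') (\<lambda>x. f (\<Delta> p x))"
proof -
  have Sfree: "\<exists>X w. S n = free_module A X w" for n using S by (simp add: is_free_complex_def)
  have Smod: "graded_mod A (S n)" for n using Sfree[of n] free_graded_mod by auto
  then have Sgrp: "abelian_group (S n)" for n by (blast dest: graded_mod.axioms module.axioms)
  have dS: "dS n \<in> graded_hom A (S (Suc n)) (S n) 0" for n using S by (simp add: is_free_complex_def)
  have dSdS: "dS n (dS (Suc n) x) = \<zero>\<^bsub>S n\<^esub>" if "x \<in> carrier (S (Suc (Suc n)))" for n x
    using S that by (simp add: is_free_complex_def)
  have lift: "\<exists>H \<in> graded_hom A (S n) (D (Suc i)) e. \<forall>x \<in> carrier (S n). dd i (H x) = E x"
    if E: "E \<in> graded_hom A (S n) (D i) e" and cyc: "\<And>x. x \<in> carrier (S n) \<Longrightarrow> is_cycle i (E x)" for E n i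
  proof -
    obtain X w where X: "S n = free_module A X w" using Sfree by blast
    show ?thesis using lift_cycle[OF E[unfolded X]] cyc X by simp
  qed
  define claim where "claim i \<longleftrightarrow> (case q + i of
       0 \<Rightarrow> \<forall>x \<in> carrier (S 0). is_cycle i (\<Delta> i x)
     | Suc r \<Rightarrow> \<exists>H \<in> graded_hom A (S r) (D i) e. \<forall>x \<in> carrier (S (Suc r)). is_cycle i (\<Delta> i x \<ominus>\<^bsub>D i\<^esub> H (dS r x)))" for i
  have "claim i" for i
  proof (induction i)
    case 0
    show ?case
    proof (cases q)
      case 0
      then show ?thesis using cob by (simp add: claim_def is_coboundary_def is_cycle_def)
    next
      case (Suc r)
      then obtain k where k: "k \<in> graded_hom A (S r) triv e" "\<forall>x \<in> carrier (S q). eps (\<Delta> 0 x) = k (dS r x)"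
        using cob by (auto simp: is_coboundary_def)
      obtain X w where X: "S r = free_module A X w" using Sfree by blast
      obtain H where H: "H \<in> graded_hom A (S r) (D 0) e" "\<forall>x \<in> carrier (S r). eps (H x) = k x"
        using lift_aug[of k X w e] k X by auto
      interpret D0: abelian_group "D 0" by (rule D_group)
      have "eps (\<Delta> 0 x \<ominus>\<^bsub>D 0\<^esub> H (dS r x)) = \<zero>\<^bsub>K\<^esub>" if "x \<in> carrier (S q)" for x
      proof -
        have c: "\<Delta> 0 x \<in> carrier (D 0)" "H (dS r x) \<in> carrier (D 0)" "dS r x \<in> carrier (S r)"
          using ghom_closed[OF \<Delta>[of 0]] ghom_closed[OF H(1)] ghom_closed[OF dS[of r]] that Suc by auto
        then have "eps (\<Delta> 0 x \<ominus>\<^bsub>D 0\<^esub> H (dS r x)) = eps (\<Delta> 0 x) \<oplus>\<^bsub>K\<^esub> (\<ominus>\<^bsub>K\<^esub> eps (H (dS r x)))"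
          using ghom_add[OF eps_hom] ghom_minus[OF D_group triv_group eps_hom] ghom_closed[OF eps_hom] 
          by (simp add: a_minus_def)
        then show ?thesis using k(2) H(2) c that ghom_closed[OF eps_hom c(1)] by (simp add: K.r_neg)
      qed
      then show ?thesis unfolding claim_def is_cycle_def using Suc H(1) by auto
    qed
  next
    case (Suc i)
    interpret Di: abelian_group "D i" by (rule D_group)
    interpret DSi: abelian_group "D (Suc i)" by (rule D_group)
    have "\<exists>E. E \<in> graded_hom A (S (q + i)) (D i) e \<and> (\<forall>x \<in> carrier (S (q + i)). is_cycle i (E x)) \<and>
         (\<forall>x \<in> carrier (S (q + Suc i)). E (dS (q + i) x) = \<Delta> i (dS (q + i) x))"
    proof (cases "q + i")
      case 0
      then show ?thesis using Suc \<Delta>[of i] by (intro exI[of _ "\<Delta> i"]) (simp add: claim_def)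
    next
      case (Suc r)
      then obtain H where H: "H \<in> graded_hom A (S r) (D i) e"
        "\<forall>x \<in> carrier (S (Suc r)). is_cycle i (\<Delta> i x \<ominus>\<^bsub>D i\<^esub> H (dS r x))"
        using \<open>claim i\<close> by (auto simp: claim_def)
      define E where "E = (\<lambda>x\<in>carrier (S (q + i)). \<Delta> i x \<ominus>\<^bsub>D i\<^esub> H (dS r x))"
      have Hd: "(\<lambda>x\<in>carrier (S (Suc r)). H (dS r x)) \<in> graded_hom A (S (q + i)) (D i) e"
        using ghom_comp0[OF Smod dS, of H r "D i" e] H Suc by simp
      have "(\<lambda>x\<in>carrier (S (q + i)). \<Delta> i x \<ominus>\<^bsub>D i\<^esub> (\<lambda>x\<in>carrier (S (Suc r)). H (dS r x)) x) 
          \<in> graded_hom A (S (q + i)) (D i) e"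
        by (rule ghom_diff[OF Smod D_mod \<Delta> Hd])
      also have "(\<lambda>x\<in>carrier (S (q + i)). \<Delta> i x \<ominus>\<^bsub>D i\<^esub> (\<lambda>x\<in>carrier (S (Suc r)). H (dS r x)) x) = E"
        unfolding E_def using Suc by auto
      finally have 1: "E \<in> graded_hom A (S (q + i)) (D i) e" .
      have 2: "is_cycle i (E x)" if "x \<in> carrier (S (q + i))" for x using H that Suc by (simp add: E_def)
      have 3: "E (dS (q + i) x) = \<Delta> i (dS (q + i) x)" if "x \<in> carrier (S (q + Suc i))" for x
      proof -
        have c: "dS (q + i) x \<in> carrier (S (q + i))" using ghom_closed[OF dS] that by simp
        have "dS r (dS (q + i) x) = \<zero>\<^bsub>S r\<^esub>" using dSdS[of x r] that Suc by simp
        then have "H (dS r (dS (q + i) x)) = \<zero>\<^bsub>D i\<^esub>" using ghom_zero[OF Sgrp D_group H(1)] by simp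
        then show ?thesis using c ghom_closed[OF \<Delta> c] by (simp add: E_def a_minus_def)
      qed
      show ?thesis using 1 2 3 by blast
    qed
    then obtain E where E: "E \<in> graded_hom A (S (q + i)) (D i) e" "\<And>x. x \<in> carrier (S (q + i)) \<Longrightarrow> is_cycle i (E x)"
      "\<And>x. x \<in> carrier (S (q + Suc i)) \<Longrightarrow> E (dS (q + i) x) = \<Delta> i (dS (q + i) x)" by blast
    obtain H where H: "H \<in> graded_hom A (S (q + i)) (D (Suc i)) e" "\<forall>x \<in> carrier (S (q + i)). dd i (H x) = E x"
      using lift[OF E(1,2)] by blast
    have "is_cycle (Suc i) (\<Delta> (Suc i) x \<ominus>\<^bsub>D (Suc i)\<^esub> H (dS (q + i) x))" if x: "x \<in> carrier (S (q + Suc i))" for x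
    proof -
      have c: "dS (q + i) x \<in> carrier (S (q + i))" using ghom_closed[OF dS] x by simp
      note c' = ghom_closed[OF H(1) c] ghom_closed[OF \<Delta> x] ghom_closed[OF \<Delta> c]
      have "dd i (\<Delta> (Suc i) x \<ominus>\<^bsub>D (Suc i)\<^esub> H (dS (q + i) x)) = dd i (\<Delta> (Suc i) x) \<oplus>\<^bsub>D i\<^esub> (\<ominus>\<^bsub>D i\<^esub> dd i (H (dS (q + i) x)))"
        using c' ghom_add[OF dd_hom] ghom_minus[OF D_group D_group dd_hom] by (simp add: a_minus_def)
      also have "\<dots> = \<zero>\<^bsub>D i\<^esub>" using chain[OF x] H(2) c E(3)[OF x] c' by (simp add: Di.r_neg)
      finally show ?thesis by (simp add: is_cycle_def)
    qed
    then show ?case unfolding claim_def using H(1) by auto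
  qed
  note cl = this[of p]
  have f_cycle: "f (E x) = \<zero>\<^bsub>K\<^esub>" if E: "E \<in> graded_hom A (S n) (D p) e" 
    and cyc: "\<And>x. x \<in> carrier (S n) \<Longrightarrow> is_cycle p (E x)" and x: "x \<in> carrier (S n)" for E n x
  proof -
    obtain H where H: "H \<in> graded_hom A (S n) (D (Suc p)) e" "\<forall>x \<in> carrier (S n). dd p (H x) = E x"
      using lift[OF E cyc] by blast
    then show ?thesis using fd[OF ghom_closed[OF H(1) x]] x by simp
  qed
  interpret Dp: abelian_group "D p" by (rule D_group)
  show ?thesis
  proof (cases "q + p")
    case 0
    then have "f (\<Delta> p x) = \<zero>\<^bsub>K\<^esub>" if "x \<in> carrier (S 0)" for x
      using f_cycle[of "\<Delta> p" 0] \<Delta>[of p] cl that by (simp add: claim_def)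
    then show ?thesis using 0 by (simp add: is_coboundary_def)
  next
    case (Suc r)
    then obtain H where H: "H \<in> graded_hom A (S r) (D p) e" 
      "\<forall>x \<in> carrier (S (Suc r)). is_cycle p (\<Delta> p x \<ominus>\<^bsub>D p\<^esub> H (dS r x))" using cl by (auto simp: claim_def)
    have \<Delta>p: "\<Delta> p \<in> graded_hom A (S (Suc r)) (D p) e" using \<Delta>[of p] Suc by simp
    have Hd: "(\<lambda>x\<in>carrier (S (Suc r)). H (dS r x)) \<in> graded_hom A (S (Suc r)) (D p) e"
      by (rule ghom_comp0[OF Smod dS H(1)])
    note E = ghom_diff[OF Smod D_mod \<Delta>p Hd]
    have "f (\<Delta> p x) = f (H (dS r x))" if x: "x \<in> carrier (S (Suc r))" for x
    proof -
      note c = ghom_closed[OF \<Delta>p x] ghom_closed[OF H(1) ghom_closed[OF dS x]]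
      have "f (\<Delta> p x \<ominus>\<^bsub>D p\<^esub> H (dS r x)) = \<zero>\<^bsub>K\<^esub>"
        using f_cycle[OF E _ x] H(2) x by simp
      then have "f (\<Delta> p x) \<oplus>\<^bsub>K\<^esub> \<ominus>\<^bsub>K\<^esub> f (H (dS r x)) = \<zero>\<^bsub>K\<^esub>"
        using c ghom_add[OF f] ghom_minus[OF D_group triv_group f] ghom_closed[OF f c(2)] by (simp add: a_minus_def)
      then show ?thesis using K.add_minus_zeroD ghom_closed[OF f] c by simp
    qed
    then show ?thesis using ghom_comp[OF Smod H(1) f] Suc ghom_closed[OF dS[of r]]
      by (auto simp: is_coboundary_def intro!: bexI[of _ "\<lambda>x\<in>carrier (S r). f (H x)"])
  qed
qed

end

section \<open>Ext as a quotient of cocycles\<close>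

locale resolution = comm_graded_alg K A
  for K :: "('k, 'z) ring_scheme" and A :: "('k, 'a) graded" +
  fixes P :: "('k, 'a, nat \<Rightarrow> 'a) augmented_complex"
  assumes res: "free_resolution K A P"
begin

lemma P_free: "\<exists>X w. (\<forall>m. finite {i \<in> X. w i \<le> m}) \<and> rmod P n = free_module A X w"
  using res by (simp add: free_resolution_def)

lemma P_mod: "graded_mod A (rmod P n)" using P_free[of n] free_graded_mod by auto

lemma P_group: "abelian_group (rmod P n)" using P_free[of n] free_abelian_group by auto

lemma P_separated: "separated (rmod P n)" using P_free[of n] free_separated by auto

lemma rdiff_hom: "rdiff P n \<in> graded_hom A (rmod P (Suc n)) (rmod P n) 0"
  using res by (simp add: free_resolution_def)

lemma raug_hom: "raug P \<in> graded_hom A (rmod P 0) triv 0"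
  using res by (simp add: free_resolution_def)

lemma ker_raug: "{x \<in> carrier (rmod P 0). raug P x = \<zero>\<^bsub>K\<^esub>} = rdiff P 0 ` carrier (rmod P 1)"
  using res by (simp add: free_resolution_def)

lemma ker_rdiff: "{x \<in> carrier (rmod P (Suc n)). rdiff P n x = \<zero>\<^bsub>rmod P n\<^esub>} =
    rdiff P (Suc n) ` carrier (rmod P (Suc (Suc n)))"
  using res by (simp add: free_resolution_def)

lemma homogeneous_boundary:
  assumes "x \<in> part (rmod P n) j" "x \<in> rdiff P n ` carrier (rmod P (Suc n))"
  shows "\<exists>y\<in>part (rmod P (Suc n)) j. rdiff P n y = x"
proof -
  obtain y where "y \<in> carrier (rmod P (Suc n))" "x = rdiff P n y" using assms by blast
  moreover obtain X w where X: "rmod P (Suc n) = free_module A X w" using P_free by blast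
  ultimately show ?thesis 
    using homogeneous_preimage[OF P_mod P_separated, of "rdiff P n" X w n y j] rdiff_hom[of n] assms by simp
qed

lemma homogeneous_raug:
  assumes "c \<in> part triv j"
  shows "\<exists>y\<in>part (rmod P 0) j. raug P y = c"
proof -
  have c: "c \<in> carrier K" using assms by (auto split: if_splits)
  then have "c \<in> raug P ` carrier (rmod P 0)" using res by (simp add: free_resolution_def)
  then obtain y where "y \<in> carrier (rmod P 0)" "c = raug P y" by blast
  moreover obtain X w where X: "rmod P 0 = free_module A X w" using P_free by blast
  ultimately show ?thesis 
    using homogeneous_preimage[OF trivial_graded_mod trivial_separated, of "raug P" X w y j] raug_hom assms
    by simp
qed

sublocale exact_augmented K A "rmod P" "rdiff P" "raug P"
proof (intro exact_augmented.intro[OF comm_graded_alg_axioms] exact_augmented_axioms.intro)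
  fix n y x j and c :: 'k
  show "graded_mod A (rmod P n)" by (rule P_mod)
  show "rdiff P n \<in> graded_hom A (rmod P (Suc n)) (rmod P n) 0" by (rule rdiff_hom)
  show "raug P \<in> graded_hom A (rmod P 0) triv 0" by (rule raug_hom)
  show "c \<in> part triv j \<Longrightarrow> \<exists>y\<in>part (rmod P 0) j. raug P y = c" by (rule homogeneous_raug)
  show "x \<in> part (rmod P 0) j \<Longrightarrow> raug P x = \<zero>\<^bsub>K\<^esub> \<Longrightarrow> \<exists>y\<in>part (rmod P 1) j. rdiff P 0 y = x"
    using homogeneous_boundary[of x 0 j] ker_raug graded_mod.mpart_carrier[OF P_mod, of x 0 j] by auto
  show "x \<in> part (rmod P (Suc n)) j \<Longrightarrow> rdiff P n x = \<zero>\<^bsub>rmod P n\<^esub> \<Longrightarrow>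
      \<exists>y\<in>part (rmod P (Suc (Suc n))) j. rdiff P (Suc n) y = x"
    using homogeneous_boundary[of x "Suc n" j] ker_rdiff[of n] graded_mod.mpart_carrier[OF P_mod, of x "Suc n" j] by blast
  show "y \<in> carrier (rmod P 1) \<Longrightarrow> raug P (rdiff P 0 y) = \<zero>\<^bsub>K\<^esub>"
    using ker_raug by blast
  show "y \<in> carrier (rmod P (Suc (Suc n))) \<Longrightarrow> rdiff P n (rdiff P (Suc n) y) = \<zero>\<^bsub>rmod P n\<^esub>"
    using ker_rdiff[of n] by blast
qed

lemma free_complex_shift: "is_free_complex A (\<lambda>i. rmod P (q + i)) (\<lambda>i. rdiff P (q + i))"
proof -
  have "\<exists>X w. rmod P (q + n) = free_module A X w" for n using P_free by blast
  moreover have "rdiff P (q + n) (rdiff P (q + Suc n) x) = \<zero>\<^bsub>rmod P (q + n)\<^esub>" 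
    if "x \<in> carrier (rmod P (q + Suc (Suc n)))" for x n using dd_dd[of x "q + n"] that by simp
  ultimately show ?thesis unfolding is_free_complex_def using rdiff_hom by auto
qed

lemma free_complex: "is_free_complex A (rmod P) (rdiff P)"
  using free_complex_shift[of 0] by simp

abbreviation "Ch n m \<equiv> cochains K A P n m"
abbreviation "Z n m \<equiv> cocycles K A P n m"
abbreviation "Bd n m \<equiv> coboundaries K A P n m"
abbreviation "cls n m \<equiv> ext_class K A P n m"
abbreviation "cob n m \<equiv> is_coboundary K A (rmod P) (rdiff P) n (- m)"

lemma Ch_simps:
  "carrier (Ch n m) = graded_hom A (rmod P n) triv (- m)"
  "zero (Ch n m) = (\<lambda>x \<in> carrier (rmod P n). \<zero>\<^bsub>K\<^esub>)"
  "add (Ch n m) = (\<lambda>f g. \<lambda>x \<in> carrier (rmod P n). f x \<oplus>\<^bsub>K\<^esub> g x)"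
  "smult (Ch n m) = (\<lambda>c f. \<lambda>x \<in> carrier (rmod P n). c \<otimes>\<^bsub>K\<^esub> f x)"
  by (simp_all add: cochains_def)

lemma Ch_val: "f \<in> carrier (Ch n m) \<Longrightarrow> x \<in> carrier (rmod P n) \<Longrightarrow> f x \<in> carrier K"
  using ghom_closed[of f A "rmod P n" triv "- m" x] by (simp add: Ch_simps)

lemma Ch_ext: "f \<in> carrier (Ch n m) \<Longrightarrow> g \<in> carrier (Ch n m) \<Longrightarrow>
   (\<And>x. x \<in> carrier (rmod P n) \<Longrightarrow> f x = g x) \<Longrightarrow> f = g"
  unfolding Ch_simps by (rule ghom_ext)

lemma Ch_group: "abelian_group (Ch n m)"
proof (rule abelian_groupI)
  show add: "f \<oplus>\<^bsub>Ch n m\<^esub> g \<in> carrier (Ch n m)" if "f \<in> carrier (Ch n m)" "g \<in> carrier (Ch n m)" for f g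
    using ghom_plus[OF P_mod trivial_graded_mod, of f n "- m" g] that by (simp add: Ch_simps)
  show zero: "\<zero>\<^bsub>Ch n m\<^esub> \<in> carrier (Ch n m)"
    using ghom_null[OF P_mod trivial_graded_mod, of n "- m"] by (simp add: Ch_simps)
  show "(f \<oplus>\<^bsub>Ch n m\<^esub> g) \<oplus>\<^bsub>Ch n m\<^esub> h = f \<oplus>\<^bsub>Ch n m\<^esub> (g \<oplus>\<^bsub>Ch n m\<^esub> h)"
    if "f \<in> carrier (Ch n m)" "g \<in> carrier (Ch n m)" "h \<in> carrier (Ch n m)" for f g h
    using that[THEN Ch_val] by (auto simp: Ch_simps(3) K.a_assoc intro!: restrict_ext)
  show "f \<oplus>\<^bsub>Ch n m\<^esub> g = g \<oplus>\<^bsub>Ch n m\<^esub> f"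
    if "f \<in> carrier (Ch n m)" "g \<in> carrier (Ch n m)" for f g
    using that[THEN Ch_val] by (auto simp: Ch_simps(3) K.a_comm intro!: restrict_ext)
  show "\<zero>\<^bsub>Ch n m\<^esub> \<oplus>\<^bsub>Ch n m\<^esub> f = f" if f: "f \<in> carrier (Ch n m)" for f
    using Ch_ext[OF add[OF zero f] f] Ch_val[OF f] by (simp add: Ch_simps)
  show "\<exists>g\<in>carrier (Ch n m). g \<oplus>\<^bsub>Ch n m\<^esub> f = \<zero>\<^bsub>Ch n m\<^esub>" if f: "f \<in> carrier (Ch n m)" for f
  proof (rule bexI[of _ "\<lambda>x\<in>carrier (rmod P n). \<ominus>\<^bsub>triv\<^esub> f x"])
    show c: "(\<lambda>x\<in>carrier (rmod P n). \<ominus>\<^bsub>triv\<^esub> f x) \<in> carrier (Ch n m)"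
      using ghom_uminus[OF P_mod trivial_graded_mod, of f n "- m"] f by (simp add: Ch_simps)
    show "(\<lambda>x\<in>carrier (rmod P n). \<ominus>\<^bsub>triv\<^esub> f x) \<oplus>\<^bsub>Ch n m\<^esub> f = \<zero>\<^bsub>Ch n m\<^esub>"
      using Ch_ext[OF add[OF c f] zero] Ch_val[OF f] by (simp add: Ch_simps K.l_neg)
  qed
qed

lemma Ch_smult: "c \<in> carrier K \<Longrightarrow> f \<in> carrier (Ch n m) \<Longrightarrow> c \<odot>\<^bsub>Ch n m\<^esub> f \<in> carrier (Ch n m)"
proof -
  assume c: "c \<in> carrier K" and f: "f \<in> carrier (Ch n m)"
  have "(\<lambda>x\<in>carrier (rmod P n). (c \<odot>\<^bsub>A\<^esub> \<one>\<^bsub>A\<^esub>) \<odot>\<^bsub>triv\<^esub> f x) \<in> graded_hom A (rmod P n) triv (- m + 0)"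
    by (rule ghom_act[OF P_mod trivial_graded_mod]) (use c f part_0 in \<open>auto simp: Ch_simps\<close>)
  then show ?thesis using c by (simp add: Ch_simps aug_const)
qed

lemma Bd_iff: "f \<in> Bd n m \<longleftrightarrow> f \<in> carrier (Ch n m) \<and> cob n m f"
proof (cases n)
  case 0
  have "\<zero>\<^bsub>Ch 0 m\<^esub> \<in> carrier (Ch 0 m)" using abelian_groupE(2)[OF Ch_group] .
  moreover have "f = \<zero>\<^bsub>Ch 0 m\<^esub>" if "f \<in> carrier (Ch 0 m)" "cob 0 m f"
    using Ch_ext[OF that(1) \<open>\<zero>\<^bsub>Ch 0 m\<^esub> \<in> carrier (Ch 0 m)\<close>] that(2) by (simp add: Ch_simps is_coboundary_def)
  moreover have "cob 0 m \<zero>\<^bsub>Ch 0 m\<^esub>" by (simp add: Ch_simps is_coboundary_def)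
  ultimately show ?thesis using 0 by auto
next
  case (Suc r)
  have "compose (carrier (rmod P (Suc r))) k (rdiff P r) \<in> carrier (Ch (Suc r) m)" if "k \<in> carrier (Ch r m)" for k
    using ghom_comp0[OF P_mod rdiff_hom, of k r triv "- m"] that by (simp add: Ch_simps compose_def)
  moreover have "f = compose (carrier (rmod P (Suc r))) k (rdiff P r)"
    if "f \<in> carrier (Ch (Suc r) m)" "\<forall>x \<in> carrier (rmod P (Suc r)). f x = k (rdiff P r x)" "k \<in> carrier (Ch r m)" for k
    by (rule Ch_ext[OF that(1)]) (use that calculation in \<open>auto simp: compose_def\<close>)
  ultimately show ?thesis unfolding Suc by (auto simp: is_coboundary_def Ch_simps(1) compose_def)
qed

lemma Z_iff: "f \<in> Z n m \<longleftrightarrow> f \<in> carrier (Ch n m) \<and> (\<forall>x \<in> carrier (rmod P (Suc n)). f (rdiff P n x) = \<zero>\<^bsub>K\<^esub>)"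
  by (simp add: cocycles_def)

lemma Z_Ch: "f \<in> Z n m \<Longrightarrow> f \<in> carrier (Ch n m)" by (simp add: Z_iff)

lemma Z_hom: "f \<in> Z n m \<Longrightarrow> f \<in> graded_hom A (rmod P n) triv (- m)" by (simp add: Z_iff Ch_simps)

lemma Bd_Z: "f \<in> Bd n m \<Longrightarrow> f \<in> Z n m"
proof -
  assume f: "f \<in> Bd n m"
  have "f (rdiff P n x) = \<zero>\<^bsub>K\<^esub>" if x: "x \<in> carrier (rmod P (Suc n))" for x
  proof (cases n)
    case 0
    have "cob n m f" using f by (simp only: Bd_iff)
    then show ?thesis using 0 x ghom_closed[OF rdiff_hom x] by (simp add: is_coboundary_def)
  next
    case (Suc r)
    have "cob n m f" using f by (simp only: Bd_iff)
    then obtain k where "k \<in> graded_hom A (rmod P r) triv (- m)" 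
      "\<forall>x \<in> carrier (rmod P (Suc r)). f x = k (rdiff P r x)"
      using Suc by (auto simp: is_coboundary_def)
    then show ?thesis using dd_dd[of x r] x Suc ghom_closed[OF rdiff_hom x] ghom_zero[OF P_group triv_group] by simp
  qed
  then show ?thesis using f by (simp add: Z_iff Bd_iff)
qed

lemma Z_add: "f \<in> Z n m \<Longrightarrow> g \<in> Z n m \<Longrightarrow> f \<oplus>\<^bsub>Ch n m\<^esub> g \<in> Z n m"
  unfolding Z_iff using abelian_groupE(1)[OF Ch_group] ghom_closed[OF rdiff_hom]
  by (auto simp: Ch_simps(3))

lemma Z_smult: "c \<in> carrier K \<Longrightarrow> f \<in> Z n m \<Longrightarrow> c \<odot>\<^bsub>Ch n m\<^esub> f \<in> Z n m"
  unfolding Z_iff using Ch_smult ghom_closed[OF rdiff_hom]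
  by (auto simp: Ch_simps(4))

lemma zero_Z: "\<zero>\<^bsub>Ch n m\<^esub> \<in> Z n m"
  unfolding Z_iff using abelian_groupE(2)[OF Ch_group] ghom_closed[OF rdiff_hom]
  by (auto simp: Ch_simps(2))

lemma cob_add: "cob n m f \<Longrightarrow> cob n m g \<Longrightarrow> cob n m (\<lambda>x. f x \<oplus>\<^bsub>K\<^esub> g x)"
proof (cases n)
  case (Suc r)
  assume "cob n m f" "cob n m g"
  then obtain k l where k: "k \<in> graded_hom A (rmod P r) triv (- m)" "\<forall>x \<in> carrier (rmod P (Suc r)). f x = k (rdiff P r x)"
    and l: "l \<in> graded_hom A (rmod P r) triv (- m)" "\<forall>x \<in> carrier (rmod P (Suc r)). g x = l (rdiff P r x)"
    using Suc by (auto simp: is_coboundary_def)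
  then show ?thesis using Suc ghom_plus[OF P_mod trivial_graded_mod k(1) l(1)] ghom_closed[OF rdiff_hom]
    by (auto simp: is_coboundary_def intro!: bexI[of _ "\<lambda>x\<in>carrier (rmod P r). k x \<oplus>\<^bsub>K\<^esub> l x"])
qed (simp add: is_coboundary_def)

lemma cob_smult: "c \<in> carrier K \<Longrightarrow> cob n m f \<Longrightarrow> cob n m (\<lambda>x. c \<otimes>\<^bsub>K\<^esub> f x)"
proof (cases n)
  case (Suc r)
  assume c: "c \<in> carrier K" and "cob n m f"
  then obtain k where k: "k \<in> graded_hom A (rmod P r) triv (- m)" "\<forall>x \<in> carrier (rmod P (Suc r)). f x = k (rdiff P r x)"
    using Suc by (auto simp: is_coboundary_def)
  have "c \<odot>\<^bsub>Ch r m\<^esub> k \<in> carrier (Ch r m)" using Ch_smult c k by (simp add: Ch_simps)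
  then show ?thesis using Suc ghom_closed[OF rdiff_hom] k(2)
    by (auto simp: is_coboundary_def Ch_simps intro!: bexI[of _ "\<lambda>x\<in>carrier (rmod P r). c \<otimes>\<^bsub>K\<^esub> k x"])
qed (simp add: is_coboundary_def)

lemma cob_cong: "(\<And>x. x \<in> carrier (rmod P n) \<Longrightarrow> f x = g x) \<Longrightarrow> cob n m f \<longleftrightarrow> cob n m g"
  by (cases n) (auto simp: is_coboundary_def)

lemma Bd_subgroup: "abelian_subgroup (Bd n m) (Ch n m)"
proof (rule abelian_subgroupI3[OF additive_subgroupI Ch_group])
  interpret C: abelian_group "Ch n m" by (rule Ch_group)
  have z: "\<zero>\<^bsub>Ch n m\<^esub> \<in> Bd n m"
    unfolding Bd_iff
  proof
    show "cob n m \<zero>\<^bsub>Ch n m\<^esub>"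
    proof (cases n)
      case (Suc r)
      have "\<zero>\<^bsub>Ch r m\<^esub> \<in> graded_hom A (rmod P r) triv (- m)"
        using abelian_groupE(2)[OF Ch_group, of r m] unfolding Ch_simps(1) .
      then show ?thesis using Suc ghom_closed[OF rdiff_hom[of r]]
        by (auto simp: is_coboundary_def Ch_simps intro!: bexI[of _ "\<lambda>x\<in>carrier (rmod P r). \<zero>\<^bsub>K\<^esub>"])
    qed (simp add: is_coboundary_def Ch_simps)
  qed auto
  have minus: "\<ominus>\<^bsub>Ch n m\<^esub> f = (\<ominus>\<^bsub>K\<^esub> \<one>\<^bsub>K\<^esub>) \<odot>\<^bsub>Ch n m\<^esub> f" if f: "f \<in> carrier (Ch n m)" for f
  proof (rule C.minus_equality)
    have s: "(\<ominus>\<^bsub>K\<^esub> \<one>\<^bsub>K\<^esub>) \<odot>\<^bsub>Ch n m\<^esub> f \<in> carrier (Ch n m)" using Ch_smult f by simp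
    show "(\<ominus>\<^bsub>K\<^esub> \<one>\<^bsub>K\<^esub>) \<odot>\<^bsub>Ch n m\<^esub> f \<oplus>\<^bsub>Ch n m\<^esub> f = \<zero>\<^bsub>Ch n m\<^esub>"
      by (rule Ch_ext[OF C.a_closed[OF s f] C.zero_closed])
         (use Ch_val[OF f] in \<open>simp add: Ch_simps K.l_minus K.l_neg\<close>)
  qed (use Ch_smult f in auto)
  show "subgroup (Bd n m) (add_monoid (Ch n m))"
  proof (rule subgroup.intro)
    show "x \<otimes>\<^bsub>add_monoid (Ch n m)\<^esub> y \<in> Bd n m" if "x \<in> Bd n m" "y \<in> Bd n m" for x y
    proof -
      have "x \<oplus>\<^bsub>Ch n m\<^esub> y \<in> carrier (Ch n m)" using that by (auto simp: Bd_iff)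
      moreover have "cob n m (x \<oplus>\<^bsub>Ch n m\<^esub> y)"
        using cob_add[of n m x y] that cob_cong[of n "x \<oplus>\<^bsub>Ch n m\<^esub> y" "\<lambda>a. x a \<oplus>\<^bsub>K\<^esub> y a" m] by (simp add: Bd_iff Ch_simps)
      ultimately show ?thesis by (simp add: Bd_iff)
    qed
    show "inv\<^bsub>add_monoid (Ch n m)\<^esub> x \<in> Bd n m" if "x \<in> Bd n m" for x
    proof -
      have x: "x \<in> carrier (Ch n m)" "cob n m x" using that by (auto simp: Bd_iff)
      have "cob n m (\<ominus>\<^bsub>Ch n m\<^esub> x)" unfolding minus[OF x(1)]
        using cob_smult[OF _ x(2), of "\<ominus>\<^bsub>K\<^esub> \<one>\<^bsub>K\<^esub>"] 
          cob_cong[of n "(\<ominus>\<^bsub>K\<^esub> \<one>\<^bsub>K\<^esub>) \<odot>\<^bsub>Ch n m\<^esub> x" "\<lambda>a. (\<ominus>\<^bsub>K\<^esub> \<one>\<^bsub>K\<^esub>) \<otimes>\<^bsub>K\<^esub> x a" m] by (simp add: Ch_simps)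
      then show ?thesis using x by (simp add: Bd_iff a_inv_def[symmetric])
    qed
  qed (use z in \<open>auto simp: Bd_iff\<close>)
qed

lemma Ch_minus_val:
  assumes "f \<in> carrier (Ch n m)" "g \<in> carrier (Ch n m)" "x \<in> carrier (rmod P n)"
  shows "(f \<oplus>\<^bsub>Ch n m\<^esub> \<ominus>\<^bsub>Ch n m\<^esub> g) x = f x \<ominus>\<^bsub>K\<^esub> g x"
proof -
  interpret C: abelian_group "Ch n m" by (rule Ch_group)
  have "(\<ominus>\<^bsub>Ch n m\<^esub> g \<oplus>\<^bsub>Ch n m\<^esub> g) x = \<zero>\<^bsub>K\<^esub>" using assms C.l_neg by (simp add: Ch_simps)
  then have "(\<ominus>\<^bsub>Ch n m\<^esub> g) x \<oplus>\<^bsub>K\<^esub> g x = \<zero>\<^bsub>K\<^esub>" using assms(3) by (simp add: Ch_simps)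
  then have "\<ominus>\<^bsub>K\<^esub> g x = (\<ominus>\<^bsub>Ch n m\<^esub> g) x" using assms Ch_val C.a_inv_closed K.minus_equality by metis
  then show ?thesis using assms(3) by (simp add: Ch_simps a_minus_def)
qed

lemma cls_eq_iff:
  assumes "f \<in> Z n m" "g \<in> Z n m"
  shows "cls n m f = cls n m g \<longleftrightarrow> cob n m (\<lambda>x. f x \<ominus>\<^bsub>K\<^esub> g x)"
proof -
  interpret B: abelian_subgroup "Bd n m" "Ch n m" by (rule Bd_subgroup)
  have c: "f \<in> carrier (Ch n m)" "g \<in> carrier (Ch n m)" using assms Z_Ch by auto
  have "cls n m f = cls n m g \<longleftrightarrow> f \<in> cls n m g"
    unfolding ext_class_def using B.a_rcos_self[OF c(1)] B.a_repr_independence[OF _ c(2) B.a_subgroup] by blast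
  also have "\<dots> \<longleftrightarrow> f \<oplus>\<^bsub>Ch n m\<^esub> \<ominus>\<^bsub>Ch n m\<^esub> g \<in> Bd n m"
    unfolding ext_class_def using B.a_rcos_module[OF c(2,1)] by simp
  also have "\<dots> \<longleftrightarrow> cob n m (\<lambda>x. f x \<ominus>\<^bsub>K\<^esub> g x)"
    using cob_cong[of n "f \<oplus>\<^bsub>Ch n m\<^esub> \<ominus>\<^bsub>Ch n m\<^esub> g" "\<lambda>x. f x \<ominus>\<^bsub>K\<^esub> g x" m] Ch_minus_val[OF c] c by (simp add: Bd_iff)
  finally show ?thesis .
qed

lemma cls_self: "f \<in> Z n m \<Longrightarrow> f \<in> cls n m f"
proof -
  interpret B: abelian_subgroup "Bd n m" "Ch n m" by (rule Bd_subgroup)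
  show "f \<in> Z n m \<Longrightarrow> f \<in> cls n m f" unfolding ext_class_def by (rule B.a_rcos_self[OF Z_Ch])
qed

lemma cls_mem:
  assumes "f \<in> Z n m" "g \<in> cls n m f"
  shows "g \<in> Z n m \<and> cls n m g = cls n m f"
proof -
  interpret B: abelian_subgroup "Bd n m" "Ch n m" by (rule Bd_subgroup)
  obtain b where b: "b \<in> Bd n m" "g = b \<oplus>\<^bsub>Ch n m\<^esub> f" using assms(2) by (auto simp: ext_class_def a_r_coset_def')
  then have "g \<in> Z n m" using Z_add Bd_Z assms(1) by simp
  moreover have "cls n m f = cls n m g"
    using B.a_repr_independence[OF _ Z_Ch[OF assms(1)] B.a_subgroup] assms(2) by (simp add: ext_class_def)
  ultimately show ?thesis by simp
qed

lemma cls_zero: "cls n m \<zero>\<^bsub>Ch n m\<^esub> = Bd n m"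
proof -
  interpret B: abelian_subgroup "Bd n m" "Ch n m" by (rule Bd_subgroup)
  show ?thesis unfolding ext_class_def by (rule B.a_coset_add_zero) (auto simp: Bd_iff)
qed

lemma cls_zero_iff: "f \<in> Z n m \<Longrightarrow> cls n m f = Bd n m \<longleftrightarrow> cob n m f"
proof -
  assume f: "f \<in> Z n m"
  then have "cls n m f = Bd n m \<longleftrightarrow> cob n m (\<lambda>x. f x \<ominus>\<^bsub>K\<^esub> \<zero>\<^bsub>Ch n m\<^esub> x)"
    using cls_eq_iff[OF f zero_Z] cls_zero by simp
  then show ?thesis using cob_cong[of n "\<lambda>x. f x \<ominus>\<^bsub>K\<^esub> \<zero>\<^bsub>Ch n m\<^esub> x" f] Ch_val[OF Z_Ch[OF f]] 
    by (simp add: Ch_simps a_minus_def)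
qed

lemma cls_add: "f \<in> Z n m \<Longrightarrow> g \<in> Z n m \<Longrightarrow> cls n m f <+>\<^bsub>Ch n m\<^esub> cls n m g = cls n m (f \<oplus>\<^bsub>Ch n m\<^esub> g)"
proof -
  interpret B: abelian_subgroup "Bd n m" "Ch n m" by (rule Bd_subgroup)
  show "f \<in> Z n m \<Longrightarrow> g \<in> Z n m \<Longrightarrow> cls n m f <+>\<^bsub>Ch n m\<^esub> cls n m g = cls n m (f \<oplus>\<^bsub>Ch n m\<^esub> g)"
    unfolding ext_class_def by (rule B.a_rcos_sum[OF Z_Ch Z_Ch])
qed

lemma cls_smult:
  assumes c: "c \<in> carrier K" and f: "f \<in> Z n m"
  shows "quot_smult (Ch n m) (Bd n m) c (cls n m f) = cls n m (c \<odot>\<^bsub>Ch n m\<^esub> f)"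
proof -
  have "cls n m (c \<odot>\<^bsub>Ch n m\<^esub> g) = cls n m (c \<odot>\<^bsub>Ch n m\<^esub> f)" if "g \<in> cls n m f" for g
  proof -
    have g: "g \<in> Z n m" "cls n m g = cls n m f" using cls_mem[OF f that] by auto
    then have "cob n m (\<lambda>x. c \<otimes>\<^bsub>K\<^esub> (g x \<ominus>\<^bsub>K\<^esub> f x))" using cls_eq_iff f cob_smult[OF c] by blast
    then have "cob n m (\<lambda>x. (c \<odot>\<^bsub>Ch n m\<^esub> g) x \<ominus>\<^bsub>K\<^esub> (c \<odot>\<^bsub>Ch n m\<^esub> f) x)"
      by (rule cob_cong[THEN iffD1, rotated])
         (use c Ch_val[OF Z_Ch[OF f]] Ch_val[OF Z_Ch[OF g(1)]] in \<open>simp add: Ch_simps a_minus_def K.r_distr K.r_minus\<close>)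
    then show ?thesis using cls_eq_iff Z_smult c f g by blast
  qed
  then have "\<And>g. g \<in> cls n m f \<Longrightarrow> Bd n m +>\<^bsub>Ch n m\<^esub> (c \<odot>\<^bsub>Ch n m\<^esub> g) = cls n m (c \<odot>\<^bsub>Ch n m\<^esub> f)"
    by (simp add: ext_class_def)
  then show ?thesis unfolding quot_smult_def using cls_self[OF f] by blast
qed

abbreviation "Xt n m \<equiv> Ext K A P n m"

lemma Xt_simps:
  "carrier (Xt n m) = cls n m ` Z n m" "zero (Xt n m) = Bd n m"
  "add (Xt n m) = set_add (Ch n m)" "smult (Xt n m) = quot_smult (Ch n m) (Bd n m)"
  by (simp_all add: Ext_def)

lemma Xt_monoid: "abelian_monoid (Xt n m)"
proof (rule abelian_monoidI)
  interpret C: abelian_group "Ch n m" by (rule Ch_group)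
  show "\<zero>\<^bsub>Xt n m\<^esub> \<in> carrier (Xt n m)" using zero_Z cls_zero by (force simp: Xt_simps)
  fix x assume x: "x \<in> carrier (Xt n m)"
  then obtain f where f: "f \<in> Z n m" "x = cls n m f" by (auto simp: Xt_simps)
  then show "\<zero>\<^bsub>Xt n m\<^esub> \<oplus>\<^bsub>Xt n m\<^esub> x = x"
    using cls_add[OF zero_Z f(1)] cls_zero Z_Ch[OF f(1)] by (simp add: Xt_simps)
  fix y assume y: "y \<in> carrier (Xt n m)"
  then obtain g where g: "g \<in> Z n m" "y = cls n m g" by (auto simp: Xt_simps)
  show "x \<oplus>\<^bsub>Xt n m\<^esub> y \<in> carrier (Xt n m)" using f g Z_add by (auto simp: Xt_simps cls_add)
  show "x \<oplus>\<^bsub>Xt n m\<^esub> y = y \<oplus>\<^bsub>Xt n m\<^esub> x" using f g Z_Ch by (auto simp: Xt_simps cls_add C.a_comm)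
  fix z assume z: "z \<in> carrier (Xt n m)"
  then obtain h where h: "h \<in> Z n m" "z = cls n m h" by (auto simp: Xt_simps)
  show "(x \<oplus>\<^bsub>Xt n m\<^esub> y) \<oplus>\<^bsub>Xt n m\<^esub> z = x \<oplus>\<^bsub>Xt n m\<^esub> (y \<oplus>\<^bsub>Xt n m\<^esub> z)"
    using f g h Z_Ch Z_add by (simp add: Xt_simps cls_add C.a_assoc)
qed

end

section \<open>Yoneda products\<close>

lemma (in abelian_monoid) finsum_in:
  assumes "Q \<subseteq> carrier G" "\<zero> \<in> Q" "\<And>x y. x \<in> Q \<Longrightarrow> y \<in> Q \<Longrightarrow> x \<oplus> y \<in> Q"
    and "\<And>i. i \<in> S \<Longrightarrow> c i \<in> Q"
  shows "(\<Oplus>i\<in>S. c i) \<in> Q"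
proof (cases "finite S")
  case True
  then show ?thesis using assms(4)
  proof (induction S)
    case (insert x F)
    then have "c \<in> F \<rightarrow> carrier G" "c x \<in> carrier G" using assms(1) by auto
    then show ?case using insert assms(3) by simp
  qed (use assms(2) in simp)
qed (use assms(2) in \<open>simp add: finsum_infinite\<close>)

declare coboundaries.simps [simp del]

context resolution
begin

lemma lifts_ex: "h \<in> Z q s \<Longrightarrow> \<exists>F. lifts A P q s h F"
  using lift_exists[OF free_complex_shift, of h q "- s"] 
  by (auto simp: lifts_def Z_iff Ch_simps)

lemma lift_cocycle:
  assumes f: "f \<in> Z p r" and F: "lifts A P q s h F"
  shows "compose (carrier (rmod P (q + p))) f (F p) \<in> Z (q + p) (r + s)"
proof -
  have Fp: "F i \<in> graded_hom A (rmod P (q + i)) (rmod P i) (- s)" for i using F by (simp add: lifts_def)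
  have c: "compose (carrier (rmod P (q + p))) f (F p) \<in> carrier (Ch (q + p) (r + s))"
    using ghom_comp[OF P_mod Fp Z_hom[OF f]] by (simp add: compose_def Ch_simps algebra_simps)
  have "f (F p (rdiff P (q + p) x)) = \<zero>\<^bsub>K\<^esub>" if x: "x \<in> carrier (rmod P (q + Suc p))" for x
  proof -
    have "F p (rdiff P (q + p) x) = rdiff P p (F (Suc p) x)" using F x by (simp add: lifts_def)
    then show ?thesis using f ghom_closed[OF Fp x] by (simp add: Z_iff)
  qed
  then show ?thesis using c ghom_closed[OF rdiff_hom[of "q + p"]] by (simp add: Z_iff compose_eq)
qed

text \<open>With \<open>\<Delta> = F - F'\<close> the difference of the two representatives is the sum of \<open>f \<Delta>\<close> and
  \<open>(f - f') F'\<close>. The first is a coboundary by uniqueness of lifts, the second because \<open>F'\<close> is a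
  chain map.\<close>

lemma lift_indep:
  assumes f: "f \<in> Z p r" "f' \<in> Z p r" "cls p r f = cls p r f'"
    and h: "h \<in> Z q s" "h' \<in> Z q s" "cls q s h = cls q s h'"
    and F: "lifts A P q s h F" and F': "lifts A P q s h' F'"
  shows "cls (q + p) (r + s) (compose (carrier (rmod P (q + p))) f (F p)) =
         cls (q + p) (r + s) (compose (carrier (rmod P (q + p))) f' (F' p))"
proof -
  have Fi: "F i \<in> graded_hom A (rmod P (q + i)) (rmod P i) (- s)" 
   "F' i \<in> graded_hom A (rmod P (q + i)) (rmod P i) (- s)" for i using F F' by (simp_all add: lifts_def)
  define \<Delta> where "\<Delta> i = (\<lambda>x\<in>carrier (rmod P (q + i)). F i x \<ominus>\<^bsub>rmod P i\<^esub> F' i x)" for i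
  have \<Delta>: "\<Delta> i \<in> graded_hom A (rmod P (q + i)) (rmod P i) (- s)" for i
    unfolding \<Delta>_def by (rule ghom_diff[OF P_mod P_mod Fi])
  have gdiff: "g (\<Delta> i x) = g (F i x) \<ominus>\<^bsub>N\<^esub> g (F' i x)"
    if "x \<in> carrier (rmod P (q + i))" "g \<in> graded_hom A (rmod P i) N e" "abelian_group N" for g i x e and N :: "('a, 'x) graded"
  proof -
    interpret Pi: abelian_group "rmod P i" by (rule P_group)
    show ?thesis using that(1) ghom_closed[OF Fi(1) that(1)] ghom_closed[OF Fi(2) that(1)]
       ghom_add[OF that(2)] ghom_minus[OF P_group that(3,2)] by (simp add: \<Delta>_def a_minus_def)
  qed
  have chain: "rdiff P i (\<Delta> (Suc i) x) = \<Delta> i (rdiff P (q + i) x)" if x: "x \<in> carrier (rmod P (q + Suc i))" for i x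
  proof -
    have "rdiff P (q + i) x \<in> carrier (rmod P (q + i))" using ghom_closed[OF rdiff_hom] x by simp
    moreover have "rdiff P i (\<Delta> (Suc i) x) = rdiff P i (F (Suc i) x) \<ominus>\<^bsub>rmod P i\<^esub> rdiff P i (F' (Suc i) x)"
      by (rule gdiff[OF x rdiff_hom P_group])
    moreover have "rdiff P i (F (Suc i) x) = F i (rdiff P (q + i) x)" "rdiff P i (F' (Suc i) x) = F' i (rdiff P (q + i) x)"
      using F F' x by (simp_all add: lifts_def)
    ultimately show ?thesis by (simp add: \<Delta>_def)
  qed
  have "is_coboundary K A (rmod P) (rdiff P) q (- s) (\<lambda>x. raug P (\<Delta> 0 x))"
  proof -
    have "raug P (\<Delta> 0 x) = h x \<ominus>\<^bsub>K\<^esub> h' x" if x: "x \<in> carrier (rmod P q)" for x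
      using gdiff[of x 0, OF _ raug_hom triv_group] F F' x Ch_val[OF Z_Ch[OF h(1)] x] Ch_val[OF Z_Ch[OF h(2)] x] 
      unfolding lifts_def by simp
    then have "cob q s (\<lambda>x. raug P (\<Delta> 0 x)) \<longleftrightarrow> cob q s (\<lambda>x. h x \<ominus>\<^bsub>K\<^esub> h' x)" by (rule cob_cong)
    then show ?thesis using cls_eq_iff h by blast
  qed
  note cob0 = this
  have "is_coboundary K A (rmod P) (rdiff P) (q + p) (- s + - r) (\<lambda>x. f (\<Delta> p x))"
  proof (rule lift_unique[OF free_complex, where \<Delta> = \<Delta> and q = q and f = f and p = p])
    show "\<Delta> i \<in> graded_hom A (rmod P (q + i)) (rmod P i) (- s)" for i by (rule \<Delta>)
    show "rdiff P i (\<Delta> (Suc i) x) = \<Delta> i (rdiff P (q + i) x)" if "x \<in> carrier (rmod P (q + Suc i))" for i x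
      using that by (rule chain)
    show "is_coboundary K A (rmod P) (rdiff P) q (- s) (\<lambda>x. raug P (\<Delta> 0 x))" by (rule cob0)
    show "f \<in> graded_hom A (rmod P p) triv (- r)" using f(1) by (rule Z_hom)
    show "f (rdiff P p y) = \<zero>\<^bsub>K\<^esub>" if "y \<in> carrier (rmod P (Suc p))" for y
      using f(1) that by (simp add: Z_iff)
  qed
  then have 1: "cob (q + p) (r + s) (\<lambda>x. f (\<Delta> p x))" by (simp add: add.commute)
  have 2: "cob (q + p) (r + s) (\<lambda>x. f (F' p x) \<ominus>\<^bsub>K\<^esub> f' (F' p x))"
  proof (cases p)
    case 0
    have "cob p r (\<lambda>x. f x \<ominus>\<^bsub>K\<^esub> f' x)" using f cls_eq_iff by blast
    then have z: "f (F' p x) \<ominus>\<^bsub>K\<^esub> f' (F' p x) = \<zero>\<^bsub>K\<^esub>" if "x \<in> carrier (rmod P (q + p))" for x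
      using 0 ghom_closed[OF Fi(2)[of 0]] that by (simp add: is_coboundary_def)
    have "cob (q + p) (r + s) \<zero>\<^bsub>Ch (q + p) (r + s)\<^esub>"
      using cls_zero_iff[OF zero_Z] cls_zero by blast
    then show ?thesis
      by (rule cob_cong[THEN iffD1, rotated]) (use z in \<open>simp add: Ch_simps\<close>)
  next
    case (Suc k)
    have "cob p r (\<lambda>x. f x \<ominus>\<^bsub>K\<^esub> f' x)" using f cls_eq_iff by blast
    then obtain l where l: "l \<in> graded_hom A (rmod P k) triv (- r)" 
       "\<forall>x \<in> carrier (rmod P p). f x \<ominus>\<^bsub>K\<^esub> f' x = l (rdiff P k x)"
      using Suc by (auto simp: is_coboundary_def)
    have "f (F' p x) \<ominus>\<^bsub>K\<^esub> f' (F' p x) = l (F' k (rdiff P (q + k) x))" if x: "x \<in> carrier (rmod P (q + p))" for x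
      using l(2) ghom_closed[OF Fi(2) x] F' x unfolding lifts_def Suc by simp
    moreover have "(\<lambda>x\<in>carrier (rmod P (q + k)). l (F' k x)) \<in> graded_hom A (rmod P (q + k)) triv (- (r + s))"
      using ghom_comp[OF P_mod Fi(2) l(1)] by (simp add: algebra_simps)
    ultimately show ?thesis unfolding is_coboundary_def using Suc ghom_closed[OF rdiff_hom[of "q + k"]]
      by (auto intro!: bexI[of _ "\<lambda>x\<in>carrier (rmod P (q + k)). l (F' k x)"])
  qed
  have "cob (q + p) (r + s) (\<lambda>x. compose (carrier (rmod P (q + p))) f (F p) x \<ominus>\<^bsub>K\<^esub> compose (carrier (rmod P (q + p))) f' (F' p) x)"
  proof (rule cob_cong[THEN iffD1, OF _ cob_add[OF 1 2]])
    fix x assume x: "x \<in> carrier (rmod P (q + p))"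
    note c = ghom_closed[OF Fi(1) x] ghom_closed[OF Fi(2) x]
    have k: "f (F p x) \<in> carrier K" "f (F' p x) \<in> carrier K" "f' (F' p x) \<in> carrier K"
      using Ch_val[OF Z_Ch[OF f(1)]] Ch_val[OF Z_Ch[OF f(2)]] c by auto
    have "f (\<Delta> p x) = f (F p x) \<ominus>\<^bsub>K\<^esub> f (F' p x)"
      using gdiff[OF x Z_hom[OF f(1)] triv_group] k by simp
    then have "f (\<Delta> p x) \<oplus>\<^bsub>K\<^esub> (f (F' p x) \<ominus>\<^bsub>K\<^esub> f' (F' p x)) = 
        f (F p x) \<oplus>\<^bsub>K\<^esub> ((\<ominus>\<^bsub>K\<^esub> f (F' p x) \<oplus>\<^bsub>K\<^esub> f (F' p x)) \<oplus>\<^bsub>K\<^esub> \<ominus>\<^bsub>K\<^esub> f' (F' p x))"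
      using k by (simp only: a_minus_def K.a_assoc K.a_inv_closed K.a_closed)
    then show "f (\<Delta> p x) \<oplus>\<^bsub>K\<^esub> (f (F' p x) \<ominus>\<^bsub>K\<^esub> f' (F' p x)) = 
       compose (carrier (rmod P (q + p))) f (F p) x \<ominus>\<^bsub>K\<^esub> compose (carrier (rmod P (q + p))) f' (F' p) x"
      using k x by (simp add: compose_eq K.l_neg a_minus_def)
  qed
  then show ?thesis using cls_eq_iff lift_cocycle[OF f(1) F] lift_cocycle[OF f(2) F'] by blast
qed

lemma yoneda_product_cls:
  assumes f: "f \<in> Z p r" and h: "h \<in> Z q s" and F: "lifts A P q s h F"
  shows "yoneda_product K A P p r q s (cls p r f) (cls q s h) =
     cls (q + p) (r + s) (compose (carrier (rmod P (q + p))) f (F p))" (is "?L = ?R")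
proof -
  have "cls (q + p) (r + s) (compose (carrier (rmod P (q + p))) f' (F' p)) = ?R"
    if "f' \<in> cls p r f" "h' \<in> cls q s h" "lifts A P q s h' F'" for f' h' F'
    using lift_indep[of f' p r f h' q s h F' F] cls_mem[OF f that(1)] cls_mem[OF h that(2)] that(3) f h F by simp
  then show ?thesis unfolding yoneda_product_def using cls_self[OF f] cls_self[OF h] F by blast
qed

abbreviation "yp \<equiv> yoneda_product K A P"

lemma zero_lifts: "lifts A P q s \<zero>\<^bsub>Ch q s\<^esub> (\<lambda>i. \<lambda>x\<in>carrier (rmod P (q + i)). \<zero>\<^bsub>rmod P i\<^esub>)"
  unfolding lifts_def
  using ghom_null[OF P_mod P_mod] ghom_zero[OF P_group P_group rdiff_hom] ghom_zero[OF P_group triv_group raug_hom]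
    ghom_closed[OF rdiff_hom] by (simp add: Ch_simps)

lemma yp_zero_right:
  assumes "X \<in> carrier (Xt p r)"
  shows "yp p r q s X (Bd q s) = Bd (q + p) (r + s)"
proof -
  obtain f where f: "f \<in> Z p r" "X = cls p r f" using assms by (auto simp: Xt_simps)
  have "compose (carrier (rmod P (q + p))) f (\<lambda>x\<in>carrier (rmod P (q + p)). \<zero>\<^bsub>rmod P p\<^esub>) = \<zero>\<^bsub>Ch (q + p) (r + s)\<^esub>"
    using ghom_zero[OF P_group triv_group Z_hom[OF f(1)]] by (auto simp: compose_def Ch_simps)
  then show ?thesis using yoneda_product_cls[OF f(1) zero_Z zero_lifts, of q s] f(2) cls_zero by metis
qed

lemma yp_zero_left:
  assumes "Y \<in> carrier (Xt q s)"
  shows "yp p r q s (Bd p r) Y = Bd (q + p) (r + s)"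
proof -
  obtain h where h: "h \<in> Z q s" "Y = cls q s h" using assms by (auto simp: Xt_simps)
  obtain F where F: "lifts A P q s h F" using lifts_ex h by blast
  have "F p \<in> graded_hom A (rmod P (q + p)) (rmod P p) (- s)" using F by (simp add: lifts_def)
  then have "compose (carrier (rmod P (q + p))) \<zero>\<^bsub>Ch p r\<^esub> (F p) = \<zero>\<^bsub>Ch (q + p) (r + s)\<^esub>"
    using ghom_closed by (fastforce simp: compose_def Ch_simps)
  then show ?thesis using yoneda_product_cls[OF zero_Z h(1) F, of p r] h(2) cls_zero by metis
qed

lemma yp_closed:
  assumes "X \<in> carrier (Xt p r)" "Y \<in> carrier (Xt q s)"
  shows "yp p r q s X Y \<in> carrier (Xt (q + p) (r + s))"
proof -
  obtain f h where "f \<in> Z p r" "X = cls p r f" "h \<in> Z q s" "Y = cls q s h" using assms by (auto simp: Xt_simps)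
  moreover obtain F where "lifts A P q s h F" using lifts_ex calculation by blast
  ultimately show ?thesis using yoneda_product_cls lift_cocycle by (simp add: Xt_simps)
qed

section \<open>The Yoneda algebra and the subalgebra generated in degrees 1 and 2\<close>

abbreviation "Y \<equiv> yoneda_algebra K A P"

lemma Y_simps:
  "carrier Y = {\<xi>. (\<forall>n m. \<xi> n m \<in> carrier (Xt n m)) \<and> finite {(n, m). \<xi> n m \<noteq> Bd n m}}"
  "monoid.mult Y = (\<lambda>\<xi> \<eta> n m. finsum (Xt n m)
      (\<lambda>(p, r). yp p r (n - p) (m - r) (\<xi> p r) (\<eta> (n - p) (m - r))) {(p, r). p \<le> n \<and> \<xi> p r \<noteq> Bd p r})"
  "one Y = (\<lambda>n m. if n = 0 \<and> m = 0 then cls 0 0 (raug P) else Bd n m)"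
  "zero Y = (\<lambda>n m. Bd n m)"
  "add Y = (\<lambda>\<xi> \<eta> n m. \<xi> n m <+>\<^bsub>Ch n m\<^esub> \<eta> n m)"
  "smult Y = (\<lambda>c \<xi> n m. quot_smult (Ch n m) (Bd n m) c (\<xi> n m))"
  by (simp_all add: yoneda_algebra_def Xt_simps fun_eq_iff)

lemma Bd_Xt: "Bd n m \<in> carrier (Xt n m)"
  using abelian_monoid.zero_closed[OF Xt_monoid] by (simp only: Xt_simps)

lemma Bd_add: "Bd n m <+>\<^bsub>Ch n m\<^esub> Bd n m = Bd n m"
  using abelian_monoid.l_zero[OF Xt_monoid Bd_Xt] by (simp only: Xt_simps)

lemma Bd_smult: "c \<in> carrier K \<Longrightarrow> quot_smult (Ch n m) (Bd n m) c (Bd n m) = Bd n m"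
  using cls_smult[OF _ zero_Z] cls_zero
proof -
  assume c: "c \<in> carrier K"
  have "c \<odot>\<^bsub>Ch n m\<^esub> \<zero>\<^bsub>Ch n m\<^esub> = \<zero>\<^bsub>Ch n m\<^esub>" using c by (auto simp: Ch_simps)
  then show ?thesis using cls_smult[OF c zero_Z] cls_zero by metis
qed

lemma raug_Z: "raug P \<in> Z 0 0"
  using raug_hom eps_dd by (simp add: Z_iff Ch_simps)

definition homog :: "nat \<Rightarrow> int \<Rightarrow> ((nat \<Rightarrow> 'a) \<Rightarrow> 'k) \<Rightarrow> nat \<Rightarrow> int \<Rightarrow> ((nat \<Rightarrow> 'a) \<Rightarrow> 'k) set" where
  "homog n m f = (\<lambda>n' m'. if n' = n \<and> m' = m then cls n m f else Bd n' m')"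

lemma homog_carrier:
  assumes f: "f \<in> Z n m" shows "homog n m f \<in> carrier Y"
proof -
  have "{(n', m'). homog n m f n' m' \<noteq> Bd n' m'} \<subseteq> {(n, m)}" by (auto simp: homog_def)
  then have "finite {(n', m'). homog n m f n' m' \<noteq> Bd n' m'}" using finite_subset by blast
  then show ?thesis using Bd_Xt f by (auto simp: Y_simps homog_def Xt_simps)
qed

lemma Y_mult_closed:
  assumes \<xi>: "\<xi> \<in> carrier Y" and \<eta>: "\<eta> \<in> carrier Y"
  shows "\<xi> \<otimes>\<^bsub>Y\<^esub> \<eta> \<in> carrier Y"
proof -
  let ?t = "\<lambda>n m (p, r). yp p r (n - p) (m - r) (\<xi> p r) (\<eta> (n - p) (m - r))"
  let ?I = "\<lambda>n. {(p, r). p \<le> n \<and> \<xi> p r \<noteq> Bd p r}"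
  let ?S = "{(p, r). \<xi> p r \<noteq> Bd p r}" and ?T = "{(p, r). \<eta> p r \<noteq> Bd p r}"
  have cl: "\<xi> n m \<in> carrier (Xt n m)" "\<eta> n m \<in> carrier (Xt n m)" for n m using \<xi> \<eta> by (auto simp: Y_simps)
  have t: "?t n m x \<in> carrier (Xt n m)" if x: "x \<in> ?I n" for n m x
  proof -
    obtain p r where x: "x = (p, r)" "p \<le> n" using x by auto
    have "yp p r (n - p) (m - r) (\<xi> p r) (\<eta> (n - p) (m - r)) \<in> carrier (Xt (n - p + p) (r + (m - r)))"
      by (rule yp_closed[OF cl])
    then show ?thesis using x by simp
  qed
  have c: "(\<xi> \<otimes>\<^bsub>Y\<^esub> \<eta>) n m \<in> carrier (Xt n m)" for n m
    unfolding Y_simps using t by (intro abelian_monoid.finsum_closed[OF Xt_monoid]) blast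
  have "(n, m) \<in> (\<lambda>((p, r), (q, s)). (p + q, r + s)) ` (?S \<times> ?T)"
    if nz: "(\<xi> \<otimes>\<^bsub>Y\<^esub> \<eta>) n m \<noteq> Bd n m" for n m
  proof -
    have "\<exists>x \<in> ?I n. ?t n m x \<noteq> Bd n m"
    proof (rule ccontr)
      assume "\<not> (\<exists>x \<in> ?I n. ?t n m x \<noteq> Bd n m)"
      then have "finsum (Xt n m) (?t n m) (?I n) = \<zero>\<^bsub>Xt n m\<^esub>"
        using abelian_monoid.finsum_in[OF Xt_monoid, of "{\<zero>\<^bsub>Xt n m\<^esub>}" n m "?I n" "?t n m"]
          Bd_Xt Bd_add by (auto simp: Xt_simps)
      then show False using nz by (simp add: Y_simps Xt_simps)
    qed
    then obtain p r where pr: "p \<le> n" "\<xi> p r \<noteq> Bd p r" "yp p r (n - p) (m - r) (\<xi> p r) (\<eta> (n - p) (m - r)) \<noteq> Bd n m" by auto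
    have "\<eta> (n - p) (m - r) \<noteq> Bd (n - p) (m - r)"
      using yp_zero_right[OF cl(1)[of p r], of "n - p" "m - r"] pr by auto
    then show "(n, m) \<in> (\<lambda>((p, r), (q, s)). (p + q, r + s)) ` (?S \<times> ?T)"
      using pr by (intro image_eqI[of _ _ "((p, r), (n - p, m - r))"]) auto
  qed
  then have "{(n, m). (\<xi> \<otimes>\<^bsub>Y\<^esub> \<eta>) n m \<noteq> Bd n m} \<subseteq> (\<lambda>((p, r), (q, s)). (p + q, r + s)) ` (?S \<times> ?T)"
    by blast
  moreover have "finite (?S \<times> ?T)" using \<xi> \<eta> by (auto simp: Y_simps)
  ultimately have "finite {(n, m). (\<xi> \<otimes>\<^bsub>Y\<^esub> \<eta>) n m \<noteq> Bd n m}" using finite_subset by blast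
  then show ?thesis using c by (simp add: Y_simps(1))
qed

lemma Y_add_closed:
  assumes \<xi>: "\<xi> \<in> carrier Y" and \<eta>: "\<eta> \<in> carrier Y"
  shows "\<xi> \<oplus>\<^bsub>Y\<^esub> \<eta> \<in> carrier Y"
proof -
  have cl: "\<xi> n m \<in> carrier (Xt n m)" "\<eta> n m \<in> carrier (Xt n m)" for n m using \<xi> \<eta> by (auto simp: Y_simps)
  have "\<xi> n m <+>\<^bsub>Ch n m\<^esub> \<eta> n m \<in> carrier (Xt n m)" for n m
    using abelian_monoid.a_closed[OF Xt_monoid cl[of n m]] by (simp only: Xt_simps)
  moreover have "finite {(n, m). \<xi> n m <+>\<^bsub>Ch n m\<^esub> \<eta> n m \<noteq> Bd n m}"
    by (rule finite_subset[of _ "{(n, m). \<xi> n m \<noteq> Bd n m} \<union> {(n, m). \<eta> n m \<noteq> Bd n m}"])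
       (use \<xi> \<eta> Bd_add in \<open>auto simp: Y_simps\<close>)
  ultimately show ?thesis by (simp add: Y_simps)
qed

lemma Y_smult_closed:
  assumes c: "c \<in> carrier K" and \<xi>: "\<xi> \<in> carrier Y"
  shows "c \<odot>\<^bsub>Y\<^esub> \<xi> \<in> carrier Y"
proof -
  have "quot_smult (Ch n m) (Bd n m) c (\<xi> n m) \<in> carrier (Xt n m)" for n m
  proof -
    have "\<xi> n m \<in> cls n m ` Z n m" using \<xi> by (simp add: Y_simps Xt_simps)
    then obtain f where "f \<in> Z n m" "\<xi> n m = cls n m f" by blast
    then show ?thesis using cls_smult[OF c] Z_smult[OF c] by (auto simp: Xt_simps)
  qed
  moreover have "finite {(n, m). quot_smult (Ch n m) (Bd n m) c (\<xi> n m) \<noteq> Bd n m}"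
    by (rule finite_subset[of _ "{(n, m). \<xi> n m \<noteq> Bd n m}"])
       (use \<xi> Bd_smult[OF c] in \<open>auto simp: Y_simps\<close>)
  ultimately show ?thesis by (simp add: Y_simps)
qed

lemma Y_one_homog: "one Y = homog 0 0 (raug P)"
  by (intro ext) (simp add: Y_simps homog_def)

abbreviation "gen2 \<equiv> generated_subalgebra K Y (yoneda_component K A P 1 \<union> yoneda_component K A P 2)"

lemma gen2_carrier: "\<xi> \<in> gen2 \<Longrightarrow> \<xi> \<in> carrier Y"
proof (induction rule: generated_subalgebra.induct)
  case one
  show ?case using homog_carrier[OF raug_Z] by (simp add: Y_one_homog)
qed (auto simp: yoneda_component_def intro: Y_mult_closed Y_add_closed Y_smult_closed)

lemma homog_mult:
  assumes f: "f \<in> Z p r" and h: "h \<in> Z q s" and F: "lifts A P q s h F"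
  shows "homog p r f \<otimes>\<^bsub>Y\<^esub> homog q s h = homog (q + p) (r + s) (compose (carrier (rmod P (q + p))) f (F p))"
proof (intro ext)
  fix n m
  interpret X: abelian_monoid "Xt n m" by (rule Xt_monoid)
  let ?I = "{(p', r'). p' \<le> n \<and> homog p r f p' r' \<noteq> Bd p' r'}"
  let ?t = "\<lambda>(p', r'). yp p' r' (n - p') (m - r') (homog p r f p' r') (homog q s h (n - p') (m - r'))"
  let ?R = "homog (q + p) (r + s) (compose (carrier (rmod P (q + p))) f (F p)) n m"
  have L: "(homog p r f \<otimes>\<^bsub>Y\<^esub> homog q s h) n m = finsum (Xt n m) ?t ?I" by (simp add: Y_simps)
  show "(homog p r f \<otimes>\<^bsub>Y\<^esub> homog q s h) n m = ?R"
  proof (cases "cls p r f = Bd p r \<or> n < p")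
    case True
    then have I: "?I = {}" by (auto simp: homog_def)
    have "?R = Bd n m"
    proof (cases "cls p r f = Bd p r")
      case True
      have "cls q s h \<in> carrier (Xt q s)" using h by (simp add: Xt_simps)
      then have "cls (q + p) (r + s) (compose (carrier (rmod P (q + p))) f (F p)) = Bd (q + p) (r + s)"
        using yoneda_product_cls[OF f h F] yp_zero_left True by metis
      then show ?thesis by (simp add: homog_def)
    qed (use True in \<open>auto simp: homog_def\<close>)
    then show ?thesis unfolding L I using Xt_simps(2) by simp
  next
    case False
    then have I: "?I = {(p, r)}" by (auto simp: homog_def)
    have "?t (p, r) = ?R"
    proof (cases "n - p = q \<and> m - r = s")
      case True
      then have "n = q + p" "m = r + s" using False by auto
      then show ?thesis using yoneda_product_cls[OF f h F] by (simp add: homog_def)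
    next
      case nq: False
      have "cls p r f \<in> carrier (Xt p r)" using f by (simp add: Xt_simps)
      then have "yp p r (n - p) (m - r) (cls p r f) (Bd (n - p) (m - r)) = Bd n m"
        using yp_zero_right[of "cls p r f" p r "n - p" "m - r"] False by simp
      moreover have "?R = Bd n m" using nq False by (auto simp: homog_def)
      ultimately show ?thesis using nq by (auto simp: homog_def)
    qed
    moreover have "?R \<in> carrier (Xt n m)"
      using homog_carrier[OF lift_cocycle[OF f F]] by (simp add: Y_simps)
    ultimately show ?thesis unfolding L I using X.finsum_insert[of "{}" "(p, r)" ?t] by simp
  qed
qed

text \<open>Generation of the Yoneda algebra is tested on cocycles: \<open>G n m\<close> consists of those whose class
  lies in the subalgebra generated in degrees 1 and 2.\<close>

definition G :: "nat \<Rightarrow> int \<Rightarrow> ((nat \<Rightarrow> 'a) \<Rightarrow> 'k) set" where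
  "G n m = {f \<in> Z n m. homog n m f \<in> gen2}"

lemma G_Z: "f \<in> G n m \<Longrightarrow> f \<in> Z n m" by (simp add: G_def)

lemma homog_Bd: "cls n m f = Bd n m \<Longrightarrow> homog n m f = zero Y"
  by (intro ext) (simp add: homog_def Y_simps)

lemma G_add: "f \<in> G n m \<Longrightarrow> g \<in> G n m \<Longrightarrow> f \<oplus>\<^bsub>Ch n m\<^esub> g \<in> G n m"
proof -
  assume fg: "f \<in> G n m" "g \<in> G n m"
  then have "homog n m (f \<oplus>\<^bsub>Ch n m\<^esub> g) = homog n m f \<oplus>\<^bsub>Y\<^esub> homog n m g"
    by (intro ext) (simp add: G_def homog_def Y_simps cls_add Bd_add)
  then show ?thesis using fg by (auto simp: G_def Z_add intro: generated_subalgebra.add)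
qed

lemma G_smult: "c \<in> carrier K \<Longrightarrow> f \<in> G n m \<Longrightarrow> c \<odot>\<^bsub>Ch n m\<^esub> f \<in> G n m"
proof -
  assume c: "c \<in> carrier K" and f: "f \<in> G n m"
  then have "homog n m (c \<odot>\<^bsub>Ch n m\<^esub> f) = c \<odot>\<^bsub>Y\<^esub> homog n m f"
    by (intro ext) (simp add: G_def homog_def Y_simps cls_smult Bd_smult)
  then show ?thesis using c f by (auto simp: G_def Z_smult intro: generated_subalgebra.smult)
qed

lemma G_mult:
  "f \<in> G p r \<Longrightarrow> h \<in> G q s \<Longrightarrow> lifts A P q s h F \<Longrightarrow>
     compose (carrier (rmod P (q + p))) f (F p) \<in> G (q + p) (r + s)"
  using lift_cocycle homog_mult generated_subalgebra.mult by (fastforce simp: G_def)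

lemma G_low: "n = 1 \<or> n = 2 \<Longrightarrow> f \<in> Z n m \<Longrightarrow> f \<in> G n m"
proof -
  assume n: "n = 1 \<or> n = 2" and f: "f \<in> Z n m"
  have "homog n m f \<in> yoneda_component K A P n"
    using homog_carrier[OF f] by (simp add: yoneda_component_def homog_def Xt_simps)
  then have "homog n m f \<in> yoneda_component K A P 1 \<union> yoneda_component K A P 2" using n by blast
  then show ?thesis using f unfolding G_def by (blast intro: generated_subalgebra.incl)
qed

lemma raug_G: "raug P \<in> G 0 0"
  using raug_Z generated_subalgebra.one[of Y K] by (simp add: G_def Y_one_homog)

lemma zero_gen2: "zero Y \<in> gen2"
proof -
  have "\<zero>\<^bsub>K\<^esub> \<odot>\<^bsub>Ch 0 0\<^esub> raug P = \<zero>\<^bsub>Ch 0 0\<^esub>"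
    using Ch_val[OF Z_Ch[OF raug_Z]] by (auto simp: Ch_simps)
  then have "\<zero>\<^bsub>Ch 0 0\<^esub> \<in> G 0 0" using G_smult[OF K.zero_closed raug_G] by simp
  moreover have "homog 0 0 \<zero>\<^bsub>Ch 0 0\<^esub> = zero Y" using cls_zero by (rule homog_Bd)
  ultimately show ?thesis by (simp add: G_def)
qed

lemma G_Bd: "f \<in> Bd n m \<Longrightarrow> f \<in> G n m"
proof -
  assume f: "f \<in> Bd n m"
  then have "cls n m f = Bd n m" using cls_zero_iff[OF Bd_Z[OF f]] Bd_iff by blast
  then have "homog n m f = zero Y" by (rule homog_Bd)
  then show ?thesis using zero_gen2 Bd_Z[OF f] by (simp add: G_def)
qed

text \<open>\<open>E\<^sup>0\<close> is one-dimensional, because elements with augmentation zero are boundaries and cocycles vanish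
  on those.\<close>

lemma G_0: assumes f: "f \<in> Z 0 m" shows "f \<in> G 0 m"
proof -
  interpret P0: graded_mod A "rmod P 0" by (rule P_mod)
  obtain x0 where x0: "x0 \<in> part (rmod P 0) 0" "raug P x0 = \<one>\<^bsub>K\<^esub>" using eps_onto[of "\<one>\<^bsub>K\<^esub>" 0] by auto
  then have x0c: "x0 \<in> carrier (rmod P 0)" using P0.mpart_carrier by blast
  have f0: "f x0 \<in> carrier K" using Ch_val[OF Z_Ch[OF f] x0c] .
  have eq: "f x = f x0 \<otimes>\<^bsub>K\<^esub> raug P x" if x: "x \<in> carrier (rmod P 0)" for x
  proof -
    have k: "raug P x \<in> carrier K" "f x \<in> carrier K" using Ch_val[OF Z_Ch[OF raug_Z] x] Ch_val[OF Z_Ch[OF f] x] .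
    define a where "a = raug P x \<odot>\<^bsub>A\<^esub> \<one>\<^bsub>A\<^esub>"
    have a: "a \<in> carrier A" "aug a = raug P x" using k by (auto simp: a_def aug_const)
    let ?y = "x \<oplus>\<^bsub>rmod P 0\<^esub> \<ominus>\<^bsub>rmod P 0\<^esub> (a \<odot>\<^bsub>rmod P 0\<^esub> x0)"
    have yc: "?y \<in> carrier (rmod P 0)" using x x0c a by simp
    have val: "g ?y = g x \<oplus>\<^bsub>K\<^esub> \<ominus>\<^bsub>K\<^esub> (raug P x \<otimes>\<^bsub>K\<^esub> g x0)" 
      if g: "g \<in> graded_hom A (rmod P 0) triv e" for g e
      using ghom_add[OF g] ghom_minus[OF P_group triv_group g] ghom_smult[OF g] x x0c a k 
        ghom_closed[OF g x0c] by simp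
    have "raug P ?y = \<zero>\<^bsub>K\<^esub>" using val[OF raug_hom] x0 k by (simp add: K.r_neg)
    then obtain z where "z \<in> carrier (rmod P 1)" "?y = rdiff P 0 z" using yc ker_raug by blast
    then have "f ?y = \<zero>\<^bsub>K\<^esub>" using f by (simp add: Z_iff)
    then show ?thesis using val[OF Z_hom[OF f]] k f0 K.add_minus_zeroD K.m_comm by simp
  qed
  have feq: "f = f x0 \<odot>\<^bsub>Ch 0 m\<^esub> raug P"
  proof (rule extensionalityI[of _ "carrier (rmod P 0)"])
    show "f \<in> extensional (carrier (rmod P 0))" using Z_hom[OF f] by (simp add: graded_hom_def PiE_def)
  qed (use eq in \<open>simp_all add: Ch_simps\<close>)
  show ?thesis
  proof (cases "m = 0")
    case True
    then show ?thesis using feq G_smult[OF f0 raug_G] by metis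
  next
    case False
    then have "f x0 = \<zero>\<^bsub>K\<^esub>" using ghom_part[OF Z_hom[OF f] x0(1)] by simp
    then have "f x = \<zero>\<^bsub>K\<^esub>" if "x \<in> carrier (rmod P 0)" for x
      using eq[OF that] Ch_val[OF Z_Ch[OF raug_Z] that] by simp
    then show ?thesis using f by (intro G_Bd) (simp only: Bd_iff is_coboundary_def Z_Ch, simp)
  qed
qed

theorem generatedI:
  assumes "\<And>n m. Z n m \<subseteq> G n m"
  shows "gen2 = carrier Y"
proof
  show "gen2 \<subseteq> carrier Y" using gen2_carrier by blast
  have "\<forall>\<xi> \<in> carrier Y. {(n, m). \<xi> n m \<noteq> Bd n m} \<subseteq> S \<longrightarrow> \<xi> \<in> gen2" if "finite S" for S
    using that
  proof (induction S)
    case empty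
    have "\<xi> = zero Y" if "{(n, m). \<xi> n m \<noteq> Bd n m} \<subseteq> {}" for \<xi> 
      by (intro ext) (use that in \<open>auto simp: Y_simps\<close>)
    note z = this
    show ?case
    proof (intro ballI impI)
      fix \<xi> assume "\<xi> \<in> carrier Y" "{(n, m). \<xi> n m \<noteq> Bd n m} \<subseteq> {}"
      from z[OF this(2)] show "\<xi> \<in> gen2" using zero_gen2 by simp
    qed
  next
    case (insert x S)
    obtain n m where x: "x = (n, m)" by (cases x)
    show ?case
    proof (intro ballI impI)
      fix \<xi> assume \<xi>: "\<xi> \<in> carrier Y" and sup: "{(n, m). \<xi> n m \<noteq> Bd n m} \<subseteq> insert x S"
      define \<eta> where "\<eta> = (\<lambda>n' m'. if n' = n \<and> m' = m then Bd n m else \<xi> n' m')"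
      have "{(n, m). \<eta> n m \<noteq> Bd n m} \<subseteq> S" using sup x by (auto simp: \<eta>_def split: if_splits)
      moreover have "\<eta> \<in> carrier Y" using \<xi> Bd_Xt finite_subset[OF calculation \<open>finite S\<close>] by (auto simp: Y_simps \<eta>_def)
      ultimately have "\<eta> \<in> gen2" using insert.IH by blast
      have "\<xi> n m \<in> cls n m ` Z n m" using \<xi> by (simp add: Y_simps Xt_simps)
      then obtain f where f: "f \<in> Z n m" "\<xi> n m = cls n m f" by blast
      then have "homog n m f \<in> gen2" using assms by (auto simp: G_def)
      moreover have "\<xi> = homog n m f \<oplus>\<^bsub>Y\<^esub> \<eta>"
      proof (intro ext)
        fix n' m'
        interpret X: abelian_monoid "Xt n' m'" by (rule Xt_monoid)
        have "\<xi> n' m' \<in> carrier (Xt n' m')" using \<xi> by (simp add: Y_simps)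
        then show "\<xi> n' m' = (homog n m f \<oplus>\<^bsub>Y\<^esub> \<eta>) n' m'"
          using X.l_zero[of "\<xi> n' m'"] X.r_zero[of "\<xi> n' m'"] f unfolding Xt_simps by (auto simp: Y_simps homog_def \<eta>_def)
      qed
      ultimately show "\<xi> \<in> gen2" using \<open>\<eta> \<in> gen2\<close> generated_subalgebra.add by metis
    qed
  qed
  then show "carrier Y \<subseteq> gen2" by (auto simp: Y_simps(1))
qed

text \<open>Rule induction in terms of bihomogeneous components: sums and products of generated elements are
  computed from those of their components.\<close>

theorem gen2_induct:
  assumes R: "\<And>n m. R n m \<subseteq> carrier (Xt n m)"
    and zero: "\<And>n m. Bd n m \<in> R n m"
    and one: "cls 0 0 (raug P) \<in> R 0 0"
    and add: "\<And>n m X Y. X \<in> R n m \<Longrightarrow> Y \<in> R n m \<Longrightarrow> X <+>\<^bsub>Ch n m\<^esub> Y \<in> R n m"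
    and smult: "\<And>n m c X. c \<in> carrier K \<Longrightarrow> X \<in> R n m \<Longrightarrow> quot_smult (Ch n m) (Bd n m) c X \<in> R n m"
    and low: "\<And>n m. n = 1 \<or> n = 2 \<Longrightarrow> carrier (Xt n m) \<subseteq> R n m"
    and mult: "\<And>p r q s X Y. X \<in> R p r \<Longrightarrow> Y \<in> R q s \<Longrightarrow> yp p r q s X Y \<in> R (q + p) (r + s)"
    and \<xi>: "\<xi> \<in> gen2"
  shows "\<xi> n m \<in> R n m"
proof -
  have "\<forall>n m. \<xi> n m \<in> R n m" using \<xi>
  proof (induction rule: generated_subalgebra.induct)
    case one
    then show ?case using zero assms(3) by (auto simp: Y_simps)
  next
    case (incl \<xi>)
    then obtain k where k: "k = 1 \<or> k = 2" "\<xi> \<in> yoneda_component K A P k" by auto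
    then have "\<xi> n m \<in> carrier (Xt n m)" "n \<noteq> k \<Longrightarrow> \<xi> n m = Bd n m" for n m 
      by (auto simp: yoneda_component_def Y_simps Xt_simps)
    note c = this
    have "\<xi> n m \<in> R n m" for n m
    proof (cases "n = k")
      case True
      then show ?thesis using c(1)[of n m] low[of n m] k(1) by auto
    next
      case False
      then show ?thesis using c(2) assms(2) by simp
    qed
    then show ?case by blast
  next
    case (smult c \<xi>)
    then show ?case using assms(5) by (simp add: Y_simps)
  next
    case (add \<xi> \<eta>)
    then show ?case using assms(4) by (simp add: Y_simps)
  next
    case (mult \<xi> \<eta>)
    show ?case
    proof (intro allI)
      fix n m
      show "(\<xi> \<otimes>\<^bsub>Y\<^esub> \<eta>) n m \<in> R n m" unfolding Y_simps
      proof (rule abelian_monoid.finsum_in[OF Xt_monoid R])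
        fix i assume i: "i \<in> {(p, r). p \<le> n \<and> \<xi> p r \<noteq> Bd p r}"
        obtain p r where pr: "i = (p, r)" "p \<le> n" using i by auto
        have "yp p r (n - p) (m - r) (\<xi> p r) (\<eta> (n - p) (m - r)) \<in> R (n - p + p) (r + (m - r))"
          using mult assms(7) by blast
        then show "(case i of (p, r) \<Rightarrow> yp p r (n - p) (m - r) (\<xi> p r) (\<eta> (n - p) (m - r))) \<in> R n m"
          using pr by simp
      qed (use zero assms(4) in \<open>auto simp: Xt_simps\<close>)
    qed
  qed
  then show ?thesis by blast
qed

end

section \<open>Base change along a surjection of graded algebras\<close>

locale graded_surjection = A: comm_graded_alg K A + B: comm_graded_alg K B
  for K :: "('k, 'z) ring_scheme" and A :: "('k, 'a) graded" and B :: "('k, 'b) graded" +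
  fixes \<pi> :: "'a \<Rightarrow> 'b"
  assumes pi_hom: "\<pi> \<in> ring_hom A B"
    and pi_smult: "\<And>c a. c \<in> carrier K \<Longrightarrow> a \<in> carrier A \<Longrightarrow> \<pi> (c \<odot>\<^bsub>A\<^esub> a) = c \<odot>\<^bsub>B\<^esub> \<pi> a"
    and pi_part: "\<And>m. \<pi> ` part A m = part B m"
begin

lemma pi_closed [simp, intro]: "a \<in> carrier A \<Longrightarrow> \<pi> a \<in> carrier B"
  and pi_mult: "a \<in> carrier A \<Longrightarrow> b \<in> carrier A \<Longrightarrow> \<pi> (a \<otimes>\<^bsub>A\<^esub> b) = \<pi> a \<otimes>\<^bsub>B\<^esub> \<pi> b"
  and pi_add: "a \<in> carrier A \<Longrightarrow> b \<in> carrier A \<Longrightarrow> \<pi> (a \<oplus>\<^bsub>A\<^esub> b) = \<pi> a \<oplus>\<^bsub>B\<^esub> \<pi> b"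
  and pi_one [simp]: "\<pi> \<one>\<^bsub>A\<^esub> = \<one>\<^bsub>B\<^esub>"
  using ring_hom_memE[OF pi_hom] by auto

lemma pi_zero [simp]: "\<pi> \<zero>\<^bsub>A\<^esub> = \<zero>\<^bsub>B\<^esub>"
  using ring_hom_zero[OF pi_hom A.ring_axioms B.ring_axioms] .

lemma pi_homogeneous: "a \<in> part A m \<Longrightarrow> \<pi> a \<in> part B m"
  using pi_part[of m] by (metis imageI)

lemma pi_onto: "b \<in> carrier B \<Longrightarrow> \<exists>a \<in> carrier A. \<pi> a = b"
proof (induction rule: B.homogeneous_induct)
  case zero
  then show ?case using pi_zero A.zero_closed by blast
next
  case (add b b')
  then show ?case using pi_add A.a_closed by metis
next
  case (homogeneous b i)
  then have "b \<in> \<pi> ` part A i" by (simp only: pi_part)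
  then obtain a where "a \<in> part A i" "b = \<pi> a" by (elim imageE)
  then show ?case using A.part_carrier by (intro bexI[of _ a]) auto
qed

lemma aug_pi: "a \<in> carrier A \<Longrightarrow> B.aug (\<pi> a) = A.aug a"
proof (rule A.aug_unique)
  show "B.aug (\<pi> (a \<oplus>\<^bsub>A\<^esub> b)) = B.aug (\<pi> a) \<oplus>\<^bsub>K\<^esub> B.aug (\<pi> b)" if "a \<in> carrier A" "b \<in> carrier A" for a b
    using that by (simp add: pi_add B.aug_add)
  show "B.aug (\<pi> a) = \<zero>\<^bsub>K\<^esub>" if "a \<in> part A i" "i \<noteq> 0" for a i
    using B.aug_homogeneous[OF pi_homogeneous[OF that(1)] that(2)] .
  show "B.aug (\<pi> (c \<odot>\<^bsub>A\<^esub> \<one>\<^bsub>A\<^esub>)) = c" if "c \<in> carrier K" for c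
    using that by (simp add: pi_smult B.aug_const)
qed

abbreviation "rs \<equiv> restrict_scalars \<pi>"

lemma rs_mod: "graded_mod B M \<Longrightarrow> graded_mod A (rs M)"
  by (rule restrict_scalars_graded_mod[OF _ A.is_cring pi_hom pi_homogeneous])

lemma rs_triv: "graded_hom A M (rs B.triv) e = graded_hom A M A.triv e"
  by (auto simp: graded_hom_def aug_pi)

text \<open>Reduction of coordinates, that is the base change map to a free \<open>B\<close>-module on the same basis.\<close>

definition red :: "('i \<Rightarrow> 'a) \<Rightarrow> 'i \<Rightarrow> 'b" where
  "red v = (\<lambda>i. \<pi> (v i))"

lemma red_finsupp: "v \<in> finsupp A X \<Longrightarrow> red v \<in> finsupp B X"
  by (auto simp: finsupp_def red_def intro: finite_subset[of _ "{i. v i \<noteq> \<zero>\<^bsub>A\<^esub>}"])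

lemma red_single: "red (single A i a) = single B i (\<pi> a)"
  by (auto simp: red_def single_def)

lemma red_hom: "restrict red (finsupp A X) \<in> graded_hom A (free_module A X w) (rs (free_module B X w)) 0"
proof -
  have "restrict red (carrier (free_module A X w)) \<in> graded_hom A (free_module A X w) (rs (free_module B X w)) 0"
  proof (rule ghomI[OF A.free_graded_mod])
    fix i x assume "x \<in> part (free_module A X w) i"
    then show "red x \<in> part (rs (free_module B X w)) (i + 0)"
      using pi_homogeneous by (auto simp: red_finsupp) (auto simp: red_def)
  qed (auto simp: red_finsupp, auto simp: red_def pi_add pi_mult A.finsuppD(1))
  then show ?thesis by simp
qed

lemma red_onto: "u \<in> finsupp B X \<Longrightarrow> \<exists>v \<in> finsupp A X. red v = u"
proof (induction rule: B.free_induct)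
  case zero
  show ?case using A.finsupp_zero by (intro bexI[of _ "\<lambda>i. \<zero>\<^bsub>A\<^esub>"]) (auto simp: red_def)
next
  case (add u v)
  then obtain u' v' where uv: "u' \<in> finsupp A X" "v' \<in> finsupp A X" "red u' = u" "red v' = v" by blast
  then have "red (\<lambda>i. u' i \<oplus>\<^bsub>A\<^esub> v' i) = (\<lambda>i. u i \<oplus>\<^bsub>B\<^esub> v i)" by (auto simp: red_def pi_add A.finsuppD(1))
  then show ?case using A.finsupp_add uv by blast
next
  case (single i b m)
  then obtain a where a: "a \<in> carrier A" "\<pi> a = b" using pi_onto B.part_carrier by blast
  then have "red (single A i a) = single B i b" by (simp add: red_single)
  then show ?case using A.finsupp_single[OF a(1) single(1)] by blast
qed

text \<open>The induced map is defined on basis elements, by reducing the values of \<open>f\<close>.\<close>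

lemma descend:
  assumes f: "f \<in> graded_hom A (free_module A X w) (free_module A X' w') e"
  shows "\<exists>f' \<in> graded_hom B (free_module B X w) (free_module B X' w') e. \<forall>v \<in> finsupp A X. f' (red v) = red (f v)"
proof -
  have y: "red (f (single A i \<one>\<^bsub>A\<^esub>)) \<in> part (free_module B X' w') (w i + e)" if "i \<in> X" for i
    using ghom_part[OF f A.basis_part[OF that]] pi_homogeneous red_finsupp by (auto simp: red_def)
  obtain f' where f': "f' \<in> graded_hom B (free_module B X w) (free_module B X' w') e"
    "\<forall>i\<in>X. f' (single B i \<one>\<^bsub>B\<^esub>) = red (f (single A i \<one>\<^bsub>A\<^esub>))"
    using B.linear_extension[where X = X and w = w and e = e and y = "\<lambda>i. red (f (single A i \<one>\<^bsub>A\<^esub>))", OF B.free_graded_mod y]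
    by blast
  note r1 = ghom_comp0[OF A.free_graded_mod red_hom restrict_scalars_ghom[OF pi_hom f'(1)]]
  note r2 = ghom_comp0'[OF A.free_graded_mod f red_hom]
  have "f' (red v) = red (f v)" if v: "v \<in> finsupp A X" for v
  proof -
    have "(\<lambda>x\<in>carrier (free_module A X w). f' (restrict red (finsupp A X) x)) v =
          (\<lambda>x\<in>carrier (free_module A X w). restrict red (finsupp A X') (f x)) v"
      by (rule A.free_eqI[OF rs_mod[OF B.free_graded_mod] r1 r2 _ v])
         (use f'(2) ghom_closed[OF f] in \<open>auto simp: A.finsupp_single red_single\<close>)
    then show ?thesis using v ghom_closed[OF f] by simp
  qed
  then show ?thesis using f'(1) by blast
qed

lemma descend_triv:
  assumes f: "f \<in> graded_hom A (free_module A X w) A.triv e"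
  shows "\<exists>f' \<in> graded_hom B (free_module B X w) B.triv e. \<forall>v \<in> finsupp A X. f' (red v) = f v"
proof -
  have y: "f (single A i \<one>\<^bsub>A\<^esub>) \<in> part B.triv (w i + e)" if "i \<in> X" for i
    using ghom_part[OF f A.basis_part[OF that]] by simp
  obtain f' where f': "f' \<in> graded_hom B (free_module B X w) B.triv e"
    "\<forall>i\<in>X. f' (single B i \<one>\<^bsub>B\<^esub>) = f (single A i \<one>\<^bsub>A\<^esub>)"
    using B.linear_extension[where X = X and w = w and e = e and y = "\<lambda>i. f (single A i \<one>\<^bsub>A\<^esub>)", OF B.trivial_graded_mod y]
    by blast
  note r1 = ghom_comp0[OF A.free_graded_mod red_hom restrict_scalars_ghom[OF pi_hom f'(1)], unfolded rs_triv]
  have "f' (red v) = f v" if v: "v \<in> finsupp A X" for v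
  proof -
    have "(\<lambda>x\<in>carrier (free_module A X w). f' (restrict red (finsupp A X) x)) v = f v"
      by (rule A.free_eqI[OF A.trivial_graded_mod r1 f _ v])
         (use f'(2) in \<open>auto simp: A.finsupp_single red_single\<close>)
    then show ?thesis using v by simp
  qed
  then show ?thesis using f'(1) by blast
qed

end

section \<open>Direct sums of free modules\<close>

text \<open>The basis of a direct sum is again a set of numbers: the even ones index the first summand, the
  odd ones the second, which is moreover shifted by \<open>d\<close>.\<close>

definition ev :: "(nat \<Rightarrow> 'a) \<Rightarrow> nat \<Rightarrow> 'a" where "ev v = (\<lambda>i. v (2 * i))"
definition od :: "(nat \<Rightarrow> 'a) \<Rightarrow> nat \<Rightarrow> 'a" where "od v = (\<lambda>i. v (2 * i + 1))"
definition jn :: "(nat \<Rightarrow> 'a) \<Rightarrow> (nat \<Rightarrow> 'a) \<Rightarrow> nat \<Rightarrow> 'a" where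
  "jn p q = (\<lambda>j. if even j then p (j div 2) else q (j div 2))"
definition sum_index :: "nat set \<Rightarrow> nat set \<Rightarrow> nat set" where
  "sum_index X X' = {j. if even j then j div 2 \<in> X else j div 2 \<in> X'}"

definition sum_weight :: "(nat \<Rightarrow> int) \<Rightarrow> (nat \<Rightarrow> int) \<Rightarrow> int \<Rightarrow> nat \<Rightarrow> int" where
  "sum_weight w w' d = (\<lambda>j. if even j then w (j div 2) else w' (j div 2) + d)"

lemma ev_jn [simp]: "ev (jn p q) = p" by (auto simp: ev_def jn_def)
lemma od_jn [simp]: "od (jn p q) = q" by (auto simp: od_def jn_def)
lemma jn_ev_od [simp]: "jn (ev x) (od x) = x" by (auto simp: ev_def od_def jn_def)

context comm_graded_alg
begin

lemma ev_finsupp: "x \<in> finsupp A (sum_index X X') \<Longrightarrow> ev x \<in> finsupp A X"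
proof -
  assume x: "x \<in> finsupp A (sum_index X X')"
  have "finite ((\<lambda>i. 2 * i) ` {i. ev x i \<noteq> \<zero>})"
    by (rule finite_subset[OF _ finsuppD(2)[OF x]]) (auto simp: ev_def)
  then have "finite {i. ev x i \<noteq> \<zero>}" by (rule finite_imageD) (auto intro: inj_onI)
  then show ?thesis using finsuppD(1)[OF x] finsuppD(3)[OF x] by (auto simp: finsupp_def ev_def sum_index_def)
qed

lemma od_finsupp: "x \<in> finsupp A (sum_index X X') \<Longrightarrow> od x \<in> finsupp A X'"
proof -
  assume x: "x \<in> finsupp A (sum_index X X')"
  have "finite ((\<lambda>i. 2 * i + 1) ` {i. od x i \<noteq> \<zero>})"
    by (rule finite_subset[OF _ finsuppD(2)[OF x]]) (auto simp: od_def)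
  then have "finite {i. od x i \<noteq> \<zero>}" by (rule finite_imageD) (auto intro: inj_onI)
  then show ?thesis using finsuppD(1)[OF x] finsuppD(3)[OF x] by (auto simp: finsupp_def od_def sum_index_def)
qed

lemma jn_finsupp: 
  assumes p: "p \<in> finsupp A X" and q: "q \<in> finsupp A X'" shows "jn p q \<in> finsupp A (sum_index X X')"
proof -
  have "j \<in> (\<lambda>i. 2 * i) ` {i. p i \<noteq> \<zero>} \<union> (\<lambda>i. 2 * i + 1) ` {i. q i \<noteq> \<zero>}" if "jn p q j \<noteq> \<zero>" for j
    using that by (cases "even j") (auto simp: jn_def image_iff elim!: evenE oddE)
  then have "{j. jn p q j \<noteq> \<zero>} \<subseteq> (\<lambda>i. 2 * i) ` {i. p i \<noteq> \<zero>} \<union> (\<lambda>i. 2 * i + 1) ` {i. q i \<noteq> \<zero>}" by blast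
  then have "finite {j. jn p q j \<noteq> \<zero>}" using finsuppD(2)[OF p] finsuppD(2)[OF q] by (auto intro: finite_subset)
  then show ?thesis using p q by (auto simp: finsupp_def jn_def sum_index_def)
qed

lemma ev_add: "ev (\<lambda>i. u i \<oplus> v i) = (\<lambda>i. ev u i \<oplus> ev v i)" by (simp add: ev_def)
lemma od_add: "od (\<lambda>i. u i \<oplus> v i) = (\<lambda>i. od u i \<oplus> od v i)" by (simp add: od_def)
lemma ev_mult: "ev (\<lambda>i. a \<otimes> v i) = (\<lambda>i. a \<otimes> ev v i)" by (simp add: ev_def)
lemma od_mult: "od (\<lambda>i. a \<otimes> v i) = (\<lambda>i. a \<otimes> od v i)" by (simp add: od_def)
lemma jn_add: "jn (\<lambda>i. p i \<oplus> p' i) (\<lambda>i. q i \<oplus> q' i) = (\<lambda>i. jn p q i \<oplus> jn p' q' i)" by (auto simp: jn_def)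
lemma jn_mult: "jn (\<lambda>i. a \<otimes> p i) (\<lambda>i. a \<otimes> q i) = (\<lambda>i. a \<otimes> jn p q i)" by (auto simp: jn_def)

lemma ev_hom: "restrict ev (finsupp A (sum_index X X')) \<in>
    graded_hom A (free_module A (sum_index X X') (sum_weight w w' d)) (free_module A X w) 0"
proof -
  let ?M = "free_module A (sum_index X X') (sum_weight w w' d)"
  have "restrict ev (carrier ?M) \<in> graded_hom A ?M (free_module A X w) 0"
  proof (rule ghomI[OF free_graded_mod])
    fix m x assume x: "x \<in> part ?M m"
    have "ev x i \<in> part A (m - w i)" for i
      using x by (auto simp: ev_def sum_weight_def dest: spec[of _ "2 * i"])
    then show "ev x \<in> part (free_module A X w) (m + 0)" using x by (auto simp: ev_finsupp)
  qed (auto simp: ev_finsupp ev_add ev_mult)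
  then show ?thesis by simp
qed

lemma od_hom: "restrict od (finsupp A (sum_index X X')) \<in>
    graded_hom A (free_module A (sum_index X X') (sum_weight w w' d)) (free_module A X' w') (- d)"
proof -
  let ?M = "free_module A (sum_index X X') (sum_weight w w' d)"
  have "restrict od (carrier ?M) \<in> graded_hom A ?M (free_module A X' w') (- d)"
  proof (rule ghomI[OF free_graded_mod])
    fix m x assume x: "x \<in> part ?M m"
    have "od x i \<in> part A (m + - d - w' i)" for i
      using x by (auto simp: od_def sum_weight_def algebra_simps dest: spec[of _ "2 * i + 1"])
    then show "od x \<in> part (free_module A X' w') (m + - d)" using x by (auto simp: od_finsupp)
  qed (auto simp: od_finsupp od_add od_mult)
  then show ?thesis by simp
qed

lemma jn_hom:
  assumes M: "graded_mod A M" and f: "f \<in> graded_hom A M (free_module A X w) e"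
    and h: "h \<in> graded_hom A M (free_module A X' w') (e - d)"
  shows "(\<lambda>x\<in>carrier M. jn (f x) (h x)) \<in> graded_hom A M (free_module A (sum_index X X') (sum_weight w w' d)) e"
proof (rule ghomI[OF M])
  fix i x assume x: "x \<in> part M i"
  interpret M: graded_mod A M by fact
  note c = M.mpart_carrier[OF x]
  have "f x k \<in> part A (i + e - w k)" "h x k \<in> part A (i + e - (w' k + d))" for k
    using ghom_part[OF f x] ghom_part[OF h x] by (auto simp: algebra_simps)
  then show "jn (f x) (h x) \<in> part (free_module A (sum_index X X') (sum_weight w w' d)) (i + e)"
    using ghom_closed[OF f c] ghom_closed[OF h c] by (auto simp: jn_finsupp) (auto simp: jn_def sum_weight_def)
qed (use ghom_closed[OF f] ghom_closed[OF h] ghom_add[OF f] ghom_add[OF h] ghom_smult[OF f] ghom_smult[OF h]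
   in \<open>simp_all add: jn_finsupp jn_add jn_mult\<close>)

end

section \<open>The resolution over a hypersurface\<close>

lemma (in resolution) lift_cycle_resolution:
  assumes E: "E \<in> graded_hom A (rmod P n) (rmod P i) e" and cyc: "\<And>x. x \<in> carrier (rmod P n) \<Longrightarrow> is_cycle i (E x)"
  shows "\<exists>H \<in> graded_hom A (rmod P n) (rmod P (Suc i)) e. \<forall>x \<in> carrier (rmod P n). rdiff P i (H x) = E x"
proof -
  obtain X w where X: "rmod P n = free_module A X w" using P_free by blast
  have "E \<in> graded_hom A (free_module A X w) (rmod P i) e" using E by (simp only: X)
  moreover have "is_cycle i (E x)" if "x \<in> finsupp A X" for x using cyc[of x] that by (simp add: X)
  ultimately show ?thesis using lift_cycle[of E X w i e] by (simp add: X)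
qed

text \<open>\<open>B = A/gA\<close> with \<open>g\<close> regular and decomposable; \<open>P\<close> is a resolution over \<open>A\<close>. Decomposability
  follows from \<open>d > 1\<close> if \<open>A\<close> is generated in degree 1.\<close>

locale hypersurface = graded_surjection K A B \<pi> + R: resolution K A P
  for K :: "('k, 'z) ring_scheme" and A :: "('k, 'a) graded" and B :: "('k, 'b) graded" and \<pi> :: "'a \<Rightarrow> 'b"
    and P :: "('k, 'a, nat \<Rightarrow> 'a) augmented_complex" +
  fixes g :: 'a and d :: int
  assumes pi_ker: "\<And>a. a \<in> carrier A \<Longrightarrow> \<pi> a = \<zero>\<^bsub>B\<^esub> \<longleftrightarrow> (\<exists>b \<in> carrier A. a = g \<otimes>\<^bsub>A\<^esub> b)"
    and g_part: "g \<in> part A d"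
    and g_regular: "regular A g"
    and g_decomposable: "g \<in> additive_span A {a \<otimes>\<^bsub>A\<^esub> b | a b i j. 0 < i \<and> 0 < j \<and> i + j = d \<and> a \<in> part A i \<and> b \<in> part A j}"
begin

lemma g_closed [simp]: "g \<in> carrier A" using A.part_carrier[OF g_part] .

lemma pi_g [simp]: "\<pi> g = \<zero>\<^bsub>B\<^esub>"
  unfolding pi_ker[OF g_closed] by (rule bexI[of _ "\<one>\<^bsub>A\<^esub>"]) simp_all

lemma g_cancel: "a \<in> carrier A \<Longrightarrow> g \<otimes>\<^bsub>A\<^esub> a = \<zero>\<^bsub>A\<^esub> \<Longrightarrow> a = \<zero>\<^bsub>A\<^esub>"
  using g_regular unfolding regular_def by blast

abbreviation "PM n \<equiv> rmod P n"

definition basis :: "nat \<Rightarrow> nat set \<times> (nat \<Rightarrow> int)" where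
  "basis n = (SOME p. (\<forall>m. finite {i \<in> fst p. snd p i \<le> m}) \<and> PM n = free_module A (fst p) (snd p))"
definition "X n = fst (basis n)"
definition "w n = snd (basis n)"

lemma basis: "(\<forall>m. finite {i \<in> X n. w n i \<le> m}) \<and> PM n = free_module A (X n) (w n)"
proof -
  have "\<exists>p. (\<forall>m. finite {i \<in> fst p. snd p i \<le> m}) \<and> PM n = free_module A (fst p) (snd p)"
    using R.P_free[of n] by auto
  then show ?thesis unfolding X_def w_def basis_def by (rule someI_ex)
qed

lemma PM_free: "PM n = free_module A (X n) (w n)" using basis by blast

abbreviation "BP n \<equiv> free_module B (X n) (w n)"

lemma PM_carrier: "carrier (PM n) = finsupp A (X n)" by (simp add: PM_free)

lemma BP_mod: "graded_mod B (BP n)" by (rule B.free_graded_mod)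
lemma BP_group: "abelian_group (BP n)" by (rule B.free_abelian_group)

subsection \<open>Reduction modulo the regular element\<close>

lemma redP_hom: "restrict red (carrier (PM n)) \<in> graded_hom A (PM n) (rs (BP n)) 0"
  using red_hom[of "X n" "w n"] by (simp add: PM_free)

lemma red_closed: "v \<in> carrier (PM n) \<Longrightarrow> red v \<in> carrier (BP n)"
  using red_finsupp by (simp add: PM_free)

lemma red_add: "u \<in> carrier (PM n) \<Longrightarrow> v \<in> carrier (PM n) \<Longrightarrow> red (u \<oplus>\<^bsub>PM n\<^esub> v) = red u \<oplus>\<^bsub>BP n\<^esub> red v"
  using ghom_add[OF redP_hom, of u n v] abelian_groupE(1)[OF R.P_group, of u n v] by simp

lemma red_smult: "a \<in> carrier A \<Longrightarrow> v \<in> carrier (PM n) \<Longrightarrow> red (a \<odot>\<^bsub>PM n\<^esub> v) = \<pi> a \<odot>\<^bsub>BP n\<^esub> red v"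
  using ghom_smult[OF redP_hom, of a v n] module.smult_closed[OF graded_mod.axioms(1)[OF R.P_mod], of a v n] by simp

lemma red_zero: "red \<zero>\<^bsub>PM n\<^esub> = \<zero>\<^bsub>BP n\<^esub>"
  by (simp add: PM_free red_def)

lemma red_minus: "u \<in> carrier (PM n) \<Longrightarrow> v \<in> carrier (PM n) \<Longrightarrow> red (u \<ominus>\<^bsub>PM n\<^esub> v) = red u \<ominus>\<^bsub>BP n\<^esub> red v"
proof -
  assume u: "u \<in> carrier (PM n)" "v \<in> carrier (PM n)"
  interpret P: abelian_group "PM n" by (rule R.P_group)
  interpret B: abelian_group "BP n" by (rule BP_group)
  have "red (u \<ominus>\<^bsub>PM n\<^esub> v) \<oplus>\<^bsub>BP n\<^esub> red v = red u"
    using red_add[of "u \<ominus>\<^bsub>PM n\<^esub> v" n v] u by (simp add: a_minus_def P.a_assoc P.l_neg)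
  then have "red u \<ominus>\<^bsub>BP n\<^esub> red v = (red (u \<ominus>\<^bsub>PM n\<^esub> v) \<oplus>\<^bsub>BP n\<^esub> red v) \<ominus>\<^bsub>BP n\<^esub> red v" by simp
  also have "\<dots> = red (u \<ominus>\<^bsub>PM n\<^esub> v)"
    using red_closed[OF P.minus_closed[OF u]] red_closed[OF u(2)]
    by (simp add: a_minus_def B.a_assoc B.r_neg del: free_module_simps)
  finally show ?thesis by simp
qed

lemma red_kernel: "v \<in> carrier (PM n) \<Longrightarrow> red v = \<zero>\<^bsub>BP n\<^esub> \<Longrightarrow> \<exists>u \<in> carrier (PM n). v = g \<odot>\<^bsub>PM n\<^esub> u"
proof -
  assume v: "v \<in> carrier (PM n)" and r: "red v = \<zero>\<^bsub>BP n\<^esub>"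
  have vf: "v \<in> finsupp A (X n)" using v PM_carrier by simp
  have "\<exists>b. b \<in> carrier A \<and> v i = g \<otimes>\<^bsub>A\<^esub> b \<and> (v i = \<zero>\<^bsub>A\<^esub> \<longrightarrow> b = \<zero>\<^bsub>A\<^esub>)" for i
  proof (cases "v i = \<zero>\<^bsub>A\<^esub>")
    case False
    have "\<pi> (v i) = \<zero>\<^bsub>B\<^esub>" using fun_cong[OF r, of i] by (simp add: red_def)
    then show ?thesis using pi_ker A.finsuppD(1)[OF vf] False by blast
  qed auto
  then obtain u where u: "\<And>i. u i \<in> carrier A" "\<And>i. v i = g \<otimes>\<^bsub>A\<^esub> u i" "\<And>i. v i = \<zero>\<^bsub>A\<^esub> \<Longrightarrow> u i = \<zero>\<^bsub>A\<^esub>"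
    by metis
  have "u \<in> finsupp A (X n)" 
    using u(1,3) A.finsuppD(2,3)[OF vf] by (auto simp: finsupp_def intro: finite_subset[of _ "{i. v i \<noteq> \<zero>\<^bsub>A\<^esub>}"])
  moreover have "v = g \<odot>\<^bsub>PM n\<^esub> u" using u(2) by (auto simp: PM_free)
  ultimately show ?thesis using PM_carrier by blast
qed

lemma g_smult_cancel: "u \<in> carrier (PM n) \<Longrightarrow> g \<odot>\<^bsub>PM n\<^esub> u = \<zero>\<^bsub>PM n\<^esub> \<Longrightarrow> u = \<zero>\<^bsub>PM n\<^esub>"
proof -
  assume u: "u \<in> carrier (PM n)" and z: "g \<odot>\<^bsub>PM n\<^esub> u = \<zero>\<^bsub>PM n\<^esub>"
  have uf: "u \<in> finsupp A (X n)" using u by (simp add: PM_carrier)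
  have "u i = \<zero>\<^bsub>A\<^esub>" for i
    by (rule g_cancel[OF A.finsuppD(1)[OF uf]]) (use fun_cong[OF z, of i] in \<open>simp add: PM_free\<close>)
  then show "u = \<zero>\<^bsub>PM n\<^esub>" by (simp add: PM_free fun_eq_iff)
qed

lemma lift_red: "u \<in> carrier (BP n) \<Longrightarrow> \<exists>v \<in> carrier (PM n). red v = u"
  using red_onto PM_carrier by simp

definition dbar :: "nat \<Rightarrow> (nat \<Rightarrow> 'b) \<Rightarrow> nat \<Rightarrow> 'b" where
  "dbar n = (SOME f. f \<in> graded_hom B (BP (Suc n)) (BP n) 0 \<and> (\<forall>v \<in> carrier (PM (Suc n)). f (red v) = red (rdiff P n v)))"

lemma dbar: "dbar n \<in> graded_hom B (BP (Suc n)) (BP n) 0 \<and> (\<forall>v \<in> carrier (PM (Suc n)). dbar n (red v) = red (rdiff P n v))"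
proof -
  have "\<exists>f. f \<in> graded_hom B (BP (Suc n)) (BP n) 0 \<and> (\<forall>v \<in> carrier (PM (Suc n)). f (red v) = red (rdiff P n v))"
    using descend[OF R.rdiff_hom[of n, unfolded PM_free]] unfolding PM_carrier by blast
  then show ?thesis unfolding dbar_def by (rule someI_ex)
qed

lemma dbar_hom: "dbar n \<in> graded_hom B (BP (Suc n)) (BP n) 0"
  and dbar_red: "v \<in> carrier (PM (Suc n)) \<Longrightarrow> dbar n (red v) = red (rdiff P n v)"
  using dbar by auto

definition epsbar :: "(nat \<Rightarrow> 'b) \<Rightarrow> 'k" where
  "epsbar = (SOME f. f \<in> graded_hom B (BP 0) B.triv 0 \<and> (\<forall>v \<in> carrier (PM 0). f (red v) = raug P v))"

lemma epsbar: "epsbar \<in> graded_hom B (BP 0) B.triv 0 \<and> (\<forall>v \<in> carrier (PM 0). epsbar (red v) = raug P v)"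
proof -
  have "\<exists>f. f \<in> graded_hom B (BP 0) B.triv 0 \<and> (\<forall>v \<in> carrier (PM 0). f (red v) = raug P v)"
    using descend_triv[OF R.raug_hom[unfolded PM_free]] unfolding PM_carrier by blast
  then show ?thesis unfolding epsbar_def by (rule someI_ex)
qed

lemma epsbar_hom: "epsbar \<in> graded_hom B (BP 0) B.triv 0"
  and epsbar_red: "v \<in> carrier (PM 0) \<Longrightarrow> epsbar (red v) = raug P v"
  using epsbar by auto

lemma PM_cancel:
  assumes "u \<in> carrier (PM n)" "v \<in> carrier (PM n)" "u \<ominus>\<^bsub>PM n\<^esub> v = \<zero>\<^bsub>PM n\<^esub>"
  shows "u = v"
  using abelian_group.add_minus_zeroD[OF R.P_group assms(1,2)] assms(3) by (simp add: a_minus_def)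

lemma rdiff_minus: "u \<in> carrier (PM (Suc n)) \<Longrightarrow> v \<in> carrier (PM (Suc n)) \<Longrightarrow>
    rdiff P n (u \<ominus>\<^bsub>PM (Suc n)\<^esub> v) = rdiff P n u \<ominus>\<^bsub>PM n\<^esub> rdiff P n v"
  using ghom_add[OF R.rdiff_hom] ghom_minus[OF R.P_group R.P_group R.rdiff_hom] 
    abelian_group.a_inv_closed[OF R.P_group, of v "Suc n"] by (simp add: a_minus_def)

lemma PM_smult: "a \<in> carrier A \<Longrightarrow> v \<in> carrier (PM n) \<Longrightarrow> a \<odot>\<^bsub>PM n\<^esub> v \<in> carrier (PM n)"
  using module.smult_closed[OF graded_mod.axioms(1)[OF R.P_mod]] .

lemma red_g: "u \<in> carrier (PM n) \<Longrightarrow> red (g \<odot>\<^bsub>PM n\<^esub> u) = \<zero>\<^bsub>BP n\<^esub>"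
proof -
  interpret B: graded_mod B "BP n" by (rule BP_mod)
  show "u \<in> carrier (PM n) \<Longrightarrow> red (g \<odot>\<^bsub>PM n\<^esub> u) = \<zero>\<^bsub>BP n\<^esub>"
    using red_smult[of g u n] red_closed[of u n] B.smult_l_null by (simp del: free_module_simps)
qed

lemma rdiff_closed: "v \<in> carrier (PM (Suc n)) \<Longrightarrow> rdiff P n v \<in> carrier (PM n)"
  by (rule ghom_closed[OF R.rdiff_hom])

subsection \<open>The regular element is homotopic to zero on the resolution\<close>

text \<open>A null homotopy of multiplication by \<open>x\<close> on the resolution in its two lowest degrees, which is
  moreover minimal: it becomes zero after tensoring with the trivial module. This is the
  place where commutativity is essential. If \<open>x = a \<otimes> b\<close> and \<open>\<tau>\<close> is a homotopy for \<open>b\<close>, then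
  \<open>a \<tau>\<close> is a module homomorphism and a homotopy for \<open>x\<close>.\<close>

definition min_homotopy :: "'a \<Rightarrow> ((nat \<Rightarrow> 'a) \<Rightarrow> nat \<Rightarrow> 'a) \<Rightarrow> ((nat \<Rightarrow> 'a) \<Rightarrow> nat \<Rightarrow> 'a) \<Rightarrow> bool" where
  "min_homotopy x \<sigma>0 \<sigma>1 \<longleftrightarrow> \<sigma>0 \<in> graded_hom A (PM 0) (PM 1) d \<and> \<sigma>1 \<in> graded_hom A (PM 1) (PM 2) d \<and>
     (\<forall>v \<in> carrier (PM 0). rdiff P 0 (\<sigma>0 v) = x \<odot>\<^bsub>PM 0\<^esub> v) \<and>
     (\<forall>v \<in> carrier (PM 1). rdiff P 1 (\<sigma>1 v) = x \<odot>\<^bsub>PM 1\<^esub> v \<ominus>\<^bsub>PM 1\<^esub> \<sigma>0 (rdiff P 0 v)) \<and>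
     (\<forall>f e. f \<in> graded_hom A (PM 1) A.triv e \<longrightarrow> (\<forall>v \<in> carrier (PM 0). f (\<sigma>0 v) = \<zero>\<^bsub>K\<^esub>)) \<and>
     (\<forall>f e. f \<in> graded_hom A (PM 2) A.triv e \<longrightarrow> (\<forall>v \<in> carrier (PM 1). f (\<sigma>1 v) = \<zero>\<^bsub>K\<^esub>))"

text \<open>Multiplication by an element of positive degree is zero on the trivial module, hence null
  homotopic on its resolution.\<close>

lemma homotopy_positive:
  assumes b: "b \<in> part A j" and j: "0 < j"
  shows "\<exists>\<tau>0 \<in> graded_hom A (PM 0) (PM 1) j. \<exists>\<tau>1 \<in> graded_hom A (PM 1) (PM 2) j.
     (\<forall>v \<in> carrier (PM 0). rdiff P 0 (\<tau>0 v) = b \<odot>\<^bsub>PM 0\<^esub> v) \<and>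
     (\<forall>v \<in> carrier (PM 1). rdiff P 1 (\<tau>1 v) = b \<odot>\<^bsub>PM 1\<^esub> v \<ominus>\<^bsub>PM 1\<^esub> \<tau>0 (rdiff P 0 v))"
proof -
  have bc: "b \<in> carrier A" using A.part_carrier[OF b] .
  have idh: "(\<lambda>x\<in>carrier (PM n). x) \<in> graded_hom A (PM n) (PM n) 0" for n
    by (rule ghomI[OF R.P_mod]) auto
  have bh: "(\<lambda>v\<in>carrier (PM n). b \<odot>\<^bsub>PM n\<^esub> v) \<in> graded_hom A (PM n) (PM n) j" for n
  proof -
    have "(\<lambda>v\<in>carrier (PM n). b \<odot>\<^bsub>PM n\<^esub> (\<lambda>x\<in>carrier (PM n). x) v) \<in> graded_hom A (PM n) (PM n) (0 + j)"
      by (rule ghom_act[OF R.P_mod R.P_mod idh b bc])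
    then show ?thesis by (simp cong: restrict_cong)
  qed
  have "R.is_cycle 0 (b \<odot>\<^bsub>PM 0\<^esub> v)" if "v \<in> carrier (PM 0)" for v
    using ghom_smult[OF R.raug_hom bc that] A.aug_homogeneous[OF b] j ghom_closed[OF R.raug_hom that]
    by (simp add: R.is_cycle_def)
  then obtain \<tau>0 where t0: "\<tau>0 \<in> graded_hom A (PM 0) (PM 1) j" "\<forall>v \<in> carrier (PM 0). rdiff P 0 (\<tau>0 v) = b \<odot>\<^bsub>PM 0\<^esub> v"
    using R.lift_cycle_resolution[OF bh[of 0]] by auto
  define E where "E = (\<lambda>v\<in>carrier (PM 1). (\<lambda>v\<in>carrier (PM 1). b \<odot>\<^bsub>PM 1\<^esub> v) v \<ominus>\<^bsub>PM 1\<^esub> (\<lambda>v\<in>carrier (PM (Suc 0)). \<tau>0 (rdiff P 0 v)) v)"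
  have E: "E \<in> graded_hom A (PM 1) (PM 1) j"
    unfolding E_def using A.ghom_diff[OF R.P_mod R.P_mod bh[of "Suc 0"] ghom_comp0[OF R.P_mod R.rdiff_hom t0(1)[unfolded One_nat_def]]] by simp
  have E_val: "E v = b \<odot>\<^bsub>PM 1\<^esub> v \<ominus>\<^bsub>PM 1\<^esub> \<tau>0 (rdiff P 0 v)" if "v \<in> carrier (PM 1)" for v
    using that by (simp add: E_def)
  have "R.is_cycle 1 (E v)" if v: "v \<in> carrier (PM 1)" for v
  proof -
    have dv: "rdiff P 0 v \<in> carrier (PM 0)" using rdiff_closed[of v 0] v by simp
    have "rdiff P 0 (E v) = rdiff P 0 (b \<odot>\<^bsub>PM 1\<^esub> v) \<ominus>\<^bsub>PM 0\<^esub> rdiff P 0 (\<tau>0 (rdiff P 0 v))"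
      unfolding E_val[OF v] using rdiff_minus[of _ 0] PM_smult[OF bc v] ghom_closed[OF t0(1) dv] by simp
    also have "\<dots> = b \<odot>\<^bsub>PM 0\<^esub> rdiff P 0 v \<ominus>\<^bsub>PM 0\<^esub> b \<odot>\<^bsub>PM 0\<^esub> rdiff P 0 v"
      using ghom_smult[OF R.rdiff_hom[of 0] bc] v t0(2) dv by simp
    also have "\<dots> = \<zero>\<^bsub>PM 0\<^esub>" using abelian_group.r_neg[OF R.P_group PM_smult[OF bc dv]] by (simp add: a_minus_def)
    finally show ?thesis by (simp add: R.is_cycle_def)
  qed
  then obtain \<tau>1 where "\<tau>1 \<in> graded_hom A (PM 1) (PM 2) j" "\<forall>v \<in> carrier (PM 1). rdiff P 1 (\<tau>1 v) = E v"
    using R.lift_cycle_resolution[OF E] by (auto simp: numeral_2_eq_2)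
  then show ?thesis using t0 E_val by auto
qed

lemma min_homotopy_mult:
  assumes a: "a \<in> part A i" "0 < i" and b: "b \<in> part A j" "0 < j" and ij: "i + j = d"
  shows "\<exists>\<sigma>0 \<sigma>1. min_homotopy (a \<otimes>\<^bsub>A\<^esub> b) \<sigma>0 \<sigma>1"
proof -
  have ac: "a \<in> carrier A" and bc: "b \<in> carrier A" using A.part_carrier a b by auto
  obtain \<tau>0 \<tau>1 where t0: "\<tau>0 \<in> graded_hom A (PM 0) (PM 1) j" and t1: "\<tau>1 \<in> graded_hom A (PM 1) (PM 2) j"
     and d0: "\<And>v. v \<in> carrier (PM 0) \<Longrightarrow> rdiff P 0 (\<tau>0 v) = b \<odot>\<^bsub>PM 0\<^esub> v"
     and d1: "\<And>v. v \<in> carrier (PM 1) \<Longrightarrow> rdiff P 1 (\<tau>1 v) = b \<odot>\<^bsub>PM 1\<^esub> v \<ominus>\<^bsub>PM 1\<^esub> \<tau>0 (rdiff P 0 v)"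
    using homotopy_positive[OF b] by blast
  interpret P0: graded_mod A "PM 0" by (rule R.P_mod)
  interpret P1: graded_mod A "PM (Suc 0)" by (rule R.P_mod)
  have ji: "j + i = d" using ij by simp
  have s0: "(\<lambda>v\<in>carrier (PM 0). a \<odot>\<^bsub>PM 1\<^esub> \<tau>0 v) \<in> graded_hom A (PM 0) (PM 1) d"
    using ghom_act[OF R.P_mod R.P_mod t0 a(1) ac] ji by simp
  have s1: "(\<lambda>v\<in>carrier (PM 1). a \<odot>\<^bsub>PM 2\<^esub> \<tau>1 v) \<in> graded_hom A (PM 1) (PM 2) d"
    using ghom_act[OF R.P_mod R.P_mod t1 a(1) ac] ji by simp
  have mh: "min_homotopy (a \<otimes>\<^bsub>A\<^esub> b) (\<lambda>v\<in>carrier (PM 0). a \<odot>\<^bsub>PM 1\<^esub> \<tau>0 v) (\<lambda>v\<in>carrier (PM 1). a \<odot>\<^bsub>PM 2\<^esub> \<tau>1 v)"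
    unfolding min_homotopy_def
  proof (intro conjI ballI allI impI)
    fix v assume v: "v \<in> carrier (PM 0)"
    show "rdiff P 0 ((\<lambda>v\<in>carrier (PM 0). a \<odot>\<^bsub>PM 1\<^esub> \<tau>0 v) v) = (a \<otimes>\<^bsub>A\<^esub> b) \<odot>\<^bsub>PM 0\<^esub> v"
      using v ghom_smult[OF R.rdiff_hom[of 0] ac] ghom_closed[OF t0 v] d0[OF v] P0.smult_assoc1[OF ac bc v] by simp
    show "f ((\<lambda>v\<in>carrier (PM 0). a \<odot>\<^bsub>PM 1\<^esub> \<tau>0 v) v) = \<zero>\<^bsub>K\<^esub>" if f: "f \<in> graded_hom A (PM 1) A.triv e" for f e
      using v ghom_smult[OF f ac ghom_closed[OF t0 v]] A.aug_homogeneous[OF a(1)] a(2) ghom_closed[OF f ghom_closed[OF t0 v]] by simp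
  next
    fix v assume v: "v \<in> carrier (PM 1)"
    have dv: "rdiff P 0 v \<in> carrier (PM 0)" using rdiff_closed[of v 0] v by simp
    note tv = ghom_closed[OF t1 v] ghom_closed[OF t0 dv]
    have "rdiff P 1 (a \<odot>\<^bsub>PM 2\<^esub> \<tau>1 v) = a \<odot>\<^bsub>PM 1\<^esub> rdiff P 1 (\<tau>1 v)"
      using ghom_smult[OF R.rdiff_hom[of 1] ac, of "\<tau>1 v"] tv by (simp add: numeral_2_eq_2)
    also have "\<dots> = a \<odot>\<^bsub>PM 1\<^esub> (b \<odot>\<^bsub>PM 1\<^esub> v) \<ominus>\<^bsub>PM 1\<^esub> a \<odot>\<^bsub>PM 1\<^esub> \<tau>0 (rdiff P 0 v)"
      using d1[OF v] tv v ac bc by (simp add: a_minus_def P1.smult_r_distr P1.smult_r_minus)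
    finally show "rdiff P 1 ((\<lambda>v\<in>carrier (PM 1). a \<odot>\<^bsub>PM 2\<^esub> \<tau>1 v) v) = (a \<otimes>\<^bsub>A\<^esub> b) \<odot>\<^bsub>PM 1\<^esub> v \<ominus>\<^bsub>PM 1\<^esub>
        (\<lambda>v\<in>carrier (PM 0). a \<odot>\<^bsub>PM 1\<^esub> \<tau>0 v) (rdiff P 0 v)"
      using v dv P1.smult_assoc1[OF ac bc, of v] by simp
    show "f ((\<lambda>v\<in>carrier (PM 1). a \<odot>\<^bsub>PM 2\<^esub> \<tau>1 v) v) = \<zero>\<^bsub>K\<^esub>" if f: "f \<in> graded_hom A (PM 2) A.triv e" for f e
      using v ghom_smult[OF f ac ghom_closed[OF t1 v]] A.aug_homogeneous[OF a(1)] a(2) ghom_closed[OF f ghom_closed[OF t1 v]] by simp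
  qed (use s0 s1 in auto)
  then show ?thesis by blast
qed

lemma min_homotopy_add:
  assumes x: "x \<in> carrier A" "min_homotopy x \<sigma>0 \<sigma>1" and y: "y \<in> carrier A" "min_homotopy y \<tau>0 \<tau>1"
  shows "\<exists>\<rho>0 \<rho>1. min_homotopy (x \<oplus>\<^bsub>A\<^esub> y) \<rho>0 \<rho>1"
proof -
  interpret P0: graded_mod A "PM 0" by (rule R.P_mod)
  interpret P1: graded_mod A "PM (Suc 0)" by (rule R.P_mod)
  interpret P2: graded_mod A "PM (Suc (Suc 0))" by (rule R.P_mod)
  have s0: "\<sigma>0 \<in> graded_hom A (PM 0) (PM 1) d" and s1: "\<sigma>1 \<in> graded_hom A (PM 1) (PM 2) d"
    and t0: "\<tau>0 \<in> graded_hom A (PM 0) (PM 1) d" and t1: "\<tau>1 \<in> graded_hom A (PM 1) (PM 2) d"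
    using x(2) y(2) by (auto simp: min_homotopy_def)
  have "min_homotopy (x \<oplus>\<^bsub>A\<^esub> y) (\<lambda>v\<in>carrier (PM 0). \<sigma>0 v \<oplus>\<^bsub>PM 1\<^esub> \<tau>0 v) (\<lambda>v\<in>carrier (PM 1). \<sigma>1 v \<oplus>\<^bsub>PM 2\<^esub> \<tau>1 v)"
    unfolding min_homotopy_def
  proof (intro conjI ballI allI impI)
    show "(\<lambda>v\<in>carrier (PM 0). \<sigma>0 v \<oplus>\<^bsub>PM 1\<^esub> \<tau>0 v) \<in> graded_hom A (PM 0) (PM 1) d"
      by (rule ghom_plus[OF R.P_mod R.P_mod s0 t0])
    show "(\<lambda>v\<in>carrier (PM 1). \<sigma>1 v \<oplus>\<^bsub>PM 2\<^esub> \<tau>1 v) \<in> graded_hom A (PM 1) (PM 2) d"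
      by (rule ghom_plus[OF R.P_mod R.P_mod s1 t1])
  next
    fix v assume v: "v \<in> carrier (PM 0)"
    note c = ghom_closed[OF s0 v] ghom_closed[OF t0 v]
    show "rdiff P 0 ((\<lambda>v\<in>carrier (PM 0). \<sigma>0 v \<oplus>\<^bsub>PM 1\<^esub> \<tau>0 v) v) = (x \<oplus>\<^bsub>A\<^esub> y) \<odot>\<^bsub>PM 0\<^esub> v"
      using v c ghom_add[OF R.rdiff_hom[of 0]] x y by (simp add: min_homotopy_def P0.smult_l_distr)
    show "f ((\<lambda>v\<in>carrier (PM 0). \<sigma>0 v \<oplus>\<^bsub>PM 1\<^esub> \<tau>0 v) v) = \<zero>\<^bsub>K\<^esub>" if f: "f \<in> graded_hom A (PM 1) A.triv e" for f e
    proof -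
      have "f (\<sigma>0 v) = \<zero>\<^bsub>K\<^esub>" "f (\<tau>0 v) = \<zero>\<^bsub>K\<^esub>" using x(2) y(2) f v unfolding min_homotopy_def by blast+
      then show ?thesis using v ghom_add[OF f c] by simp
    qed
  next
    fix v assume v: "v \<in> carrier (PM 1)"
    have dv: "rdiff P 0 v \<in> carrier (PM 0)" using rdiff_closed[of v 0] v by simp
    note c = ghom_closed[OF s1 v] ghom_closed[OF t1 v] ghom_closed[OF s0 dv] ghom_closed[OF t0 dv]
    have "rdiff P 1 (\<sigma>1 v \<oplus>\<^bsub>PM 2\<^esub> \<tau>1 v) = rdiff P 1 (\<sigma>1 v) \<oplus>\<^bsub>PM 1\<^esub> rdiff P 1 (\<tau>1 v)"
      using c ghom_add[OF R.rdiff_hom[of 1]] by (simp add: numeral_2_eq_2)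
    also have "\<dots> = (x \<odot>\<^bsub>PM 1\<^esub> v \<ominus>\<^bsub>PM 1\<^esub> \<sigma>0 (rdiff P 0 v)) \<oplus>\<^bsub>PM 1\<^esub> (y \<odot>\<^bsub>PM 1\<^esub> v \<ominus>\<^bsub>PM 1\<^esub> \<tau>0 (rdiff P 0 v))"
      using x(2) y(2) v by (simp add: min_homotopy_def)
    also have "\<dots> = (x \<oplus>\<^bsub>A\<^esub> y) \<odot>\<^bsub>PM 1\<^esub> v \<ominus>\<^bsub>PM 1\<^esub> (\<sigma>0 (rdiff P 0 v) \<oplus>\<^bsub>PM 1\<^esub> \<tau>0 (rdiff P 0 v))"
      using c v x(1) y(1) by (simp add: a_minus_def P1.smult_l_distr P1.M.minus_add P1.M.a_ac)
    finally show "rdiff P 1 ((\<lambda>v\<in>carrier (PM 1). \<sigma>1 v \<oplus>\<^bsub>PM 2\<^esub> \<tau>1 v) v) = (x \<oplus>\<^bsub>A\<^esub> y) \<odot>\<^bsub>PM 1\<^esub> v \<ominus>\<^bsub>PM 1\<^esub>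
        (\<lambda>v\<in>carrier (PM 0). \<sigma>0 v \<oplus>\<^bsub>PM 1\<^esub> \<tau>0 v) (rdiff P 0 v)" using v dv by simp
    show "f ((\<lambda>v\<in>carrier (PM 1). \<sigma>1 v \<oplus>\<^bsub>PM 2\<^esub> \<tau>1 v) v) = \<zero>\<^bsub>K\<^esub>" if f: "f \<in> graded_hom A (PM 2) A.triv e" for f e
    proof -
      have "f (\<sigma>1 v) = \<zero>\<^bsub>K\<^esub>" "f (\<tau>1 v) = \<zero>\<^bsub>K\<^esub>" using x(2) y(2) f v unfolding min_homotopy_def by blast+
      then show ?thesis using v ghom_add[OF f c(1,2)] by simp
    qed
  qed
  then show ?thesis by blast
qed

lemma min_homotopy_zero: "\<exists>\<sigma>0 \<sigma>1. min_homotopy \<zero>\<^bsub>A\<^esub> \<sigma>0 \<sigma>1"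
proof -
  interpret P0: graded_mod A "PM 0" by (rule R.P_mod)
  interpret P1: graded_mod A "PM (Suc 0)" by (rule R.P_mod)
  have m0: "\<ominus>\<^bsub>PM (Suc 0)\<^esub> \<zero>\<^bsub>PM (Suc 0)\<^esub> = \<zero>\<^bsub>PM (Suc 0)\<^esub>" by (rule P1.M.minus_equality) auto
  have "min_homotopy \<zero>\<^bsub>A\<^esub> (\<lambda>v\<in>carrier (PM 0). \<zero>\<^bsub>PM 1\<^esub>) (\<lambda>v\<in>carrier (PM 1). \<zero>\<^bsub>PM 2\<^esub>)"
    unfolding min_homotopy_def
    using ghom_null[OF R.P_mod R.P_mod] ghom_zero[OF R.P_group R.P_group R.rdiff_hom, of 0] ghom_zero[OF R.P_group R.P_group R.rdiff_hom, of 1]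
      ghom_zero[OF R.P_group A.triv_group] rdiff_closed[of _ 0]
    by (auto simp: a_minus_def numeral_2_eq_2 m0)
  then show ?thesis by blast
qed

text \<open>\<open>g\<close> is a sum of products of elements of positive degree.\<close>

lemma min_homotopy_exists: "\<exists>\<sigma>0 \<sigma>1. min_homotopy g \<sigma>0 \<sigma>1"
proof -
  let ?H = "{a \<otimes>\<^bsub>A\<^esub> b | a b i j. 0 < i \<and> 0 < j \<and> i + j = d \<and> a \<in> part A i \<and> b \<in> part A j}"
  have "x \<in> carrier A \<and> (\<exists>\<sigma>0 \<sigma>1. min_homotopy x \<sigma>0 \<sigma>1)" if "x \<in> additive_span A ?H" for x
    using that
  proof induction
    case zero
    then show ?case using min_homotopy_zero by simp
  next
    case (incl x)
    then obtain a b i j where "x = a \<otimes>\<^bsub>A\<^esub> b" "0 < i" "0 < j" "i + j = d" "a \<in> part A i" "b \<in> part A j" by blast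
    then show ?case using min_homotopy_mult A.part_carrier by simp
  next
    case (add x y)
    then show ?case using min_homotopy_add A.a_closed by blast
  qed
  then show ?thesis using g_decomposable by blast
qed

definition "homotopy = (SOME p. min_homotopy g (fst p) (snd p))"
definition "\<sigma>0 = fst homotopy"
definition "\<sigma>1 = snd homotopy"

lemma \<sigma>: "min_homotopy g \<sigma>0 \<sigma>1"
proof -
  have "\<exists>p. min_homotopy g (fst p) (snd p)" using min_homotopy_exists by auto
  then show ?thesis unfolding \<sigma>0_def \<sigma>1_def homotopy_def by (rule someI_ex)
qed

lemma \<sigma>0_hom: "\<sigma>0 \<in> graded_hom A (PM 0) (PM 1) d"
  and \<sigma>1_hom: "\<sigma>1 \<in> graded_hom A (PM 1) (PM 2) d"
  and d_\<sigma>0: "v \<in> carrier (PM 0) \<Longrightarrow> rdiff P 0 (\<sigma>0 v) = g \<odot>\<^bsub>PM 0\<^esub> v"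
  and d_\<sigma>1: "v \<in> carrier (PM 1) \<Longrightarrow> rdiff P 1 (\<sigma>1 v) = g \<odot>\<^bsub>PM 1\<^esub> v \<ominus>\<^bsub>PM 1\<^esub> \<sigma>0 (rdiff P 0 v)"
  and \<sigma>0_min: "f \<in> graded_hom A (PM 1) A.triv e \<Longrightarrow> v \<in> carrier (PM 0) \<Longrightarrow> f (\<sigma>0 v) = \<zero>\<^bsub>K\<^esub>"
  and \<sigma>1_min: "f \<in> graded_hom A (PM 2) A.triv e \<Longrightarrow> v \<in> carrier (PM 1) \<Longrightarrow> f (\<sigma>1 v) = \<zero>\<^bsub>K\<^esub>"
  using \<sigma> unfolding min_homotopy_def by blast+

text \<open>The homotopies modulo \<open>g\<close>. They anticommute with the reduced differential, since \<open>g\<close> acts as zero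
  over \<open>B\<close>.\<close>

definition "sb0 = (SOME f. f \<in> graded_hom B (BP 0) (BP 1) d \<and> (\<forall>v \<in> carrier (PM 0). f (red v) = red (\<sigma>0 v)))"
definition "sb1 = (SOME f. f \<in> graded_hom B (BP 1) (BP 2) d \<and> (\<forall>v \<in> carrier (PM 1). f (red v) = red (\<sigma>1 v)))"

lemma sb0: "sb0 \<in> graded_hom B (BP 0) (BP 1) d \<and> (\<forall>v \<in> carrier (PM 0). sb0 (red v) = red (\<sigma>0 v))"
proof -
  have "\<exists>f. f \<in> graded_hom B (BP 0) (BP 1) d \<and> (\<forall>v \<in> carrier (PM 0). f (red v) = red (\<sigma>0 v))"
    using descend[OF \<sigma>0_hom[unfolded PM_free]] unfolding PM_carrier by blast
  then show ?thesis unfolding sb0_def by (rule someI_ex)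
qed
lemma sb1: "sb1 \<in> graded_hom B (BP 1) (BP 2) d \<and> (\<forall>v \<in> carrier (PM 1). sb1 (red v) = red (\<sigma>1 v))"
proof -
  have "\<exists>f. f \<in> graded_hom B (BP 1) (BP 2) d \<and> (\<forall>v \<in> carrier (PM 1). f (red v) = red (\<sigma>1 v))"
    using descend[OF \<sigma>1_hom[unfolded PM_free]] unfolding PM_carrier by blast
  then show ?thesis unfolding sb1_def by (rule someI_ex)
qed

lemma sb0_hom: "sb0 \<in> graded_hom B (BP 0) (BP 1) d" 
  and sb0_red: "v \<in> carrier (PM 0) \<Longrightarrow> sb0 (red v) = red (\<sigma>0 v)"
  and sb1_hom: "sb1 \<in> graded_hom B (BP 1) (BP 2) d" 
  and sb1_red: "v \<in> carrier (PM 1) \<Longrightarrow> sb1 (red v) = red (\<sigma>1 v)"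
  using sb0 sb1 by auto

lemma red_triv_hom: "f \<in> graded_hom B (BP n) B.triv e \<Longrightarrow> (\<lambda>v\<in>carrier (PM n). f (red v)) \<in> graded_hom A (PM n) A.triv e"
proof -
  assume f: "f \<in> graded_hom B (BP n) B.triv e"
  have "(\<lambda>v\<in>carrier (PM n). f (restrict red (carrier (PM n)) v)) \<in> graded_hom A (PM n) A.triv e"
    using ghom_comp0[OF R.P_mod redP_hom restrict_scalars_ghom[OF pi_hom f]] by (simp add: rs_triv)
  then show ?thesis by (simp cong: restrict_cong)
qed

lemma sb0_min: "f \<in> graded_hom B (BP 1) B.triv e \<Longrightarrow> u \<in> carrier (BP 0) \<Longrightarrow> f (sb0 u) = \<zero>\<^bsub>K\<^esub>"
proof -
  assume f: "f \<in> graded_hom B (BP 1) B.triv e" and u: "u \<in> carrier (BP 0)"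
  obtain v where v: "v \<in> carrier (PM 0)" "red v = u" using lift_red[OF u] by blast
  have "(\<lambda>v\<in>carrier (PM 1). f (red v)) (\<sigma>0 v) = \<zero>\<^bsub>K\<^esub>" by (rule \<sigma>0_min[OF red_triv_hom[OF f] v(1)])
  then have "f (red (\<sigma>0 v)) = \<zero>\<^bsub>K\<^esub>" by (simp only: restrict_apply' ghom_closed[OF \<sigma>0_hom v(1)])
  then show "f (sb0 u) = \<zero>\<^bsub>K\<^esub>" using sb0_red[OF v(1)] v(2) by metis
qed

lemma sb1_min: "f \<in> graded_hom B (BP 2) B.triv e \<Longrightarrow> u \<in> carrier (BP 1) \<Longrightarrow> f (sb1 u) = \<zero>\<^bsub>K\<^esub>"
proof -
  assume f: "f \<in> graded_hom B (BP 2) B.triv e" and u: "u \<in> carrier (BP 1)"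
  obtain v where v: "v \<in> carrier (PM 1)" "red v = u" using lift_red[OF u] by blast
  have "(\<lambda>v\<in>carrier (PM 2). f (red v)) (\<sigma>1 v) = \<zero>\<^bsub>K\<^esub>" by (rule \<sigma>1_min[OF red_triv_hom[OF f] v(1)])
  then have "f (red (\<sigma>1 v)) = \<zero>\<^bsub>K\<^esub>" by (simp only: restrict_apply' ghom_closed[OF \<sigma>1_hom v(1)])
  then show "f (sb1 u) = \<zero>\<^bsub>K\<^esub>" using sb1_red[OF v(1)] v(2) by metis
qed

subsection \<open>Homology of the reduced resolution\<close>

lemma dbar_dbar: "u \<in> carrier (BP (Suc (Suc n))) \<Longrightarrow> dbar n (dbar (Suc n) u) = \<zero>\<^bsub>BP n\<^esub>"
  using lift_red[of u "Suc (Suc n)"] by (metis dbar_red R.dd_dd red_zero rdiff_closed)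

lemma epsbar_dbar: "u \<in> carrier (BP 1) \<Longrightarrow> epsbar (dbar 0 u) = \<zero>\<^bsub>K\<^esub>"
  using lift_red[of u 1] by (metis dbar_red R.eps_dd epsbar_red rdiff_closed One_nat_def)

lemma epsbar_kernel: "u \<in> carrier (BP 0) \<Longrightarrow> epsbar u = \<zero>\<^bsub>K\<^esub> \<Longrightarrow> \<exists>y \<in> carrier (BP 1). dbar 0 y = u"
proof -
  assume u: "u \<in> carrier (BP 0)" "epsbar u = \<zero>\<^bsub>K\<^esub>"
  obtain v where v: "v \<in> carrier (PM 0)" "red v = u" using lift_red[OF u(1)] by blast
  have "raug P v = \<zero>\<^bsub>K\<^esub>" using epsbar_red[OF v(1)] u(2) v(2) by simp
  then have "v \<in> rdiff P 0 ` carrier (PM 1)" using R.ker_raug v(1) by blast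
  then obtain y where "y \<in> carrier (PM 1)" "v = rdiff P 0 y" by (elim imageE)
  then show ?thesis using dbar_red[of y 0] red_closed[of y 1] v by auto
qed

lemma dbar_cycle_lift:
  assumes v: "v \<in> carrier (PM (Suc n))" and z: "dbar n (red v) = \<zero>\<^bsub>BP n\<^esub>"
  shows "\<exists>u \<in> carrier (PM n). rdiff P n v = g \<odot>\<^bsub>PM n\<^esub> u"
  using red_kernel[OF rdiff_closed[OF v]] dbar_red[OF v] z by simp

text \<open>The reduced resolution computes \<open>Tor\<^sup>A(B, K)\<close>. As \<open>g\<close> is regular, this is \<open>K\<close> in degrees 0 and 1
  and zero otherwise.\<close>

lemma homology_high:
  assumes u: "u \<in> carrier (BP (Suc (Suc n)))" "dbar (Suc n) u = \<zero>\<^bsub>BP (Suc n)\<^esub>"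
  shows "\<exists>y \<in> carrier (BP (Suc (Suc (Suc n)))). dbar (Suc (Suc n)) y = u"
proof -
  interpret P0: graded_mod A "PM (Suc n)" by (rule R.P_mod)
  interpret B: graded_mod B "BP (Suc (Suc n))" by (rule BP_mod)
  obtain v where v: "v \<in> carrier (PM (Suc (Suc n)))" "red v = u" using lift_red[OF u(1)] by blast
  obtain z where z: "z \<in> carrier (PM (Suc n))" "rdiff P (Suc n) v = g \<odot>\<^bsub>PM (Suc n)\<^esub> z"
    using dbar_cycle_lift[OF v(1)] v u by blast
  have "g \<odot>\<^bsub>PM n\<^esub> rdiff P n z = rdiff P n (rdiff P (Suc n) v)"
    using ghom_smult[OF R.rdiff_hom g_closed z(1)] z(2) by simp
  then have "rdiff P n z = \<zero>\<^bsub>PM n\<^esub>" using R.dd_dd[OF v(1)] g_smult_cancel rdiff_closed z(1) by simp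
  then obtain y where y: "y \<in> carrier (PM (Suc (Suc n)))" "z = rdiff P (Suc n) y" using R.ker_rdiff z(1) by blast
  let ?v = "v \<ominus>\<^bsub>PM (Suc (Suc n))\<^esub> g \<odot>\<^bsub>PM (Suc (Suc n))\<^esub> y"
  have vc: "?v \<in> carrier (PM (Suc (Suc n)))"
    using abelian_group.minus_closed[OF R.P_group] v(1) PM_smult[OF g_closed y(1)] by blast
  have "rdiff P (Suc n) ?v = rdiff P (Suc n) v \<ominus>\<^bsub>PM (Suc n)\<^esub> g \<odot>\<^bsub>PM (Suc n)\<^esub> z"
    using rdiff_minus[OF v(1) PM_smult[OF g_closed y(1)]] ghom_smult[OF R.rdiff_hom g_closed y(1)] y(2) by simp
  also have "\<dots> = \<zero>\<^bsub>PM (Suc n)\<^esub>" using z PM_smult[OF g_closed z(1)] by (simp add: a_minus_def P0.M.r_neg)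
  finally obtain t where t: "t \<in> carrier (PM (Suc (Suc (Suc n))))" "?v = rdiff P (Suc (Suc n)) t"
    using R.ker_rdiff[of "Suc n"] vc by blast
  have "red ?v = u" using red_minus[OF v(1) PM_smult[OF g_closed y(1)]] red_g[OF y(1)] v(2) u(1)
    by (simp add: a_minus_def del: free_module_simps)
  then show ?thesis using t dbar_red[OF t(1)] red_closed[OF t(1)] by metis
qed

text \<open>In degree 1 the homology is spanned by the image of the reduced homotopy \<open>sb0\<close>; the next lemma says
  that an element of augmentation different from zero has a nontrivial image.\<close>

lemma homology_one:
  assumes u: "u \<in> carrier (BP 1)" "dbar 0 u = \<zero>\<^bsub>BP 0\<^esub>"
  shows "\<exists>y \<in> carrier (BP 2). \<exists>z \<in> carrier (BP 0). u = dbar 1 y \<oplus>\<^bsub>BP 1\<^esub> sb0 z"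
proof -
  interpret P0: graded_mod A "PM 0" by (rule R.P_mod)
  interpret P1: graded_mod A "PM (Suc 0)" by (rule R.P_mod)
  obtain v where v: "v \<in> carrier (PM 1)" "red v = u" using lift_red[OF u(1)] by blast
  obtain z where z: "z \<in> carrier (PM 0)" "rdiff P 0 v = g \<odot>\<^bsub>PM 0\<^esub> z"
    using dbar_cycle_lift[of v 0] v u by auto
  have sz: "\<sigma>0 z \<in> carrier (PM 1)" using ghom_closed[OF \<sigma>0_hom z(1)] .
  have "rdiff P 0 (v \<ominus>\<^bsub>PM 1\<^esub> \<sigma>0 z) = \<zero>\<^bsub>PM 0\<^esub>"
    using rdiff_minus[of v 0 "\<sigma>0 z"] v(1) sz d_\<sigma>0[OF z(1)] z PM_smult[OF g_closed z(1)] by (simp add: a_minus_def P0.M.r_neg)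
  then obtain t where t: "t \<in> carrier (PM 2)" "v \<ominus>\<^bsub>PM 1\<^esub> \<sigma>0 z = rdiff P 1 t"
    using R.ker_rdiff[of 0] v(1) sz by (force simp: numeral_2_eq_2)
  have "v = rdiff P 1 t \<oplus>\<^bsub>PM 1\<^esub> \<sigma>0 z" unfolding t(2)[symmetric] using v(1) sz by (simp add: a_minus_def P1.M.a_assoc P1.M.l_neg)
  then have "u = red (rdiff P 1 t) \<oplus>\<^bsub>BP 1\<^esub> red (\<sigma>0 z)" 
    using red_add[of "rdiff P 1 t" 1 "\<sigma>0 z"] v(2) sz rdiff_closed[of t 1] t(1) by (simp add: numeral_2_eq_2)
  moreover have "red (rdiff P 1 t) = dbar 1 (red t)" using dbar_red[of t 1] t(1) by (simp add: numeral_2_eq_2)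
  ultimately show ?thesis using sb0_red[OF z(1)] red_closed[OF t(1)] red_closed[OF z(1)] by metis
qed

lemma homology_one_class:
  assumes z: "z \<in> carrier (BP 0)" and y: "y \<in> carrier (BP 2)" and eq: "sb0 z = dbar 1 y"
  shows "epsbar z = \<zero>\<^bsub>K\<^esub>"
proof -
  interpret P0: graded_mod A "PM 0" by (rule R.P_mod)
  interpret P1: graded_mod A "PM (Suc 0)" by (rule R.P_mod)
  obtain z' where z': "z' \<in> carrier (PM 0)" "red z' = z" using lift_red[OF z] by blast
  obtain y' where y': "y' \<in> carrier (PM 2)" "red y' = y" using lift_red[OF y] by blast
  have c: "\<sigma>0 z' \<in> carrier (PM 1)" "rdiff P 1 y' \<in> carrier (PM 1)"
    using ghom_closed[OF \<sigma>0_hom z'(1)] rdiff_closed[of y' 1] y'(1) by (auto simp: numeral_2_eq_2)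
  have "red (\<sigma>0 z' \<ominus>\<^bsub>PM 1\<^esub> rdiff P 1 y') = red (\<sigma>0 z') \<ominus>\<^bsub>BP 1\<^esub> red (rdiff P 1 y')" by (rule red_minus[OF c])
  also have "red (\<sigma>0 z') = red (rdiff P 1 y')"
    using eq sb0_red[OF z'(1)] dbar_red[of y' 1] z' y' by (simp add: numeral_2_eq_2)
  also have "red (rdiff P 1 y') \<ominus>\<^bsub>BP 1\<^esub> red (rdiff P 1 y') = \<zero>\<^bsub>BP 1\<^esub>"
    using abelian_group.r_neg[OF BP_group red_closed[OF c(2)]] by (simp only: a_minus_def)
  finally have rz: "red (\<sigma>0 z' \<ominus>\<^bsub>PM 1\<^esub> rdiff P 1 y') = \<zero>\<^bsub>BP 1\<^esub>" .
  have mc: "\<sigma>0 z' \<ominus>\<^bsub>PM 1\<^esub> rdiff P 1 y' \<in> carrier (PM 1)" using P1.M.minus_closed c by simp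
  obtain t where t: "t \<in> carrier (PM 1)" "\<sigma>0 z' \<ominus>\<^bsub>PM 1\<^esub> rdiff P 1 y' = g \<odot>\<^bsub>PM 1\<^esub> t"
    using red_kernel[OF mc rz] by blast
  have dt: "rdiff P 0 t \<in> carrier (PM 0)" using rdiff_closed[of t 0] t(1) by simp
  have "rdiff P 0 (\<sigma>0 z' \<ominus>\<^bsub>PM 1\<^esub> rdiff P 1 y') = g \<odot>\<^bsub>PM 0\<^esub> z' \<ominus>\<^bsub>PM 0\<^esub> \<zero>\<^bsub>PM 0\<^esub>"
    using rdiff_minus[of "\<sigma>0 z'" 0 "rdiff P 1 y'"] c d_\<sigma>0[OF z'(1)] R.dd_dd[of y' 0] y'(1) by (simp add: numeral_2_eq_2)
  then have "g \<odot>\<^bsub>PM 0\<^esub> rdiff P 0 t = g \<odot>\<^bsub>PM 0\<^esub> z'"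
    using t ghom_smult[OF R.rdiff_hom[of 0] g_closed] z'(1) by (simp add: a_minus_def)
  then have "g \<odot>\<^bsub>PM 0\<^esub> (z' \<ominus>\<^bsub>PM 0\<^esub> rdiff P 0 t) = \<zero>\<^bsub>PM 0\<^esub>"
    using z'(1) dt by (simp add: a_minus_def P0.smult_r_distr P0.smult_r_minus P0.M.r_neg)
  then have "z' = rdiff P 0 t" using g_smult_cancel PM_cancel z'(1) dt by simp
  then show ?thesis using R.eps_dd[of t] t(1) epsbar_red[OF z'(1)] z'(2) by simp
qed

lemma dbar_sb0: "u \<in> carrier (BP 0) \<Longrightarrow> dbar 0 (sb0 u) = \<zero>\<^bsub>BP 0\<^esub>"
proof -
  assume u: "u \<in> carrier (BP 0)"
  obtain v where v: "v \<in> carrier (PM 0)" "red v = u" using lift_red[OF u] by blast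
  then show ?thesis using dbar_red[of "\<sigma>0 v" 0] ghom_closed[OF \<sigma>0_hom v(1)] d_\<sigma>0[OF v(1)] red_g[OF v(1)] sb0_red[OF v(1)] 
    by (simp del: free_module_simps)
qed

lemma dbar_sb1: "u \<in> carrier (BP 1) \<Longrightarrow> dbar 1 (sb1 u) \<oplus>\<^bsub>BP 1\<^esub> sb0 (dbar 0 u) = \<zero>\<^bsub>BP 1\<^esub>"
proof -
  assume u: "u \<in> carrier (BP 1)"
  interpret P1: graded_mod A "PM (Suc 0)" by (rule R.P_mod)
  obtain v where v: "v \<in> carrier (PM 1)" "red v = u" using lift_red[OF u] by blast
  have dv: "rdiff P 0 v \<in> carrier (PM 0)" using rdiff_closed[of v 0] v(1) by simp
  have c: "\<sigma>1 v \<in> carrier (PM 2)" "\<sigma>0 (rdiff P 0 v) \<in> carrier (PM 1)" 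
    using ghom_closed[OF \<sigma>1_hom v(1)] ghom_closed[OF \<sigma>0_hom dv] .
  have dc: "rdiff P 1 (\<sigma>1 v) \<in> carrier (PM 1)" using rdiff_closed[of "\<sigma>1 v" 1] c by (simp add: numeral_2_eq_2)
  have "dbar 1 (sb1 u) = red (rdiff P 1 (\<sigma>1 v))" using dbar_red[of "\<sigma>1 v" 1] c sb1_red[OF v(1)] v(2) by (simp add: numeral_2_eq_2)
  moreover have "sb0 (dbar 0 u) = red (\<sigma>0 (rdiff P 0 v))" using dbar_red[of v 0] v sb0_red[OF dv] by simp
  ultimately have "dbar 1 (sb1 u) \<oplus>\<^bsub>BP 1\<^esub> sb0 (dbar 0 u) = red (rdiff P 1 (\<sigma>1 v) \<oplus>\<^bsub>PM 1\<^esub> \<sigma>0 (rdiff P 0 v))"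
    using red_add[OF dc c(2)] by simp
  also have "rdiff P 1 (\<sigma>1 v) \<oplus>\<^bsub>PM 1\<^esub> \<sigma>0 (rdiff P 0 v) = g \<odot>\<^bsub>PM 1\<^esub> v"
    using d_\<sigma>1[OF v(1)] c(2) v(1) PM_smult[OF g_closed v(1)] by (simp add: a_minus_def P1.M.a_assoc P1.M.l_neg)
  finally show ?thesis using red_g[OF v(1)] by simp
qed

end

context hypersurface
begin

subsection \<open>The cone\<close>

text \<open>A second copy of the resolution, raised by 2 in homological degree and by \<open>d\<close> in internal degree,
  kills the homology in degree 1. This leads to the recursion \<open>Q\<^sub>n = P\<^sub>n/g \<oplus> Q\<^sub>n\<^sub>-\<^sub>2\<close> and to the
  differential \<open>(p, q) \<mapsto> (d p + s q, d q)\<close>, where \<open>s\<close> extends the reduced homotopies. Since \<open>s\<close>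
  is defined on all of \<open>Q\<close>, both are constructed simultaneously.\<close>

fun XQ :: "nat \<Rightarrow> nat set" where
  "XQ 0 = sum_index (X 0) {}"
| "XQ (Suc 0) = sum_index (X 1) {}"
| "XQ (Suc (Suc n)) = sum_index (X (Suc (Suc n))) (XQ n)"

fun wQ :: "nat \<Rightarrow> nat \<Rightarrow> int" where
  "wQ 0 = sum_weight (w 0) (\<lambda>_. 0) d"
| "wQ (Suc 0) = sum_weight (w 1) (\<lambda>_. 0) d"
| "wQ (Suc (Suc n)) = sum_weight (w (Suc (Suc n))) (wQ n) d"

text \<open>The second summand of \<open>Q\<^sub>n\<close>, which is zero for \<open>n < 2\<close>.\<close>

definition XO :: "nat \<Rightarrow> nat set" where
  "XO n = (if n < 2 then {} else XQ (n - 2))"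
definition wO :: "nat \<Rightarrow> nat \<Rightarrow> int" where
  "wO n = (if n < 2 then (\<lambda>_. 0) else wQ (n - 2))"

abbreviation "Qm n \<equiv> free_module B (XQ n) (wQ n)"
abbreviation "OM n \<equiv> free_module B (XO n) (wO n)"
abbreviation "zB \<equiv> (\<lambda>i::nat. \<zero>\<^bsub>B\<^esub>)"

lemma XQ_eq: "XQ n = sum_index (X n) (XO n)" and wQ_eq: "wQ n = sum_weight (w n) (wO n) d"
  by (cases n rule: XQ.cases; simp add: XO_def wO_def)+

lemma OM_Suc_Suc: "OM (Suc (Suc n)) = Qm n" by (simp add: XO_def wO_def)

lemma Qm_mod: "graded_mod B (Qm n)" by (rule B.free_graded_mod)
lemma Qm_group: "abelian_group (Qm n)" by (rule B.free_abelian_group)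
lemma OM_mod: "graded_mod B (OM n)" by (rule B.free_graded_mod)
lemma OM_group: "abelian_group (OM n)" by (rule B.free_abelian_group)

lemma ev_Q: "x \<in> carrier (Qm n) \<Longrightarrow> ev x \<in> carrier (BP n)" using B.ev_finsupp by (simp add: XQ_eq)
lemma od_O: "x \<in> carrier (Qm n) \<Longrightarrow> od x \<in> carrier (OM n)" using B.od_finsupp by (simp add: XQ_eq)
lemma od_Q: "x \<in> carrier (Qm (Suc (Suc n))) \<Longrightarrow> od x \<in> carrier (Qm n)" using od_O[of x "Suc (Suc n)"] by (simp only: OM_Suc_Suc)
lemma jn_O: "p \<in> carrier (BP n) \<Longrightarrow> q \<in> carrier (OM n) \<Longrightarrow> jn p q \<in> carrier (Qm n)" using B.jn_finsupp by (simp add: XQ_eq)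
lemma jn_Q: "p \<in> carrier (BP (Suc (Suc n))) \<Longrightarrow> q \<in> carrier (Qm n) \<Longrightarrow> jn p q \<in> carrier (Qm (Suc (Suc n)))" 
  using jn_O[of p "Suc (Suc n)"] by (simp only: OM_Suc_Suc)
lemma zB_finsupp [simp]: "zB \<in> finsupp B Y" by (rule B.finsupp_zero)
lemma jn_zero_Q: "p \<in> carrier (BP n) \<Longrightarrow> jn p zB \<in> carrier (Qm n)" by (rule jn_O) simp_all

lemma od_low: "x \<in> carrier (Qm n) \<Longrightarrow> n < 2 \<Longrightarrow> od x = zB"
  using od_O[of x n] B.finsuppD(3)[of "od x" "{}"] by (auto simp: XO_def)

lemma evQ_hom: "restrict ev (carrier (Qm n)) \<in> graded_hom B (Qm n) (BP n) 0"
  unfolding free_module_simps XQ_eq wQ_eq by (rule B.ev_hom)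

lemma odO_hom: "restrict od (carrier (Qm n)) \<in> graded_hom B (Qm n) (OM n) (- d)"
  unfolding free_module_simps XQ_eq wQ_eq by (rule B.od_hom)

lemma odQ_hom: "restrict od (carrier (Qm (Suc (Suc n)))) \<in> graded_hom B (Qm (Suc (Suc n))) (Qm n) (- d)"
  using odO_hom[of "Suc (Suc n)"] by (simp only: OM_Suc_Suc)

lemma jnO_hom:
  assumes "graded_mod B M" "f \<in> graded_hom B M (BP n) e" "h \<in> graded_hom B M (OM n) (e - d)"
  shows "(\<lambda>x\<in>carrier M. jn (f x) (h x)) \<in> graded_hom B M (Qm n) e"
  unfolding XQ_eq wQ_eq by (rule B.jn_hom[OF assms])

definition cone :: "nat \<Rightarrow> ((nat \<Rightarrow> 'b) \<Rightarrow> nat \<Rightarrow> 'b) \<Rightarrow> ((nat \<Rightarrow> 'b) \<Rightarrow> nat \<Rightarrow> 'b) \<Rightarrow> (nat \<Rightarrow> 'b) \<Rightarrow> nat \<Rightarrow> 'b" where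
  "cone n u E = (\<lambda>x\<in>carrier (Qm (Suc (Suc n))). jn (dbar (Suc n) (ev x) \<oplus>\<^bsub>BP (Suc n)\<^esub> u (od x)) (E (od x)))"

lemma cone_hom:
  assumes u: "u \<in> graded_hom B (Qm n) (BP (Suc n)) d" and E: "E \<in> graded_hom B (Qm n) (OM (Suc n)) 0"
  shows "cone n u E \<in> graded_hom B (Qm (Suc (Suc n))) (Qm (Suc n)) 0"
proof -
  let ?Q = "Qm (Suc (Suc n))"
  have 1: "(\<lambda>x\<in>carrier ?Q. dbar (Suc n) (restrict ev (carrier ?Q) x)) \<in> graded_hom B ?Q (BP (Suc n)) 0"
    by (rule ghom_comp0[OF Qm_mod evQ_hom dbar_hom])
  have 2: "(\<lambda>x\<in>carrier ?Q. u (restrict od (carrier ?Q) x)) \<in> graded_hom B ?Q (BP (Suc n)) 0"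
    using ghom_comp[OF Qm_mod odQ_hom u] by (simp del: free_module_simps)
  have 3: "(\<lambda>x\<in>carrier ?Q. E (restrict od (carrier ?Q) x)) \<in> graded_hom B ?Q (OM (Suc n)) (0 - d)"
    using ghom_comp[OF Qm_mod odQ_hom E] by (simp del: free_module_simps)
  note jnO_hom[OF Qm_mod ghom_plus[OF Qm_mod BP_mod 1 2] 3]
  then show ?thesis unfolding cone_def by (simp del: free_module_simps cong: restrict_cong)
qed

lemma cone_val: "x \<in> carrier (Qm (Suc (Suc n))) \<Longrightarrow>
    cone n u E x = jn (dbar (Suc n) (ev x) \<oplus>\<^bsub>BP (Suc n)\<^esub> u (od x)) (E (od x))"
  by (simp add: cone_def)

lemma homology_high_graded:
  assumes u: "u \<in> part (BP (Suc (Suc n))) j" "dbar (Suc n) u = \<zero>\<^bsub>BP (Suc n)\<^esub>"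
  shows "\<exists>y \<in> part (BP (Suc (Suc (Suc n)))) j. dbar (Suc (Suc n)) y = u"
proof -
  have "u \<in> carrier (BP (Suc (Suc n)))" using graded_mod.mpart_carrier[OF BP_mod u(1)] .
  then obtain y where y: "y \<in> carrier (BP (Suc (Suc (Suc n))))" "dbar (Suc (Suc n)) y = u"
    using homology_high u(2) by blast
  then show ?thesis 
    using B.homogeneous_preimage[OF BP_mod B.free_separated dbar_hom, of y "Suc (Suc n)" j] u(1) by simp
qed

text \<open>The data that determine the next step of the construction: \<open>u\<close> and \<open>v\<close> are \<open>s\<close> in degrees \<open>n\<close>
  and \<open>n + 1\<close>, \<open>D\<close> is the differential \<open>Q\<^sub>n\<^sub>+\<^sub>1 \<rightarrow> Q\<^sub>n\<close> and \<open>E\<close> the one leaving \<open>Q\<^sub>n\<close>, which is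
  the differential of the second summand two degrees higher.\<close>

definition cone_state :: "nat \<Rightarrow> ((nat \<Rightarrow> 'b) \<Rightarrow> nat \<Rightarrow> 'b) \<Rightarrow> ((nat \<Rightarrow> 'b) \<Rightarrow> nat \<Rightarrow> 'b) \<Rightarrow> ((nat \<Rightarrow> 'b) \<Rightarrow> nat \<Rightarrow> 'b) 
    \<Rightarrow> ((nat \<Rightarrow> 'b) \<Rightarrow> nat \<Rightarrow> 'b) \<Rightarrow> bool" where
  "cone_state n u v D E \<longleftrightarrow>
     u \<in> graded_hom B (Qm n) (BP (Suc n)) d \<and> v \<in> graded_hom B (Qm (Suc n)) (BP (Suc (Suc n))) d \<and>
     D \<in> graded_hom B (Qm (Suc n)) (Qm n) 0 \<and> E \<in> graded_hom B (Qm n) (OM (Suc n)) 0 \<and>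
     (\<forall>x \<in> carrier (Qm (Suc n)). dbar (Suc n) (v x) \<oplus>\<^bsub>BP (Suc n)\<^esub> u (D x) = \<zero>\<^bsub>BP (Suc n)\<^esub>) \<and>
     (\<forall>x \<in> carrier (Qm (Suc n)). E (D x) = zB) \<and>
     (\<forall>x \<in> carrier (Qm (Suc (Suc n))). D (cone n u E x) = zB)"

text \<open>The minimal homotopies start the recursion. So \<open>s\<close> is minimal in the two lowest degrees, which is
  what the comparison of \<open>E(B)\<close> with \<open>E(A)\<close> depends on.\<close>

lemma cone_state_0:
  "cone_state 0 (\<lambda>x\<in>carrier (Qm 0). sb0 (ev x)) (\<lambda>x\<in>carrier (Qm 1). sb1 (ev x))
     (\<lambda>x\<in>carrier (Qm 1). jn (dbar 0 (ev x)) zB) (\<lambda>x\<in>carrier (Qm 0). zB)" (is "cone_state 0 ?u ?v ?D ?E")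
proof -
  note [simp del] = free_module_simps XQ.simps wQ.simps
  have u: "?u \<in> graded_hom B (Qm 0) (BP (Suc 0)) d"
    using ghom_comp0[OF Qm_mod evQ_hom sb0_hom] by (simp cong: restrict_cong)
  have v: "?v \<in> graded_hom B (Qm (Suc 0)) (BP (Suc (Suc 0))) d"
    using ghom_comp0[OF Qm_mod evQ_hom sb1_hom] by (simp cong: restrict_cong add: numeral_2_eq_2)
  have ed: "(\<lambda>x\<in>carrier (Qm 1). dbar 0 (restrict ev (carrier (Qm 1)) x)) \<in> graded_hom B (Qm 1) (BP 0) 0"
    using ghom_comp0[OF Qm_mod evQ_hom dbar_hom, of 0] by simp
  have D: "?D \<in> graded_hom B (Qm (Suc 0)) (Qm 0) 0"
    using jnO_hom[OF Qm_mod ed ghom_null[OF Qm_mod OM_mod]] by (simp cong: restrict_cong add: free_module_simps(2))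
  have E: "?E \<in> graded_hom B (Qm 0) (OM (Suc 0)) 0"
    using ghom_null[OF Qm_mod[of 0] OM_mod[of "Suc 0"]] by (simp add: free_module_simps(2))
  have Dc: "?D x \<in> carrier (Qm 0)" if "x \<in> carrier (Qm (Suc 0))" for x using ghom_closed[OF D that] .
  have r1: "dbar (Suc 0) (?v x) \<oplus>\<^bsub>BP (Suc 0)\<^esub> ?u (?D x) = \<zero>\<^bsub>BP (Suc 0)\<^esub>" if x: "x \<in> carrier (Qm (Suc 0))" for x
    using dbar_sb1[OF ev_Q, of x] x Dc[OF x] by simp
  have r2: "?E (?D x) = zB" if x: "x \<in> carrier (Qm (Suc 0))" for x using Dc[OF x] by simp
  have r3: "?D (cone 0 ?u ?E x) = zB" if x: "x \<in> carrier (Qm (Suc (Suc 0)))" for x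
  proof -
    have c: "cone 0 ?u ?E x \<in> carrier (Qm (Suc 0))" using ghom_closed[OF cone_hom[OF u E] x] .
    note e = ev_Q[OF x] od_Q[OF x]
    have dd: "dbar 0 (dbar (Suc 0) (ev x) \<oplus>\<^bsub>BP (Suc 0)\<^esub> sb0 (ev (od x))) = \<zero>\<^bsub>BP 0\<^esub>"
    proof -
      have c: "dbar (Suc 0) (ev x) \<in> carrier (BP (Suc 0))" "sb0 (ev (od x)) \<in> carrier (BP (Suc 0))"
        using ghom_closed[OF dbar_hom e(1)] ghom_closed[OF sb0_hom ev_Q[OF e(2)]] by auto
      interpret B0: abelian_group "BP 0" by (rule BP_group)
      show ?thesis using ghom_add[OF dbar_hom c] dbar_dbar[OF e(1)] dbar_sb0[OF ev_Q[OF e(2)]] by simp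
    qed
    have "ev (cone 0 ?u ?E x) = dbar (Suc 0) (ev x) \<oplus>\<^bsub>BP (Suc 0)\<^esub> sb0 (ev (od x))"
      using e x by (simp add: cone_val)
    then have "?D (cone 0 ?u ?E x) = jn \<zero>\<^bsub>BP 0\<^esub> zB" using c dd by simp
    then show ?thesis by (auto simp: free_module_simps(2) jn_def)
  qed
  show ?thesis unfolding cone_state_def using u v D E r1 r2 r3 by blast
qed

text \<open>The composite of \<open>v\<close> with the differential consists of cycles of the reduced resolution, and these
  bound because its homology vanishes above degree 1; a lift of \<open>- v D\<close> is the next component of
  \<open>s\<close>.\<close>

lemma cone_state_Suc:
  assumes "cone_state n u v D E"
  shows "\<exists>v'. cone_state (Suc n) v v' (cone n u E) D"
proof -
  note [simp del] = free_module_simps XQ.simps wQ.simps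
  have u: "u \<in> graded_hom B (Qm n) (BP (Suc n)) d" and v: "v \<in> graded_hom B (Qm (Suc n)) (BP (Suc (Suc n))) d"
    and D: "D \<in> graded_hom B (Qm (Suc n)) (Qm n) 0" and E: "E \<in> graded_hom B (Qm n) (OM (Suc n)) 0"
    and r1: "\<And>x. x \<in> carrier (Qm (Suc n)) \<Longrightarrow> dbar (Suc n) (v x) \<oplus>\<^bsub>BP (Suc n)\<^esub> u (D x) = \<zero>\<^bsub>BP (Suc n)\<^esub>"
    and r2: "\<And>x. x \<in> carrier (Qm (Suc n)) \<Longrightarrow> E (D x) = zB"
    and r3: "\<And>x. x \<in> carrier (Qm (Suc (Suc n))) \<Longrightarrow> D (cone n u E x) = zB"
    using assms by (simp_all add: cone_state_def)
  interpret B1: abelian_group "BP (Suc n)" by (rule BP_group)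
  interpret B2: abelian_group "BP (Suc (Suc n))" by (rule BP_group)
  note D' = cone_hom[OF u E]
  have D2: "D \<in> graded_hom B (Qm (Suc n)) (OM (Suc (Suc n))) 0" using D by (simp only: OM_Suc_Suc)
  have uz: "u zB = \<zero>\<^bsub>BP (Suc n)\<^esub>" using ghom_zero[OF Qm_group BP_group u] by (simp add: free_module_simps(2))
  have f: "(\<lambda>x\<in>carrier (Qm (Suc (Suc n))). \<ominus>\<^bsub>BP (Suc (Suc n))\<^esub> (\<lambda>x\<in>carrier (Qm (Suc (Suc n))). v (cone n u E x)) x)
     \<in> graded_hom B (Qm (Suc (Suc n))) (BP (Suc (Suc n))) d" (is "?f \<in> _")
    by (rule B.ghom_uminus[OF Qm_mod BP_mod ghom_comp0[OF Qm_mod D' v]])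
  have "\<exists>y\<in>part (BP (Suc (Suc (Suc n)))) (j + d). dbar (Suc (Suc n)) y = ?f x"
    if x: "x \<in> part (Qm (Suc (Suc n))) j" for j x
  proof (rule homology_high_graded[OF ghom_part[OF f x]])
    have xc: "x \<in> carrier (Qm (Suc (Suc n)))" using graded_mod.mpart_carrier[OF Qm_mod x] .
    note c = ghom_closed[OF D' xc]
    note c2 = ghom_closed[OF v c]
    have "dbar (Suc n) (v (cone n u E x)) = \<zero>\<^bsub>BP (Suc n)\<^esub>"
      using r1[OF c] r3[OF xc] uz ghom_closed[OF dbar_hom c2] by simp
    then show "dbar (Suc n) (?f x) = \<zero>\<^bsub>BP (Suc n)\<^esub>"
      using ghom_minus[OF BP_group BP_group dbar_hom c2] xc B1.minus_equality[of "\<zero>\<^bsub>BP (Suc n)\<^esub>" "\<zero>\<^bsub>BP (Suc n)\<^esub>"] by simp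
  qed
  then obtain v' where v': "v' \<in> graded_hom B (Qm (Suc (Suc n))) (BP (Suc (Suc (Suc n)))) d"
    "\<And>x. x \<in> finsupp B (XQ (Suc (Suc n))) \<Longrightarrow> dbar (Suc (Suc n)) (v' x) = ?f x"
    using B.projective_lift[OF BP_mod BP_mod f dbar_hom] by blast
  have q1: "dbar (Suc (Suc n)) (v' x) \<oplus>\<^bsub>BP (Suc (Suc n))\<^esub> v (cone n u E x) = \<zero>\<^bsub>BP (Suc (Suc n))\<^esub>"
    if x: "x \<in> carrier (Qm (Suc (Suc n)))" for x
    using v'(2)[of x] x ghom_closed[OF v ghom_closed[OF D' x]] by (simp add: B2.l_neg free_module_simps(1))
  have q3: "cone n u E (cone (Suc n) v D x) = zB" if x: "x \<in> carrier (Qm (Suc (Suc (Suc n))))" for x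
  proof -
    note e = ev_Q[OF x] od_Q[OF x]
    have c: "cone (Suc n) v D x \<in> carrier (Qm (Suc (Suc n)))" using ghom_closed[OF cone_hom[OF v D2] x] .
    have c2: "dbar (Suc (Suc n)) (ev x) \<in> carrier (BP (Suc (Suc n)))" "v (od x) \<in> carrier (BP (Suc (Suc n)))"
      using ghom_closed[OF dbar_hom e(1)] ghom_closed[OF v e(2)] by auto
    have "cone n u E (cone (Suc n) v D x) = 
       jn (dbar (Suc n) (dbar (Suc (Suc n)) (ev x) \<oplus>\<^bsub>BP (Suc (Suc n))\<^esub> v (od x)) \<oplus>\<^bsub>BP (Suc n)\<^esub> u (D (od x))) (E (D (od x)))"
      using cone_val[OF c] cone_val[OF x] by simp
    also have "dbar (Suc n) (dbar (Suc (Suc n)) (ev x) \<oplus>\<^bsub>BP (Suc (Suc n))\<^esub> v (od x)) = dbar (Suc n) (v (od x))"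
      using ghom_add[OF dbar_hom c2] dbar_dbar[OF e(1)] ghom_closed[OF dbar_hom c2(2)] by simp
    also have "\<dots> \<oplus>\<^bsub>BP (Suc n)\<^esub> u (D (od x)) = \<zero>\<^bsub>BP (Suc n)\<^esub>" by (rule r1[OF e(2)])
    also have "E (D (od x)) = zB" by (rule r2[OF e(2)])
    finally show ?thesis by (auto simp: free_module_simps(2) jn_def)
  qed
  have "cone_state (Suc n) v v' (cone n u E) D"
    unfolding cone_state_def using v v'(1) D' D2 q1 r3 q3 by blast
  then show ?thesis by blast
qed

lemma cone_sequence_exists:
  "\<exists>f. \<forall>n. (case f n of (u, v, D, E) \<Rightarrow> cone_state n u v D E \<and> (n = 0 \<longrightarrow> 
        u = (\<lambda>x\<in>carrier (Qm 0). sb0 (ev x)) \<and> v = (\<lambda>x\<in>carrier (Qm 1). sb1 (ev x)) \<and>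
        D = (\<lambda>x\<in>carrier (Qm 1). jn (dbar 0 (ev x)) zB) \<and> E = (\<lambda>x\<in>carrier (Qm 0). zB))) \<and>
     (case f n of (u, v, D, E) \<Rightarrow> case f (Suc n) of (u', v', D', E') \<Rightarrow> u' = v \<and> D' = cone n u E \<and> E' = D)"
proof (rule dependent_nat_choice)
  show "\<exists>x. case x of (u, v, D, E) \<Rightarrow> cone_state 0 u v D E \<and> ((0::nat) = 0 \<longrightarrow>
        u = (\<lambda>x\<in>carrier (Qm 0). sb0 (ev x)) \<and> v = (\<lambda>x\<in>carrier (Qm 1). sb1 (ev x)) \<and>
        D = (\<lambda>x\<in>carrier (Qm 1). jn (dbar 0 (ev x)) zB) \<and> E = (\<lambda>x\<in>carrier (Qm 0). zB))"
    using cone_state_0 by (intro exI[of _ "(\<lambda>x\<in>carrier (Qm 0). sb0 (ev x), \<lambda>x\<in>carrier (Qm 1). sb1 (ev x),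
       \<lambda>x\<in>carrier (Qm 1). jn (dbar 0 (ev x)) zB, \<lambda>x\<in>carrier (Qm 0). zB)"]) simp
next
  fix x n
  assume st: "case x of (u, v, D, E) \<Rightarrow> cone_state n u v D E \<and> (n = 0 \<longrightarrow>
        u = (\<lambda>x\<in>carrier (Qm 0). sb0 (ev x)) \<and> v = (\<lambda>x\<in>carrier (Qm 1). sb1 (ev x)) \<and>
        D = (\<lambda>x\<in>carrier (Qm 1). jn (dbar 0 (ev x)) zB) \<and> E = (\<lambda>x\<in>carrier (Qm 0). zB))"
  obtain u v D E where x: "x = (u, v, D, E)" by (cases x) 
  then have "cone_state n u v D E" using st by simp
  then obtain v' where "cone_state (Suc n) v v' (cone n u E) D" using cone_state_Suc by blast
  then show "\<exists>y. (case y of (u, v, D, E) \<Rightarrow> cone_state (Suc n) u v D E \<and> (Suc n = 0 \<longrightarrow>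
        u = (\<lambda>x\<in>carrier (Qm 0). sb0 (ev x)) \<and> v = (\<lambda>x\<in>carrier (Qm 1). sb1 (ev x)) \<and>
        D = (\<lambda>x\<in>carrier (Qm 1). jn (dbar 0 (ev x)) zB) \<and> E = (\<lambda>x\<in>carrier (Qm 0). zB))) \<and>
     (case x of (u, v, D, E) \<Rightarrow> case y of (u', v', D', E') \<Rightarrow> u' = v \<and> D' = cone n u E \<and> E' = D)"
    unfolding x by (intro exI[of _ "(v, v', cone n u E, D)"]) simp
qed

definition "cone_seq = (SOME f. \<forall>n. (case f n of (u, v, D, E) \<Rightarrow> cone_state n u v D E \<and> (n = 0 \<longrightarrow> 
        u = (\<lambda>x\<in>carrier (Qm 0). sb0 (ev x)) \<and> v = (\<lambda>x\<in>carrier (Qm 1). sb1 (ev x)) \<and>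
        D = (\<lambda>x\<in>carrier (Qm 1). jn (dbar 0 (ev x)) zB) \<and> E = (\<lambda>x\<in>carrier (Qm 0). zB))) \<and>
     (case f n of (u, v, D, E) \<Rightarrow> case f (Suc n) of (u', v', D', E') \<Rightarrow> u' = v \<and> D' = cone n u E \<and> E' = D))"

definition "sQ n = fst (cone_seq n)"
definition "vQ n = fst (snd (cone_seq n))"
definition "dQ n = fst (snd (snd (cone_seq n)))"
definition "EQ n = snd (snd (snd (cone_seq n)))"

lemma cone_seq: "cone_state n (sQ n) (vQ n) (dQ n) (EQ n)"
  and cone_seq_0: "sQ 0 = (\<lambda>x\<in>carrier (Qm 0). sb0 (ev x))" "vQ 0 = (\<lambda>x\<in>carrier (Qm 1). sb1 (ev x))"
    "dQ 0 = (\<lambda>x\<in>carrier (Qm 1). jn (dbar 0 (ev x)) zB)" "EQ 0 = (\<lambda>x\<in>carrier (Qm 0). zB)"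
  and cone_seq_Suc: "sQ (Suc n) = vQ n" "dQ (Suc n) = cone n (sQ n) (EQ n)" "EQ (Suc n) = dQ n"
proof -
  note f = someI_ex[OF cone_sequence_exists, folded cone_seq_def, rule_format]
  show "cone_state n (sQ n) (vQ n) (dQ n) (EQ n)"
    using f[of n] by (simp add: sQ_def vQ_def dQ_def EQ_def case_prod_beta)
  show "sQ 0 = (\<lambda>x\<in>carrier (Qm 0). sb0 (ev x))" "vQ 0 = (\<lambda>x\<in>carrier (Qm 1). sb1 (ev x))"
    "dQ 0 = (\<lambda>x\<in>carrier (Qm 1). jn (dbar 0 (ev x)) zB)" "EQ 0 = (\<lambda>x\<in>carrier (Qm 0). zB)"
    using f[of 0] by (simp_all add: sQ_def vQ_def dQ_def EQ_def case_prod_beta)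
  show "sQ (Suc n) = vQ n" "dQ (Suc n) = cone n (sQ n) (EQ n)" "EQ (Suc n) = dQ n"
    using f[of n] by (simp_all add: sQ_def vQ_def dQ_def EQ_def case_prod_beta)
qed

lemma sQ_hom: "sQ n \<in> graded_hom B (Qm n) (BP (Suc n)) d"
  and dQ_hom: "dQ n \<in> graded_hom B (Qm (Suc n)) (Qm n) 0"
  and EQ_hom: "EQ n \<in> graded_hom B (Qm n) (OM (Suc n)) 0"
  and sQ_dQ: "x \<in> carrier (Qm (Suc n)) \<Longrightarrow> dbar (Suc n) (sQ (Suc n) x) \<oplus>\<^bsub>BP (Suc n)\<^esub> sQ n (dQ n x) = \<zero>\<^bsub>BP (Suc n)\<^esub>"
  and dQ_dQ: "x \<in> carrier (Qm (Suc (Suc n))) \<Longrightarrow> dQ n (dQ (Suc n) x) = zB"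
  using cone_seq[of n] unfolding cone_state_def cone_seq_Suc by blast+

lemma dQ_0: "x \<in> carrier (Qm (Suc 0)) \<Longrightarrow> dQ 0 x = jn (dbar 0 (ev x)) zB"
  by (simp add: cone_seq_0)

lemma dQ_Suc: "x \<in> carrier (Qm (Suc (Suc n))) \<Longrightarrow>
   dQ (Suc n) x = jn (dbar (Suc n) (ev x) \<oplus>\<^bsub>BP (Suc n)\<^esub> sQ n (od x)) (EQ n (od x))"
  unfolding cone_seq_Suc by (rule cone_val)

lemma od_dQ: "x \<in> carrier (Qm (Suc (Suc (Suc n)))) \<Longrightarrow> od (dQ (Suc (Suc n)) x) = dQ n (od x)"
  by (simp add: dQ_Suc cone_seq_Suc(3) del: free_module_simps)

lemma ev_dQ: "x \<in> carrier (Qm (Suc (Suc n))) \<Longrightarrow> ev (dQ (Suc n) x) = dbar (Suc n) (ev x) \<oplus>\<^bsub>BP (Suc n)\<^esub> sQ n (od x)"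
  by (simp add: dQ_Suc del: free_module_simps)

definition raugQ :: "(nat \<Rightarrow> 'b) \<Rightarrow> 'k" where
  "raugQ = (\<lambda>x\<in>carrier (Qm 0). epsbar (ev x))"

lemma raugQ_hom: "raugQ \<in> graded_hom B (Qm 0) B.triv 0"
  using ghom_comp0[OF Qm_mod evQ_hom epsbar_hom] by (simp add: raugQ_def del: free_module_simps cong: restrict_cong)

lemma raugQ_val: "x \<in> carrier (Qm 0) \<Longrightarrow> raugQ x = epsbar (ev x)" by (simp add: raugQ_def)

definition PQ :: "('k, 'b, nat \<Rightarrow> 'b) augmented_complex" where
  "PQ = \<lparr>rmod = Qm, rdiff = dQ, raug = raugQ\<rparr>"

text \<open>A cycle of the cone whose image under the projection is a boundary can be moved into the
  subcomplex, where it bounds.\<close>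

lemma cone_cycle:
  assumes x: "x \<in> carrier (Qm (Suc (Suc n)))" and z: "dQ (Suc n) x = zB" 
    and q: "q \<in> carrier (Qm (Suc n))" "od x = dQ n q"
  shows "x \<in> dQ (Suc (Suc n)) ` carrier (Qm (Suc (Suc (Suc n))))"
proof -
  note [simp del] = free_module_simps XQ.simps wQ.simps
  interpret B1: abelian_group "BP (Suc n)" by (rule BP_group)
  interpret B2: abelian_group "BP (Suc (Suc n))" by (rule BP_group)
  note e = ev_Q[OF x]
  note s = ghom_closed[OF sQ_hom q(1)]
  have sdq: "sQ n (dQ n q) \<in> carrier (BP (Suc n))" using ghom_closed[OF sQ_hom ghom_closed[OF dQ_hom q(1)]] .
  have "ev zB = zB" by (simp add: ev_def)
  then have "dbar (Suc n) (ev x) \<oplus>\<^bsub>BP (Suc n)\<^esub> sQ n (dQ n q) = \<zero>\<^bsub>BP (Suc n)\<^esub>"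
    using ev_dQ[OF x] z q(2) by (simp add: free_module_simps(2))
  then have "dbar (Suc n) (ev x) \<oplus>\<^bsub>BP (Suc n)\<^esub> sQ n (dQ n q) = dbar (Suc n) (sQ (Suc n) q) \<oplus>\<^bsub>BP (Suc n)\<^esub> sQ n (dQ n q)"
    using sQ_dQ[OF q(1)] by simp
  then have eq: "dbar (Suc n) (ev x) = dbar (Suc n) (sQ (Suc n) q)"
    using B1.add.right_cancel[OF sdq] ghom_closed[OF dbar_hom e] ghom_closed[OF dbar_hom s] by simp
  have "dbar (Suc n) (ev x \<ominus>\<^bsub>BP (Suc (Suc n))\<^esub> sQ (Suc n) q) = \<zero>\<^bsub>BP (Suc n)\<^esub>"
    using ghom_add[OF dbar_hom e B2.a_inv_closed[OF s]] ghom_minus[OF BP_group BP_group dbar_hom s] eq ghom_closed[OF dbar_hom s]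
    by (simp add: a_minus_def B1.r_neg)
  then obtain y where y: "y \<in> carrier (BP (Suc (Suc (Suc n))))" "dbar (Suc (Suc n)) y = ev x \<ominus>\<^bsub>BP (Suc (Suc n))\<^esub> sQ (Suc n) q"
    using homology_high[of "ev x \<ominus>\<^bsub>BP (Suc (Suc n))\<^esub> sQ (Suc n) q" n] e s B2.minus_closed by blast
  have c: "jn y q \<in> carrier (Qm (Suc (Suc (Suc n))))" by (rule jn_Q[OF y(1) q(1)])
  have "dQ (Suc (Suc n)) (jn y q) = jn (dbar (Suc (Suc n)) y \<oplus>\<^bsub>BP (Suc (Suc n))\<^esub> sQ (Suc n) q) (dQ n q)"
    using dQ_Suc[OF c] by (simp add: cone_seq_Suc(3))
  also have "dbar (Suc (Suc n)) y \<oplus>\<^bsub>BP (Suc (Suc n))\<^esub> sQ (Suc n) q = ev x"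
    unfolding y(2) using e s by (simp add: a_minus_def B2.a_assoc B2.l_neg)
  finally have "dQ (Suc (Suc n)) (jn y q) = x" using q(2) jn_ev_od[of x] by simp
  then show ?thesis using c by (metis imageI)
qed

lemma kernel_raugQ:
  assumes x: "x \<in> carrier (Qm 0)" "raugQ x = \<zero>\<^bsub>K\<^esub>"
  shows "x \<in> dQ 0 ` carrier (Qm (Suc 0))"
proof -
  obtain y where y: "y \<in> carrier (BP (Suc 0))" "dbar 0 y = ev x"
    using epsbar_kernel[OF ev_Q[OF x(1)]] x raugQ_val[OF x(1)] by auto
  have c: "jn y zB \<in> carrier (Qm (Suc 0))" using jn_zero_Q[OF y(1)] .
  have "dQ 0 (jn y zB) = jn (ev x) (od x)" using dQ_0[OF c] y(2) od_low[OF x(1)] by simp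
  then have "dQ 0 (jn y zB) = x" by simp
  then show ?thesis using c by (metis imageI)
qed

lemma kernel_dQ_0:
  assumes x: "x \<in> carrier (Qm (Suc 0))" "dQ 0 x = zB"
  shows "x \<in> dQ (Suc 0) ` carrier (Qm (Suc (Suc 0)))"
proof -
  note [simp del] = free_module_simps XQ.simps wQ.simps
  have "ev zB = zB" by (simp add: ev_def)
  then have "dbar 0 (ev x) = \<zero>\<^bsub>BP 0\<^esub>" 
    using arg_cong[of _ _ ev, OF trans[OF dQ_0[OF x(1), symmetric] x(2)]] by (simp add: free_module_simps(2))
  then obtain y z where yz: "y \<in> carrier (BP (Suc (Suc 0)))" "z \<in> carrier (BP 0)" "ev x = dbar 1 y \<oplus>\<^bsub>BP 1\<^esub> sb0 z"
    using homology_one[of "ev x"] ev_Q[OF x(1)] by (auto simp: numeral_2_eq_2)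
  have zc: "jn z zB \<in> carrier (Qm 0)" using jn_zero_Q[OF yz(2)] .
  have c: "jn y (jn z zB) \<in> carrier (Qm (Suc (Suc 0)))" using jn_Q[OF yz(1) zc] .
  have "dQ (Suc 0) (jn y (jn z zB)) = jn (ev x) zB"
    using dQ_Suc[OF c] yz(3) zc by (simp add: cone_seq_0)
  also have "\<dots> = x" using od_low[OF x(1)] using jn_ev_od[of x] by simp
  finally show ?thesis using c by (metis imageI)
qed

text \<open>The projection of a cycle to the second summand is a cycle two degrees lower, so the induction
  advances by 2.\<close>

lemma kernel_dQ:
  assumes "x \<in> carrier (Qm (Suc n))" "dQ n x = zB"
  shows "x \<in> dQ (Suc n) ` carrier (Qm (Suc (Suc n)))"
  using assms
proof (induction n arbitrary: x rule: induct_nat_012)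
  case 0
  then show ?case by (rule kernel_dQ_0)
next
  case 1
  note [simp del] = free_module_simps XQ.simps wQ.simps
  interpret B1: abelian_group "BP (Suc 0)" by (rule BP_group)
  note x = 1
  note e = ev_Q[OF x(1)] od_Q[OF x(1)]
  note e2 = ev_Q[OF e(2)]
  have "ev zB = zB" by (simp add: ev_def)
  then have "dbar (Suc 0) (ev x) \<oplus>\<^bsub>BP (Suc 0)\<^esub> sb0 (ev (od x)) = \<zero>\<^bsub>BP (Suc 0)\<^esub>"
    using ev_dQ[OF x(1)] x(2) e(2) by (simp add: free_module_simps(2) cone_seq_0)
  moreover have c: "dbar (Suc 0) (ev x) \<in> carrier (BP (Suc 0))" "sb0 (ev (od x)) \<in> carrier (BP (Suc 0))"
    using ghom_closed[OF dbar_hom e(1)] ghom_closed[OF sb0_hom e2] by auto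
  ultimately have "\<ominus>\<^bsub>BP (Suc 0)\<^esub> dbar (Suc 0) (ev x) = sb0 (ev (od x))"
    using B1.minus_equality[of "sb0 (ev (od x))" "dbar (Suc 0) (ev x)"] B1.a_comm by simp
  then have "sb0 (ev (od x)) = dbar 1 (\<ominus>\<^bsub>BP (Suc (Suc 0))\<^esub> ev x)"
    using ghom_minus[OF BP_group BP_group dbar_hom e(1)] by simp
  then have "epsbar (ev (od x)) = \<zero>\<^bsub>K\<^esub>"
    using homology_one_class[OF e2] abelian_group.a_inv_closed[OF BP_group e(1)] by (simp add: numeral_2_eq_2)
  then obtain q where "q \<in> carrier (Qm (Suc 0))" "od x = dQ 0 q"
    using kernel_raugQ[OF e(2)] raugQ_val[OF e(2)] by auto
  then show ?case using cone_cycle[OF x(1,2)] by blast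
next
  case (ge2 n)
  note x = ge2.prems
  have "od zB = zB" by (simp add: od_def)
  then have "dQ n (od x) = zB" using od_dQ[OF x(1)] x(2) by simp
  then obtain q where "q \<in> carrier (Qm (Suc (Suc n)))" "od x = dQ (Suc n) q"
    using ge2.IH(1)[OF od_Q[OF x(1)]] by blast
  then show ?case using cone_cycle[OF x] by blast
qed

lemma raugQ_dQ: "x \<in> carrier (Qm (Suc 0)) \<Longrightarrow> raugQ (dQ 0 x) = \<zero>\<^bsub>K\<^esub>"
  using raugQ_val[OF ghom_closed[OF dQ_hom]] dQ_0 epsbar_dbar[of "ev x"] ev_Q[of x "Suc 0"] by simp

lemma finite_XQ: "finite {i \<in> XQ n. wQ n i \<le> m}"
proof (induction n arbitrary: m rule: XQ.induct)
  have *: "finite {i \<in> sum_index (X n) Y. sum_weight (w n) w' d i \<le> m}"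
    if "finite {i \<in> Y. w' i \<le> m - d}" for n Y w' m
  proof (rule finite_subset)
    show "{i \<in> sum_index (X n) Y. sum_weight (w n) w' d i \<le> m} \<subseteq>
       (\<lambda>i. 2 * i) ` {i \<in> X n. w n i \<le> m} \<union> (\<lambda>i. 2 * i + 1) ` {i \<in> Y. w' i \<le> m - d}"
    proof
      fix j assume j: "j \<in> {i \<in> sum_index (X n) Y. sum_weight (w n) w' d i \<le> m}"
      show "j \<in> (\<lambda>i. 2 * i) ` {i \<in> X n. w n i \<le> m} \<union> (\<lambda>i. 2 * i + 1) ` {i \<in> Y. w' i \<le> m - d}"
        using j by (cases "even j") (auto simp: sum_index_def sum_weight_def elim!: evenE oddE)
    qed
  qed (use basis that in auto)
  { case 1 show ?case using *[of "{}" "\<lambda>_. 0"] by simp }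
  { case 2 show ?case using *[of "{}" "\<lambda>_. 0"] by simp }
  { case (3 n) then show ?case using *[of "XQ n" "wQ n"] by simp }
qed

theorem PQ_resolution: "free_resolution K B PQ"
  unfolding free_resolution_def PQ_def augmented_complex.simps
proof (intro conjI allI)
  fix n
  show "\<exists>X w. (\<forall>m. finite {i \<in> X. w i \<le> m}) \<and> Qm n = free_module B X w" using finite_XQ by blast
  show "raugQ \<in> graded_hom B (Qm 0) B.triv 0" by (rule raugQ_hom)
  show "dQ n \<in> graded_hom B (Qm (Suc n)) (Qm n) 0" by (rule dQ_hom)
  show "raugQ ` carrier (Qm 0) = carrier K"
  proof (intro equalityI subsetI)
    show "c \<in> carrier K" if "c \<in> raugQ ` carrier (Qm 0)" for c using that ghom_closed[OF raugQ_hom] by fastforce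
    fix c assume c: "c \<in> carrier K"
    then have "c \<in> raug P ` carrier (PM 0)" using R.res by (simp add: free_resolution_def)
    then obtain v where v: "v \<in> carrier (PM 0)" "raug P v = c" by (elim imageE) simp
    have j: "jn (red v) zB \<in> carrier (Qm 0)" using jn_zero_Q[OF red_closed[OF v(1)]] .
    then have "raugQ (jn (red v) zB) = c" using raugQ_val epsbar_red[OF v(1)] v(2) by simp
    then show "c \<in> raugQ ` carrier (Qm 0)" using j by (metis imageI)
  qed
  show "{x \<in> carrier (Qm 0). raugQ x = \<zero>\<^bsub>K\<^esub>} = dQ 0 ` carrier (Qm 1)"
    using kernel_raugQ raugQ_dQ ghom_closed[OF dQ_hom[of 0]] by auto
  show "{x \<in> carrier (Qm (Suc n)). dQ n x = \<zero>\<^bsub>Qm n\<^esub>} = dQ (Suc n) ` carrier (Qm (Suc (Suc n)))"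
    using kernel_dQ[of _ n] dQ_dQ[of _ n] ghom_closed[OF dQ_hom[of "Suc n"]] unfolding free_module_simps(2) by blast
qed

end

section \<open>Generation in degrees 1 and 2 descends to the hypersurface\<close>

context hypersurface
begin

lemma PQ_simps [simp]: "rmod PQ = Qm" "rdiff PQ = dQ" "raug PQ = raugQ"
  by (simp_all add: PQ_def)

sublocale Q: resolution K B PQ
  by unfold_locales (rule PQ_resolution)

definition iota :: "(nat \<Rightarrow> 'a) \<Rightarrow> nat \<Rightarrow> 'b" where
  "iota v = jn (red v) zB"

lemma inQ_hom: "(\<lambda>u\<in>carrier (BP n). jn u zB) \<in> graded_hom B (BP n) (Qm n) 0"
proof -
  have i: "(\<lambda>u\<in>carrier (BP n). u) \<in> graded_hom B (BP n) (BP n) 0"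
    by (rule ghomI[OF BP_mod]) auto
  have "(\<lambda>u\<in>carrier (BP n). jn ((\<lambda>u\<in>carrier (BP n). u) u) ((\<lambda>u\<in>carrier (BP n). \<zero>\<^bsub>OM n\<^esub>) u)) \<in> graded_hom B (BP n) (Qm n) 0"
    by (rule jnO_hom[OF BP_mod i ghom_null[OF BP_mod OM_mod]])
  then show ?thesis by (simp cong: restrict_cong)
qed

lemma iota_hom: "restrict iota (carrier (PM n)) \<in> graded_hom A (PM n) (rs (Qm n)) 0"
proof -
  have "(\<lambda>v\<in>carrier (PM n). (\<lambda>u\<in>carrier (BP n). jn u zB) (restrict red (carrier (PM n)) v)) \<in> graded_hom A (PM n) (rs (Qm n)) 0"
    by (rule ghom_comp0[OF R.P_mod redP_hom restrict_scalars_ghom[OF pi_hom inQ_hom]])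
  then show ?thesis using red_closed by (simp add: iota_def cong: restrict_cong)
qed

lemma iota_closed: "v \<in> carrier (PM n) \<Longrightarrow> iota v \<in> carrier (Qm n)"
  using jn_zero_Q[OF red_closed] by (simp add: iota_def)

lemma dQ_iota: "v \<in> carrier (PM (Suc n)) \<Longrightarrow> dQ n (iota v) = iota (rdiff P n v)"
proof (cases n)
  case 0
  assume v: "v \<in> carrier (PM (Suc n))"
  then show ?thesis using dQ_0[of "iota v"] iota_closed[OF v] dbar_red[of v 0] 0 by (simp add: iota_def)
next
  case (Suc k)
  assume v: "v \<in> carrier (PM (Suc n))"
  interpret Bk: abelian_group "BP (Suc k)" by (rule BP_group)
  have z: "sQ k zB = \<zero>\<^bsub>BP (Suc k)\<^esub>" "EQ k zB = zB"
    using ghom_zero[OF Qm_group BP_group sQ_hom, of k] ghom_zero[OF Qm_group OM_group EQ_hom, of k] by auto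
  have c: "iota v \<in> carrier (Qm (Suc (Suc k)))" "dbar (Suc k) (red v) \<in> carrier (BP (Suc k))"
    using iota_closed[OF v] ghom_closed[OF dbar_hom red_closed[OF v[unfolded Suc]]] Suc by auto
  have "dQ (Suc k) (iota v) = jn (dbar (Suc k) (red v) \<oplus>\<^bsub>BP (Suc k)\<^esub> \<zero>\<^bsub>BP (Suc k)\<^esub>) zB"
    using dQ_Suc[OF c(1)] z by (simp add: iota_def del: free_module_simps)
  also have "\<dots> = iota (rdiff P (Suc k) v)"
    using dbar_red[of v "Suc k"] v Suc Bk.r_zero[OF c(2)] by (simp add: iota_def del: free_module_simps)
  finally show ?thesis using Suc by simp
qed

lemma raugQ_iota: "v \<in> carrier (PM 0) \<Longrightarrow> raugQ (iota v) = raug P v"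
  using raugQ_val[OF iota_closed] epsbar_red by (simp add: iota_def)

text \<open>The resolution over \<open>B\<close>, viewed as an exact complex over \<open>A\<close>, receives the lifts that compare
  products over the two algebras.\<close>

lemma exact_over_A: "exact_augmented K A (\<lambda>n. rs (Qm n)) dQ raugQ"
proof (intro exact_augmented.intro[OF A.comm_graded_alg_axioms] exact_augmented_axioms.intro)
  note [simp del] = free_module_simps
  fix n y x j and c :: 'k
  show "graded_mod A (rs (Qm n))" by (rule rs_mod[OF Qm_mod])
  show "dQ n \<in> graded_hom A (rs (Qm (Suc n))) (rs (Qm n)) 0" by (rule restrict_scalars_ghom[OF pi_hom dQ_hom])
  show "raugQ \<in> graded_hom A (rs (Qm 0)) A.triv 0" 
    using restrict_scalars_ghom[OF pi_hom raugQ_hom] unfolding rs_triv .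
  show "c \<in> part A.triv j \<Longrightarrow> \<exists>y\<in>part (rs (Qm 0)) j. raugQ y = c" using Q.eps_onto[of c j] by simp
  show "x \<in> part (rs (Qm 0)) j \<Longrightarrow> raugQ x = \<zero>\<^bsub>K\<^esub> \<Longrightarrow> \<exists>y\<in>part (rs (Qm 1)) j. dQ 0 y = x"
    using Q.exact_0[of x j] by simp
  show "x \<in> part (rs (Qm (Suc n))) j \<Longrightarrow> dQ n x = \<zero>\<^bsub>rs (Qm n)\<^esub> \<Longrightarrow>
      \<exists>y\<in>part (rs (Qm (Suc (Suc n)))) j. dQ (Suc n) y = x"
    using Q.exact_Suc[of x n j] by simp
  show "y \<in> carrier (rs (Qm 1)) \<Longrightarrow> raugQ (dQ 0 y) = \<zero>\<^bsub>K\<^esub>" using Q.eps_dd[of y] by simp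
  show "y \<in> carrier (rs (Qm (Suc (Suc n)))) \<Longrightarrow> dQ n (dQ (Suc n) y) = \<zero>\<^bsub>rs (Qm n)\<^esub>" 
    using Q.dd_dd[of y n] by simp
qed

text \<open>Restriction of cochains along \<open>iota\<close> is the map \<open>E(B) \<rightarrow> E(A)\<close>.\<close>

definition pull :: "nat \<Rightarrow> ((nat \<Rightarrow> 'b) \<Rightarrow> 'k) \<Rightarrow> (nat \<Rightarrow> 'a) \<Rightarrow> 'k" where
  "pull n f = (\<lambda>v\<in>carrier (PM n). f (iota v))"

lemma pull_hom: "f \<in> graded_hom B (Qm n) B.triv e \<Longrightarrow> pull n f \<in> graded_hom A (PM n) A.triv e"
proof -
  assume f: "f \<in> graded_hom B (Qm n) B.triv e"
  have "(\<lambda>v\<in>carrier (PM n). f (restrict iota (carrier (PM n)) v)) \<in> graded_hom A (PM n) A.triv e"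
    using ghom_comp0[OF R.P_mod iota_hom restrict_scalars_ghom[OF pi_hom f]] unfolding rs_triv .
  then show ?thesis by (simp add: pull_def cong: restrict_cong)
qed

lemma Q_Z_iff: "f \<in> Q.Z n m \<longleftrightarrow> f \<in> graded_hom B (Qm n) B.triv (- m) \<and> (\<forall>x \<in> carrier (Qm (Suc n)). f (dQ n x) = \<zero>\<^bsub>K\<^esub>)"
  by (simp add: Q.Z_iff Q.Ch_simps)

lemma pull_Z: "f \<in> Q.Z n m \<Longrightarrow> pull n f \<in> R.Z n m"
proof -
  assume f: "f \<in> Q.Z n m"
  have "pull n f (rdiff P n v) = \<zero>\<^bsub>K\<^esub>" if v: "v \<in> carrier (PM (Suc n))" for v
  proof -
    have "f (iota (rdiff P n v)) = f (dQ n (iota v))" using dQ_iota[OF v] by simp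
    also have "\<dots> = \<zero>\<^bsub>K\<^esub>" using f iota_closed[OF v] by (simp add: Q_Z_iff)
    finally show ?thesis using rdiff_closed[OF v] by (simp add: pull_def)
  qed
  then show ?thesis using pull_hom f by (simp add: R.Z_iff R.Ch_simps Q_Z_iff)
qed

lemma pull_add: "pull n (f \<oplus>\<^bsub>Q.Ch n m\<^esub> h) = pull n f \<oplus>\<^bsub>R.Ch n m\<^esub> pull n h"
  using iota_closed by (auto simp: pull_def Q.Ch_simps R.Ch_simps fun_eq_iff)

lemma pull_smult: "pull n (c \<odot>\<^bsub>Q.Ch n m\<^esub> f) = c \<odot>\<^bsub>R.Ch n m\<^esub> pull n f"
  using iota_closed by (auto simp: pull_def Q.Ch_simps R.Ch_simps fun_eq_iff)

lemma pull_zero: "pull n \<zero>\<^bsub>Q.Ch n m\<^esub> = \<zero>\<^bsub>R.Ch n m\<^esub>"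
  using iota_closed by (auto simp: pull_def Q.Ch_simps R.Ch_simps fun_eq_iff)

lemma pull_raugQ: "pull 0 raugQ = raug P"
proof (rule extensionalityI[of _ "carrier (PM 0)"])
  show "raug P \<in> extensional (carrier (PM 0))" using R.raug_hom by (simp add: graded_hom_def PiE_def)
qed (simp_all add: pull_def raugQ_iota)

lemma extend_cochain:
  assumes f: "f \<in> graded_hom A (PM n) A.triv e"
  shows "\<exists>fb \<in> graded_hom B (BP n) B.triv e. (\<forall>v \<in> carrier (PM n). fb (red v) = f v) \<and>
     (\<lambda>x\<in>carrier (Qm n). fb (ev x)) \<in> graded_hom B (Qm n) B.triv e"
proof -
  obtain fb where fb: "fb \<in> graded_hom B (BP n) B.triv e" "\<forall>v \<in> finsupp A (X n). fb (red v) = f v"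
    using descend_triv[of f "X n" "w n" e] f by (auto simp: PM_free)
  have "(\<lambda>x\<in>carrier (Qm n). fb (restrict ev (carrier (Qm n)) x)) \<in> graded_hom B (Qm n) B.triv e"
    by (rule ghom_comp0[OF Qm_mod evQ_hom fb(1)])
  then show ?thesis using fb by (intro bexI[of _ fb]) (auto simp: PM_carrier cong: restrict_cong)
qed

text \<open>Surjectivity of \<open>E(B) \<rightarrow> E(A)\<close> in degrees 1 and 2: a cocycle on the resolution over \<open>A\<close>,
  extended by zero to the cone, is again a cocycle because the homotopies are minimal.\<close>

lemma extend_cocycle:
  assumes n: "n = 1 \<or> n = 2" and f: "f \<in> R.Z n m"
  shows "\<exists>F \<in> Q.Z n m. pull n F = f"
proof -
  obtain fb where fb: "fb \<in> graded_hom B (BP n) B.triv (- m)" "\<forall>v \<in> carrier (PM n). fb (red v) = f v"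
    and F: "(\<lambda>x\<in>carrier (Qm n). fb (ev x)) \<in> graded_hom B (Qm n) B.triv (- m)" (is "?F \<in> _")
    using extend_cochain[OF R.Z_hom[OF f]] by blast
  obtain k where k: "n = Suc k" "k = 0 \<or> k = Suc 0" using n by (cases n) auto
  have s: "fb (sQ k y) = \<zero>\<^bsub>K\<^esub>" if y: "y \<in> carrier (Qm k)" for y
    using k(2)
  proof
    assume "k = 0"
    then show ?thesis using sb0_min[of fb "- m" "ev y"] fb(1) k(1) ev_Q[OF y] y by (simp add: cone_seq_0 del: free_module_simps XQ.simps wQ.simps)
  next
    assume "k = Suc 0"
    then show ?thesis using sb1_min[of fb "- m" "ev y"] fb(1) k(1) ev_Q[OF y] y 
      by (simp add: cone_seq_Suc(1)[of 0] cone_seq_0 numeral_2_eq_2 del: free_module_simps XQ.simps wQ.simps)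
  qed
  have "?F (dQ n x) = \<zero>\<^bsub>K\<^esub>" if x: "x \<in> carrier (Qm (Suc n))" for x
  proof -
    have x': "x \<in> carrier (Qm (Suc (Suc k)))" using x k by simp
    obtain v where v: "v \<in> carrier (PM (Suc (Suc k)))" "red v = ev x" using lift_red[OF ev_Q[OF x']] by blast
    have c: "dbar (Suc k) (ev x) \<in> carrier (BP (Suc k))" "sQ k (od x) \<in> carrier (BP (Suc k))"
      using ghom_closed[OF dbar_hom ev_Q[OF x']] ghom_closed[OF sQ_hom od_Q[OF x']] .
    have fb': "fb \<in> graded_hom B (BP (Suc k)) B.triv (- m)" using fb(1) k by simp
    have "fb (dbar (Suc k) (ev x)) = f (rdiff P (Suc k) v)"
      using dbar_red[OF v(1)] v(2) fb(2) rdiff_closed[OF v(1)] k by simp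
    also have "\<dots> = \<zero>\<^bsub>K\<^esub>" using f v(1) k by (simp add: R.Z_iff)
    finally have "fb (ev (dQ (Suc k) x)) = \<zero>\<^bsub>K\<^esub>"
      using ev_dQ[OF x'] ghom_add[OF fb' c] s[OF od_Q[OF x']] by (simp del: free_module_simps)
    then show ?thesis using ghom_closed[OF dQ_hom x] k by (simp del: free_module_simps)
  qed
  then have "?F \<in> Q.Z n m" using F by (simp add: Q_Z_iff)
  moreover have "pull n ?F = f"
  proof (rule extensionalityI[of _ "carrier (PM n)"])
    show "f \<in> extensional (carrier (PM n))" using R.Z_hom[OF f] by (simp add: graded_hom_def PiE_def)
    show "pull n ?F v = f v" if "v \<in> carrier (PM n)" for v
      using iota_closed[OF that] fb(2) that by (simp add: pull_def iota_def)
  qed (simp add: pull_def)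
  ultimately show ?thesis by blast
qed

text \<open>The map \<open>E(B) \<rightarrow> E(A)\<close> is multiplicative: for lifts \<open>H\<close> over \<open>B\<close> and \<open>F\<close> over \<open>A\<close> of corresponding
  cocycles, the composites of \<open>H\<close> after \<open>iota\<close> and of \<open>iota\<close> after \<open>F\<close> are lifts over \<open>A\<close> of the same cocycle.\<close>

lemma pull_mult:
  assumes f: "f \<in> Q.Z p r" and h: "h \<in> Q.Z q s" and H: "lifts B PQ q s h H" and F: "lifts A P q s (pull q h) F"
  shows "R.cls (q + p) (r + s) (compose (carrier (PM (q + p))) (pull p f) (F p)) =
     R.cls (q + p) (r + s) (pull (q + p) (compose (carrier (Qm (q + p))) f (H p)))"
proof -
  note [simp del] = free_module_simps
  interpret D: exact_augmented K A "\<lambda>n. rs (Qm n)" dQ raugQ by (rule exact_over_A)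
  have Hi: "H i \<in> graded_hom B (Qm (q + i)) (Qm i) (- s)" and Fi: "F i \<in> graded_hom A (PM (q + i)) (PM i) (- s)" for i
    using H F by (simp_all add: lifts_def)
  define \<Delta> where "\<Delta> i = (\<lambda>v\<in>carrier (PM (q + i)). H i (iota v) \<ominus>\<^bsub>rs (Qm i)\<^esub> iota (F i v))" for i
  have Hc: "H i (iota v) \<in> carrier (Qm i)" "iota (F i v) \<in> carrier (Qm i)" if "v \<in> carrier (PM (q + i))" for i v
    using ghom_closed[OF Hi iota_closed[OF that]] iota_closed[OF ghom_closed[OF Fi that]] .
  have 1: "(\<lambda>v\<in>carrier (PM (q + i)). H i (restrict iota (carrier (PM (q + i))) v)) \<in> graded_hom A (PM (q + i)) (rs (Qm i)) (- s)" for i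
    by (rule ghom_comp0[OF R.P_mod iota_hom restrict_scalars_ghom[OF pi_hom Hi]])
  have 2: "(\<lambda>v\<in>carrier (PM (q + i)). restrict iota (carrier (PM i)) (F i v)) \<in> graded_hom A (PM (q + i)) (rs (Qm i)) (- s)" for i
    by (rule ghom_comp0'[OF R.P_mod Fi iota_hom])
  have \<Delta>: "\<Delta> i \<in> graded_hom A (PM (q + i)) (rs (Qm i)) (- s)" for i
    using A.ghom_diff[OF R.P_mod D.D_mod 1 2] ghom_closed[OF Fi] by (simp add: \<Delta>_def cong: restrict_cong)
  have gdiff: "k (\<Delta> i v) = k (H i (iota v)) \<ominus>\<^bsub>N\<^esub> k (iota (F i v))"
    if v: "v \<in> carrier (PM (q + i))" and k: "k \<in> graded_hom A (rs (Qm i)) N e" and N: "abelian_group N" for k i v e and N :: "('a, 'x) graded"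
  proof -
    interpret Di: abelian_group "rs (Qm i)" by (rule D.D_group)
    have c: "H i (iota v) \<in> carrier (rs (Qm i))" "iota (F i v) \<in> carrier (rs (Qm i))" using Hc[OF v] by simp_all
    have "k (H i (iota v) \<oplus>\<^bsub>rs (Qm i)\<^esub> \<ominus>\<^bsub>rs (Qm i)\<^esub> iota (F i v)) = k (H i (iota v)) \<oplus>\<^bsub>N\<^esub> \<ominus>\<^bsub>N\<^esub> k (iota (F i v))"
      using ghom_add[OF k c(1) Di.a_inv_closed[OF c(2)]] ghom_minus[OF D.D_group N k c(2)] by simp
    then show ?thesis using v by (simp add: \<Delta>_def a_minus_def)
  qed
  have chain: "dQ i (\<Delta> (Suc i) v) = \<Delta> i (rdiff P (q + i) v)" if v: "v \<in> carrier (PM (q + Suc i))" for i v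
  proof -
    have dv: "rdiff P (q + i) v \<in> carrier (PM (q + i))" using rdiff_closed[of v "q + i"] v by simp
    have "dQ i (\<Delta> (Suc i) v) = dQ i (H (Suc i) (iota v)) \<ominus>\<^bsub>rs (Qm i)\<^esub> dQ i (iota (F (Suc i) v))"
      by (rule gdiff[OF v D.dd_hom D.D_group])
    also have "dQ i (H (Suc i) (iota v)) = H i (dQ (q + i) (iota v))" using H iota_closed[OF v] by (simp add: lifts_def)
    also have "dQ (q + i) (iota v) = iota (rdiff P (q + i) v)" using dQ_iota[of v "q + i"] v by simp
    also have "dQ i (iota (F (Suc i) v)) = iota (rdiff P i (F (Suc i) v))" 
      using dQ_iota[of "F (Suc i) v" i] ghom_closed[OF Fi v] by simp
    also have "rdiff P i (F (Suc i) v) = F i (rdiff P (q + i) v)" using F v by (simp add: lifts_def)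
    finally show ?thesis using dv by (simp add: \<Delta>_def)
  qed
  have "raugQ (\<Delta> 0 v) = \<zero>\<^bsub>K\<^esub>" if v: "v \<in> carrier (PM q)" for v
  proof -
    have v0: "v \<in> carrier (PM (q + 0))" using v by simp
    have hv: "h (iota v) \<in> carrier K" using ghom_closed[OF conjunct1[OF h[unfolded Q_Z_iff]] iota_closed[OF v]] by simp
    have "raugQ (\<Delta> 0 v) = raugQ (H 0 (iota v)) \<ominus>\<^bsub>A.triv\<^esub> raugQ (iota (F 0 v))"
      by (rule gdiff[OF v0 D.eps_hom A.triv_group])
    also have "raugQ (H 0 (iota v)) = h (iota v)" using H iota_closed[OF v] by (simp add: lifts_def)
    also have "raugQ (iota (F 0 v)) = raug P (F 0 v)" using raugQ_iota ghom_closed[OF Fi v0] by simp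
    also have "raug P (F 0 v) = h (iota v)" using F v by (simp add: lifts_def pull_def)
    finally show ?thesis using hv by (simp add: a_minus_def A.K.r_neg)
  qed
  note aug0 = this
  have "is_coboundary K A (rmod P) (rdiff P) q (- s) (\<lambda>v. raugQ (\<Delta> 0 v))"
  proof -
    have "R.cob q s \<zero>\<^bsub>R.Ch q s\<^esub>" using R.cls_zero_iff[OF R.zero_Z] R.cls_zero by blast
    then show ?thesis by (rule R.cob_cong[THEN iffD1, rotated]) (use aug0 in \<open>simp add: R.Ch_simps\<close>)
  qed
  note cob0 = this
  have fh: "f \<in> graded_hom A (rs (Qm p)) A.triv (- r)"
    using restrict_scalars_ghom[OF pi_hom, of f "Qm p" B.triv "- r"] f unfolding rs_triv by (simp add: Q_Z_iff)
  have "is_coboundary K A (rmod P) (rdiff P) (q + p) (- s + - r) (\<lambda>v. f (\<Delta> p v))"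
  proof (rule D.lift_unique[OF R.free_complex, where \<Delta> = \<Delta> and q = q and f = f and p = p])
    show "\<Delta> i \<in> graded_hom A (rmod P (q + i)) (rs (Qm i)) (- s)" for i by (rule \<Delta>)
    show "dQ i (\<Delta> (Suc i) x) = \<Delta> i (rdiff P (q + i) x)" if "x \<in> carrier (rmod P (q + Suc i))" for i x
      using that by (rule chain)
    show "is_coboundary K A (rmod P) (rdiff P) q (- s) (\<lambda>x. raugQ (\<Delta> 0 x))" by (rule cob0)
    show "f \<in> graded_hom A (rs (Qm p)) A.triv (- r)" by (rule fh)
    show "f (dQ p y) = \<zero>\<^bsub>K\<^esub>" if "y \<in> carrier (rs (Qm (Suc p)))" for y
      using f that by (simp add: Q_Z_iff)
  qed
  then have cob: "R.cob (q + p) (r + s) (\<lambda>v. f (\<Delta> p v))" by (simp add: add.commute)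
  have L: "pull (q + p) (compose (carrier (Qm (q + p))) f (H p)) \<in> R.Z (q + p) (r + s)"
    using pull_Z[OF Q.lift_cocycle[OF f H]] by simp
  have Rr: "compose (carrier (PM (q + p))) (pull p f) (F p) \<in> R.Z (q + p) (r + s)"
    by (rule R.lift_cocycle[OF pull_Z[OF f] F])
  have "R.cob (q + p) (r + s) (\<lambda>v. pull (q + p) (compose (carrier (Qm (q + p))) f (H p)) v \<ominus>\<^bsub>K\<^esub> compose (carrier (PM (q + p))) (pull p f) (F p) v)"
  proof (rule R.cob_cong[THEN iffD1, OF _ cob])
    fix v assume v: "v \<in> carrier (PM (q + p))"
    have k: "f (H p (iota v)) \<in> carrier K" "f (iota (F p v)) \<in> carrier K"
      using ghom_closed[OF fh] Hc[OF v] by auto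
    have "f (\<Delta> p v) = f (H p (iota v)) \<ominus>\<^bsub>A.triv\<^esub> f (iota (F p v))" by (rule gdiff[OF v fh A.triv_group])
    then show "f (\<Delta> p v) = pull (q + p) (compose (carrier (Qm (q + p))) f (H p)) v \<ominus>\<^bsub>K\<^esub> compose (carrier (PM (q + p))) (pull p f) (F p) v"
      using v k iota_closed[OF v] ghom_closed[OF Fi v] by (simp add: pull_def compose_eq)
  qed
  then show ?thesis using R.cls_eq_iff[OF L Rr] by simp
qed

text \<open>If \<open>E(A)\<close> is generated in degrees 1 and 2, then its generators come from \<open>E(B)\<close>. So all of it is
  the image of the subalgebra generated there.\<close>

lemma G_pull_yoneda:
  assumes gen: "generated_subalgebra K R.Y (yoneda_component K A P 1 \<union> yoneda_component K A P 2) = carrier R.Y"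
    and f: "f \<in> R.Z n m"
  shows "\<exists>F \<in> Q.G n m. R.cls n m f = R.cls n m (pull n F)"
proof -
  define T where "T n m = {R.cls n m (pull n F) | F. F \<in> Q.G n m}" for n m
  have "R.homog n m f \<in> R.gen2" using R.homog_carrier[OF f] gen by simp
  then have "R.homog n m f n m \<in> T n m"
  proof (rule R.gen2_induct[rotated -1])
    show "T n m \<subseteq> carrier (R.Xt n m)" for n m
      using pull_Z Q.G_Z by (auto simp: T_def R.Xt_simps)
    show "R.Bd n m \<in> T n m" for n m
    proof -
      have "\<zero>\<^bsub>Q.Ch n m\<^esub> \<in> Q.G n m" using Q.G_Bd Q.cls_zero[of n m] Q.cls_self[OF Q.zero_Z, of n m] by simp
      moreover have "R.Bd n m = R.cls n m (pull n \<zero>\<^bsub>Q.Ch n m\<^esub>)" by (simp only: pull_zero R.cls_zero)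
      ultimately show ?thesis unfolding T_def by blast
    qed
    show "R.cls 0 0 (raug P) \<in> T 0 0"
    proof -
      have "raugQ \<in> Q.G 0 0" using Q.raug_G by simp
      moreover have "R.cls 0 0 (raug P) = R.cls 0 0 (pull 0 raugQ)" by (simp only: pull_raugQ)
      ultimately show ?thesis unfolding T_def by blast
    qed
    show "X <+>\<^bsub>R.Ch n m\<^esub> Y \<in> T n m" if XY: "X \<in> T n m" "Y \<in> T n m" for n m X Y
    proof -
      obtain F H where FH: "F \<in> Q.G n m" "X = R.cls n m (pull n F)" "H \<in> Q.G n m" "Y = R.cls n m (pull n H)" 
        using XY unfolding T_def by blast
      have "X <+>\<^bsub>R.Ch n m\<^esub> Y = R.cls n m (pull n (F \<oplus>\<^bsub>Q.Ch n m\<^esub> H))"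
        unfolding FH pull_add by (rule R.cls_add) (use FH pull_Z Q.G_Z in auto)
      then show ?thesis using Q.G_add[OF FH(1,3)] unfolding T_def by blast
    qed
    show "quot_smult (R.Ch n m) (R.Bd n m) c X \<in> T n m" if c: "c \<in> carrier K" and XY: "X \<in> T n m" for n m c X
    proof -
      obtain F where F: "F \<in> Q.G n m" "X = R.cls n m (pull n F)" using XY unfolding T_def by blast
      have "quot_smult (R.Ch n m) (R.Bd n m) c X = R.cls n m (pull n (c \<odot>\<^bsub>Q.Ch n m\<^esub> F))"
        unfolding F pull_smult by (rule R.cls_smult[OF c]) (use F pull_Z Q.G_Z in auto)
      then show ?thesis using Q.G_smult[OF c F(1)] unfolding T_def by blast
    qed
    show "carrier (R.Xt n m) \<subseteq> T n m" if n: "n = 1 \<or> n = 2" for n m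
    proof
      fix X assume "X \<in> carrier (R.Xt n m)"
      then obtain f where f: "f \<in> R.Z n m" "X = R.cls n m f" by (auto simp: R.Xt_simps)
      obtain F where "F \<in> Q.Z n m" "pull n F = f" using extend_cocycle[OF n f(1)] by blast
      then show "X \<in> T n m" using Q.G_low[OF n] f(2) unfolding T_def by blast
    qed
    show "R.yp p r q s X Y \<in> T (q + p) (r + s)" if XY: "X \<in> T p r" "Y \<in> T q s" for p r q s X Y
    proof -
      obtain F H where FH: "F \<in> Q.G p r" "X = R.cls p r (pull p F)" "H \<in> Q.G q s" "Y = R.cls q s (pull q H)" 
        using XY unfolding T_def by blast
      note Z = Q.G_Z[OF FH(1)] Q.G_Z[OF FH(3)]
      obtain L where L: "lifts B PQ q s H L" using Q.lifts_ex[OF Z(2)] by blast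
      obtain M where M: "lifts A P q s (pull q H) M" using R.lifts_ex[OF pull_Z[OF Z(2)]] by blast
      have "R.yp p r q s X Y = R.cls (q + p) (r + s) (pull (q + p) (compose (carrier (Qm (q + p))) F (L p)))"
        unfolding FH R.yoneda_product_cls[OF pull_Z[OF Z(1)] pull_Z[OF Z(2)] M] by (rule pull_mult[OF Z L M])
      moreover have "compose (carrier (Qm (q + p))) F (L p) \<in> Q.G (q + p) (r + s)"
        using Q.G_mult[OF FH(1,3) L] by simp
      ultimately show ?thesis unfolding T_def by blast
    qed
  qed
  then show ?thesis by (auto simp: R.homog_def T_def)
qed

subsection \<open>The periodicity operator\<close>

text \<open>The projection of the cone onto its second summand is a chain map of degree 2 and lifts the
  cocycle \<open>chi\<close>.\<close>

definition chi :: "(nat \<Rightarrow> 'b) \<Rightarrow> 'k" where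
  "chi = (\<lambda>x\<in>carrier (Qm 2). raugQ (od x))"

lemma chi_Z: "chi \<in> Q.Z 2 d"
proof -
  note [simp del] = free_module_simps
  have "(\<lambda>x\<in>carrier (Qm (Suc (Suc 0))). raugQ (restrict od (carrier (Qm (Suc (Suc 0)))) x)) \<in> graded_hom B (Qm (Suc (Suc 0))) B.triv (- d)"
    by (rule ghom_comp0'[OF Qm_mod odQ_hom raugQ_hom])
  then have h: "chi \<in> graded_hom B (Qm 2) B.triv (- d)"
    by (simp add: chi_def numeral_2_eq_2 del: XQ.simps wQ.simps cong: restrict_cong)
  have "chi (dQ 2 x) = \<zero>\<^bsub>K\<^esub>" if x: "x \<in> carrier (Qm (Suc 2))" for x
  proof -
    have x': "x \<in> carrier (Qm (Suc (Suc (Suc 0))))" using x by (simp only: numeral_2_eq_2)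
    have "chi (dQ 2 x) = raugQ (od (dQ 2 x))" using ghom_closed[OF dQ_hom x] by (simp add: chi_def)
    also have "od (dQ 2 x) = dQ 0 (od x)" using od_dQ[OF x'] by (simp only: numeral_2_eq_2)
    also have "raugQ (dQ 0 (od x)) = \<zero>\<^bsub>K\<^esub>" by (rule raugQ_dQ[OF od_Q[OF x']])
    finally show ?thesis .
  qed
  then show ?thesis using h by (simp add: Q_Z_iff)
qed

lemma od_lifts: "lifts B PQ 2 d chi (\<lambda>i. restrict od (carrier (Qm (2 + i))))"
  unfolding lifts_def PQ_simps
proof (intro conjI allI ballI)
  note [simp del] = free_module_simps XQ.simps wQ.simps
  fix i
  show "restrict od (carrier (Qm (2 + i))) \<in> graded_hom B (Qm (2 + i)) (Qm i) (- d)"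
    using odQ_hom[of i] by (simp add: numeral_2_eq_2)
  show "raugQ (restrict od (carrier (Qm (2 + 0))) x) = chi x" if "x \<in> carrier (Qm 2)" for x
    using that by (simp add: chi_def)
  show "dQ i (restrict od (carrier (Qm (2 + Suc i))) x) = restrict od (carrier (Qm (2 + i))) (dQ (2 + i) x)"
    if x: "x \<in> carrier (Qm (2 + Suc i))" for x
  proof -
    have x': "x \<in> carrier (Qm (Suc (Suc (Suc i))))" using x by (simp add: numeral_2_eq_2)
    have "dQ (2 + i) x \<in> carrier (Qm (2 + i))" using ghom_closed[OF dQ_hom, of x "2 + i"] x by simp
    then show ?thesis using x od_dQ[OF x'] by (simp add: numeral_2_eq_2)
  qed
qed

text \<open>The kernel of \<open>E(B) \<rightarrow> E(A)\<close> consists of multiples of the class of \<open>chi\<close>: a cocycle that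
  vanishes on the subcomplex factors through the projection.\<close>

lemma vanishing_cocycle:
  assumes f: "f \<in> Q.Z (Suc (Suc n)) m" and v: "\<And>u. u \<in> carrier (BP (Suc (Suc n))) \<Longrightarrow> f (jn u zB) = \<zero>\<^bsub>K\<^esub>"
  shows "\<exists>f' \<in> Q.Z n (m - d). f = compose (carrier (Qm (2 + n))) f' (restrict od (carrier (Qm (2 + n))))"
proof -
  note [simp del] = free_module_simps XQ.simps wQ.simps
  let ?n = "Suc (Suc n)"
  have fh: "f \<in> graded_hom B (Qm ?n) B.triv (- m)" using f by (simp add: Q_Z_iff)
  have z: "zB \<in> carrier (BP ?n)" "zB \<in> carrier (Qm n)" by (simp_all add: free_module_simps)
  have split: "jn u q = jn u zB \<oplus>\<^bsub>Qm ?n\<^esub> jn zB q" if "u \<in> carrier (BP ?n)" "q \<in> carrier (Qm n)" for u q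
  proof -
    have "u i \<in> carrier B" "q i \<in> carrier B" for i
      using that B.finsuppD(1)[of u "X ?n"] B.finsuppD(1)[of q "XQ n"] by (auto simp: free_module_simps)
    then show ?thesis by (auto simp: free_module_simps jn_def fun_eq_iff)
  qed
  have f_jn: "f (jn u q) = f (jn zB q)" if u: "u \<in> carrier (BP ?n)" and q: "q \<in> carrier (Qm n)" for u q
    using ghom_add[OF fh jn_Q[OF u z(2)] jn_Q[OF z(1) q]] split[OF u q] v[OF u] ghom_closed[OF fh jn_Q[OF z(1) q]] by simp
  define f' where "f' = (\<lambda>q\<in>carrier (Qm n). f (jn zB q))"
  have i: "(\<lambda>q\<in>carrier (Qm n). q) \<in> graded_hom B (Qm n) (OM ?n) (d - d)"
    unfolding OM_Suc_Suc by (rule ghomI[OF Qm_mod]) simp_all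
  have "(\<lambda>q\<in>carrier (Qm n). jn ((\<lambda>q\<in>carrier (Qm n). \<zero>\<^bsub>BP ?n\<^esub>) q) ((\<lambda>q\<in>carrier (Qm n). q) q)) \<in> graded_hom B (Qm n) (Qm ?n) d"
    by (rule jnO_hom[OF Qm_mod ghom_null[OF Qm_mod BP_mod] i])
  then have j: "(\<lambda>q\<in>carrier (Qm n). jn zB q) \<in> graded_hom B (Qm n) (Qm ?n) d"
    by (simp add: free_module_simps(2) cong: restrict_cong)
  have "(\<lambda>q\<in>carrier (Qm n). f ((\<lambda>q\<in>carrier (Qm n). jn zB q) q)) \<in> graded_hom B (Qm n) B.triv (d + - m)"
    by (rule ghom_comp[OF Qm_mod j fh])
  then have f'h: "f' \<in> graded_hom B (Qm n) B.triv (- (m - d))"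
    by (simp add: f'_def algebra_simps cong: restrict_cong)
  have "f' (dQ n x) = \<zero>\<^bsub>K\<^esub>" if x: "x \<in> carrier (Qm (Suc n))" for x
  proof -
    have dx: "dQ n x \<in> carrier (Qm n)" by (rule ghom_closed[OF dQ_hom x])
    have z': "zB \<in> carrier (BP (Suc ?n))" by (simp add: free_module_simps)
    have c: "jn zB x \<in> carrier (Qm (Suc ?n))" by (rule jn_Q[OF z' x])
    have dc: "dQ ?n (jn zB x) \<in> carrier (Qm ?n)" by (rule ghom_closed[OF dQ_hom c])
    have "f (jn (ev (dQ ?n (jn zB x))) (od (dQ ?n (jn zB x)))) = \<zero>\<^bsub>K\<^esub>"
      using f c by (simp add: Q_Z_iff)
    then have "f (jn zB (od (dQ ?n (jn zB x)))) = \<zero>\<^bsub>K\<^esub>" using f_jn[OF ev_Q[OF dc] od_Q[OF dc]] by simp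
    then show ?thesis using od_dQ[OF c] dx by (simp add: f'_def)
  qed
  then have "f' \<in> Q.Z n (m - d)" using f'h by (simp add: Q_Z_iff)
  moreover have "f = compose (carrier (Qm (2 + n))) f' (restrict od (carrier (Qm (2 + n))))"
  proof (rule extensionalityI[of _ "carrier (Qm ?n)"])
    show "f \<in> extensional (carrier (Qm ?n))" using fh by (simp add: graded_hom_def PiE_def)
    show "f x = compose (carrier (Qm (2 + n))) f' (restrict od (carrier (Qm (2 + n)))) x" if x: "x \<in> carrier (Qm ?n)" for x
      using f_jn[OF ev_Q[OF x] od_Q[OF x]] x od_Q[OF x] by (simp add: compose_eq f'_def numeral_2_eq_2)
  qed (simp add: compose_def numeral_2_eq_2)
  ultimately show ?thesis by blast
qed

text \<open>After subtraction of a generated cocycle and of a coboundary, a cocycle vanishes on the subcomplex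
  and is a multiple of \<open>chi\<close>, which has degree 2. The other factor has smaller degree.\<close>

theorem generated:
  assumes gen: "generated_subalgebra K R.Y (yoneda_component K A P 1 \<union> yoneda_component K A P 2) = carrier R.Y"
  shows "generated_subalgebra K Q.Y (yoneda_component K B PQ 1 \<union> yoneda_component K B PQ 2) = carrier Q.Y"
proof (rule Q.generatedI)
  note [simp del] = free_module_simps XQ.simps wQ.simps
  fix n m
  show "Q.Z n m \<subseteq> Q.G n m"
  proof (induction n arbitrary: m rule: induct_nat_012)
    case 0
    then show ?case using Q.G_0 by blast
  next
    case 1
    then show ?case using Q.G_low[of 1] by auto
  next
    case (ge2 n)
    show ?case
    proof
      let ?n = "Suc (Suc n)"
      fix f assume f: "f \<in> Q.Z ?n m"
      obtain F where F: "F \<in> Q.G ?n m" "R.cls ?n m (pull ?n f) = R.cls ?n m (pull ?n F)"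
        using G_pull_yoneda[OF gen pull_Z[OF f]] by blast
      note FZ = Q.G_Z[OF F(1)]
      have "R.cob ?n m (\<lambda>v. pull ?n f v \<ominus>\<^bsub>K\<^esub> pull ?n F v)"
        using R.cls_eq_iff[OF pull_Z[OF f] pull_Z[OF FZ]] F(2) by simp
      then obtain k where k: "k \<in> graded_hom A (PM (Suc n)) A.triv (- m)"
        "\<And>v. v \<in> carrier (PM ?n) \<Longrightarrow> pull ?n f v \<ominus>\<^bsub>K\<^esub> pull ?n F v = k (rdiff P (Suc n) v)"
        by (auto simp: is_coboundary_def)
      obtain kb where kb: "kb \<in> graded_hom B (BP (Suc n)) B.triv (- m)" 
        "\<And>v. v \<in> carrier (PM (Suc n)) \<Longrightarrow> kb (red v) = k v"
        and kQ: "(\<lambda>x\<in>carrier (Qm (Suc n)). kb (ev x)) \<in> graded_hom B (Qm (Suc n)) B.triv (- m)" (is "?k \<in> _")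
        using extend_cochain[OF k(1)] by blast
      define b where "b = (\<lambda>x\<in>carrier (Qm ?n). ?k (dQ (Suc n) x))"
      have bh: "b \<in> graded_hom B (Qm ?n) B.triv (- m)" unfolding b_def by (rule ghom_comp0[OF Qm_mod dQ_hom kQ])
      have bB: "b \<in> Q.Bd ?n m" unfolding Q.Bd_iff
        using bh kQ by (auto simp: Q.Ch_simps is_coboundary_def b_def intro!: bexI[of _ ?k])
      interpret C: abelian_group "Q.Ch ?n m" by (rule Q.Ch_group)
      note bZ = Q.Bd_Z[OF bB]
      have cc: "f \<in> carrier (Q.Ch ?n m)" "F \<in> carrier (Q.Ch ?n m)" "b \<in> carrier (Q.Ch ?n m)"
        using Q.Z_Ch f FZ bZ by auto
      have mone: "\<ominus>\<^bsub>K\<^esub> \<one>\<^bsub>K\<^esub> \<in> carrier K" by simp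
      have Fb: "F \<oplus>\<^bsub>Q.Ch ?n m\<^esub> b \<in> Q.G ?n m" by (rule Q.G_add[OF F(1) Q.G_Bd[OF bB]])
      define f1 where "f1 = f \<oplus>\<^bsub>Q.Ch ?n m\<^esub> ((\<ominus>\<^bsub>K\<^esub> \<one>\<^bsub>K\<^esub>) \<odot>\<^bsub>Q.Ch ?n m\<^esub> (F \<oplus>\<^bsub>Q.Ch ?n m\<^esub> b))"
      have f1Z: "f1 \<in> Q.Z ?n m" unfolding f1_def by (rule Q.Z_add[OF f Q.Z_smult[OF mone Q.G_Z[OF Fb]]])
      have val: "f x \<in> carrier K" "F x \<in> carrier K" "b x \<in> carrier K" if "x \<in> carrier (Qm ?n)" for x
        using Q.Ch_val[OF cc(1)] Q.Ch_val[OF cc(2)] Q.Ch_val[OF cc(3)] that by auto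
      have f1_val: "f1 x = f x \<ominus>\<^bsub>K\<^esub> (F x \<oplus>\<^bsub>K\<^esub> b x)" if "x \<in> carrier (Qm ?n)" for x
        using that val[OF that] by (simp add: f1_def Q.Ch_simps A.K.l_minus a_minus_def)
      \<comment> \<open>The coboundary \<open>b\<close> extends the one by which \<open>f\<close> and \<open>F\<close> differ on the subcomplex.\<close>
      have "f1 (jn u zB) = \<zero>\<^bsub>K\<^esub>" if u: "u \<in> carrier (BP ?n)" for u
      proof -
        obtain v where v: "v \<in> carrier (PM ?n)" "red v = u" using lift_red[OF u] by blast
        have i: "jn u zB = iota v" using v(2) by (simp add: iota_def)
        have dv: "rdiff P (Suc n) v \<in> carrier (PM (Suc n))" by (rule rdiff_closed[OF v(1)])
        note ic = iota_closed[OF v(1)]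
        have "b (iota v) = kb (ev (iota (rdiff P (Suc n) v)))"
          using ic dQ_iota[OF v(1)] iota_closed[OF dv] by (simp add: b_def)
        also have "\<dots> = pull ?n f v \<ominus>\<^bsub>K\<^esub> pull ?n F v" using kb(2)[OF dv] k(2)[OF v(1)] by (simp add: iota_def)
        finally have bv: "b (iota v) = f (iota v) \<ominus>\<^bsub>K\<^esub> F (iota v)" using v(1) by (simp add: pull_def)
        have "F (iota v) \<oplus>\<^bsub>K\<^esub> b (iota v) = f (iota v)" 
          unfolding bv using val[OF ic] A.K.a_lcomm[of "F (iota v)" "f (iota v)" "\<ominus>\<^bsub>K\<^esub> F (iota v)"]
          by (simp add: a_minus_def A.K.r_neg)
        then show ?thesis unfolding i using f1_val[OF ic] val[OF ic] by (simp add: a_minus_def A.K.r_neg)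
      qed
      then obtain f' where f': "f' \<in> Q.Z n (m - d)" 
        "f1 = compose (carrier (Qm (2 + n))) f' (restrict od (carrier (Qm (2 + n))))"
        using vanishing_cocycle[OF f1Z] by blast
      have "f' \<in> Q.G n (m - d)" using ge2.IH(1) f'(1) by blast
      from Q.G_mult[OF this Q.G_low[OF disjI2[OF refl] chi_Z] od_lifts]
      have f1G: "f1 \<in> Q.G ?n m" using f'(2) by (simp add: numeral_2_eq_2)
      have "f1 \<oplus>\<^bsub>Q.Ch ?n m\<^esub> (F \<oplus>\<^bsub>Q.Ch ?n m\<^esub> b) = f"
      proof (rule Q.Ch_ext[OF _ cc(1)])
        show "f1 \<oplus>\<^bsub>Q.Ch ?n m\<^esub> (F \<oplus>\<^bsub>Q.Ch ?n m\<^esub> b) \<in> carrier (Q.Ch ?n m)"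
          using Q.Z_Ch[OF f1Z] cc by simp
        fix x assume "x \<in> carrier (rmod PQ ?n)"
        then have x: "x \<in> carrier (Qm ?n)" by simp
        then show "(f1 \<oplus>\<^bsub>Q.Ch ?n m\<^esub> (F \<oplus>\<^bsub>Q.Ch ?n m\<^esub> b)) x = f x"
          using f1_val[OF x] val[OF x] by (simp add: Q.Ch_simps a_minus_def A.K.a_assoc A.K.l_neg)
      qed
      then show "f \<in> Q.G ?n m" using Q.G_add[OF f1G Fb] by simp
    qed
  qed
qed

end

section \<open>Graded monoid algebras\<close>

text \<open>Tensor algebras and polynomial algebras are monoid algebras of graded monoids \<open>W\<close>, of words and of
  monomials. The set \<open>I w\<close> indexes the factorizations of \<open>w\<close>, the factors being \<open>l w i\<close> and
  \<open>r w i\<close>.\<close>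

locale monoid_algebra = field K for K :: "('k, 'z) ring_scheme" (structure) +
  fixes M :: "('k, 'w \<Rightarrow> 'k) graded" and mul :: "'w \<Rightarrow> 'w \<Rightarrow> 'w" and e :: 'w and W :: "'w set"
    and len :: "'w \<Rightarrow> nat" and I :: "'w \<Rightarrow> 'i set" and l r :: "'w \<Rightarrow> 'i \<Rightarrow> 'w"
  assumes M_simps: "carrier M = finsupp K W" "one M = (\<lambda>w. if w = e then \<one>\<^bsub>K\<^esub> else \<zero>\<^bsub>K\<^esub>)"
      "zero M = (\<lambda>w. \<zero>\<^bsub>K\<^esub>)" "add M = (\<lambda>f g w. f w \<oplus>\<^bsub>K\<^esub> g w)" "smult M = (\<lambda>c f w. c \<otimes>\<^bsub>K\<^esub> f w)"
      "part M = (\<lambda>m. finsupp K {w \<in> W. int (len w) = m})"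
    and M_mult: "monoid.mult M = (\<lambda>f g w. \<Oplus>\<^bsub>K\<^esub>i \<in> I w. f (l w i) \<otimes>\<^bsub>K\<^esub> g (r w i))"
    and mul_assoc: "mul (mul u v) w = mul u (mul v w)" and mul_e: "mul e u = u" "mul u e = u"
    and W_mul: "u \<in> W \<Longrightarrow> v \<in> W \<Longrightarrow> mul u v \<in> W" and W_e: "e \<in> W"
    and len_mul: "len (mul u v) = len u + len v" and len_0: "len u = 0 \<longleftrightarrow> u = e"
    and finite_I: "finite (I w)" and lr: "i \<in> I w \<Longrightarrow> mul (l w i) (r w i) = w"
    and lr_ex1: "mul u v = w \<Longrightarrow> \<exists>!i. i \<in> I w \<and> l w i = u \<and> r w i = v"
begin

lemma mult_single:
  assumes c: "c \<in> carrier K" "d \<in> carrier K"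
  shows "single K u c \<otimes>\<^bsub>M\<^esub> single K v d = single K (mul u v) (c \<otimes> d)"
proof
  fix w
  show "(single K u c \<otimes>\<^bsub>M\<^esub> single K v d) w = single K (mul u v) (c \<otimes> d) w"
  proof (cases "w = mul u v")
    case True
    obtain i where *: "i \<in> I w \<and> l w i = u \<and> r w i = v" "\<forall>j. j \<in> I w \<and> l w j = u \<and> r w j = v \<longrightarrow> j = i"
      using lr_ex1[OF True[symmetric]] by (elim ex1E) (rule that)
    have i: "i \<in> I w" "l w i = u" "r w i = v" using *(1) by blast+
    have uniq: "j = i" if "j \<in> I w" "l w j = u" "r w j = v" for j using *(2) that by blast
    have "single K u c (l w j) \<otimes> single K v d (r w j) = (if i = j then c \<otimes> d else \<zero>)" if "j \<in> I w" for j
    proof (cases "l w j = u \<and> r w j = v")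
      case True
      then have "i = j" using uniq[OF that] by blast
      then show ?thesis using True by (simp add: single_def)
    next
      case False
      then have "i \<noteq> j" using i by blast
      then show ?thesis using False c by (auto simp: single_def)
    qed
    then have "(single K u c \<otimes>\<^bsub>M\<^esub> single K v d) w = (\<Oplus>j \<in> I w. if i = j then c \<otimes> d else \<zero>)"
      unfolding M_mult by (intro finsum_cong') (use c in auto)
    also have "\<dots> = c \<otimes> d" using finsum_singleton[OF i(1) finite_I, of "\<lambda>_. c \<otimes> d"] c by simp
    finally show ?thesis using True by (simp add: single_def)
  next
    case False
    then have "(single K u c \<otimes>\<^bsub>M\<^esub> single K v d) w = (\<Oplus>j \<in> I w. \<zero>)"
      unfolding M_mult by (intro finsum_cong') (use c lr in \<open>auto simp: single_def\<close>)
    then show ?thesis using False by (simp add: single_def)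
  qed
qed

lemma mult_add_left:
  assumes f: "f \<in> finsupp K W" "f' \<in> finsupp K W" "g \<in> finsupp K W"
  shows "(\<lambda>w. f w \<oplus> f' w) \<otimes>\<^bsub>M\<^esub> g = (\<lambda>w. (f \<otimes>\<^bsub>M\<^esub> g) w \<oplus> (f' \<otimes>\<^bsub>M\<^esub> g) w)"
proof
  fix w
  note cl = f[THEN finsuppD(1)]
  have "(\<Oplus>i \<in> I w. (f (l w i) \<oplus> f' (l w i)) \<otimes> g (r w i)) = (\<Oplus>i \<in> I w. f (l w i) \<otimes> g (r w i) \<oplus> f' (l w i) \<otimes> g (r w i))"
    by (rule finsum_cong') (use cl in \<open>auto simp: l_distr\<close>)
  also have "\<dots> = (\<Oplus>i \<in> I w. f (l w i) \<otimes> g (r w i)) \<oplus> (\<Oplus>i \<in> I w. f' (l w i) \<otimes> g (r w i))"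
    by (rule finsum_addf) (use cl in auto)
  finally show "((\<lambda>w. f w \<oplus> f' w) \<otimes>\<^bsub>M\<^esub> g) w = (f \<otimes>\<^bsub>M\<^esub> g) w \<oplus> (f' \<otimes>\<^bsub>M\<^esub> g) w" by (simp add: M_mult)
qed

lemma mult_add_right:
  assumes f: "g \<in> finsupp K W" "f \<in> finsupp K W" "f' \<in> finsupp K W"
  shows "g \<otimes>\<^bsub>M\<^esub> (\<lambda>w. f w \<oplus> f' w) = (\<lambda>w. (g \<otimes>\<^bsub>M\<^esub> f) w \<oplus> (g \<otimes>\<^bsub>M\<^esub> f') w)"
proof
  fix w
  note cl = f[THEN finsuppD(1)]
  have "(\<Oplus>i \<in> I w. g (l w i) \<otimes> (f (r w i) \<oplus> f' (r w i))) = (\<Oplus>i \<in> I w. g (l w i) \<otimes> f (r w i) \<oplus> g (l w i) \<otimes> f' (r w i))"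
    by (rule finsum_cong') (use cl in \<open>auto simp: r_distr\<close>)
  also have "\<dots> = (\<Oplus>i \<in> I w. g (l w i) \<otimes> f (r w i)) \<oplus> (\<Oplus>i \<in> I w. g (l w i) \<otimes> f' (r w i))"
    by (rule finsum_addf) (use cl in auto)
  finally show "(g \<otimes>\<^bsub>M\<^esub> (\<lambda>w. f w \<oplus> f' w)) w = (g \<otimes>\<^bsub>M\<^esub> f) w \<oplus> (g \<otimes>\<^bsub>M\<^esub> f') w" by (simp add: M_mult)
qed

lemma mult_zero_left: "g \<in> finsupp K W \<Longrightarrow> (\<lambda>w. \<zero>) \<otimes>\<^bsub>M\<^esub> g = (\<lambda>w. \<zero>)"
  and mult_zero_right: "g \<in> finsupp K W \<Longrightarrow> g \<otimes>\<^bsub>M\<^esub> (\<lambda>w. \<zero>) = (\<lambda>w. \<zero>)"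
  using finsuppD(1)[of g W] by (simp_all add: M_mult)

lemma bilinear_induct:
  assumes f: "f \<in> finsupp K W" and g: "g \<in> finsupp K W" and "Q (\<lambda>w. \<zero>)"
    and "\<And>u v. Q u \<Longrightarrow> Q v \<Longrightarrow> Q (\<lambda>w. u w \<oplus> v w)"
    and sg: "\<And>u v c d. u \<in> W \<Longrightarrow> v \<in> W \<Longrightarrow> c \<in> carrier K \<Longrightarrow> d \<in> carrier K \<Longrightarrow> Q (single K (mul u v) (c \<otimes> d))"
  shows "Q (f \<otimes>\<^bsub>M\<^esub> g)"
  using f
proof (induction f rule: finsupp_induct)
  case zero
  then show ?case using assms(3) mult_zero_left[OF g] by simp
next
  case (add f f')
  then show ?case using assms(4) mult_add_left[OF add(1,2) g] by simp
next
  case (single u c)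
  show ?case using g
  proof (induction g rule: finsupp_induct)
    case zero
    then show ?case using assms(3) mult_zero_right[OF finsupp_single[OF single(2,1)]] by simp
  next
    case (add h h')
    then show ?case using assms(4) mult_add_right[OF finsupp_single[OF single(2,1)] add(1,2)] by simp
  next
    case (single v d)
    then show ?case using sg \<open>u \<in> W\<close> \<open>c \<in> carrier K\<close> by (simp add: mult_single)
  qed
qed

lemma mult_closed: "f \<in> finsupp K W \<Longrightarrow> g \<in> finsupp K W \<Longrightarrow> f \<otimes>\<^bsub>M\<^esub> g \<in> finsupp K W"
  by (rule bilinear_induct) (auto intro: finsupp_zero finsupp_add finsupp_single W_mul)

lemma M_assoc:
  assumes f: "f \<in> finsupp K W" and g: "g \<in> finsupp K W" and h: "h \<in> finsupp K W"
  shows "(f \<otimes>\<^bsub>M\<^esub> g) \<otimes>\<^bsub>M\<^esub> h = f \<otimes>\<^bsub>M\<^esub> (g \<otimes>\<^bsub>M\<^esub> h)"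
  using f
proof (induction f rule: finsupp_induct)
  case zero
  then show ?case using g h by (simp add: mult_zero_left mult_closed)
next
  case (add f f')
  then show ?case using g h by (simp add: mult_add_left mult_closed)
next
  case (single u c)
  note u = finsupp_single[OF single(2,1)]
  show ?case using g
  proof (induction g rule: finsupp_induct)
    case zero
    then show ?case using u h by (simp add: mult_zero_left mult_zero_right)
  next
    case (add g g')
    then show ?case using u h by (simp add: mult_add_left mult_add_right mult_closed)
  next
    case (single v d)
    note v = finsupp_single[OF single(2,1)]
    show ?case using h
    proof (induction h rule: finsupp_induct)
      case zero
      then show ?case using u v by (simp add: mult_zero_right mult_closed)
    next
      case (add g g')
      then show ?case using u v by (simp add: mult_add_right mult_closed)
    next
      case (single w a)
      then show ?case using \<open>c \<in> carrier K\<close> \<open>d \<in> carrier K\<close> by (simp add: mult_single mul_assoc m_assoc)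
    qed
  qed
qed

lemma one_single: "one M = single K e \<one>"
  by (auto simp: M_simps single_def)

lemma mult_one_left: "f \<in> finsupp K W \<Longrightarrow> one M \<otimes>\<^bsub>M\<^esub> f = f"
  unfolding one_single
proof (induction f rule: finsupp_induct)
  case zero
  then show ?case by (simp add: mult_zero_right finsupp_single W_e)
next
  case (add f f')
  then show ?case by (simp add: mult_add_right finsupp_single W_e)
qed (simp add: mult_single mul_e)

lemma mult_one_right: "f \<in> finsupp K W \<Longrightarrow> f \<otimes>\<^bsub>M\<^esub> one M = f"
  unfolding one_single
proof (induction f rule: finsupp_induct)
  case zero
  then show ?case by (simp add: mult_zero_left finsupp_single W_e)
next
  case (add f f')
  then show ?case by (simp add: mult_add_left finsupp_single W_e)
qed (simp add: mult_single mul_e)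

lemma finsupp_const_mult: "a \<in> carrier K \<Longrightarrow> v \<in> finsupp K X \<Longrightarrow> (\<lambda>i. a \<otimes> v i) \<in> finsupp K X"
  by (auto simp: finsupp_def intro: finite_subset[of _ "{i. v i \<noteq> \<zero>}"])

lemma M_group: "abelian_group M"
proof (rule abelian_groupI)
  fix f assume "f \<in> carrier M"
  then have f: "f \<in> finsupp K W" by (simp add: M_simps)
  have "(\<lambda>w. \<ominus> \<one> \<otimes> f w) \<in> finsupp K W" by (rule finsupp_const_mult[OF _ f]) simp
  moreover have "(\<lambda>w. \<ominus> \<one> \<otimes> f w \<oplus> f w) = (\<lambda>w. \<zero>)" using finsuppD(1)[OF f] by (simp add: l_minus l_neg)
  ultimately show "\<exists>y\<in>carrier M. y \<oplus>\<^bsub>M\<^esub> f = \<zero>\<^bsub>M\<^esub>" 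
    by (intro bexI[of _ "\<lambda>w. \<ominus> \<one> \<otimes> f w"]) (simp_all add: M_simps)
qed (auto simp: M_simps finsupp_zero finsupp_add finsuppD a_ac)

lemma M_ring: "ring M"
proof (rule ringI[OF M_group])
  show "Group.monoid M"
    by (rule monoidI) (auto simp: M_simps(1) mult_closed M_assoc mult_one_left mult_one_right, simp add: one_single finsupp_single W_e)
qed (auto simp: M_simps(1,4) mult_add_left mult_add_right)

lemma M_module: "module K M"
  by (rule moduleI[OF is_cring M_group])
     (auto simp: M_simps finsupp_const_mult finsuppD(1) l_distr r_distr m_assoc)

lemma smult_mult:
  assumes "c \<in> carrier K" "f \<in> finsupp K W" "g \<in> finsupp K W"
  shows "(c \<odot>\<^bsub>M\<^esub> f) \<otimes>\<^bsub>M\<^esub> g = c \<odot>\<^bsub>M\<^esub> (f \<otimes>\<^bsub>M\<^esub> g)" "f \<otimes>\<^bsub>M\<^esub> (c \<odot>\<^bsub>M\<^esub> g) = c \<odot>\<^bsub>M\<^esub> (f \<otimes>\<^bsub>M\<^esub> g)"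
proof -
  note cl = finsuppD(1)[OF assms(2)] finsuppD(1)[OF assms(3)]
  show "(c \<odot>\<^bsub>M\<^esub> f) \<otimes>\<^bsub>M\<^esub> g = c \<odot>\<^bsub>M\<^esub> (f \<otimes>\<^bsub>M\<^esub> g)" "f \<otimes>\<^bsub>M\<^esub> (c \<odot>\<^bsub>M\<^esub> g) = c \<odot>\<^bsub>M\<^esub> (f \<otimes>\<^bsub>M\<^esub> g)"
    unfolding M_simps M_mult
    by (intro ext, subst finsum_rdistr; use cl assms finite_I in \<open>auto intro!: finsum_cong' simp: m_ac\<close>)+
qed

lemma part_subset: "part M m \<subseteq> carrier M" by (auto simp: M_simps finsupp_def)

lemma single_part: "w \<in> W \<Longrightarrow> c \<in> carrier K \<Longrightarrow> single K w c \<in> part M (int (len w))"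
  by (simp add: M_simps finsupp_single)

lemma part_induct [consumes 1, case_names zero add single]:
  assumes "f \<in> part M m" "Q (\<lambda>w. \<zero>)"
    and "\<And>u v. u \<in> part M m \<Longrightarrow> v \<in> part M m \<Longrightarrow> Q u \<Longrightarrow> Q v \<Longrightarrow> Q (\<lambda>i. u i \<oplus> v i)"
    and "\<And>w c. w \<in> W \<Longrightarrow> int (len w) = m \<Longrightarrow> c \<in> carrier K \<Longrightarrow> Q (single K w c)"
  shows "Q f"
  using assms(1) unfolding M_simps
  by (induction f rule: finsupp_induct) (use assms(2-4) in \<open>auto simp: M_simps\<close>)

lemma part_mult: "f \<in> part M i \<Longrightarrow> g \<in> part M j \<Longrightarrow> f \<otimes>\<^bsub>M\<^esub> g \<in> part M (i + j)"
proof (induction f rule: part_induct)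
  case zero
  then show ?case using mult_zero_left[of g] part_subset[of j] by (auto simp: M_simps finsupp_zero)
next
  case (add u v)
  then show ?case using mult_add_left[of u v g] part_subset[of j] part_subset[of i] finsupp_add
    by (auto simp: M_simps subset_iff)
next
  case (single u c)
  note u = finsupp_single[OF single(3,1)]
  show ?case using single(4)
  proof (induction g rule: part_induct)
    case zero
    then show ?case using mult_zero_right[OF u] by (auto simp: M_simps finsupp_zero)
  next
    case (add h h')
    then show ?case using mult_add_right[OF u, of h h'] part_subset[of j] finsupp_add
      by (auto simp: M_simps subset_iff)
  next
    case (single v d)
    then show ?case using single_part[OF W_mul, of u v "c \<otimes> d"] \<open>u \<in> W\<close> \<open>c \<in> carrier K\<close> \<open>int (len u) = i\<close>
      by (simp add: mult_single len_mul)
  qed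
qed

lemma M_grading: "grading K M"
proof (rule gradingI[OF M_group, where p = "\<lambda>m f w. if int (len w) = m then f w else \<zero>"])
  interpret M: module K M by (rule M_module)
  interpret MG: abelian_group M by (rule M_group)
  fix m :: int and i f g
  have sc: "c \<odot>\<^bsub>M\<^esub> x \<in> part M m" if "c \<in> carrier K" "x \<in> part M m" for c x
    using that finsupp_const_mult by (auto simp: M_simps)
  have minus: "\<ominus>\<^bsub>M\<^esub> x = (\<ominus> \<one>) \<odot>\<^bsub>M\<^esub> x" if "x \<in> carrier M" for x using M.smult_l_minus[of \<one> x] that by simp
  show "submodule (part M m) K M"
  proof (rule M.submoduleI)
    show "\<ominus>\<^bsub>M\<^esub> x \<in> part M m" if "x \<in> part M m" for x using minus[of x] sc[of "\<ominus> \<one>" x] that part_subset[of m] by auto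
  qed (use part_subset sc finsupp_zero finsupp_add in \<open>auto simp: M_simps\<close>)
  show "carrier M \<subseteq> additive_span M (\<Union>m. part M m)"
  proof
    fix f assume "f \<in> carrier M"
    then have "f \<in> finsupp K W" by (simp add: M_simps)
    then show "f \<in> additive_span M (\<Union>m. part M m)"
    proof (induction f rule: finsupp_induct)
      case zero then show ?case using additive_span.zero[of M] by (simp add: M_simps)
    next
      case (add u v) then show ?case using additive_span.add[of u M _ v] by (simp add: M_simps)
    next
      case (single w c) then show ?case using single_part by (blast intro: additive_span.incl)
    qed
  qed
  show "(\<lambda>w. if int (len w) = m then f w else \<zero>) \<in> carrier M" if "f \<in> carrier M"
    using that by (auto simp: M_simps finsupp_def intro: finite_subset[of _ "{i. f i \<noteq> \<zero>}"])
  show "(\<lambda>w. if int (len w) = m then (f \<oplus>\<^bsub>M\<^esub> g) w else \<zero>) =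
      (\<lambda>w. if int (len w) = m then f w else \<zero>) \<oplus>\<^bsub>M\<^esub> (\<lambda>w. if int (len w) = m then g w else \<zero>)"
    by (auto simp: M_simps)
  show "(\<lambda>w. if int (len w) = m then f w else \<zero>) = (if m = i then f else \<zero>\<^bsub>M\<^esub>)" if "f \<in> part M i"
    using that by (auto simp: M_simps finsupp_def)
qed

lemma M_connected: "connected_graded_algebra K M"
  unfolding connected_graded_algebra_def
proof (intro conjI allI ballI impI)
  show "field K" by (rule field_axioms)
  show "\<one>\<^bsub>M\<^esub> \<noteq> \<zero>\<^bsub>M\<^esub>" using one_not_zero by (auto simp: M_simps fun_eq_iff)
  show "part M m = {\<zero>\<^bsub>M\<^esub>}" if "m < 0" for m using that by (auto simp: M_simps finsupp_def)
  have "f = f e \<odot>\<^bsub>M\<^esub> \<one>\<^bsub>M\<^esub>" if "f \<in> part M 0" for f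
    using that by (auto simp: M_simps finsupp_def len_0 fun_eq_iff)
  moreover have "c \<odot>\<^bsub>M\<^esub> \<one>\<^bsub>M\<^esub> \<in> part M 0" if "c \<in> carrier K" for c
  proof -
    have "c \<odot>\<^bsub>M\<^esub> \<one>\<^bsub>M\<^esub> = single K e c" using that by (auto simp: M_simps single_def)
    then show ?thesis using single_part[OF W_e that] len_0[of e] by simp
  qed
  moreover have "f e \<in> carrier K" if "f \<in> part M 0" for f using that by (auto simp: M_simps finsupp_def)
  ultimately show "part M 0 = {c \<odot>\<^bsub>M\<^esub> \<one>\<^bsub>M\<^esub> |c. c \<in> carrier K}" by blast
qed (auto simp: M_ring M_module smult_mult M_simps(1) M_grading part_mult)

end

lemma (in field) tensor_monoid_algebra:
  "monoid_algebra R (tensor_algebra R N) (@) [] (lists {..<N}) length (\<lambda>w. {..length w}) (\<lambda>w k. take k w) (\<lambda>w k. drop k w)"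
proof
  show "\<exists>!k. k \<in> {..length w} \<and> take k w = u \<and> drop k w = v" if "u @ v = w" for u v w :: "nat list"
  proof (rule ex1I[of _ "length u"])
    fix k assume k: "k \<in> {..length w} \<and> take k w = u \<and> drop k w = v"
    then show "k = length u" by (metis atMost_iff length_take min.absorb2)
  qed (use that in auto)
qed (auto simp: tensor_algebra_def)

lemma finite_submultisets: "finite {v. v \<subseteq># u}"
proof (induction u)
  case (add x u)
  have "{v. v \<subseteq># add_mset x u} \<subseteq> {v. v \<subseteq># u} \<union> add_mset x ` {v. v \<subseteq># u}"
  proof
    fix v assume v: "v \<in> {v. v \<subseteq># add_mset x u}"
    show "v \<in> {v. v \<subseteq># u} \<union> add_mset x ` {v. v \<subseteq># u}"
    proof (cases "x \<in># v")
      case True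
      then obtain v' where v': "v = add_mset x v'" by (metis mset_add)
      then show ?thesis using v by auto
    next
      case False
      then have "v \<subseteq># u" using v subset_eq_diff_conv[of v "{#x#}" u] by simp
      then show ?thesis by simp
    qed
  qed
  then show ?case using add finite_subset by blast
qed simp

lemma (in field) polynomial_monoid_algebra:
  "monoid_algebra R (polynomial_algebra R n) (+) {#} {u. set_mset u \<subseteq> {..<n}} size (\<lambda>u. {v. v \<subseteq># u}) (\<lambda>u v. v) (\<lambda>u v. u - v)"
proof
  show "\<exists>!i. i \<in> {v. v \<subseteq># w} \<and> i = u \<and> w - i = v" if "u + v = w" for u v w :: "nat multiset"
    by (intro ex1I[of _ u]) (use that in auto)
qed (auto simp: polynomial_algebra_def finite_submultisets add.assoc)

section \<open>Quotients of graded algebras\<close>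

locale graded_ideal = graded_alg K A + ideal J A
  for K :: "('k, 'z) ring_scheme" and A :: "('k, 'a) graded" (structure) and J :: "'a set"
begin

abbreviation "Q \<equiv> quotient_algebra A J"

lemma coset_eq_iff: "a \<in> carrier A \<Longrightarrow> b \<in> carrier A \<Longrightarrow> J +> a = J +> b \<longleftrightarrow> a \<oplus> \<ominus> b \<in> J"
proof -
  assume a: "a \<in> carrier A" "b \<in> carrier A"
  have "J +> a = J +> b \<longleftrightarrow> a \<in> J +> b"
    using a_rcos_self[OF a(1)] a_repr_independence[OF _ a(2) a_subgroup, of a] by blast
  then show ?thesis using a_rcos_module[OF a(2,1)] by simp
qed

lemma Q_carrier: "carrier Q = (\<lambda>a. J +> a) ` carrier A"
  by (auto simp: quotient_algebra_def FactRing_def A_RCOSETS_def')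

lemma Q_part: "part Q m = (\<lambda>a. J +> a) ` part A m"
  by (simp add: quotient_algebra_def)

lemma Q_add: "a \<in> carrier A \<Longrightarrow> b \<in> carrier A \<Longrightarrow> (J +> a) \<oplus>\<^bsub>Q\<^esub> (J +> b) = J +> (a \<oplus> b)"
  by (simp add: quotient_algebra_def FactRing_def a_rcos_sum)

lemma Q_mult: "a \<in> carrier A \<Longrightarrow> b \<in> carrier A \<Longrightarrow> (J +> a) \<otimes>\<^bsub>Q\<^esub> (J +> b) = J +> (a \<otimes> b)"
  by (simp add: quotient_algebra_def FactRing_def rcoset_mult_add)

lemma Q_one: "\<one>\<^bsub>Q\<^esub> = J +> \<one>"
  by (simp add: quotient_algebra_def FactRing_def)

lemma Q_zero: "\<zero>\<^bsub>Q\<^esub> = J +> \<zero>"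
  by (simp add: quotient_algebra_def FactRing_def a_subset)

lemma J_smult: "c \<in> carrier K \<Longrightarrow> a \<in> J \<Longrightarrow> c \<odot> a \<in> J"
  using I_l_closed[of a "c \<odot> \<one>"] Icarr by (simp add: smult_one_mult)

lemma Q_smult: 
  assumes c: "c \<in> carrier K" and a: "a \<in> carrier A"
  shows "c \<odot>\<^bsub>Q\<^esub> (J +> a) = J +> (c \<odot> a)"
proof -
  have "J +> (c \<odot> x) = J +> (c \<odot> a)" if x: "x \<in> J +> a" for x
  proof -
    have xc: "x \<in> carrier A" using x a_r_coset_subset_G[OF a_subset a] by blast
    have "x \<oplus> \<ominus> a \<in> J" by (rule a_rcos_module_imp[OF a x])
    then have "c \<odot> (x \<oplus> \<ominus> a) \<in> J" by (rule J_smult[OF c])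
    moreover have "c \<odot> (x \<oplus> \<ominus> a) = c \<odot> x \<oplus> \<ominus> (c \<odot> a)"
      using KA.smult_r_distr[OF c xc, of "\<ominus> a"] KA.smult_r_minus[OF c a] a by simp
    ultimately show ?thesis using coset_eq_iff[OF KA.smult_closed[OF c xc] KA.smult_closed[OF c a]] by simp
  qed
  then have "(\<Union>x \<in> J +> a. J +> (c \<odot> x)) = J +> (c \<odot> a)" by (intro UN_constant_eq[OF a_rcos_self[OF a]] ballI)
  then show ?thesis by (simp add: quotient_algebra_def quot_smult_def)
qed

lemma Q_zero_iff: "a \<in> carrier A \<Longrightarrow> J +> a = \<zero>\<^bsub>Q\<^esub> \<longleftrightarrow> a \<in> J"
proof -
  assume a: "a \<in> carrier A"
  have "a \<oplus> \<ominus> \<zero> = a" using a add.inv_one by simp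
  then show ?thesis unfolding Q_zero using coset_eq_iff[of a \<zero>] a by simp
qed

lemma Q_group: "abelian_group Q"
proof (rule abelian_groupI)
  fix x assume "x \<in> carrier Q"
  then obtain a where a: "a \<in> carrier A" "x = J +> a" by (auto simp: Q_carrier)
  then show "\<exists>y\<in>carrier Q. y \<oplus>\<^bsub>Q\<^esub> x = \<zero>\<^bsub>Q\<^esub>"
    by (intro bexI[of _ "J +> \<ominus> a"]) (auto simp: Q_add Q_zero l_neg Q_carrier)
qed (auto simp: Q_carrier Q_add Q_zero a_ac)

lemma Q_ring: "ring Q"
proof (rule ringI[OF Q_group])
  show "Group.monoid Q" by (rule monoidI) (auto simp: Q_carrier Q_mult Q_one m_assoc)
qed (auto simp: Q_carrier Q_add Q_mult l_distr r_distr)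

lemma Q_module: "module K Q"
  by (rule moduleI[OF K.is_cring Q_group])
     (auto simp: Q_carrier Q_add Q_smult KA.smult_l_distr KA.smult_r_distr KA.smult_assoc1)

lemma Q_smult_mult:
  assumes "c \<in> carrier K" "x \<in> carrier Q" "y \<in> carrier Q"
  shows "(c \<odot>\<^bsub>Q\<^esub> x) \<otimes>\<^bsub>Q\<^esub> y = c \<odot>\<^bsub>Q\<^esub> (x \<otimes>\<^bsub>Q\<^esub> y)" "x \<otimes>\<^bsub>Q\<^esub> (c \<odot>\<^bsub>Q\<^esub> y) = c \<odot>\<^bsub>Q\<^esub> (x \<otimes>\<^bsub>Q\<^esub> y)"
  using assms by (auto simp: Q_carrier Q_mult Q_smult smult_mult mult_smult)

lemma coset_hom: "(\<lambda>a. J +> a) \<in> ring_hom A Q"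
  by (rule ring_hom_memI) (auto simp: Q_carrier Q_add Q_mult Q_one)

lemma Q_connected:
  assumes hom: "\<And>a m. a \<in> J \<Longrightarrow> hcomp A m a \<in> J" and proper: "J \<noteq> carrier A"
  shows "connected_graded_algebra K Q"
proof -
  interpret QM: module K Q by (rule Q_module)
  have psub: "part Q m \<subseteq> carrier Q" for m using part_carrier by (auto simp: Q_part Q_carrier)
  have mono: "x \<in> additive_span Q (\<Union>m. part Q m)" if "x \<in> carrier Q" for x
  proof -
    obtain a where a: "a \<in> carrier A" "x = J +> a" using \<open>x \<in> carrier Q\<close> by (auto simp: Q_carrier)
    have "J +> a \<in> additive_span Q (\<Union>m. part Q m)" using a(1)
    proof (induction rule: homogeneous_induct)
      case zero then show ?case using additive_span.zero[of Q] by (simp add: Q_zero)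
    next
      case (add a b) then show ?case using additive_span.add[of "J +> a" Q _ "J +> b"] by (simp add: Q_add)
    next
      case (homogeneous a i) then show ?case by (intro additive_span.incl) (auto simp: Q_part)
    qed
    then show ?thesis using a by simp
  qed
  define p where "p m x = J +> hcomp A m (SOME a. a \<in> carrier A \<and> J +> a = x)" for m x
  have p: "p m (J +> a) = J +> hcomp A m a" if a: "a \<in> carrier A" for m a
  proof -
    define b where "b = (SOME b. b \<in> carrier A \<and> J +> b = J +> a)"
    have b: "b \<in> carrier A" "J +> b = J +> a" 
      using someI[of "\<lambda>b. b \<in> carrier A \<and> J +> b = J +> a" a] a unfolding b_def by auto
    then have "hcomp A m (b \<oplus> \<ominus> a) \<in> J" using hom coset_eq_iff[OF b(1) a] by simp
    moreover have "hcomp A m (b \<oplus> \<ominus> a) = hcomp A m b \<oplus> \<ominus> hcomp A m a"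
    proof -
      have "hcomp A m (\<ominus> a) \<oplus> hcomp A m a = \<zero>" using hcomp_add[of "\<ominus> a" a m] a by (simp add: l_neg)
      then have "\<ominus> hcomp A m a = hcomp A m (\<ominus> a)" using a by (intro minus_equality) auto
      then show ?thesis using a b(1) by (simp add: hcomp_add)
    qed
    ultimately have "J +> hcomp A m b = J +> hcomp A m a" using a b(1) by (simp add: coset_eq_iff)
    then show ?thesis by (simp add: p_def b_def)
  qed
  have gr: "grading K Q"
  proof (rule gradingI[OF Q_group, where p = p])
    fix m i :: int and x y
    have mi: "\<ominus>\<^bsub>Q\<^esub> (J +> a) = J +> \<ominus> a" if "a \<in> carrier A" for a
      using that by (intro QM.M.minus_equality) (auto simp: Q_add Q_zero l_neg Q_carrier)
    show "submodule (part Q m) K Q"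
      by (rule QM.submoduleI) (use psub mi part_carrier in \<open>auto simp: Q_part Q_zero Q_add Q_smult\<close>)
    show "carrier Q \<subseteq> additive_span Q (\<Union>m. part Q m)" using mono by blast
    show "p m x \<in> carrier Q" if "x \<in> carrier Q" using that p by (auto simp: Q_carrier)
    show "p m (x \<oplus>\<^bsub>Q\<^esub> y) = p m x \<oplus>\<^bsub>Q\<^esub> p m y" if "x \<in> carrier Q" "y \<in> carrier Q"
      using that by (auto simp: Q_carrier Q_add p hcomp_add)
    show "p m x = (if m = i then x else \<zero>\<^bsub>Q\<^esub>)" if "x \<in> part Q i"
      using that part_carrier by (auto simp: Q_part p hcomp_homogeneous Q_zero)
  qed
  have "\<one> \<notin> J" using one_imp_carrier proper by blast
  then have one: "\<one>\<^bsub>Q\<^esub> \<noteq> \<zero>\<^bsub>Q\<^esub>" using Q_zero_iff[OF one_closed] by (simp add: Q_one)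
  show ?thesis unfolding connected_graded_algebra_def
  proof (intro conjI allI ballI impI)
    fix i j :: int and x y
    show "x \<otimes>\<^bsub>Q\<^esub> y \<in> part Q (i + j)" if xy: "x \<in> part Q i" "y \<in> part Q j"
    proof -
      obtain a b where ab: "a \<in> part A i" "x = J +> a" "b \<in> part A j" "y = J +> b" using xy by (auto simp: Q_part)
      then show ?thesis using part_mult[OF ab(1,3)] part_carrier by (auto simp: Q_part Q_mult)
    qed
    show "part Q i = {\<zero>\<^bsub>Q\<^esub>}" if "i < 0" using that by (simp add: Q_part part_negative Q_zero)
    show "part Q 0 = {c \<odot>\<^bsub>Q\<^esub> \<one>\<^bsub>Q\<^esub> |c. c \<in> carrier K}"
    proof -
      have P0: "part Q 0 = {J +> (c \<odot> \<one>) |c. c \<in> carrier K}" unfolding Q_part part_0 by auto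
      have E: "c \<odot>\<^bsub>Q\<^esub> \<one>\<^bsub>Q\<^esub> = J +> (c \<odot> \<one>)" if "c \<in> carrier K" for c
        using Q_smult[OF that one_closed] by (simp add: Q_one)
      show ?thesis unfolding P0 by (rule Collect_cong, rule ex_cong1) (auto simp: E)
    qed
  qed (use K.field_axioms Q_ring Q_module Q_smult_mult gr one in auto)
qed

end

section \<open>Presentations\<close>

text \<open>A presentation \<open>\<psi>\<close> by generators and relations, kept as a map that can be composed with further
  quotient maps.\<close>

definition presents ::
  "('k, 'z) ring_scheme \<Rightarrow> nat \<Rightarrow> (nat list \<Rightarrow> 'k) set \<Rightarrow> ('k, 'a) graded \<Rightarrow> ((nat list \<Rightarrow> 'k) \<Rightarrow> 'a) \<Rightarrow> bool" where
  "presents K N R A \<psi> \<longleftrightarrow> (let T = tensor_algebra K N in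
     \<psi> \<in> ring_hom T A \<and> (\<forall>c \<in> carrier K. \<forall>t \<in> carrier T. \<psi> (c \<odot>\<^bsub>T\<^esub> t) = c \<odot>\<^bsub>A\<^esub> \<psi> t) \<and>
     (\<forall>m. \<psi> ` part T m = part A m) \<and> (\<forall>t \<in> carrier T. \<psi> t = \<zero>\<^bsub>A\<^esub> \<longleftrightarrow> t \<in> Idl\<^bsub>T\<^esub> R) \<and>
     finite R \<and> (\<forall>r \<in> R. \<exists>m \<ge> 2. r \<in> part T m))"

lemma tensor_connected: "field K \<Longrightarrow> connected_graded_algebra K (tensor_algebra K N)"
  using monoid_algebra.M_connected[OF field.tensor_monoid_algebra] .

lemma tensor_ideal:
  assumes "field K" "\<And>r. r \<in> R \<Longrightarrow> r \<in> carrier (tensor_algebra K N)"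
  shows "graded_ideal K (tensor_algebra K N) (Idl\<^bsub>tensor_algebra K N\<^esub> R)"
proof -
  interpret graded_alg K "tensor_algebra K N" using tensor_connected[OF assms(1)] by unfold_locales
  show ?thesis using genideal_ideal[of R] assms(2) by (intro graded_ideal.intro graded_alg_axioms) auto
qed

text \<open>Here \<open>h R\<close> is meant to be the ideal generated by \<open>R\<close>.\<close>

lemma minimal_generators:
  assumes "finite R"
  shows "\<exists>R' \<subseteq> R. h R' = h R \<and> (\<forall>S. S \<subset> R' \<longrightarrow> h S \<noteq> h R')"
  using assms
proof (induction R rule: finite_psubset_induct)
  case (psubset R)
  show ?case
  proof (cases "\<exists>S. S \<subset> R \<and> h S = h R")
    case True
    then obtain S where S: "S \<subset> R" "h S = h R" by blast
    from psubset.IH[OF S(1)] S show ?thesis by (metis order.trans psubset_imp_subset)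
  qed auto
qed

lemma presents_onto:
  assumes conn: "connected_graded_algebra K A" and pres: "presents K N R A \<psi>" and a: "a \<in> carrier A"
  shows "\<exists>t \<in> carrier (tensor_algebra K N). \<psi> t = a"
proof -
  let ?T = "tensor_algebra K N"
  interpret A: graded_alg K A by unfold_locales (rule conn)
  interpret T: graded_alg K ?T by unfold_locales (rule tensor_connected[OF A.K.field_axioms])
  have \<psi>: "\<psi> \<in> ring_hom ?T A" "\<And>m. \<psi> ` part ?T m = part A m" using pres by (auto simp: presents_def Let_def)
  interpret \<psi>: ring_hom_ring ?T A \<psi>
    using \<psi>(1) by (intro ring_hom_ring.intro T.ring_axioms A.ring_axioms ring_hom_ring_axioms.intro)
  show ?thesis using a
  proof (induction rule: A.homogeneous_induct)
    case zero show ?case using \<psi>.hom_zero by blast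
  next
    case (add a b) then show ?case using \<psi>.hom_add T.a_closed by metis
  next
    case (homogeneous a i) 
    then have "a \<in> \<psi> ` part ?T i" using \<psi>(2) by simp
    then show ?case using T.part_carrier by blast
  qed
qed

lemma graded_algebraI:
  assumes conn: "connected_graded_algebra K A" and pres: "presents K N R A \<psi>"
  shows "graded_algebra K A"
proof -
  let ?T = "tensor_algebra K N" and ?J = "Idl\<^bsub>tensor_algebra K N\<^esub> R"
  interpret A: graded_alg K A by unfold_locales (rule conn)
  have K: "field K" by (rule A.K.field_axioms)
  interpret T: graded_alg K ?T by unfold_locales (rule tensor_connected[OF K])
  have \<psi>: "\<psi> \<in> ring_hom ?T A" "\<And>c t. c \<in> carrier K \<Longrightarrow> t \<in> carrier ?T \<Longrightarrow> \<psi> (c \<odot>\<^bsub>?T\<^esub> t) = c \<odot>\<^bsub>A\<^esub> \<psi> t"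
    "\<And>m. \<psi> ` part ?T m = part A m" "\<And>t. t \<in> carrier ?T \<Longrightarrow> \<psi> t = \<zero>\<^bsub>A\<^esub> \<longleftrightarrow> t \<in> ?J"
    and R: "finite R" "\<And>r. r \<in> R \<Longrightarrow> \<exists>m \<ge> 2. r \<in> part ?T m"
    using pres by (auto simp: presents_def Let_def)
  have Rc: "r \<in> carrier ?T" if "r \<in> R" for r using R(2)[OF that] T.part_carrier by blast
  interpret J: graded_ideal K ?T ?J by (rule tensor_ideal[OF K Rc])
  interpret \<psi>: ring_hom_ring ?T A \<psi>
    using \<psi>(1) by (intro ring_hom_ring.intro T.ring_axioms A.ring_axioms ring_hom_ring_axioms.intro)
  note onto = presents_onto[OF conn pres]
  have coset: "?J +>\<^bsub>?T\<^esub> t = ?J +>\<^bsub>?T\<^esub> t' \<longleftrightarrow> \<psi> t = \<psi> t'" if t: "t \<in> carrier ?T" "t' \<in> carrier ?T" for t t'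
  proof -
    have "\<psi> t = \<psi> t' \<longleftrightarrow> \<psi> t \<oplus>\<^bsub>A\<^esub> \<ominus>\<^bsub>A\<^esub> \<psi> t' = \<zero>\<^bsub>A\<^esub>"
      using t A.add_minus_zeroD[of "\<psi> t" "\<psi> t'"] by (auto simp: A.r_neg)
    also have "\<dots> \<longleftrightarrow> t \<oplus>\<^bsub>?T\<^esub> \<ominus>\<^bsub>?T\<^esub> t' \<in> ?J" using t \<psi>(4)[of "t \<oplus>\<^bsub>?T\<^esub> \<ominus>\<^bsub>?T\<^esub> t'"] by simp
    finally show ?thesis using J.coset_eq_iff[OF t] by simp
  qed
  define h where "h a = ?J +>\<^bsub>?T\<^esub> (SOME t. t \<in> carrier ?T \<and> \<psi> t = a)" for a
  have h: "h (\<psi> t) = ?J +>\<^bsub>?T\<^esub> t" if t: "t \<in> carrier ?T" for t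
    using someI[of "\<lambda>s. s \<in> carrier ?T \<and> \<psi> s = \<psi> t" t] t coset[of _ t] unfolding h_def by blast
  have ops: "h (a \<otimes>\<^bsub>A\<^esub> b) = h a \<otimes>\<^bsub>J.Q\<^esub> h b" "h (a \<oplus>\<^bsub>A\<^esub> b) = h a \<oplus>\<^bsub>J.Q\<^esub> h b"
    if "a \<in> carrier A" "b \<in> carrier A" for a b
  proof -
    obtain s t where st: "s \<in> carrier ?T" "\<psi> s = a" "t \<in> carrier ?T" "\<psi> t = b" using onto \<open>a \<in> _\<close> \<open>b \<in> _\<close> by meson
    show "h (a \<otimes>\<^bsub>A\<^esub> b) = h a \<otimes>\<^bsub>J.Q\<^esub> h b" "h (a \<oplus>\<^bsub>A\<^esub> b) = h a \<oplus>\<^bsub>J.Q\<^esub> h b"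
      using st h[of s] h[of t] h[of "s \<otimes>\<^bsub>?T\<^esub> t"] h[of "s \<oplus>\<^bsub>?T\<^esub> t"] by (auto simp: J.Q_mult J.Q_add)
  qed
  have hc: "h a \<in> carrier J.Q" if a: "a \<in> carrier A" for a using onto[OF a] h by (auto simp: J.Q_carrier)
  have "h \<in> ring_hom A J.Q"
    by (rule ring_hom_memI) (use ops hc h[OF T.one_closed] in \<open>auto simp: J.Q_one\<close>)
  moreover have "bij_betw h (carrier A) (carrier J.Q)"
  proof (rule bij_betwI')
    show "h a = h b \<longleftrightarrow> a = b" if ab: "a \<in> carrier A" "b \<in> carrier A" for a b
      using onto[OF ab(1)] onto[OF ab(2)] h coset by auto
    show "\<exists>a\<in>carrier A. x = h a" if "x \<in> carrier J.Q" for x using that h by (auto simp: J.Q_carrier intro!: bexI[of _ "\<psi> _"])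
  qed (rule hc)
  moreover have "h (c \<odot>\<^bsub>A\<^esub> a) = c \<odot>\<^bsub>J.Q\<^esub> h a" if c: "c \<in> carrier K" and a: "a \<in> carrier A" for c a
  proof -
    obtain t where t: "t \<in> carrier ?T" "\<psi> t = a" using onto[OF a] by blast
    have "h (\<psi> (c \<odot>\<^bsub>?T\<^esub> t)) = ?J +>\<^bsub>?T\<^esub> (c \<odot>\<^bsub>?T\<^esub> t)" by (rule h) (use c t in simp)
    then show ?thesis using t c h[OF t(1)] \<psi>(2)[OF c t(1)] by (simp add: J.Q_smult)
  qed
  moreover have "h ` part A m = part J.Q m" for m
    unfolding \<psi>(3)[symmetric] J.Q_part image_image using h T.part_carrier by (intro image_cong) auto
  ultimately have iso: "h \<in> graded_algebra_iso K A J.Q" by (simp add: graded_algebra_iso_def ring_iso_def)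
  define gen where "gen S = Idl\<^bsub>?T\<^esub> S" for S
  obtain R' where R': "R' \<subseteq> R" "gen R' = gen R" "\<forall>S. S \<subset> R' \<longrightarrow> gen S \<noteq> gen R'"
    using minimal_generators[OF R(1), of gen] by blast
  have "finite R'" "\<forall>r \<in> R'. \<exists>m \<ge> 2. r \<in> part ?T m" using R'(1) R finite_subset[of R' R] by auto
  then show ?thesis unfolding graded_algebra_def using conn iso R'(2,3)
    by (intro conjI exI[of _ N] exI[of _ R']) (auto simp: gen_def)
qed

lemma graded_algebraE:
  assumes "graded_algebra K A"
  shows "\<exists>N R \<psi>. presents K N R A \<psi>"
proof -
  have conn: "connected_graded_algebra K A" using assms by (simp add: graded_algebra_def)
  obtain N R where R: "finite R" "\<forall>r \<in> R. \<exists>m \<ge> 2. r \<in> part (tensor_algebra K N) m"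
    and "graded_algebra_iso K A (quotient_algebra (tensor_algebra K N) (Idl\<^bsub>tensor_algebra K N\<^esub> R)) \<noteq> {}"
    using assms unfolding graded_algebra_def by (elim conjE exE) (rule that)
  then obtain h where iso: "h \<in> graded_algebra_iso K A (quotient_algebra (tensor_algebra K N) (Idl\<^bsub>tensor_algebra K N\<^esub> R))"
    by (auto simp only: ex_in_conv[symmetric])
  note R = R(1) R(2)[rule_format]
  let ?T = "tensor_algebra K N" and ?J = "Idl\<^bsub>tensor_algebra K N\<^esub> R"
  interpret A: graded_alg K A by unfold_locales (rule conn)
  have K: "field K" by (rule A.K.field_axioms)
  interpret T: graded_alg K ?T by unfold_locales (rule tensor_connected[OF K])
  have Rc: "r \<in> carrier ?T" if "r \<in> R" for r using R(2)[OF that] T.part_carrier by blast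
  interpret J: graded_ideal K ?T ?J by (rule tensor_ideal[OF K Rc])
  have h: "h \<in> ring_hom A J.Q" "bij_betw h (carrier A) (carrier J.Q)" 
    "\<And>c a. c \<in> carrier K \<Longrightarrow> a \<in> carrier A \<Longrightarrow> h (c \<odot>\<^bsub>A\<^esub> a) = c \<odot>\<^bsub>J.Q\<^esub> h a" "\<And>m. h ` part A m = part J.Q m"
    using iso by (auto simp: graded_algebra_iso_def ring_iso_def)
  note hh = ring_hom_memE[OF h(1)]
  define \<psi> where "\<psi> t = inv_into (carrier A) h (?J +>\<^bsub>?T\<^esub> t)" for t
  have \<psi>: "\<psi> t \<in> carrier A \<and> h (\<psi> t) = ?J +>\<^bsub>?T\<^esub> t" if "t \<in> carrier ?T" for t
    using bij_betw_inv_into_right[OF h(2)] bij_betw_imp_surj_on[OF h(2)] that inv_into_into[of _ h "carrier A"]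
    unfolding \<psi>_def J.Q_carrier by auto
  have eq: "\<psi> t = a" if "t \<in> carrier ?T" "a \<in> carrier A" "h a = ?J +>\<^bsub>?T\<^esub> t" for t a
    using \<psi>[OF that(1)] that(2,3) bij_betw_imp_inj_on[OF h(2)] by (auto dest: inj_onD)
  have "\<psi> \<in> ring_hom ?T A"
    by (rule ring_hom_memI) (use \<psi> hh in \<open>auto intro!: eq simp: J.Q_mult J.Q_add J.Q_one\<close>)
  moreover have "\<psi> (c \<odot>\<^bsub>?T\<^esub> t) = c \<odot>\<^bsub>A\<^esub> \<psi> t" if "c \<in> carrier K" "t \<in> carrier ?T" for c t
    using \<psi>[OF that(2)] h(3) that by (intro eq) (auto simp: J.Q_smult)
  moreover have "\<psi> ` part ?T m = part A m" for m
  proof (intro equalityI subsetI)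
    fix a assume "a \<in> \<psi> ` part ?T m"
    then obtain t where t: "t \<in> part ?T m" "a = \<psi> t" by blast
    then have "?J +>\<^bsub>?T\<^esub> t \<in> h ` part A m" using h(4) by (simp add: J.Q_part)
    then obtain b where "b \<in> part A m" "h b = ?J +>\<^bsub>?T\<^esub> t" by auto
    then show "a \<in> part A m" using eq[of t b] t T.part_carrier A.part_carrier by auto
  next
    fix a assume a: "a \<in> part A m"
    then have "h a \<in> (\<lambda>t. ?J +>\<^bsub>?T\<^esub> t) ` part ?T m" using h(4)[of m] by (auto simp: J.Q_part)
    then obtain t where t: "t \<in> part ?T m" "h a = ?J +>\<^bsub>?T\<^esub> t" by auto
    then have "\<psi> t = a" using eq a T.part_carrier A.part_carrier by blast
    then show "a \<in> \<psi> ` part ?T m" using t by blast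
  qed
  moreover have "\<psi> t = \<zero>\<^bsub>A\<^esub> \<longleftrightarrow> t \<in> ?J" if t: "t \<in> carrier ?T" for t
  proof -
    have "h \<zero>\<^bsub>A\<^esub> = \<zero>\<^bsub>J.Q\<^esub>" using ring_hom_zero[OF h(1) A.ring_axioms J.Q_ring] .
    then have "\<psi> t = \<zero>\<^bsub>A\<^esub> \<longleftrightarrow> ?J +>\<^bsub>?T\<^esub> t = \<zero>\<^bsub>J.Q\<^esub>" using \<psi>[OF t] eq[OF t A.zero_closed] by auto
    then show ?thesis using J.Q_zero_iff[OF t] by simp
  qed
  ultimately have "presents K N R A \<psi>" using R by (simp add: presents_def)
  then show ?thesis by blast
qed

text \<open>The images of the variables generate \<open>A\<close> in degree 1.\<close>

lemma presents_degree_one: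
  assumes conn: "connected_graded_algebra K A" and pres: "presents K N R A \<psi>"
  shows "\<exists>x. (\<forall>i < N. x i \<in> part A 1) \<and> (\<forall>m \<ge> 1. \<forall>a \<in> part A m. a \<in> additive_span A {b \<otimes>\<^bsub>A\<^esub> x i | b i. b \<in> part A (m - 1) \<and> i < N})"
proof -
  let ?T = "tensor_algebra K N"
  interpret A: graded_alg K A by unfold_locales (rule conn)
  interpret T: monoid_algebra K ?T "(@)" "[]" "lists {..<N}" length "\<lambda>w. {..length w}" "\<lambda>w k. take k w" "\<lambda>w k. drop k w"
    by (rule A.K.tensor_monoid_algebra)
  have \<psi>: "\<psi> \<in> ring_hom ?T A" "\<And>m. \<psi> ` part ?T m = part A m"
    using pres by (auto simp: presents_def Let_def)
  interpret \<psi>: ring_hom_ring ?T A \<psi>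
    using \<psi>(1) by (intro ring_hom_ring.intro T.M_ring A.ring_axioms ring_hom_ring_axioms.intro)
  have hp: "\<psi> t \<in> part A m" if "t \<in> part ?T m" for t m using \<psi>(2)[of m] that by (metis imageI)
  define x where "x i = \<psi> (single K [i] \<one>\<^bsub>K\<^esub>)" for i
  have "\<psi> t \<in> additive_span A {b \<otimes>\<^bsub>A\<^esub> x i | b i. b \<in> part A (m - 1) \<and> i < N}" if m: "m \<ge> 1" and t: "t \<in> part ?T m" for m t
    using t
  proof (induction t rule: T.part_induct)
    case zero
    then show ?case using \<psi>.hom_zero additive_span.zero[of A] by (simp add: T.M_simps)
  next
    case (add u v)
    have "u \<in> carrier ?T" "v \<in> carrier ?T" using add T.part_subset by auto
    then have "\<psi> (\<lambda>i. u i \<oplus>\<^bsub>K\<^esub> v i) = \<psi> u \<oplus>\<^bsub>A\<^esub> \<psi> v" using \<psi>.hom_add[of u v] by (simp add: T.M_simps)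
    then show ?case using additive_span.add[OF add(3,4)] by simp
  next
    case (single w c)
    then obtain w' i where w: "w = w' @ [i]" using m by (cases w rule: rev_cases) auto
    then have wi: "w' \<in> lists {..<N}" "i < N" "int (length w') = m - 1" using single by auto
    have "single K w c = single K w' c \<otimes>\<^bsub>?T\<^esub> single K [i] \<one>\<^bsub>K\<^esub>" using T.mult_single[of c "\<one>\<^bsub>K\<^esub>" w' "[i]"] single w by simp
    moreover have "single K w' c \<in> part ?T (m - 1)" using T.single_part[OF wi(1) single(3)] wi(3) by simp
    moreover have "single K [i] \<one>\<^bsub>K\<^esub> \<in> carrier ?T" using wi(2) by (simp add: T.M_simps A.K.finsupp_single)
    ultimately have "\<psi> (single K w c) = \<psi> (single K w' c) \<otimes>\<^bsub>A\<^esub> x i" "\<psi> (single K w' c) \<in> part A (m - 1)"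
      using \<psi>.hom_mult[of "single K w' c" "single K [i] \<one>\<^bsub>K\<^esub>"] subsetD[OF T.part_subset[of "m - 1"]] hp
      unfolding x_def by simp_all
    then show ?case using wi(2) by (intro additive_span.incl) blast
  qed
  moreover have "x i \<in> part A 1" if "i < N" for i
    unfolding x_def by (rule hp) (use T.single_part[of "[i]" "\<one>\<^bsub>K\<^esub>"] that in simp)
  ultimately have "(\<forall>i < N. x i \<in> part A 1) \<and> (\<forall>m \<ge> 1. \<forall>a \<in> part A m. a \<in> additive_span A {b \<otimes>\<^bsub>A\<^esub> x i | b i. b \<in> part A (m - 1) \<and> i < N})"
    unfolding \<psi>(2)[symmetric] by blast
  then show ?thesis by blast
qed

lemma presents_quotient:
  assumes connA: "connected_graded_algebra K A" and pres: "presents K N R A \<psi>" and connB: "connected_graded_algebra K B"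
    and \<pi>: "\<pi> \<in> ring_hom A B" "\<And>c a. c \<in> carrier K \<Longrightarrow> a \<in> carrier A \<Longrightarrow> \<pi> (c \<odot>\<^bsub>A\<^esub> a) = c \<odot>\<^bsub>B\<^esub> \<pi> a"
      "\<And>m. \<pi> ` part A m = part B m" "\<And>a. a \<in> carrier A \<Longrightarrow> \<pi> a = \<zero>\<^bsub>B\<^esub> \<longleftrightarrow> (\<exists>b \<in> carrier A. a = g \<otimes>\<^bsub>A\<^esub> b)"
    and g: "g \<in> part A d" "1 < d"
  shows "\<exists>R'. presents K N R' B (\<pi> \<circ> \<psi>)"
proof -
  let ?T = "tensor_algebra K N"
  interpret A: graded_alg K A by unfold_locales (rule connA)
  interpret B: graded_alg K B by unfold_locales (rule connB)
  interpret T: graded_alg K ?T by unfold_locales (rule tensor_connected[OF A.K.field_axioms])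
  have \<psi>: "\<psi> \<in> ring_hom ?T A" "\<And>c t. c \<in> carrier K \<Longrightarrow> t \<in> carrier ?T \<Longrightarrow> \<psi> (c \<odot>\<^bsub>?T\<^esub> t) = c \<odot>\<^bsub>A\<^esub> \<psi> t"
    "\<And>m. \<psi> ` part ?T m = part A m" "\<And>t. t \<in> carrier ?T \<Longrightarrow> \<psi> t = \<zero>\<^bsub>A\<^esub> \<longleftrightarrow> t \<in> Idl\<^bsub>?T\<^esub> R"
    and R: "finite R" "\<And>r. r \<in> R \<Longrightarrow> \<exists>m \<ge> 2. r \<in> part ?T m"
    using pres by (auto simp: presents_def Let_def)
  interpret \<psi>: ring_hom_ring ?T A \<psi>
    using \<psi>(1) by (intro ring_hom_ring.intro T.ring_axioms A.ring_axioms ring_hom_ring_axioms.intro)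
  have "g \<in> \<psi> ` part ?T d" using g(1) \<psi>(3) by simp
  then obtain g' where g': "g' \<in> part ?T d" "\<psi> g' = g" by auto
  let ?R = "insert g' R"
  have Rc: "?R \<subseteq> carrier ?T" using R(2) g'(1) T.part_carrier by blast
  interpret h: ring_hom_ring ?T B "\<pi> \<circ> \<psi>"
    using ring_hom_trans[OF \<psi>(1) \<pi>(1)] by (intro ring_hom_ring.intro T.ring_axioms B.ring_axioms ring_hom_ring_axioms.intro)
  have gc: "g \<in> carrier A" using A.part_carrier g(1) .
  have pz: "\<pi> \<zero>\<^bsub>A\<^esub> = \<zero>\<^bsub>B\<^esub>" using ring_hom_zero[OF \<pi>(1) A.ring_axioms B.ring_axioms] .
  have pg: "\<pi> g = \<zero>\<^bsub>B\<^esub>" unfolding \<pi>(4)[OF gc] by (rule bexI[of _ "\<one>\<^bsub>A\<^esub>"]) (simp_all add: gc)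
  interpret I: ideal "Idl\<^bsub>?T\<^esub> ?R" ?T using T.genideal_ideal[OF Rc] .
  have RI: "?R \<subseteq> Idl\<^bsub>?T\<^esub> ?R" by (rule T.genideal_self[OF Rc])
  have "(\<pi> \<circ> \<psi>) t = \<zero>\<^bsub>B\<^esub> \<longleftrightarrow> t \<in> Idl\<^bsub>?T\<^esub> ?R" if t: "t \<in> carrier ?T" for t
  proof
    assume "t \<in> Idl\<^bsub>?T\<^esub> ?R"
    moreover have "Idl\<^bsub>?T\<^esub> ?R \<subseteq> a_kernel ?T B (\<pi> \<circ> \<psi>)"
    proof (rule T.genideal_minimal[OF h.kernel_is_ideal], rule subsetI)
      fix x assume x: "x \<in> ?R"
      have "\<pi> (\<psi> x) = \<zero>\<^bsub>B\<^esub>"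
      proof (cases "x = g'")
        case True
        show ?thesis unfolding True g'(2) by (rule pg)
      next
        case False
        then have "x \<in> carrier ?T" "x \<in> Idl\<^bsub>?T\<^esub> R" using x Rc T.genideal_self[of R] by blast+
        then have "\<psi> x = \<zero>\<^bsub>A\<^esub>" using \<psi>(4)[of x] by simp
        then show ?thesis by (simp only: pz)
      qed
      moreover have "x \<in> carrier ?T" using x Rc by blast
      ultimately show "x \<in> a_kernel ?T B (\<pi> \<circ> \<psi>)" unfolding a_kernel_def' by simp
    qed
    ultimately have "t \<in> a_kernel ?T B (\<pi> \<circ> \<psi>)" by (rule subsetD[rotated])
    then show "(\<pi> \<circ> \<psi>) t = \<zero>\<^bsub>B\<^esub>" unfolding a_kernel_def' by simp
  next
    assume "(\<pi> \<circ> \<psi>) t = \<zero>\<^bsub>B\<^esub>"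
    then obtain b where b: "b \<in> carrier A" "\<psi> t = g \<otimes>\<^bsub>A\<^esub> b" using \<pi>(4)[OF \<psi>.hom_closed[OF t]] by auto
    obtain s where s: "s \<in> carrier ?T" "\<psi> s = b" using presents_onto[OF connA pres b(1)] by blast
    have gs: "g' \<otimes>\<^bsub>?T\<^esub> s \<in> carrier ?T" using s(1) g'(1) T.part_carrier by blast
    have "\<psi> (t \<oplus>\<^bsub>?T\<^esub> \<ominus>\<^bsub>?T\<^esub> (g' \<otimes>\<^bsub>?T\<^esub> s)) = \<zero>\<^bsub>A\<^esub>"
      using t gs s g' b T.part_carrier[OF g'(1)] gc by (simp add: A.r_neg)
    then have "t \<oplus>\<^bsub>?T\<^esub> \<ominus>\<^bsub>?T\<^esub> (g' \<otimes>\<^bsub>?T\<^esub> s) \<in> Idl\<^bsub>?T\<^esub> R"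
      using \<psi>(4)[OF T.a_closed[OF t T.a_inv_closed[OF gs]]] by blast
    then have tI: "t \<oplus>\<^bsub>?T\<^esub> \<ominus>\<^bsub>?T\<^esub> (g' \<otimes>\<^bsub>?T\<^esub> s) \<in> Idl\<^bsub>?T\<^esub> ?R"
      by (rule subsetD[OF T.genideal_minimal[OF I.is_ideal subset_trans[OF subset_insertI RI]]])
    have gI: "g' \<otimes>\<^bsub>?T\<^esub> s \<in> Idl\<^bsub>?T\<^esub> ?R" by (rule I.I_r_closed[OF subsetD[OF RI insertI1] s(1)])
    have "(t \<oplus>\<^bsub>?T\<^esub> \<ominus>\<^bsub>?T\<^esub> (g' \<otimes>\<^bsub>?T\<^esub> s)) \<oplus>\<^bsub>?T\<^esub> (g' \<otimes>\<^bsub>?T\<^esub> s) \<in> Idl\<^bsub>?T\<^esub> ?R"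
      by (rule I.a_closed[OF tI gI])
    moreover have "(t \<oplus>\<^bsub>?T\<^esub> \<ominus>\<^bsub>?T\<^esub> (g' \<otimes>\<^bsub>?T\<^esub> s)) \<oplus>\<^bsub>?T\<^esub> (g' \<otimes>\<^bsub>?T\<^esub> s) = t"
      using t gs by (simp add: T.a_assoc T.l_neg)
    ultimately show "t \<in> Idl\<^bsub>?T\<^esub> ?R" by (simp only:)
  qed
  moreover have "(\<pi> \<circ> \<psi>) (c \<odot>\<^bsub>?T\<^esub> t) = c \<odot>\<^bsub>B\<^esub> (\<pi> \<circ> \<psi>) t" if "c \<in> carrier K" "t \<in> carrier ?T" for c t
    using \<psi>(2)[OF that] \<pi>(2)[OF that(1) \<psi>.hom_closed[OF that(2)]] by simp
  moreover have "\<exists>m \<ge> 2. g' \<in> part ?T m" using g'(1) g(2) by (intro exI[of _ d] conjI) simp_all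
  then have "\<forall>r \<in> ?R. \<exists>m \<ge> 2. r \<in> part ?T m" using R(2) by blast
  moreover have "(\<pi> \<circ> \<psi>) ` part ?T m = part B m" for m by (simp only: image_comp[symmetric] \<psi>(3) \<pi>(3))
  ultimately have "presents K N ?R B (\<pi> \<circ> \<psi>)"
    unfolding presents_def Let_def using ring_hom_trans[OF \<psi>(1) \<pi>(1)] R(1) by (intro conjI ballI allI) (rule finite.insertI | blast)+
  then show ?thesis by blast
qed

section \<open>Graded-commutative algebras with a regular element\<close>

text \<open>In characteristic 2 signs do not matter. Otherwise the degree 1 generators of a graded-commutative algebra square to
  zero. A product of generators, prolonged by one generator after the other as long as it remains
  nonzero, is annihilated by every element of positive degree, so such an algebra has no regular elements of positive degree.\<close>

lemma regular_commutative:
  assumes ga: "graded_algebra K A" and gc: "graded_commutative_algebra A"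
    and g: "g \<in> part A d" "1 < d" "regular A g"
  shows "commutative_algebra A"
proof -
  have conn: "connected_graded_algebra K A" using ga by (simp add: graded_algebra_def)
  interpret A: graded_alg K A by unfold_locales (rule conn)
  have comm: "a \<otimes>\<^bsub>A\<^esub> b = (if even (i * j) then b \<otimes>\<^bsub>A\<^esub> a else \<ominus>\<^bsub>A\<^esub> (b \<otimes>\<^bsub>A\<^esub> a))" if "a \<in> part A i" "b \<in> part A j" for a b i j
    using gc that unfolding graded_commutative_algebra_def by blast
  let ?two = "\<one>\<^bsub>K\<^esub> \<oplus>\<^bsub>K\<^esub> \<one>\<^bsub>K\<^esub>"
  have two: "?two \<odot>\<^bsub>A\<^esub> a = a \<oplus>\<^bsub>A\<^esub> a" if "a \<in> carrier A" for a using that by (simp add: A.KA.smult_l_distr)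
  show ?thesis
  proof (cases "?two = \<zero>\<^bsub>K\<^esub>")
    case True
    have neg: "\<ominus>\<^bsub>A\<^esub> a = a" if "a \<in> carrier A" for a
      using two[OF that] True that by (intro A.minus_equality) simp_all
    have hc: "a \<otimes>\<^bsub>A\<^esub> b = b \<otimes>\<^bsub>A\<^esub> a" if "a \<in> part A i" "b \<in> part A j" for a b i j
      using comm[OF that] neg[of "b \<otimes>\<^bsub>A\<^esub> a"] A.part_carrier[OF that(1)] A.part_carrier[OF that(2)] by simp
    have "a \<otimes>\<^bsub>A\<^esub> b = b \<otimes>\<^bsub>A\<^esub> a" if a: "a \<in> carrier A" and b: "b \<in> carrier A" for a b
      using a
    proof (induction rule: A.homogeneous_induct)
      case (homogeneous a i)
      then have ac: "a \<in> carrier A" by (rule A.part_carrier)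
      show ?case using b
        by (induction rule: A.homogeneous_induct) (use homogeneous hc ac in \<open>simp_all add: A.l_distr A.r_distr\<close>)
    qed (use b in \<open>simp_all add: A.l_distr A.r_distr\<close>)
    then show ?thesis by (simp add: commutative_algebra_def)
  next
    case False
    then have u: "?two \<in> Units K" by (simp add: A.K.field_Units)
    obtain N R \<psi> where pres: "presents K N R A \<psi>" using graded_algebraE[OF ga] by blast
    obtain x where x: "\<And>i. i < N \<Longrightarrow> x i \<in> part A 1"
      and span: "\<And>m a. m \<ge> 1 \<Longrightarrow> a \<in> part A m \<Longrightarrow> a \<in> additive_span A {b \<otimes>\<^bsub>A\<^esub> x i | b i. b \<in> part A (m - 1) \<and> i < N}"
      using presents_degree_one[OF conn pres] by blast
    have xc: "x i \<in> carrier A" if "i < N" for i using x[OF that] A.part_carrier by blast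
    have sq: "x i \<otimes>\<^bsub>A\<^esub> x i = \<zero>\<^bsub>A\<^esub>" if i: "i < N" for i
    proof -
      have c: "x i \<otimes>\<^bsub>A\<^esub> x i \<in> carrier A" using xc[OF i] by simp
      have "x i \<otimes>\<^bsub>A\<^esub> x i = \<ominus>\<^bsub>A\<^esub> (x i \<otimes>\<^bsub>A\<^esub> x i)" using comm[OF x[OF i] x[OF i]] by simp
      then have "?two \<odot>\<^bsub>A\<^esub> (x i \<otimes>\<^bsub>A\<^esub> x i) = \<zero>\<^bsub>A\<^esub>" using two[OF c] A.r_neg[OF c] by simp
      then have "(inv\<^bsub>K\<^esub> ?two \<otimes>\<^bsub>K\<^esub> ?two) \<odot>\<^bsub>A\<^esub> (x i \<otimes>\<^bsub>A\<^esub> x i) = \<zero>\<^bsub>A\<^esub>"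
        using A.KA.smult_assoc1[OF A.K.Units_inv_closed[OF u] _ c, of ?two] A.K.Units_inv_closed[OF u] by simp
      then show ?thesis using A.K.Units_l_inv[OF u] c by simp
    qed
    have "\<exists>m. \<exists>a \<in> part A m. a \<noteq> \<zero>\<^bsub>A\<^esub> \<and> (\<forall>j < n. a \<otimes>\<^bsub>A\<^esub> x j = \<zero>\<^bsub>A\<^esub>)" if "n \<le> N" for n
      using that
    proof (induction n)
      case 0
      show ?case using A.one_part A.one_neq_zero by auto
    next
      case (Suc n)
      then obtain m a where a: "a \<in> part A m" "a \<noteq> \<zero>\<^bsub>A\<^esub>" "\<And>j. j < n \<Longrightarrow> a \<otimes>\<^bsub>A\<^esub> x j = \<zero>\<^bsub>A\<^esub>" by auto
      have n: "n < N" using Suc by simp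
      note ac = A.part_carrier[OF a(1)]
      show ?case
      proof (cases "a \<otimes>\<^bsub>A\<^esub> x n = \<zero>\<^bsub>A\<^esub>")
        case True
        then show ?thesis using a less_Suc_eq by metis
      next
        case False
        have "a \<otimes>\<^bsub>A\<^esub> x n \<otimes>\<^bsub>A\<^esub> x j = \<zero>\<^bsub>A\<^esub>" if j: "j < Suc n" for j
        proof (cases "j = n")
          case True
          then show ?thesis using sq[OF n] ac xc[OF n] by (simp add: A.m_assoc)
        next
          case False
          then have jn: "j < n" "j < N" using j n by auto
          have "x n \<otimes>\<^bsub>A\<^esub> x j = \<ominus>\<^bsub>A\<^esub> (x j \<otimes>\<^bsub>A\<^esub> x n)" using comm[OF x[OF n] x[OF jn(2)]] by simp
          then have "a \<otimes>\<^bsub>A\<^esub> x n \<otimes>\<^bsub>A\<^esub> x j = \<ominus>\<^bsub>A\<^esub> (a \<otimes>\<^bsub>A\<^esub> x j \<otimes>\<^bsub>A\<^esub> x n)"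
            using ac xc[OF n] xc[OF jn(2)] by (simp add: A.m_assoc A.r_minus)
          then show ?thesis using a(3)[OF jn(1)] xc[OF n] by simp
        qed
        moreover have "a \<otimes>\<^bsub>A\<^esub> x n \<in> part A (m + 1)" using A.part_mult[OF a(1) x[OF n]] .
        ultimately show ?thesis using False by blast
      qed
    qed
    from this[OF order_refl] obtain m a where a: "a \<in> part A m" "a \<noteq> \<zero>\<^bsub>A\<^esub>" "\<And>j. j < N \<Longrightarrow> a \<otimes>\<^bsub>A\<^esub> x j = \<zero>\<^bsub>A\<^esub>" by blast
    note ac = A.part_carrier[OF a(1)]
    have "y \<in> carrier A \<and> a \<otimes>\<^bsub>A\<^esub> y = \<zero>\<^bsub>A\<^esub>" if "y \<in> additive_span A {b \<otimes>\<^bsub>A\<^esub> x i | b i. b \<in> part A (d - 1) \<and> i < N}" for y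
      using that
    proof (induction rule: additive_span.induct)
      case (incl y)
      then obtain b i where b: "y = b \<otimes>\<^bsub>A\<^esub> x i" "b \<in> part A (d - 1)" "i < N" by blast
      note bc = A.part_carrier[OF b(2)]
      have "b \<otimes>\<^bsub>A\<^esub> a \<otimes>\<^bsub>A\<^esub> x i = \<zero>\<^bsub>A\<^esub>" using a(3)[OF b(3)] ac bc xc[OF b(3)] by (simp add: A.m_assoc)
      then have "a \<otimes>\<^bsub>A\<^esub> b \<otimes>\<^bsub>A\<^esub> x i = \<zero>\<^bsub>A\<^esub>"
        using comm[OF a(1) b(2)] ac bc xc[OF b(3)] by (simp add: A.l_minus split: if_splits)
      then show ?case using ac bc xc[OF b(3)] b(1) by (simp add: A.m_assoc)
    qed (use ac in \<open>auto simp: A.r_distr\<close>)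
    then have "a \<otimes>\<^bsub>A\<^esub> g = \<zero>\<^bsub>A\<^esub>" using span[OF _ g(1)] g(2) by simp
    then show ?thesis using g(3) ac a(2) unfolding regular_def by blast
  qed
qed

section \<open>Passage to a hypersurface\<close>

text \<open>\<open>B\<close> is given up to isomorphism, by a surjection with kernel \<open>gA\<close>; so the theorem applies to an
  iterated quotient, such as an ideal that grows by one generator.\<close>

theorem K2_hypersurface:
  assumes K2: "K2_algebra K A" and commA: "commutative_algebra A"
    and connB: "connected_graded_algebra K B" and commB: "commutative_algebra B"
    and \<pi>: "\<pi> \<in> ring_hom A B" "\<And>c a. c \<in> carrier K \<Longrightarrow> a \<in> carrier A \<Longrightarrow> \<pi> (c \<odot>\<^bsub>A\<^esub> a) = c \<odot>\<^bsub>B\<^esub> \<pi> a"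
      "\<And>m. \<pi> ` part A m = part B m" "\<And>a. a \<in> carrier A \<Longrightarrow> \<pi> a = \<zero>\<^bsub>B\<^esub> \<longleftrightarrow> (\<exists>b \<in> carrier A. a = g \<otimes>\<^bsub>A\<^esub> b)"
    and g: "g \<in> part A d" "1 < d" "regular A g"
  shows "K2_algebra K B"
proof -
  have ga: "graded_algebra K A" using K2 by (simp add: K2_algebra_def)
  have connA: "connected_graded_algebra K A" using ga by (simp add: graded_algebra_def)
  obtain N R \<psi> where pres: "presents K N R A \<psi>" using graded_algebraE[OF ga] by blast
  obtain R' where "presents K N R' B (\<pi> \<circ> \<psi>)"
    using presents_quotient[OF connA pres connB \<pi> g(1,2)] by blast
  then have gB: "graded_algebra K B" by (rule graded_algebraI[OF connB])
  obtain P where P: "free_resolution K A P" and gen: "generated_subalgebra K (yoneda_algebra K A P)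
      (yoneda_component K A P 1 \<union> yoneda_component K A P 2) = carrier (yoneda_algebra K A P)"
    using K2 by (auto simp: K2_algebra_def)
  interpret A: comm_graded_alg K A by unfold_locales (fact connA commA)+
  interpret B: comm_graded_alg K B by unfold_locales (fact connB commB)+
  have dec: "g \<in> additive_span A {a \<otimes>\<^bsub>A\<^esub> b | a b i j. 0 < i \<and> 0 < j \<and> i + j = d \<and> a \<in> part A i \<and> b \<in> part A j}" (is "_ \<in> additive_span A ?H")
  proof -
    obtain x where x: "\<And>i. i < N \<Longrightarrow> x i \<in> part A 1"
      and span: "\<And>m a. m \<ge> 1 \<Longrightarrow> a \<in> part A m \<Longrightarrow> a \<in> additive_span A {b \<otimes>\<^bsub>A\<^esub> x i | b i. b \<in> part A (m - 1) \<and> i < N}"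
      using presents_degree_one[OF connA pres] by blast
    have "b \<otimes>\<^bsub>A\<^esub> x i \<in> ?H" if "b \<in> part A (d - 1)" "i < N" for b i
      using that x[OF that(2)] g(2) by (intro CollectI exI[of _ b] exI[of _ "x i"] exI[of _ "d - 1"] exI[of _ 1]) auto
    then have sub: "{b \<otimes>\<^bsub>A\<^esub> x i | b i. b \<in> part A (d - 1) \<and> i < N} \<subseteq> ?H" by blast
    have "y \<in> additive_span A ?H" if "y \<in> additive_span A {b \<otimes>\<^bsub>A\<^esub> x i | b i. b \<in> part A (d - 1) \<and> i < N}" for y
      using that by induction (use sub in \<open>blast intro: additive_span.intros\<close>)+
    then show ?thesis using span[OF _ g(1)] g(2) by simp
  qed
  interpret H: hypersurface K A B \<pi> P g d
    by unfold_locales (use \<pi> P g dec in auto)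
  show ?thesis unfolding K2_algebra_def using gB H.PQ_resolution H.generated[OF gen] by blast
qed

lemma quotient_commutative:
  assumes "graded_ideal K A J" "commutative_algebra A"
  shows "commutative_algebra (quotient_algebra A J)"
proof -
  interpret graded_ideal K A J by fact
  show ?thesis using assms(2) by (auto simp: commutative_algebra_def Q_carrier Q_mult)
qed

theorem K2_quotient:
  assumes K2: "K2_algebra K A" and comm: "commutative_algebra A \<or> graded_commutative_algebra A"
    and g: "g \<in> part A d" "1 < d" "regular A g"
  shows "K2_algebra K (quotient_algebra A (g <#\<^bsub>A\<^esub> carrier A))"
proof -
  have ga: "graded_algebra K A" using K2 by (simp add: K2_algebra_def)
  have commA: "commutative_algebra A" using comm regular_commutative[OF ga _ g] by blast
  interpret A: comm_graded_alg K A
    by unfold_locales (use ga commA in \<open>simp_all add: graded_algebra_def\<close>)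
  have gc: "g \<in> carrier A" using A.part_carrier[OF g(1)] .
  let ?J = "g <#\<^bsub>A\<^esub> carrier A"
  have J: "?J = {g \<otimes>\<^bsub>A\<^esub> a | a. a \<in> carrier A}" by (auto simp: l_coset_def)
  have "?J = PIdl\<^bsub>A\<^esub> g" unfolding J cgenideal_def using gc A.m_comm by blast
  then have "ideal ?J A" using A.cgenideal_ideal[OF gc] by simp
  then have gi: "graded_ideal K A ?J" by (intro graded_ideal.intro A.graded_alg_axioms)
  interpret J: graded_ideal K A ?J by (rule gi)
  have "hcomp A m a \<in> ?J" if "a \<in> ?J" for a m
    using that A.hcomp_mult_left[OF _ g(1)] unfolding J by auto
  moreover have "?J \<noteq> carrier A"
  proof
    assume "?J = carrier A"
    then obtain a where a: "a \<in> carrier A" "\<one>\<^bsub>A\<^esub> = g \<otimes>\<^bsub>A\<^esub> a" unfolding J using A.one_closed by blast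
    have "\<one>\<^bsub>A\<^esub> = hcomp A 0 (g \<otimes>\<^bsub>A\<^esub> a)" using A.hcomp_homogeneous[OF A.one_part, of 0] a(2) by simp
    also have "\<dots> = g \<otimes>\<^bsub>A\<^esub> hcomp A (0 - d) a" by (rule A.hcomp_mult_left[OF a(1) g(1)])
    also have "hcomp A (0 - d) a = \<zero>\<^bsub>A\<^esub>" using A.hcomp_part[OF a(1), of "0 - d"] A.part_negative[of "0 - d"] g(2) by simp
    finally show False using A.one_neq_zero gc by simp
  qed
  ultimately have conn: "connected_graded_algebra K J.Q" by (rule J.Q_connected)
  show ?thesis
  proof (rule K2_hypersurface[OF K2 commA conn quotient_commutative[OF gi commA] J.coset_hom _ _ _ g])
    show "?J +>\<^bsub>A\<^esub> (c \<odot>\<^bsub>A\<^esub> a) = c \<odot>\<^bsub>J.Q\<^esub> (?J +>\<^bsub>A\<^esub> a)" if "c \<in> carrier K" "a \<in> carrier A" for c a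
      using J.Q_smult that by simp
    show "(\<lambda>a. ?J +>\<^bsub>A\<^esub> a) ` part A m = part J.Q m" for m by (simp add: J.Q_part)
    show "(?J +>\<^bsub>A\<^esub> a = \<zero>\<^bsub>J.Q\<^esub>) = (\<exists>b\<in>carrier A. a = g \<otimes>\<^bsub>A\<^esub> b)" if "a \<in> carrier A" for a
      using J.Q_zero_iff[OF that] unfolding J by blast
  qed
qed

section \<open>Polynomial algebras as quotients of tensor algebras\<close>

lemma (in monoid_algebra) M_commutative:
  assumes "\<And>u v. mul u v = mul v u"
  shows "commutative_algebra M"
proof -
  have "f \<otimes>\<^bsub>M\<^esub> g = g \<otimes>\<^bsub>M\<^esub> f" if f: "f \<in> finsupp K W" and g: "g \<in> finsupp K W" for f g
    using f
  proof (induction f rule: finsupp_induct)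
    case zero
    show ?case by (simp add: mult_zero_left[OF g] mult_zero_right[OF g])
  next
    case (add f f')
    then show ?case by (simp add: mult_add_left[OF _ _ g] mult_add_right[OF g])
  next
    case (single u c)
    note u = finsupp_single[OF single(2,1)] and c = single(2)
    show ?case using g
    proof (induction g rule: finsupp_induct)
      case zero
      show ?case by (simp add: mult_zero_left[OF u] mult_zero_right[OF u])
    next
      case (add g g')
      then show ?case by (simp add: mult_add_left[OF _ _ u] mult_add_right[OF u])
    next
      case (single v d)
      then show ?case using c by (simp add: mult_single m_comm assms[of u v])
    qed
  qed
  then show ?thesis by (simp add: commutative_algebra_def M_simps(1))
qed

locale polynomial_ring = field K for K :: "('k, 'z) ring_scheme" (structure) + fixes n :: nat
begin

abbreviation "S \<equiv> polynomial_algebra K n"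
abbreviation "T \<equiv> tensor_algebra K n"
abbreviation "Mon \<equiv> {u. set_mset u \<subseteq> {..<n}}"

sublocale S: monoid_algebra K S "(+)" "{#}" Mon size "\<lambda>u. {v. v \<subseteq># u}" "\<lambda>u v. v" "\<lambda>u v. u - v"
  by (rule polynomial_monoid_algebra)

sublocale T: monoid_algebra K T "(@)" "[]" "lists {..<n}" length "\<lambda>w. {..length w}" "\<lambda>w k. take k w" "\<lambda>w k. drop k w"
  by (rule tensor_monoid_algebra)

lemma S_commutative: "commutative_algebra S"
  by (rule S.M_commutative) (rule add.commute)

lemma variable_mult:
  assumes f: "f \<in> carrier S"
  shows "(single K {#j#} \<one> \<otimes>\<^bsub>S\<^esub> f) u = (if j \<in># u then f (u - {#j#}) else \<zero>)"
proof -
  have c: "f v \<in> carrier K" for v using finsuppD(1)[of f Mon] f by (simp add: S.M_simps)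
  have "(single K {#j#} \<one> \<otimes>\<^bsub>S\<^esub> f) u = (\<Oplus>v \<in> {v. v \<subseteq># u}. if {#j#} = v then f (u - v) else \<zero>)"
    unfolding S.M_mult by (rule finsum_cong') (use c in \<open>auto simp: single_def\<close>)
  also have "\<dots> = (if j \<in># u then f (u - {#j#}) else \<zero>)"
  proof (cases "j \<in># u")
    case True
    then show ?thesis using c finsum_singleton[of "{#j#}" "{v. v \<subseteq># u}" "\<lambda>v. f (u - v)"]
      by (simp add: finite_submultisets)
  next
    case False
    then have "(\<Oplus>v \<in> {v. v \<subseteq># u}. if {#j#} = v then f (u - v) else \<zero>) = (\<Oplus>v \<in> {v. v \<subseteq># u}. \<zero>)"
      by (intro finsum_cong') auto
    then show ?thesis using False by simp
  qed
  finally show ?thesis .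
qed

lemma finite_words: "finite {w. mset w = u}" for u :: "nat multiset"
  using mset_eq_finite[of "sorted_list_of_multiset u"] by simp

text \<open>Abelianization \<open>T(V) \<rightarrow> K[x\<^sub>0, \<dots>, x\<^sub>n\<^sub>-\<^sub>1]\<close>, which adds up the coefficients of all words that give
  the same monomial.\<close>

definition ab :: "(nat list \<Rightarrow> 'k) \<Rightarrow> nat multiset \<Rightarrow> 'k" where
  "ab f u = (\<Oplus>w \<in> {w. mset w = u}. f w)"

lemma ab_single: "c \<in> carrier K \<Longrightarrow> ab (single K w c) = single K (mset w) c"
proof
  fix u assume c: "c \<in> carrier K"
  have "ab (single K w c) u = (\<Oplus>w' \<in> {w. mset w = u}. if w = w' then c else \<zero>)"
    unfolding ab_def by (rule finsum_cong') (use c in \<open>auto simp: single_def\<close>)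
  also have "\<dots> = single K (mset w) c u"
  proof (cases "mset w = u")
    case True
    then show ?thesis using c finsum_singleton[of w "{w. mset w = u}" "\<lambda>_. c"] by (simp add: finite_words single_def)
  next
    case False
    then have "(\<Oplus>w' \<in> {w. mset w = u}. if w = w' then c else \<zero>) = (\<Oplus>w' \<in> {w. mset w = u}. \<zero>)"
      by (intro finsum_cong') auto
    then show ?thesis using False by (simp add: single_def)
  qed
  finally show "ab (single K w c) u = single K (mset w) c u" .
qed

lemma ab_zero: "ab (\<lambda>w. \<zero>) = (\<lambda>u. \<zero>)"
  by (rule ext) (simp add: ab_def)

lemma ab_add: "f \<in> finsupp K X \<Longrightarrow> g \<in> finsupp K X \<Longrightarrow> ab (\<lambda>w. f w \<oplus> g w) = (\<lambda>u. ab f u \<oplus> ab g u)"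
  using finsuppD(1)[of f X] finsuppD(1)[of g X] by (intro ext) (simp add: ab_def finsum_addf)

lemma ab_smult: "c \<in> carrier K \<Longrightarrow> f \<in> finsupp K X \<Longrightarrow> ab (\<lambda>w. c \<otimes> f w) = (\<lambda>u. c \<otimes> ab f u)"
  using finsuppD(1)[of f X] by (intro ext) (simp add: ab_def finsum_rdistr finite_words Pi_def)

lemma ab_part: "f \<in> part T m \<Longrightarrow> ab f \<in> part S m"
proof (induction f rule: T.part_induct)
  case (add f g)
  have "f \<in> finsupp K (lists {..<n})" "g \<in> finsupp K (lists {..<n})" using add(1,2) T.part_subset by (auto simp: T.M_simps)
  then show ?case using add(3,4) by (simp add: ab_add S.M_simps finsupp_add)
qed (auto simp: ab_single ab_zero S.M_simps finsupp_zero intro!: finsupp_single)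

lemma ab_part_onto: "ab ` part T m = part S m"
proof
  show "ab ` part T m \<subseteq> part S m" using ab_part by blast
  show "part S m \<subseteq> ab ` part T m"
  proof
    fix g assume "g \<in> part S m"
    then show "g \<in> ab ` part T m"
    proof (induction g rule: S.part_induct)
      case zero
      show ?case using ab_zero by (intro image_eqI[of _ _ "\<lambda>w. \<zero>"]) (simp_all add: T.M_simps finsupp_zero)
    next
      case (add g g')
      then obtain f f' where f: "f \<in> part T m" "g = ab f" "f' \<in> part T m" "g' = ab f'" by blast
      then have "f \<in> finsupp K (lists {..<n})" "f' \<in> finsupp K (lists {..<n})" using T.part_subset by (auto simp: T.M_simps)
      then show ?case using f
        by (intro image_eqI[of _ _ "\<lambda>w. f w \<oplus> f' w"]) (simp_all add: ab_add T.M_simps finsupp_add)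
    next
      case (single u c)
      then show ?case
        by (intro image_eqI[of _ _ "single K (sorted_list_of_multiset u) c"])
           (auto simp: ab_single T.M_simps intro!: finsupp_single simp flip: size_mset)
    qed
  qed
qed

lemma ab_closed: "f \<in> finsupp K (lists {..<n}) \<Longrightarrow> ab f \<in> finsupp K Mon"
  by (induction f rule: finsupp_induct) (auto simp: ab_single ab_zero ab_add finsupp_zero finsupp_add intro!: finsupp_single)

lemma ab_mult:
  assumes f: "f \<in> finsupp K (lists {..<n})" and g: "g \<in> finsupp K (lists {..<n})"
  shows "ab (f \<otimes>\<^bsub>T\<^esub> g) = ab f \<otimes>\<^bsub>S\<^esub> ab g"
  using f
proof (induction f rule: finsupp_induct)
  case zero
  show ?case by (simp add: T.mult_zero_left[OF g] ab_zero S.mult_zero_left[OF ab_closed[OF g]])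
next
  case (add f f')
  then show ?case
    by (simp add: T.mult_add_left[OF _ _ g] ab_add[OF add(1,2)] ab_add[OF T.mult_closed T.mult_closed] g
        S.mult_add_left[OF _ _ ab_closed[OF g]] ab_closed)
next
  case (single w c)
  note w = finsupp_single[OF single(2,1)] and c = single(2)
  show ?case using g
  proof (induction g rule: finsupp_induct)
    case zero
    show ?case by (simp add: T.mult_zero_right[OF w] ab_zero S.mult_zero_right[OF ab_closed[OF w]])
  next
    case (add g g')
    then show ?case
      by (simp add: T.mult_add_right[OF w] ab_add[OF add(1,2)] ab_add[OF T.mult_closed T.mult_closed] w
          S.mult_add_right[OF ab_closed[OF w]] ab_closed)
  next
    case (single v d)
    then show ?case using c by (simp add: T.mult_single S.mult_single ab_single)
  qed
qed

lemma ab_hom: "ab \<in> ring_hom T S"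
proof (rule ring_hom_memI)
  show "ab \<one>\<^bsub>T\<^esub> = \<one>\<^bsub>S\<^esub>" unfolding T.one_single S.one_single by (simp add: ab_single)
qed (simp_all add: T.M_simps S.M_simps ab_closed ab_mult ab_add)

definition commutators :: "(nat list \<Rightarrow> 'k) set" where
  "commutators = {single K [i, j] \<one> \<ominus>\<^bsub>T\<^esub> single K [j, i] \<one> | i j. i < n \<and> j < n}"

text \<open>Modulo the commutators, letters can be moved past each other, so every word is congruent to its
  sorted rearrangement.\<close>

lemma sort_congruent:
  assumes "w \<in> lists {..<n}" "c \<in> carrier K"
  shows "single K w c \<ominus>\<^bsub>T\<^esub> single K (sort w) c \<in> Idl\<^bsub>T\<^esub> commutators"
proof -
  interpret R: ring T by (rule T.M_ring)
  have carr: "single K w c \<in> carrier T" if "w \<in> lists {..<n}" "c \<in> carrier K" for w c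
    using that by (simp add: T.M_simps finsupp_single)
  have cc: "commutators \<subseteq> carrier T"
    unfolding commutators_def using carr by (auto intro!: R.minus_closed)
  interpret I: ideal "Idl\<^bsub>T\<^esub> commutators" T by (rule R.genideal_ideal[OF cc])
  let ?I = "Idl\<^bsub>T\<^esub> commutators"
  define E where "E v w \<longleftrightarrow> v \<in> lists {..<n} \<and> w \<in> lists {..<n} \<and>
    (\<forall>c \<in> carrier K. single K v c \<ominus>\<^bsub>T\<^esub> single K w c \<in> ?I)" for v w
  have refl: "E w w" if "w \<in> lists {..<n}" for w
    using that R.r_neg[OF carr] I.zero_closed by (simp add: E_def a_minus_def)
  have trans: "E u w" if uv: "E u v" "E v w" for u v w
  proof -
    have "single K u c \<ominus>\<^bsub>T\<^esub> single K w c \<in> ?I" if c: "c \<in> carrier K" for c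
    proof -
      have cs: "single K u c \<in> carrier T" "single K v c \<in> carrier T" "single K w c \<in> carrier T"
        using uv carr c by (simp_all add: E_def)
      have "(single K u c \<ominus>\<^bsub>T\<^esub> single K v c) \<oplus>\<^bsub>T\<^esub> (single K v c \<ominus>\<^bsub>T\<^esub> single K w c) \<in> ?I"
        using uv c unfolding E_def by (blast intro: I.a_closed)
      moreover have "(single K u c \<ominus>\<^bsub>T\<^esub> single K v c) \<oplus>\<^bsub>T\<^esub> (single K v c \<ominus>\<^bsub>T\<^esub> single K w c) = single K u c \<ominus>\<^bsub>T\<^esub> single K w c"
        using cs unfolding a_minus_def by (simp add: R.a_assoc R.r_neg2 R.r_neg1)
      ultimately show ?thesis by simp
    qed
    then show ?thesis using uv by (simp add: E_def)
  qed
  have cons: "E (i # v) (i # w)" if vw: "E v w" and i: "i < n" for i v w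
  proof -
    have "single K (i # v) c \<ominus>\<^bsub>T\<^esub> single K (i # w) c \<in> ?I" if c: "c \<in> carrier K" for c
    proof -
      have cs: "single K [i] \<one> \<in> carrier T" "single K v c \<in> carrier T" "single K w c \<in> carrier T"
        using vw i carr c by (simp_all add: E_def)
      have "single K [i] \<one> \<otimes>\<^bsub>T\<^esub> (single K v c \<ominus>\<^bsub>T\<^esub> single K w c) \<in> ?I"
        using vw c cs(1) unfolding E_def by (blast intro: I.I_l_closed)
      then show ?thesis using cs c by (simp add: a_minus_def R.r_distr R.r_minus T.mult_single)
    qed
    then show ?thesis using vw i by (simp add: E_def)
  qed
  have swap: "E (i # j # v) (j # i # v)" if ij: "i < n" "j < n" and v: "v \<in> lists {..<n}" for i j v
  proof -
    have "single K (i # j # v) c \<ominus>\<^bsub>T\<^esub> single K (j # i # v) c \<in> ?I" if c: "c \<in> carrier K" for c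
    proof -
      have cs: "single K [i, j] \<one> \<in> carrier T" "single K [j, i] \<one> \<in> carrier T" "single K v c \<in> carrier T"
        using ij v carr c by simp_all
      have "single K [i, j] \<one> \<ominus>\<^bsub>T\<^esub> single K [j, i] \<one> \<in> ?I"
        using R.genideal_self[OF cc] ij unfolding commutators_def by blast
      then have "(single K [i, j] \<one> \<ominus>\<^bsub>T\<^esub> single K [j, i] \<one>) \<otimes>\<^bsub>T\<^esub> single K v c \<in> ?I"
        using cs(3) by (rule I.I_r_closed)
      then show ?thesis using cs c by (simp add: a_minus_def R.l_distr R.l_minus T.mult_single)
    qed
    then show ?thesis using ij v by (simp add: E_def)
  qed
  have ins: "E (i # v) (insort i v)" if "v \<in> lists {..<n}" "i < n" for i v
    using that
  proof (induction v rule: list.induct)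
    case (Cons j v)
    then have "E (j # i # v) (j # insort i v)" by (intro cons) auto
    moreover have "E (i # j # v) (j # i # v)" using Cons by (intro swap) auto
    ultimately have "E (i # j # v) (j # insort i v)" by (rule trans[rotated])
    then show ?case using refl[of "i # j # v"] Cons(2,3) by simp
  qed (simp add: refl)
  have "E w (sort w)" using assms(1)
  proof (induction w)
    case (Cons i w)
    then have "E (i # w) (i # sort w)" "E (i # sort w) (insort i (sort w))" by (auto intro!: cons ins)
    then show ?case by (simp add: trans[of "i # w" "i # sort w"])
  qed (simp add: refl)
  then show ?thesis using assms(2) by (simp add: E_def)
qed

text \<open>A tensor is congruent modulo the commutators to the combination of sorted words with the
  coefficients of its image.\<close>

lemma ab_kernel:
  assumes f: "f \<in> carrier T"
  shows "ab f = \<zero>\<^bsub>S\<^esub> \<longleftrightarrow> f \<in> Idl\<^bsub>T\<^esub> commutators"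
proof -
  interpret R: ring T by (rule T.M_ring)
  interpret h: ring_hom_ring T S ab
    using ab_hom by (intro ring_hom_ring.intro T.M_ring S.M_ring ring_hom_ring_axioms.intro)
  have carr: "single K w c \<in> carrier T" if "w \<in> lists {..<n}" "c \<in> carrier K" for w c
    using that by (simp add: T.M_simps finsupp_single)
  have cc: "commutators \<subseteq> carrier T"
    unfolding commutators_def using carr by (auto intro!: R.minus_closed)
  interpret I: ideal "Idl\<^bsub>T\<^esub> commutators" T by (rule R.genideal_ideal[OF cc])
  define \<sigma> where "\<sigma> g w = (if sorted w then g (mset w) else \<zero>)" for g :: "nat multiset \<Rightarrow> 'k" and w
  have "f \<ominus>\<^bsub>T\<^esub> \<sigma> (ab f) \<in> Idl\<^bsub>T\<^esub> commutators \<and> \<sigma> (ab f) \<in> carrier T"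
    using f unfolding T.M_simps(1)
  proof (induction f rule: finsupp_induct)
    case zero
    have "\<sigma> (ab (\<lambda>w. \<zero>)) = \<zero>\<^bsub>T\<^esub>" by (simp add: ab_zero \<sigma>_def T.M_simps fun_eq_iff)
    then show ?case using R.r_neg[OF R.zero_closed] I.zero_closed by (simp add: a_minus_def T.M_simps finsupp_zero)
  next
    case (add u v)
    then have uv: "u \<in> carrier T" "v \<in> carrier T" "\<sigma> (ab u) \<in> carrier T" "\<sigma> (ab v) \<in> carrier T" by (simp_all add: T.M_simps)
    have s: "\<sigma> (ab (\<lambda>i. u i \<oplus> v i)) = \<sigma> (ab u) \<oplus>\<^bsub>T\<^esub> \<sigma> (ab v)" 
      by (auto simp: \<sigma>_def ab_add[OF add(1,2)] T.M_simps)
    have "(\<lambda>i. u i \<oplus> v i) \<ominus>\<^bsub>T\<^esub> \<sigma> (ab (\<lambda>i. u i \<oplus> v i)) = (u \<ominus>\<^bsub>T\<^esub> \<sigma> (ab u)) \<oplus>\<^bsub>T\<^esub> (v \<ominus>\<^bsub>T\<^esub> \<sigma> (ab v))"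
    proof -
      have "(\<lambda>i. u i \<oplus> v i) = u \<oplus>\<^bsub>T\<^esub> v" by (simp add: T.M_simps)
      then show ?thesis unfolding s using uv by (simp add: a_minus_def R.minus_add R.a_ac)
    qed
    then show ?case using add(3,4) I.a_closed s uv R.a_closed by (simp add: T.M_simps)
  next
    case (single w c)
    have "sorted x \<and> mset x = mset w \<longleftrightarrow> x = sort w" for x by (metis mset_sort sorted_sort properties_for_sort)
    then have "\<sigma> (single K (mset w) c) = single K (sort w) c" by (auto simp: \<sigma>_def single_def fun_eq_iff)
    then have "\<sigma> (ab (single K w c)) = single K (sort w) c" by (simp only: ab_single[OF single(2)])
    then show ?case using sort_congruent[OF single] single finsupp_single[of c "sort w" "lists {..<n}"]
      by (simp add: T.M_simps subset_iff in_lists_conv_set)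
  qed
  moreover have "\<sigma> \<zero>\<^bsub>S\<^esub> = \<zero>\<^bsub>T\<^esub>" by (simp add: \<sigma>_def S.M_simps T.M_simps fun_eq_iff)
  moreover have "f \<ominus>\<^bsub>T\<^esub> \<zero>\<^bsub>T\<^esub> = f" using f by (simp add: a_minus_def)
  ultimately have "f \<in> Idl\<^bsub>T\<^esub> commutators" if "ab f = \<zero>\<^bsub>S\<^esub>" using that by simp
  moreover have "Idl\<^bsub>T\<^esub> commutators \<subseteq> a_kernel T S ab"
  proof (rule R.genideal_minimal[OF h.kernel_is_ideal], rule subsetI)
    fix r assume r: "r \<in> commutators"
    then obtain i j where ij: "r = single K [i, j] \<one> \<ominus>\<^bsub>T\<^esub> single K [j, i] \<one>" "i < n" "j < n"
      unfolding commutators_def by blast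
    have cs: "single K [i, j] \<one> \<in> carrier T" "single K [j, i] \<one> \<in> carrier T" using ij(2,3) carr by simp_all
    have "ab r = ab (single K [i, j] \<one>) \<oplus>\<^bsub>S\<^esub> \<ominus>\<^bsub>S\<^esub> ab (single K [j, i] \<one>)"
      unfolding ij(1) a_minus_def using cs by simp
    also have "ab (single K [j, i] \<one>) = ab (single K [i, j] \<one>)" by (simp add: ab_single add_mset_commute)
    finally have "ab r = \<zero>\<^bsub>S\<^esub>" using h.hom_closed[OF cs(1)] h.S.r_neg by simp
    then show "r \<in> a_kernel T S ab" unfolding a_kernel_def' using subsetD[OF cc r] by simp
  qed
  then have "ab f = \<zero>\<^bsub>S\<^esub>" if "f \<in> Idl\<^bsub>T\<^esub> commutators" using subsetD[OF _ that] unfolding a_kernel_def' by blast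
  ultimately show ?thesis by blast
qed

lemma polynomial_presents: "presents K n commutators S ab"
proof -
  have "commutators = (\<lambda>(i, j). single K [i, j] \<one> \<ominus>\<^bsub>T\<^esub> single K [j, i] \<one>) ` ({..<n} \<times> {..<n})"
    by (auto simp: commutators_def)
  then have "finite commutators" by simp
  moreover have "\<exists>m \<ge> 2. r \<in> part T m" if "r \<in> commutators" for r
  proof -
    interpret T: graded_alg K T by unfold_locales (rule T.M_connected)
    obtain i j where ij: "r = single K [i, j] \<one> \<ominus>\<^bsub>T\<^esub> single K [j, i] \<one>" "i < n" "j < n"
      using \<open>r \<in> commutators\<close> unfolding commutators_def by blast
    have "single K [i, j] \<one> \<in> part T 2" "single K [j, i] \<one> \<in> part T 2"
      using ij(2,3) by (simp_all add: T.M_simps finsupp_single)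
    then have "r \<in> part T 2" unfolding ij(1) a_minus_def by blast
    then show ?thesis by blast
  qed
  moreover have "ab (c \<odot>\<^bsub>T\<^esub> t) = c \<odot>\<^bsub>S\<^esub> ab t" if "c \<in> carrier K" "t \<in> carrier T" for c t
    using that ab_smult[of c t] by (simp add: T.M_simps S.M_simps)
  ultimately show ?thesis unfolding presents_def Let_def using ab_hom ab_part_onto ab_kernel by blast
qed

end

section \<open>The Koszul resolution\<close>

text \<open>The Koszul differential squares to zero because variables commute and contractions anticommute. The
  vanishing of the diagonal is a separate condition in characteristic 2.\<close>

lemma (in abelian_group) antisymmetric_sum:
  assumes a: "\<And>j k. a j k \<in> carrier G" and "\<And>j. a j j = \<zero>" and "\<And>j k. a j k \<oplus> a k j = \<zero>"
  shows "(\<Oplus>j \<in> {..<N :: nat}. \<Oplus>k \<in> {..<N}. a j k) = \<zero>"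
proof (induction N)
  case (Suc N)
  have "(\<Oplus>k \<in> {..<N}. a N k) \<oplus> (\<Oplus>j \<in> {..<N}. a j N) = (\<Oplus>k \<in> {..<N}. a N k \<oplus> a k N)"
    by (rule finsum_addf[symmetric]) (use a in auto)
  also have "\<dots> = (\<Oplus>k \<in> {..<N}. \<zero>)" by (rule finsum_cong') (use assms in auto)
  finally have z: "(\<Oplus>k \<in> {..<N}. a N k) \<oplus> (\<Oplus>j \<in> {..<N}. a j N) = \<zero>" by simp
  have "(\<Oplus>j \<in> {..<N}. \<Oplus>k \<in> {..<Suc N}. a j k) = (\<Oplus>j \<in> {..<N}. a j N \<oplus> (\<Oplus>k \<in> {..<N}. a j k))"
    by (rule finsum_cong') (use a in \<open>auto simp: lessThan_Suc\<close>)
  also have "\<dots> = (\<Oplus>j \<in> {..<N}. a j N) \<oplus> (\<Oplus>j \<in> {..<N}. \<Oplus>k \<in> {..<N}. a j k)"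
    by (rule finsum_addf) (use a in auto)
  finally have s: "(\<Oplus>j \<in> {..<N}. \<Oplus>k \<in> {..<Suc N}. a j k) = (\<Oplus>j \<in> {..<N}. a j N)" using Suc a by simp
  have "(\<Oplus>j \<in> {..<Suc N}. \<Oplus>k \<in> {..<Suc N}. a j k) = (\<Oplus>k \<in> {..<Suc N}. a N k) \<oplus> (\<Oplus>j \<in> {..<N}. \<Oplus>k \<in> {..<Suc N}. a j k)"
    using finsum_insert[of "{..<N}" N "\<lambda>j. \<Oplus>k \<in> {..<Suc N}. a j k"] a by (simp add: lessThan_Suc[of N])
  also have "(\<Oplus>k \<in> {..<Suc N}. a N k) = (\<Oplus>k \<in> {..<N}. a N k)" using a assms(2) by (simp add: lessThan_Suc)
  finally show ?case unfolding s using z by simp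
qed simp

abbreviation "dec \<equiv> set_decode"

definition ins :: "nat \<Rightarrow> nat \<Rightarrow> nat" where "ins j i = set_encode (insert j (dec i))"
definition rem :: "nat \<Rightarrow> nat \<Rightarrow> nat" where "rem j i = set_encode (dec i - {j})"
definition above :: "nat \<Rightarrow> nat \<Rightarrow> nat" where "above j i = card {k \<in> dec i. j < k}"

lemma dec_ins [simp]: "dec (ins j i) = insert j (dec i)" by (simp add: ins_def set_encode_inverse)
lemma dec_rem [simp]: "dec (rem j i) = dec i - {j}" by (simp add: rem_def set_encode_inverse)
lemma dec_inj: "dec i = dec k \<Longrightarrow> i = k" by (metis set_decode_inverse)

lemma ins_commute: "ins j (ins k i) = ins k (ins j i)" by (rule dec_inj) auto
lemma ins_rem: "j \<in> dec i \<Longrightarrow> ins j (rem j i) = i" by (rule dec_inj) auto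
lemma rem_ins: "j \<notin> dec i \<Longrightarrow> rem j (ins j i) = i" by (rule dec_inj) auto
lemma rem_ins_commute: "j \<noteq> m \<Longrightarrow> rem m (ins j i) = ins j (rem m i)" by (rule dec_inj) auto

lemma above_ins: "k \<notin> dec i \<Longrightarrow> above j (ins k i) = (if j < k then Suc (above j i) else above j i)"
proof -
  assume k: "k \<notin> dec i"
  have "{l \<in> dec (ins k i). j < l} = (if j < k then insert k {l \<in> dec i. j < l} else {l \<in> dec i. j < l})" by auto
  then show ?thesis using k by (simp add: above_def)
qed

lemma above_eq_0: "(\<And>k. k \<in> dec i \<Longrightarrow> k \<le> j) \<Longrightarrow> above j i = 0"
proof -
  assume "\<And>k. k \<in> dec i \<Longrightarrow> k \<le> j"
  then have "{k \<in> dec i. j < k} = {}" by fastforce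
  then show ?thesis by (simp add: above_def)
qed

text \<open>A polynomial algebra up to isomorphism. The isomorphism matters for \<open>S/(0)\<close>, whose elements are
  cosets and which is the quotient for the empty regular sequence.\<close>

locale koszul = comm_graded_alg K A + PR: polynomial_ring K n
  for K :: "('k, 'z) ring_scheme" and A :: "('k, 'a) graded" (structure) and n :: nat +
  fixes p :: "(nat multiset \<Rightarrow> 'k) \<Rightarrow> 'a"
  assumes p_hom: "p \<in> ring_hom PR.S A"
    and p_smult: "\<And>c f. c \<in> carrier K \<Longrightarrow> f \<in> carrier PR.S \<Longrightarrow> p (c \<odot>\<^bsub>PR.S\<^esub> f) = c \<odot> p f"
    and p_part: "\<And>m. p ` part PR.S m = part A m"
    and p_onto: "p ` carrier PR.S = carrier A" and p_inj: "inj_on p (carrier PR.S)"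
begin

definition co :: "'a \<Rightarrow> nat multiset \<Rightarrow> 'k" where "co = inv_into (carrier PR.S) p"

lemma co_closed: "a \<in> carrier A \<Longrightarrow> co a \<in> carrier PR.S"
  unfolding co_def p_onto[symmetric] by (rule inv_into_into)
lemma p_co: "a \<in> carrier A \<Longrightarrow> p (co a) = a"
  using f_inv_into_f[of a p "carrier PR.S"] by (simp add: co_def p_onto)
lemma co_p: "f \<in> carrier PR.S \<Longrightarrow> co (p f) = f"
  unfolding co_def by (rule inv_into_f_f[OF p_inj])
lemma co_inj: "a \<in> carrier A \<Longrightarrow> b \<in> carrier A \<Longrightarrow> co a = co b \<Longrightarrow> a = b"
  by (metis p_co)
lemma p_closed: "f \<in> carrier PR.S \<Longrightarrow> p f \<in> carrier A" using p_onto by blast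

lemma co_val [simp, intro]: "a \<in> carrier A \<Longrightarrow> co a u \<in> carrier K"
  using co_closed[of a] K.finsuppD(1)[of "co a"] by (simp add: PR.S.M_simps)

lemma co_outside: "a \<in> carrier A \<Longrightarrow> \<not> set_mset u \<subseteq> {..<n} \<Longrightarrow> co a u = \<zero>\<^bsub>K\<^esub>"
  using co_closed[of a] K.finsuppD(3)[of "co a" PR.Mon u] by (simp add: PR.S.M_simps)

lemma co_add: "a \<in> carrier A \<Longrightarrow> b \<in> carrier A \<Longrightarrow> co (a \<oplus> b) u = co a u \<oplus>\<^bsub>K\<^esub> co b u"
proof -
  assume a: "a \<in> carrier A" and b: "b \<in> carrier A"
  have "co a \<oplus>\<^bsub>PR.S\<^esub> co b \<in> carrier PR.S" using co_closed[OF a] co_closed[OF b] by (simp add: PR.S.M_simps K.finsupp_add)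
  moreover have "p (co a \<oplus>\<^bsub>PR.S\<^esub> co b) = a \<oplus> b"
    using ring_hom_add[OF p_hom] co_closed a b by (simp add: p_co)
  ultimately have "co (a \<oplus> b) = co a \<oplus>\<^bsub>PR.S\<^esub> co b" using co_p by fastforce
  then show ?thesis by (simp add: PR.S.M_simps)
qed

lemma co_zero [simp]: "co \<zero> u = \<zero>\<^bsub>K\<^esub>"
proof -
  have "co \<zero> u \<oplus>\<^bsub>K\<^esub> co \<zero> u = co \<zero> u \<oplus>\<^bsub>K\<^esub> \<zero>\<^bsub>K\<^esub>" using co_add[OF zero_closed zero_closed, of u] by simp
  then show ?thesis by simp
qed

lemma co_uminus: "a \<in> carrier A \<Longrightarrow> co (\<ominus> a) u = \<ominus>\<^bsub>K\<^esub> co a u"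
  using co_add[of a "\<ominus> a" u] by (intro K.minus_equality[symmetric]) (simp_all add: r_neg K.a_comm)

lemma co_finsum:
  assumes "finite F" "\<And>i. i \<in> F \<Longrightarrow> c i \<in> carrier A"
  shows "co (\<Oplus>i \<in> F. c i) u = (\<Oplus>\<^bsub>K\<^esub>i \<in> F. co (c i) u)"
  using assms
proof (induction F)
  case (insert x F)
  then have "c \<in> F \<rightarrow> carrier A" "c x \<in> carrier A" by auto
  then show ?case using insert co_add by (simp add: Pi_def)
qed simp

definition x :: "nat \<Rightarrow> 'a" where "x j = p (single K {#j#} \<one>\<^bsub>K\<^esub>)"

lemma x_part: "j < n \<Longrightarrow> x j \<in> part A 1"
  unfolding x_def p_part[symmetric] using PR.S.single_part[of "{#j#}" "\<one>\<^bsub>K\<^esub>"] by (intro imageI) simp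

lemma x_closed [simp, intro]: "j < n \<Longrightarrow> x j \<in> carrier A" using x_part part_carrier by blast

lemma co_x: "j < n \<Longrightarrow> a \<in> carrier A \<Longrightarrow> co (x j \<otimes> a) u = (if j \<in># u then co a (u - {#j#}) else \<zero>\<^bsub>K\<^esub>)"
proof -
  assume j: "j < n" and a: "a \<in> carrier A"
  have s: "single K {#j#} \<one>\<^bsub>K\<^esub> \<in> carrier PR.S" using j by (simp add: PR.S.M_simps K.finsupp_single)
  have "p (single K {#j#} \<one>\<^bsub>K\<^esub> \<otimes>\<^bsub>PR.S\<^esub> co a) = x j \<otimes> a"
    using ring_hom_mult[OF p_hom s co_closed[OF a]] a by (simp add: x_def p_co)
  moreover have "single K {#j#} \<one>\<^bsub>K\<^esub> \<otimes>\<^bsub>PR.S\<^esub> co a \<in> carrier PR.S"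
    using s co_closed[OF a] by (simp add: PR.S.M_simps(1) PR.S.mult_closed)
  ultimately have "co (x j \<otimes> a) = single K {#j#} \<one>\<^bsub>K\<^esub> \<otimes>\<^bsub>PR.S\<^esub> co a" using co_p by fastforce
  then show ?thesis using PR.variable_mult[OF co_closed[OF a]] by simp
qed

lemma aug_co: "a \<in> carrier A \<Longrightarrow> aug a = co a {#}"
proof (rule aug_unique[where h = "\<lambda>a. co a {#}", symmetric])
  show "co a {#} = \<zero>\<^bsub>K\<^esub>" if ai: "a \<in> part A i" "i \<noteq> 0" for a i
  proof -
    obtain f where f: "f \<in> part PR.S i" "a = p f" using ai(1) unfolding p_part[symmetric] by (rule imageE)
    have "co a = f" unfolding f(2) by (rule co_p[OF subsetD[OF PR.S.part_subset f(1)]])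
    then show ?thesis using f(1) ai(2) by (auto simp: PR.S.M_simps finsupp_def)
  qed
  show "co (c \<odot> \<one>) {#} = c" if c: "c \<in> carrier K" for c
  proof -
    have o: "\<one>\<^bsub>PR.S\<^esub> \<in> carrier PR.S" unfolding PR.S.one_single PR.S.M_simps(1) by (rule K.finsupp_single) simp_all
    have "p (c \<odot>\<^bsub>PR.S\<^esub> \<one>\<^bsub>PR.S\<^esub>) = c \<odot> \<one>" using p_smult[OF c o] ring_hom_one[OF p_hom] by simp
    moreover have "c \<odot>\<^bsub>PR.S\<^esub> \<one>\<^bsub>PR.S\<^esub> \<in> carrier PR.S" by (rule module.smult_closed[OF PR.S.M_module c o])
    ultimately have "co (c \<odot> \<one>) = c \<odot>\<^bsub>PR.S\<^esub> \<one>\<^bsub>PR.S\<^esub>" using co_p by fastforce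
    then show ?thesis using c by (simp add: PR.S.M_simps)
  qed
qed (simp_all add: co_add)

definition sn :: "nat \<Rightarrow> 'a" where "sn k = (if even k then \<one> else \<ominus> \<one>)"

lemma sn_closed [simp, intro]: "sn k \<in> carrier A" by (simp add: sn_def)
lemma sn_0 [simp]: "sn 0 = \<one>" by (simp add: sn_def)
lemma sn_Suc: "sn (Suc k) = \<ominus> sn k" by (simp add: sn_def)
lemma sn_part: "sn k \<in> part A 0" using one_part by (auto simp: sn_def)
lemma sn_add: "sn k \<otimes> sn l = sn (k + l)" by (auto simp: sn_def l_minus)

lemma sn_sn: "a \<in> carrier A \<Longrightarrow> sn k \<otimes> (sn l \<otimes> a) = sn (k + l) \<otimes> a"
  by (simp add: sn_add flip: m_assoc)

definition ks :: "nat \<Rightarrow> 'k \<Rightarrow> 'k" where "ks k c = (if even k then c else \<ominus>\<^bsub>K\<^esub> c)"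

lemma co_sn: "a \<in> carrier A \<Longrightarrow> co (sn k \<otimes> a) u = ks k (co a u)"
  by (simp add: sn_def ks_def l_minus co_uminus)

text \<open>A basis element of the Koszul complex is a finite set of variables, coded as a number; \<open>pd j\<close>
  is the contraction with the \<open>j\<close>-th coordinate form, so that the Koszul differential \<open>kd\<close> is the
  sum of the \<open>x\<^sub>j\<close> times these. The sign counts the larger elements of the set; there is no sign for its
  largest element, on which the homotopy below acts.\<close>

definition pd :: "nat \<Rightarrow> (nat \<Rightarrow> 'a) \<Rightarrow> nat \<Rightarrow> 'a" where
  "pd j v i = (if j \<in> dec i then \<zero> else sn (above j i) \<otimes> v (ins j i))"

definition kd :: "(nat \<Rightarrow> 'a) \<Rightarrow> nat \<Rightarrow> 'a" where
  "kd v i = (\<Oplus>j \<in> {..<n}. x j \<otimes> pd j v i)"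

definition Xk :: "nat \<Rightarrow> nat set" where
  "Xk q = {i. dec i \<subseteq> {..<n} \<and> card (dec i) = q}"

abbreviation "KP q \<equiv> free_module A (Xk q) (\<lambda>_. int q)"

lemma pd_closed: "(\<And>i. v i \<in> carrier A) \<Longrightarrow> pd j v i \<in> carrier A" by (simp add: pd_def)

lemma kd_closed: "(\<And>i. v i \<in> carrier A) \<Longrightarrow> kd v i \<in> carrier A"
  unfolding kd_def by (rule finsum_closed) (auto intro: pd_closed)

lemma pd_add: "(\<And>i. u i \<in> carrier A) \<Longrightarrow> (\<And>i. v i \<in> carrier A) \<Longrightarrow> pd j (\<lambda>i. u i \<oplus> v i) i = pd j u i \<oplus> pd j v i"
  by (simp add: pd_def r_distr)

lemma pd_smult: "a \<in> carrier A \<Longrightarrow> (\<And>i. v i \<in> carrier A) \<Longrightarrow> pd j (\<lambda>i. a \<otimes> v i) i = a \<otimes> pd j v i"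
  by (simp add: pd_def m_lcomm)

lemma kd_add:
  assumes "\<And>i. u i \<in> carrier A" "\<And>i. v i \<in> carrier A"
  shows "kd (\<lambda>i. u i \<oplus> v i) i = kd u i \<oplus> kd v i"
proof -
  have "kd (\<lambda>i. u i \<oplus> v i) i = (\<Oplus>j \<in> {..<n}. x j \<otimes> pd j u i \<oplus> x j \<otimes> pd j v i)"
    unfolding kd_def by (rule finsum_cong') (use assms in \<open>auto simp: pd_add r_distr pd_closed\<close>)
  then show ?thesis unfolding kd_def using assms by (subst finsum_addf[symmetric]) (auto simp: pd_closed)
qed

lemma kd_smult:
  assumes "a \<in> carrier A" "\<And>i. v i \<in> carrier A"
  shows "kd (\<lambda>i. a \<otimes> v i) i = a \<otimes> kd v i"
proof -
  have "kd (\<lambda>i. a \<otimes> v i) i = (\<Oplus>j \<in> {..<n}. a \<otimes> (x j \<otimes> pd j v i))"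
    unfolding kd_def by (rule finsum_cong') (use assms in \<open>auto simp: pd_smult m_lcomm pd_closed\<close>)
  then show ?thesis unfolding kd_def using assms by (subst finsum_rdistr) (auto simp: pd_closed)
qed

lemma pd_pd_less:
  assumes "j < k" "\<And>i. v i \<in> carrier A"
  shows "pd j (pd k v) i = \<ominus> pd k (pd j v) i"
proof (cases "j \<in> dec i \<or> k \<in> dec i")
  case True
  then show ?thesis by (auto simp: pd_def)
next
  case False
  have "pd j (pd k v) i = sn (above j i + above k i) \<otimes> v (ins k (ins j i))"
    using False assms above_ins[of j i k] by (simp add: pd_def sn_sn)
  moreover have "pd k (pd j v) i = sn (Suc (above j i + above k i)) \<otimes> v (ins k (ins j i))"
    using False assms above_ins[of k i j] by (simp add: pd_def sn_sn ins_commute[of j k] add.commute)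
  ultimately show ?thesis using assms by (simp add: sn_Suc l_minus)
qed

lemma pd_pd:
  assumes "\<And>i. v i \<in> carrier A"
  shows "pd j (pd k v) i = \<ominus> pd k (pd j v) i" "pd j (pd j v) i = \<zero>"
proof -
  show z: "pd j (pd j v) i = \<zero>" for j by (simp add: pd_def)
  show "pd j (pd k v) i = \<ominus> pd k (pd j v) i"
    using pd_pd_less[of j k v i] pd_pd_less[of k j v i] assms z[of j] pd_closed
    by (cases j k rule: linorder_cases) auto
qed

lemma pd_kd:
  assumes v: "\<And>i. v i \<in> carrier A"
  shows "pd j (kd v) i = (\<Oplus>k \<in> {..<n}. x k \<otimes> pd j (pd k v) i)"
proof (cases "j \<in> dec i")
  case True
  then have "(\<Oplus>k \<in> {..<n}. x k \<otimes> pd j (pd k v) i) = (\<Oplus>k \<in> {..<n}. \<zero>)"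
    by (intro finsum_cong') (auto simp: pd_def)
  then show ?thesis using True by (simp add: pd_def)
next
  case False
  have "pd j (kd v) i = (\<Oplus>k \<in> {..<n}. sn (above j i) \<otimes> (x k \<otimes> pd k v (ins j i)))"
    using False v unfolding pd_def[of j "kd v"] kd_def by (simp add: finsum_rdistr pd_closed Pi_def)
  also have "\<dots> = (\<Oplus>k \<in> {..<n}. x k \<otimes> pd j (pd k v) i)"
    by (rule finsum_cong') (use False v in \<open>auto simp: pd_def[of j "pd _ v"] m_lcomm pd_closed\<close>)
  finally show ?thesis .
qed

lemma kd_pd:
  assumes v: "\<And>i. v i \<in> carrier A"
  shows "kd (pd j v) i = \<ominus> pd j (kd v) i"
proof -
  have "kd (pd j v) i \<oplus> pd j (kd v) i = (\<Oplus>k \<in> {..<n}. x k \<otimes> pd k (pd j v) i \<oplus> x k \<otimes> pd j (pd k v) i)"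
    unfolding pd_kd[where v = v, OF v] kd_def by (rule finsum_addf[symmetric]) (auto intro!: pd_closed v)
  also have "\<dots> = (\<Oplus>k \<in> {..<n}. \<zero>)"
  proof (rule finsum_cong')
    fix k assume "k \<in> {..<n}"
    then have c: "x k \<in> carrier A" "pd j (pd k v) i \<in> carrier A" by (auto intro!: pd_closed v)
    show "x k \<otimes> pd k (pd j v) i \<oplus> x k \<otimes> pd j (pd k v) i = \<zero>"
      unfolding pd_pd(1)[where v = v and j = k and k = j and i = i, OF v] using c by (simp add: r_minus l_neg)
  qed auto
  finally show ?thesis by (intro minus_equality[symmetric]) (auto intro!: pd_closed kd_closed v)
qed

lemma kd_kd:
  assumes v: "\<And>i. v i \<in> carrier A"
  shows "kd (kd v) i = \<zero>"
proof -
  let ?a = "\<lambda>j k. if j < n \<and> k < n then x j \<otimes> (x k \<otimes> pd j (pd k v) i) else \<zero>"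
  have c: "pd j (pd k v) i \<in> carrier A" for j k i by (intro pd_closed v)
  have "kd (kd v) i = (\<Oplus>j \<in> {..<n}. \<Oplus>k \<in> {..<n}. ?a j k)"
    unfolding kd_def[of "kd v"]
  proof (rule finsum_cong')
    fix j assume j: "j \<in> {..<n}"
    have "x j \<otimes> pd j (kd v) i = (\<Oplus>k \<in> {..<n}. x j \<otimes> (x k \<otimes> pd j (pd k v) i))"
      unfolding pd_kd[where v = v, OF v] by (rule finsum_rdistr) (use j c in auto)
    also have "\<dots> = (\<Oplus>k \<in> {..<n}. ?a j k)" by (rule finsum_cong') (use j c in auto)
    finally show "x j \<otimes> pd j (kd v) i = (\<Oplus>k \<in> {..<n}. ?a j k)" .
  qed (use c in \<open>auto intro!: finsum_closed\<close>)
  also have "\<dots> = \<zero>"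
  proof (rule antisymmetric_sum)
    fix j k
    show "?a j k \<in> carrier A" using c by auto
    show "?a j j = \<zero>" by (simp add: pd_pd(2)[where v = v, OF v])
    have "x j \<otimes> (x k \<otimes> pd j (pd k v) i) \<oplus> x k \<otimes> (x j \<otimes> pd k (pd j v) i) = \<zero>" if "j < n" "k < n"
      unfolding pd_pd(1)[where v = v and j = k and k = j and i = i, OF v] using that c[of j k i] by (simp add: r_minus m_lcomm[of "x k"] r_neg)
    then show "?a j k \<oplus> ?a k j = \<zero>" by simp
  qed
  finally show ?thesis .
qed

text \<open>The contracting homotopy moves the largest variable of a monomial multiple of a basis element from
  the coefficient to the basis element; multiples whose basis element already contains this variable
  go to zero. The definition gives the coefficients of the result.\<close>

definition hh :: "(nat \<Rightarrow> 'a) \<Rightarrow> nat \<Rightarrow> 'a" where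
  "hh v i = p (\<lambda>u. let m = Max (dec i \<union> set_mset u) in
     if m \<in> dec i then co (v (rem m i)) (add_mset m u) else \<zero>\<^bsub>K\<^esub>)"

lemma hh_co:
  assumes v: "\<And>i. v i \<in> carrier A"
  shows "hh v i \<in> carrier A"
    and "co (hh v i) u = (let m = Max (dec i \<union> set_mset u) in
     if m \<in> dec i then co (v (rem m i)) (add_mset m u) else \<zero>\<^bsub>K\<^esub>)"
proof -
  let ?f = "\<lambda>u. let m = Max (dec i \<union> set_mset u) in if m \<in> dec i then co (v (rem m i)) (add_mset m u) else \<zero>\<^bsub>K\<^esub>"
  have "?f \<in> finsupp K PR.Mon"
  proof (rule K.finsuppI)
    show "?f u \<in> carrier K" for u using v by (simp add: Let_def)
    show "?f u = \<zero>\<^bsub>K\<^esub>" if "u \<notin> PR.Mon" for u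
    proof -
      have "\<not> set_mset (add_mset m u) \<subseteq> {..<n}" for m using that by simp
      then show ?thesis using co_outside[OF v] by (simp add: Let_def del: set_mset_add_mset_insert)
    qed
    have "{u. ?f u \<noteq> \<zero>\<^bsub>K\<^esub>} \<subseteq> (\<Union>m \<in> dec i. (\<lambda>u. u - {#m#}) ` {u. co (v (rem m i)) u \<noteq> \<zero>\<^bsub>K\<^esub>})"
    proof
      fix u assume "u \<in> {u. ?f u \<noteq> \<zero>\<^bsub>K\<^esub>}"
      then obtain m where "m \<in> dec i" "co (v (rem m i)) (add_mset m u) \<noteq> \<zero>\<^bsub>K\<^esub>"
        by (auto simp: Let_def split: if_splits)
      moreover have "u = add_mset m u - {#m#}" by simp
      ultimately show "u \<in> (\<Union>m \<in> dec i. (\<lambda>u. u - {#m#}) ` {u. co (v (rem m i)) u \<noteq> \<zero>\<^bsub>K\<^esub>})" by blast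
    qed
    moreover have "finite {u. co (v (rem m i)) u \<noteq> \<zero>\<^bsub>K\<^esub>}" for m
      using K.finsuppD(2)[of "co (v (rem m i))" PR.Mon] co_closed[OF v] by (simp add: PR.S.M_simps)
    ultimately show "finite {u. ?f u \<noteq> \<zero>\<^bsub>K\<^esub>}" by (auto intro: finite_subset)
  qed
  then have f: "?f \<in> carrier PR.S" by (simp add: PR.S.M_simps)
  show "hh v i \<in> carrier A" unfolding hh_def by (rule p_closed[OF f])
  show "co (hh v i) u = ?f u" unfolding hh_def co_p[OF f] by (rule refl)
qed

lemma co_kd:
  assumes v: "\<And>i. v i \<in> carrier A"
  shows "co (kd v i) u = (\<Oplus>\<^bsub>K\<^esub>j \<in> {..<n}.
    if j \<in># u \<and> j \<notin> dec i then ks (above j i) (co (v (ins j i)) (u - {#j#})) else \<zero>\<^bsub>K\<^esub>)"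
proof -
  have "co (kd v i) u = (\<Oplus>\<^bsub>K\<^esub>j \<in> {..<n}. co (x j \<otimes> pd j v i) u)"
    unfolding kd_def by (rule co_finsum) (auto intro: pd_closed v)
  also have "\<dots> = (\<Oplus>\<^bsub>K\<^esub>j \<in> {..<n}. if j \<in># u \<and> j \<notin> dec i then ks (above j i) (co (v (ins j i)) (u - {#j#})) else \<zero>\<^bsub>K\<^esub>)"
    by (rule K.finsum_cong') (use v in \<open>auto simp: co_x pd_closed pd_def co_sn ks_def\<close>)
  finally show ?thesis .
qed

lemma homotopy:
  assumes v: "\<And>i. v i \<in> carrier A" and i: "dec i \<subseteq> {..<n}" and u: "set_mset u \<subseteq> {..<n}"
    and ne: "dec i \<noteq> {} \<or> u \<noteq> {#}"
  shows "co (kd (hh v) i) u \<oplus>\<^bsub>K\<^esub> co (hh (kd v) i) u = co (v i) u"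
proof -
  define m where "m = Max (dec i \<union> set_mset u)"
  have fin: "finite (dec i \<union> set_mset u)" by simp
  have m: "m \<in> dec i \<union> set_mset u" unfolding m_def by (rule Max_in[OF fin]) (use ne in auto)
  have max: "k \<le> m" if "k \<in> dec i \<union> set_mset u" for k unfolding m_def by (rule Max_ge[OF fin that])
  have mn: "m \<in> {..<n}" using m i u by blast
  have step: "co (hh v (ins j i)) (u - {#j#}) =
      (if m \<in> insert j (dec i) then co (v (rem m (ins j i))) (add_mset m (u - {#j#})) else \<zero>\<^bsub>K\<^esub>)" if "j \<in># u" for j
  proof -
    have "set_mset u = insert j (set_mset (u - {#j#}))" using insert_DiffM[OF that] by (metis set_mset_add_mset_insert)
    then have "dec (ins j i) \<union> set_mset (u - {#j#}) = dec i \<union> set_mset u" by auto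
    then show ?thesis using hh_co(2)[where v = v, OF v, of "ins j i" "u - {#j#}"] by (simp add: m_def Let_def)
  qed
  define s where "s j = (if j \<in># u \<and> j \<notin> dec i then ks (above j i) (co (hh v (ins j i)) (u - {#j#})) else \<zero>\<^bsub>K\<^esub>)" for j
  have s: "co (kd (hh v) i) u = (\<Oplus>\<^bsub>K\<^esub>j \<in> {..<n}. s j)" unfolding s_def by (rule co_kd[where v = "hh v", OF hh_co(1)[where v = v, OF v]])
  have sc: "s j \<in> carrier K" for j using hh_co(1)[where v = v, OF v] by (simp add: s_def ks_def)
  have single: "(\<Oplus>\<^bsub>K\<^esub>j \<in> {..<n}. if m = j then co (v i) u else \<zero>\<^bsub>K\<^esub>) = co (v i) u"
    using K.finsum_singleton[OF mn, of "\<lambda>_. co (v i) u"] v by simp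
  have above_m: "above m i = 0" by (rule above_eq_0) (use max in blast)
  have h: "co (hh (kd v) i) u = (if m \<in> dec i then co (kd v (rem m i)) (add_mset m u) else \<zero>\<^bsub>K\<^esub>)"
    unfolding hh_co(2)[where v = "kd v", OF kd_closed[where v = v, OF v]] by (simp add: m_def Let_def)
  show ?thesis
  proof (cases "m \<in> dec i")
    case False
    have "s j = (if m = j then co (v i) u else \<zero>\<^bsub>K\<^esub>)" for j
      using False m step[of j] above_m by (auto simp: s_def ks_def rem_ins)
    then show ?thesis using s single h False v by simp
  next
    case True
    define t where "t j = (if j \<in># add_mset m u \<and> j \<notin> dec (rem m i) then
      ks (above j (rem m i)) (co (v (ins j (rem m i))) (add_mset m u - {#j#})) else \<zero>\<^bsub>K\<^esub>)" for j
    have t: "co (kd v (rem m i)) (add_mset m u) = (\<Oplus>\<^bsub>K\<^esub>j \<in> {..<n}. t j)" unfolding t_def by (rule co_kd[where v = v, OF v])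
    have tc: "t j \<in> carrier K" for j using v by (simp add: t_def ks_def)
    have "s j \<oplus>\<^bsub>K\<^esub> t j = (if m = j then co (v i) u else \<zero>\<^bsub>K\<^esub>)" for j
    proof (cases "m = j")
      case mj: True
      have "above m (rem m i) = 0" by (rule above_eq_0) (use max in auto)
      then have "t j = co (v i) u" using True mj ins_rem[OF True] by (simp add: t_def ks_def)
      then show ?thesis using True mj v by (simp add: s_def)
    next
      case mj: False
      show ?thesis
      proof (cases "j \<in># u \<and> j \<notin> dec i")
        case ju: True
        have "j < m" using max[of j] ju mj by simp
        then have "above j i = Suc (above j (rem m i))" using above_ins[of m "rem m i" j] ins_rem[OF True] by simp
        moreover have "rem m (ins j i) = ins j (rem m i)" using mj by (intro rem_ins_commute) simp
        moreover have "add_mset m u - {#j#} = add_mset m (u - {#j#})" using ju mj by (simp add: diff_union_swap2)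
        ultimately show ?thesis using ju mj True step[of j] v by (simp add: s_def t_def ks_def K.l_neg K.r_neg)
      next
        case False
        then show ?thesis using mj by (auto simp: s_def t_def)
      qed
    qed
    then have "(\<Oplus>\<^bsub>K\<^esub>j \<in> {..<n}. s j \<oplus>\<^bsub>K\<^esub> t j) = co (v i) u" using single by simp
    then show ?thesis using s t h True sc tc by (simp add: K.finsum_addf Pi_def)
  qed
qed

end

context koszul
begin

lemma finite_Xk: "finite (Xk q)"
proof (rule finite_subset)
  show "Xk q \<subseteq> set_encode ` Pow {..<n}"
  proof
    fix i assume "i \<in> Xk q"
    then have "set_encode (dec i) \<in> set_encode ` Pow {..<n}" by (intro imageI) (simp add: Xk_def)
    then show "i \<in> set_encode ` Pow {..<n}" by simp
  qed
qed simp

lemma finsupp_Xk: "(\<And>i. v i \<in> carrier A) \<Longrightarrow> (\<And>i. i \<notin> Xk q \<Longrightarrow> v i = \<zero>) \<Longrightarrow> v \<in> finsupp A (Xk q)"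
  by (rule finsuppI) (auto intro: finite_subset[OF _ finite_Xk[of q]])

lemma pd_outside:
  assumes v: "v \<in> finsupp A (Xk q)" and i: "\<And>j. j \<notin> dec i \<Longrightarrow> ins j i \<notin> Xk q"
  shows "pd j v i = \<zero>"
  using finsuppD(3)[OF v i] by (simp add: pd_def)

lemma kd_outside:
  assumes v: "v \<in> finsupp A (Xk q)" and i: "\<And>j. j \<notin> dec i \<Longrightarrow> ins j i \<notin> Xk q"
  shows "kd v i = \<zero>"
proof -
  have "kd v i = (\<Oplus>j \<in> {..<n}. \<zero>)"
    unfolding kd_def by (rule finsum_cong') (auto simp: pd_outside[OF v i])
  then show ?thesis by simp
qed

lemma ins_Xk: "j \<notin> dec i \<Longrightarrow> ins j i \<in> Xk (Suc q) \<Longrightarrow> i \<in> Xk q" by (auto simp: Xk_def)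

lemma pd_finsupp: "v \<in> finsupp A (Xk (Suc q)) \<Longrightarrow> pd j v \<in> finsupp A (Xk q)"
  by (rule finsupp_Xk) (auto intro!: pd_closed pd_outside dest: ins_Xk simp: finsuppD(1))

lemma kd_finsupp: "v \<in> finsupp A (Xk (Suc q)) \<Longrightarrow> kd v \<in> finsupp A (Xk q)"
  by (rule finsupp_Xk) (auto intro!: kd_closed kd_outside dest: ins_Xk simp: finsuppD(1))

lemma hh_finsupp:
  assumes v: "v \<in> finsupp A (Xk q)"
  shows "hh v \<in> finsupp A (Xk (Suc q))"
proof (rule finsupp_Xk)
  note vc = finsuppD(1)[OF v]
  show "hh v i \<in> carrier A" for i by (rule hh_co(1)[where v = v, OF vc])
  show "hh v i = \<zero>" if i: "i \<notin> Xk (Suc q)" for i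
  proof (rule co_inj)
    show "hh v i \<in> carrier A" by (rule hh_co(1)[where v = v, OF vc])
    have "co (v (rem m i)) (add_mset m u) = \<zero>\<^bsub>K\<^esub>" if m: "m \<in> dec i" for m u
    proof (rule ccontr)
      assume ne: "co (v (rem m i)) (add_mset m u) \<noteq> \<zero>\<^bsub>K\<^esub>"
      then have "m < n" using co_outside[OF vc, of "add_mset m u"] by fastforce
      moreover have "rem m i \<in> Xk q" using ne finsuppD(3)[OF v, of "rem m i"] co_zero by metis
      ultimately have "i \<in> Xk (Suc q)" using card_Suc_Diff1[OF finite_set_decode m] by (auto simp: Xk_def)
      then show False using i by simp
    qed
    then show "co (hh v i) = co \<zero>"
      unfolding hh_co(2)[where v = v, OF vc] fun_eq_iff by (simp add: Let_def)
  qed simp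
qed

lemma aug_kd: "(\<And>i. v i \<in> carrier A) \<Longrightarrow> aug (kd v i) = \<zero>\<^bsub>K\<^esub>"
  using co_kd[of v i "{#}"] by (simp add: aug_co kd_closed)

text \<open>The homotopy formula fails only for the monomial 1 on the empty set, where the augmentation takes
  over.\<close>

lemma exact:
  assumes v: "v \<in> finsupp A (Xk q)" and kd: "\<And>i. kd v i = \<zero>" and z: "q = 0 \<Longrightarrow> aug (v 0) = \<zero>\<^bsub>K\<^esub>"
  shows "kd (hh v) = v"
proof
  fix i
  note vc = finsuppD(1)[OF v] and h = hh_finsupp[OF v]
  note hc = finsuppD(1)[OF h]
  show "kd (hh v) i = v i"
  proof (cases "i \<in> Xk q")
    case False
    then show ?thesis using finsuppD(3)[OF v, of i] finsuppD(3)[OF kd_finsupp[OF h], of i] by simp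
  next
    case True
    show ?thesis
    proof (rule co_inj[OF kd_closed[where v = "hh v", OF hc] vc], rule ext)
      fix u
      consider "\<not> set_mset u \<subseteq> {..<n}" | "set_mset u \<subseteq> {..<n}" "dec i \<noteq> {} \<or> u \<noteq> {#}" | "dec i = {}" "u = {#}" by blast
      then show "co (kd (hh v) i) u = co (v i) u"
      proof cases
        case 1
        then show ?thesis using co_outside[OF kd_closed[where v = "hh v", OF hc]] co_outside[OF vc] by simp
      next
        case 2
        have "co (hh (kd v) i) u = \<zero>\<^bsub>K\<^esub>" using hh_co(2)[of "kd v" i u] kd by (simp add: Let_def)
        then show ?thesis using homotopy[of v i u] 2 True vc kd_closed[where v = "hh v", OF hc] by (simp add: Xk_def)
      next
        case 3
        then have i: "i = 0" "q = 0" using True dec_inj[of i 0] by (auto simp: Xk_def)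
        then have "co (v i) u = \<zero>\<^bsub>K\<^esub>" using z aug_co[OF vc, of 0] 3 by simp
        moreover have "co (kd (hh v) i) u = \<zero>\<^bsub>K\<^esub>"
          using aug_kd[of "hh v" i] hc aug_co[OF kd_closed[where v = "hh v", OF hc]] 3 by simp
        ultimately show ?thesis by simp
      qed
    qed
  qed
qed

definition KC :: "('k, 'a, nat \<Rightarrow> 'a) augmented_complex" where
  "KC = \<lparr>rmod = (\<lambda>q. KP q), rdiff = (\<lambda>q. \<lambda>v \<in> carrier (KP (Suc q)). kd v), raug = (\<lambda>v \<in> carrier (KP 0). aug (v 0))\<rparr>"

lemma KC_simps:
  "rmod KC q = KP q" "v \<in> finsupp A (Xk (Suc q)) \<Longrightarrow> rdiff KC q v = kd v" "v \<in> finsupp A (Xk 0) \<Longrightarrow> raug KC v = aug (v 0)"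
  by (simp_all add: KC_def)

lemma eps_hom: "(\<lambda>v \<in> carrier (KP q). aug (v i)) \<in> graded_hom A (KP q) triv (- int q)"
proof (rule ghomI[OF free_graded_mod])
  fix m v assume "v \<in> part (KP q) m"
  then have "v i \<in> part A (m - int q)" by simp
  then show "aug (v i) \<in> part triv (m + - int q)" using aug_homogeneous[of "v i" "m - int q"] part_carrier by simp
qed (auto simp: finsuppD(1) aug_add aug_mult)

lemma pd_part: "v \<in> part (KP (Suc q)) m \<Longrightarrow> pd j v i \<in> part A (m - 1 - int q)"
proof -
  assume "v \<in> part (KP (Suc q)) m"
  then have "v (ins j i) \<in> part A (m - 1 - int q)" by (simp add: algebra_simps)
  then show ?thesis using part_mult[OF sn_part, of "v (ins j i)" "m - 1 - int q" "above j i"] by (simp add: pd_def)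
qed

lemma kd_hom: "(\<lambda>v \<in> carrier (KP (Suc q)). kd v) \<in> graded_hom A (KP (Suc q)) (KP q) 0"
proof (rule ghomI[OF free_graded_mod])
  fix m v assume v: "v \<in> part (KP (Suc q)) m"
  then have vf: "v \<in> finsupp A (Xk (Suc q))" by simp
  have "x j \<otimes> pd j v i \<in> part A (m - int q)" if "j < n" for i j
    using part_mult[OF x_part[OF that] pd_part[OF v, of j i]] by simp
  then have "kd v i \<in> part A (m - int q)" for i
    unfolding kd_def using part_carrier by (intro finsum_in) auto
  then show "kd v \<in> part (KP q) (m + 0)" using kd_finsupp[OF vf] by simp
qed (auto simp: kd_finsupp finsuppD(1) kd_add kd_smult)

lemma KC_resolution: "free_resolution K A KC"
  unfolding free_resolution_def
proof (intro conjI allI)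
  fix q
  show "\<exists>X w. (\<forall>m :: int. finite {i \<in> X. w i \<le> m}) \<and> rmod KC q = free_module A X w"
    using finite_Xk[of q] by (intro exI[of _ "Xk q"] exI[of _ "\<lambda>_. int q"]) (simp add: KC_simps)
  show "raug KC \<in> graded_hom A (rmod KC 0) triv 0" using eps_hom[of 0 0] by (simp add: KC_def)
  show "rdiff KC q \<in> graded_hom A (rmod KC (Suc q)) (rmod KC q) 0" using kd_hom[of q] by (simp add: KC_def)
  have 0: "0 \<in> Xk 0" by (simp add: Xk_def)
  have "c = raug KC (single A 0 (c \<odot> \<one>))" if "c \<in> carrier K" for c
    using that 0 finsupp_single[of "c \<odot> \<one>" 0 "Xk 0"] by (simp add: KC_simps(3) single_def aug_const)
  then show "raug KC ` carrier (rmod KC 0) = carrier K"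
    using finsupp_single[OF KA.smult_closed[OF _ one_closed] 0] 
    by (force simp: KC_simps finsuppD(1))
  have ex: "v \<in> rdiff KC q ` carrier (rmod KC (Suc q))" 
    if v: "v \<in> finsupp A (Xk q)" "\<And>i. kd v i = \<zero>" "q = 0 \<Longrightarrow> aug (v 0) = \<zero>\<^bsub>K\<^esub>" for v q
  proof (rule image_eqI)
    show "hh v \<in> carrier (rmod KC (Suc q))" using hh_finsupp[OF v(1)] by (simp add: KC_simps)
    show "v = rdiff KC q (hh v)" using exact[OF v] hh_finsupp[OF v(1)] by (simp add: KC_simps)
  qed
  show "{v \<in> carrier (rmod KC 0). raug KC v = \<zero>\<^bsub>K\<^esub>} = rdiff KC 0 ` carrier (rmod KC 1)"
  proof (intro Set.set_eqI iffI)
    fix v assume "v \<in> {v \<in> carrier (rmod KC 0). raug KC v = \<zero>\<^bsub>K\<^esub>}"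
    then have v: "v \<in> finsupp A (Xk 0)" "aug (v 0) = \<zero>\<^bsub>K\<^esub>" by (auto simp: KC_simps)
    have "ins j i \<notin> Xk 0" for i j by (simp add: Xk_def)
    then have "kd v i = \<zero>" for i using kd_outside[OF v(1)] by simp
    then show "v \<in> rdiff KC 0 ` carrier (rmod KC 1)" using ex[OF v(1)] v(2) by simp
  next
    fix v assume "v \<in> rdiff KC 0 ` carrier (rmod KC 1)"
    then obtain y where y: "y \<in> finsupp A (Xk (Suc 0))" "v = kd y" by (auto simp: KC_simps)
    then show "v \<in> {v \<in> carrier (rmod KC 0). raug KC v = \<zero>\<^bsub>K\<^esub>}"
      using kd_finsupp[OF y(1)] aug_kd[of y 0] finsuppD(1)[OF y(1)] by (simp add: KC_simps)
  qed
  show "{v \<in> carrier (rmod KC (Suc q)). rdiff KC q v = \<zero>\<^bsub>rmod KC q\<^esub>} = rdiff KC (Suc q) ` carrier (rmod KC (Suc (Suc q)))"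
  proof (intro Set.set_eqI iffI)
    fix v assume "v \<in> {v \<in> carrier (rmod KC (Suc q)). rdiff KC q v = \<zero>\<^bsub>rmod KC q\<^esub>}"
    then have v: "v \<in> finsupp A (Xk (Suc q))" "kd v = (\<lambda>i. \<zero>)" by (auto simp: KC_simps)
    show "v \<in> rdiff KC (Suc q) ` carrier (rmod KC (Suc (Suc q)))" by (rule ex[OF v(1)]) (simp_all add: v(2))
  next
    fix v assume "v \<in> rdiff KC (Suc q) ` carrier (rmod KC (Suc (Suc q)))"
    then obtain y where y: "y \<in> finsupp A (Xk (Suc (Suc q)))" "v = kd y" by (auto simp: KC_simps)
    have "kd (kd y) = (\<lambda>i. \<zero>)" by (rule ext) (rule kd_kd, rule finsuppD(1)[OF y(1)])
    then show "v \<in> {v \<in> carrier (rmod KC (Suc q)). rdiff KC q v = \<zero>\<^bsub>rmod KC q\<^esub>}"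
      using kd_finsupp[OF y(1)] y(2) by (simp add: KC_simps)
  qed
qed

definition eps :: "nat \<Rightarrow> nat \<Rightarrow> (nat \<Rightarrow> 'a) \<Rightarrow> 'k" where
  "eps q i = (\<lambda>v \<in> carrier (KP q). aug (v i))"

definition ctr :: "nat \<Rightarrow> nat \<Rightarrow> (nat \<Rightarrow> 'a) \<Rightarrow> nat \<Rightarrow> 'a" where
  "ctr m r = (\<lambda>v \<in> carrier (KP (Suc r)). \<lambda>i. sn r \<otimes> pd m v i)"

lemma ctr_hom: "ctr m r \<in> graded_hom A (KP (Suc r)) (KP r) (- 1)"
  unfolding ctr_def
proof (rule ghomI[OF free_graded_mod])
  fix d v assume v: "v \<in> part (KP (Suc r)) d"
  then have "(\<lambda>i. sn r \<otimes> pd m v i) \<in> finsupp A (Xk r)" by (simp add: finsupp_smult pd_finsupp)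
  moreover have "sn r \<otimes> pd m v i \<in> part A (d - 1 - int r)" for i using part_mult[OF sn_part pd_part[OF v]] by simp
  ultimately show "(\<lambda>i. sn r \<otimes> pd m v i) \<in> part (KP r) (d + - 1)" by simp
qed (auto simp: finsupp_smult pd_finsupp pd_add pd_smult finsuppD(1) r_distr m_lcomm pd_closed)

text \<open>The contraction with a coordinate form anticommutes with the Koszul differential; with
  alternating signs it is a chain map, which lifts that form.\<close>

lemma ctr_lifts: "lifts A KC 1 1 (eps 1 (ins m 0)) (ctr m)"
  unfolding lifts_def
proof (intro conjI allI ballI)
  fix r v
  show "ctr m r \<in> graded_hom A (rmod KC (1 + r)) (rmod KC r) (- 1)" using ctr_hom[of m r] by (simp add: KC_simps)
  show "raug KC (ctr m 0 v) = eps 1 (ins m 0) v" if "v \<in> carrier (rmod KC 1)"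
  proof -
    have v: "v \<in> finsupp A (Xk (Suc 0))" using that by (simp add: KC_simps)
    have "pd m v 0 = v (ins m 0)" using finsuppD(1)[OF v] by (simp add: pd_def above_def)
    then show ?thesis using v ghom_closed[OF ctr_hom[of m 0], of v] finsuppD(1)[OF v]
      by (simp add: KC_simps ctr_def eps_def)
  qed
  show "rdiff KC r (ctr m (Suc r) v) = ctr m r (rdiff KC (1 + r) v)" if "v \<in> carrier (rmod KC (1 + Suc r))"
  proof -
    have v: "v \<in> finsupp A (Xk (Suc (Suc r)))" using that by (simp add: KC_simps)
    note vc = finsuppD(1)[OF v] and kf = kd_finsupp[OF v]
    have "kd (\<lambda>i. sn (Suc r) \<otimes> pd m v i) i = sn r \<otimes> pd m (kd v) i" for i
      using kd_smult[of "sn (Suc r)" "pd m v" i] kd_pd[of v m i] vc pd_closed[of v m] pd_closed[of "kd v" m i] kd_closed[of v]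
      by (simp add: sn_Suc l_minus r_minus)
    then show ?thesis using v kf ghom_closed[OF ctr_hom[of m "Suc r"], of v]
      by (auto simp: KC_simps ctr_def)
  qed
qed

text \<open>All cochains on the Koszul complex are cocycles. Up to sign, its dual basis consists of
  products of classes of degree 1: a set is reached from the empty one by adding variables in
  increasing order.\<close>

theorem K2: "K2_algebra K A"
proof -
  interpret R: resolution K A KC by unfold_locales (rule KC_resolution)
  have epsZ: "eps q i \<in> R.Z q (int q)" for q i
    unfolding R.Z_iff using eps_hom[where i = i and q = q] ghom_closed[OF R.rdiff_hom[of q]] kd_finsupp
    by (auto simp: R.Ch_simps KC_simps eps_def aug_kd finsuppD(1))
  have epsG: "eps q i \<in> R.G q (int q)" if "i \<in> Xk q" for q i
    using that
  proof (induction q arbitrary: i)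
    case 0
    show ?case using R.G_0[OF epsZ[of 0 i, simplified]] by simp
  next
    case (Suc q)
    define m where "m = Max (dec i)"
    have i: "dec i \<subseteq> {..<n}" "card (dec i) = Suc q" using Suc(2) by (auto simp: Xk_def)
    then have m: "m \<in> dec i" unfolding m_def by (intro Max_in) auto
    have max: "above m (rem m i) = 0" by (rule above_eq_0) (auto simp: m_def)
    have "rem m i \<in> Xk q" using i m by (auto simp: Xk_def)
    moreover have "eps 1 (ins m 0) \<in> R.G 1 1" using epsZ[of 1 "ins m 0"] by (intro R.G_low) simp_all
    ultimately have g: "compose (carrier (rmod KC (1 + q))) (eps q (rem m i)) (ctr m q) \<in> R.G (1 + q) (int q + 1)" (is "?h \<in> _")
      using R.G_mult[OF Suc.IH[of "rem m i"] _ ctr_lifts] by blast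
    \<comment> \<open>The sign comes from the chain map \<open>ctr\<close>; contraction with the largest variable has none.\<close>
    have "eps (Suc q) i = aug (sn q) \<odot>\<^bsub>R.Ch (Suc q) (int q + 1)\<^esub> ?h"
    proof (rule extensionalityI[of _ "carrier (rmod KC (Suc q))"])
      fix v assume "v \<in> carrier (rmod KC (Suc q))"
      then have v: "v \<in> finsupp A (Xk (Suc q))" by (simp add: KC_simps)
      note vc = finsuppD(1)[OF v]
      have e: "pd m v (rem m i) = v i" using max ins_rem[OF m] vc by (simp add: pd_def)
      have "?h v = aug (sn q \<otimes> v i)"
        using v ghom_closed[OF ctr_hom[of m q], of v] by (simp add: compose_eq KC_simps eps_def ctr_def e)
      moreover have "sn q \<otimes> (sn q \<otimes> v i) = v i" using sn_sn[OF vc, of q q i] vc by (simp add: sn_def)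
      then have "aug (sn q) \<otimes>\<^bsub>K\<^esub> aug (sn q \<otimes> v i) = aug (v i)" using aug_mult[of "sn q" "sn q \<otimes> v i"] vc by simp
      ultimately show "eps (Suc q) i v = (aug (sn q) \<odot>\<^bsub>R.Ch (Suc q) (int q + 1)\<^esub> ?h) v"
        using v by (simp add: R.Ch_simps KC_simps eps_def)
    qed (simp_all add: eps_def R.Ch_simps KC_simps)
    then show ?case using R.G_smult[OF _ g, of "aug (sn q)"] by (simp add: add.commute)
  qed
  have zeroG: "\<zero>\<^bsub>R.Ch q m\<^esub> \<in> R.G q m" for q m
    by (rule R.G_Bd) (rule additive_subgroup.zero_closed[OF abelian_subgroup.axioms(1)[OF R.Bd_subgroup]])
  have "f \<in> R.G q m" if f: "f \<in> R.Z q m" for f q m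
  proof -
    have fh: "f \<in> graded_hom A (KP q) triv (- m)" using R.Z_hom[OF f] by (simp add: KC_simps)
    let ?b = "\<lambda>i. f (single A i \<one>)"
    have b: "?b i \<in> part triv (int q - m)" if "i \<in> Xk q" for i
      using ghom_part[OF fh basis_part[OF that, of "\<lambda>_. int q"]] by simp
    have bK: "?b i \<in> carrier K" if "i \<in> Xk q" for i using b[OF that] by (simp split: if_splits)
    have fext: "f \<in> extensional (carrier (KP q))" using fh by (simp add: graded_hom_def PiE_def)
    show ?thesis
    proof (cases "m = int q")
      case False
      have "f v = (\<lambda>v \<in> carrier (KP q). \<zero>\<^bsub>triv\<^esub>) v" if v: "v \<in> finsupp A (Xk q)" for v
      proof (rule free_eqI[OF trivial_graded_mod fh ghom_null[OF free_graded_mod trivial_graded_mod] _ v])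
        fix i assume i: "i \<in> Xk q"
        then show "?b i = (\<lambda>v \<in> carrier (KP q). \<zero>\<^bsub>triv\<^esub>) (single A i \<one>)"
          using b[OF i] False finsupp_single[OF one_closed i] by simp
      qed
      then have "f = \<zero>\<^bsub>R.Ch q m\<^esub>"
        using fext by (intro extensionalityI[of _ "carrier (KP q)"]) (auto simp: R.Ch_simps KC_simps)
      then show ?thesis using zeroG by simp
    next
      case True
      let ?s = "\<lambda>F. \<lambda>v \<in> carrier (KP q). \<Oplus>\<^bsub>K\<^esub>i \<in> F. ?b i \<otimes>\<^bsub>K\<^esub> aug (v i)"
      have "?s F \<in> R.G q (int q)" if "finite F" "F \<subseteq> Xk q" for F
        using that
      proof (induction F)
        case empty
        show ?case using zeroG[of q "int q"] by (simp add: R.Ch_simps KC_simps restrict_def)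
      next
        case (insert i F)
        have "(?b i \<odot>\<^bsub>R.Ch q (int q)\<^esub> eps q i) \<oplus>\<^bsub>R.Ch q (int q)\<^esub> ?s F \<in> R.G q (int q)"
          using insert(4) by (intro R.G_add R.G_smult bK epsG insert.IH) simp_all
        also have "(?b i \<odot>\<^bsub>R.Ch q (int q)\<^esub> eps q i) \<oplus>\<^bsub>R.Ch q (int q)\<^esub> ?s F = ?s (insert i F)"
        proof (rule extensionalityI[of _ "carrier (KP q)"])
          fix v assume v: "v \<in> carrier (KP q)"
          then have "(\<lambda>i. ?b i \<otimes>\<^bsub>K\<^esub> aug (v i)) \<in> insert i F \<rightarrow> carrier K" 
            using insert(4) bK finsuppD(1)[of v "Xk q"] by auto
          then show "((?b i \<odot>\<^bsub>R.Ch q (int q)\<^esub> eps q i) \<oplus>\<^bsub>R.Ch q (int q)\<^esub> ?s F) v = ?s (insert i F) v"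
            using v insert(1,2) by (simp add: R.Ch_simps KC_simps eps_def)
        qed (simp_all add: R.Ch_simps KC_simps)
        finally show ?case .
      qed
      then have s: "?s (Xk q) \<in> R.G q (int q)" using finite_Xk by simp
      have "?s (Xk q) (single A k \<one>) = ?b k" if k: "k \<in> Xk q" for k
      proof -
        have "(\<Oplus>\<^bsub>K\<^esub>i \<in> Xk q. ?b i \<otimes>\<^bsub>K\<^esub> aug (single A k \<one> i)) = (\<Oplus>\<^bsub>K\<^esub>i \<in> Xk q. if k = i then ?b i else \<zero>\<^bsub>K\<^esub>)"
          by (rule K.finsum_cong') (use bK in \<open>auto simp: single_def\<close>)
        also have "\<dots> = ?b k" using K.finsum_singleton[OF k finite_Xk, of ?b] bK by auto
        finally show ?thesis using finsupp_single[OF one_closed k] by simp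
      qed
      then have "f v = ?s (Xk q) v" if v: "v \<in> finsupp A (Xk q)" for v
        using free_eqI[OF trivial_graded_mod fh _ _ v, of "?s (Xk q)" "- int q"] R.Z_hom[OF R.G_Z[OF s]] by (simp add: KC_simps)
      then have "f = ?s (Xk q)" using fext by (intro extensionalityI[of _ "carrier (KP q)"]) auto
      then show ?thesis using s True by simp
    qed
  qed
  then have "generated_subalgebra K (yoneda_algebra K A KC)
      (yoneda_component K A KC 1 \<union> yoneda_component K A KC 2) = carrier (yoneda_algebra K A KC)"
    by (intro R.generatedI) blast
  moreover have "presents K n PR.commutators A (p \<circ> PR.ab)"
  proof -
    note ab = PR.polynomial_presents[unfolded presents_def Let_def]
    have abc: "PR.ab t \<in> carrier PR.S" if "t \<in> carrier PR.T" for t using PR.ab_closed that by (simp add: PR.T.M_simps PR.S.M_simps)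
    have z: "\<zero>\<^bsub>PR.S\<^esub> \<in> carrier PR.S" by (simp add: PR.S.M_simps K.finsupp_zero)
    have "(p \<circ> PR.ab) t = \<zero> \<longleftrightarrow> t \<in> Idl\<^bsub>PR.T\<^esub> PR.commutators" if t: "t \<in> carrier PR.T" for t
      using inj_onD[OF p_inj _ abc[OF t] z] ring_hom_zero[OF p_hom PR.S.M_ring ring_axioms] PR.ab_kernel[OF t] by auto
    moreover have "(p \<circ> PR.ab) (c \<odot>\<^bsub>PR.T\<^esub> t) = c \<odot> (p \<circ> PR.ab) t" if "c \<in> carrier K" "t \<in> carrier PR.T" for c t
      using p_smult[OF that(1) abc[OF that(2)]] ab that by simp
    moreover have "(p \<circ> PR.ab) ` part PR.T m = part A m" for m by (simp only: image_comp[symmetric] PR.ab_part_onto p_part)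
    ultimately show ?thesis
      unfolding presents_def Let_def using ring_hom_trans[OF PR.ab_hom p_hom] ab by blast
  qed
  ultimately show ?thesis
    unfolding K2_algebra_def using graded_algebraI[OF connected] KC_resolution by blast
qed

end

section \<open>Complete intersections\<close>

lemma polynomial_K2:
  assumes "field K" and S: "S = polynomial_algebra K n"
  shows "K2_algebra K (quotient_algebra S (Idl\<^bsub>S\<^esub> {}))" "Idl\<^bsub>S\<^esub> {} = {\<zero>\<^bsub>S\<^esub>}"
proof -
  interpret PR: polynomial_ring K n using assms(1) by (rule polynomial_ring.intro)
  interpret S: comm_graded_alg K S unfolding S by unfold_locales (rule PR.S.M_connected, rule PR.S_commutative)
  interpret I: ideal "Idl\<^bsub>S\<^esub> {}" S by (rule S.genideal_ideal) simp
  have "Idl\<^bsub>S\<^esub> {} \<subseteq> {\<zero>\<^bsub>S\<^esub>}" by (rule S.genideal_minimal[OF S.zeroideal]) simp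
  then show z: "Idl\<^bsub>S\<^esub> {} = {\<zero>\<^bsub>S\<^esub>}" using I.zero_closed by blast
  have gi: "graded_ideal K S (Idl\<^bsub>S\<^esub> {})" by (intro graded_ideal.intro S.graded_alg_axioms I.ideal_axioms)
  interpret J: graded_ideal K S "Idl\<^bsub>S\<^esub> {}" by (rule gi)
  have "Idl\<^bsub>S\<^esub> {} \<noteq> carrier S" using S.one_neq_zero S.one_closed unfolding z by blast
  then have conn: "connected_graded_algebra K J.Q" by (intro J.Q_connected) (simp_all add: z)
  interpret koszul K J.Q n "\<lambda>a. Idl\<^bsub>S\<^esub> {} +>\<^bsub>S\<^esub> a"
  proof
    show "connected_graded_algebra K J.Q" by (rule conn)
    show "commutative_algebra J.Q" by (rule quotient_commutative[OF gi S.commutative])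
    show "(\<lambda>a. Idl\<^bsub>S\<^esub> {} +>\<^bsub>S\<^esub> a) \<in> ring_hom (polynomial_algebra K n) J.Q" using J.coset_hom unfolding S .
    show "inj_on (\<lambda>a. Idl\<^bsub>S\<^esub> {} +>\<^bsub>S\<^esub> a) (carrier (polynomial_algebra K n))"
    proof (rule inj_onI)
      fix a b assume ab: "a \<in> carrier (polynomial_algebra K n)" "b \<in> carrier (polynomial_algebra K n)"
        "Idl\<^bsub>S\<^esub> {} +>\<^bsub>S\<^esub> a = Idl\<^bsub>S\<^esub> {} +>\<^bsub>S\<^esub> b"
      then have c: "a \<in> carrier S" "b \<in> carrier S" by (simp_all add: S)
      have "a \<oplus>\<^bsub>S\<^esub> \<ominus>\<^bsub>S\<^esub> b = \<zero>\<^bsub>S\<^esub>" using J.coset_eq_iff[OF c] ab(3) unfolding z by blast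
      then show "a = b" using c S.add_minus_zeroD by blast
    qed
  qed (use J.Q_smult J.Q_part J.Q_carrier in \<open>simp_all add: S\<close>)
  show "K2_algebra K (quotient_algebra S (Idl\<^bsub>S\<^esub> {}))" by (rule K2)
qed

text \<open>By commutativity the multiples of \<open>f\<close> form an ideal.\<close>

lemma (in comm_graded_alg) genideal_insert:
  assumes X: "X \<subseteq> carrier A" and f: "f \<in> carrier A"
  shows "Idl (insert f X) = {a \<oplus> f \<otimes> s | a s. a \<in> Idl X \<and> s \<in> carrier A}"
proof -
  interpret I: ideal "Idl X" A by (rule genideal_ideal[OF X])
  interpret J: ideal "Idl (insert f X)" A using X f by (intro genideal_ideal) simp
  have eq: "Idl X <+> PIdl f = {a \<oplus> f \<otimes> s | a s. a \<in> Idl X \<and> s \<in> carrier A}"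
  proof -
    have pf: "PIdl f = {f \<otimes> s | s. s \<in> carrier A}" unfolding cgenideal_def using f m_comm by blast
    show ?thesis unfolding set_add_def' pf by blast
  qed
  have XI: "X \<subseteq> Idl X" by (rule genideal_self[OF X])
  have XJ: "insert f X \<subseteq> Idl (insert f X)" using X f by (intro genideal_self) simp
  have "insert f X \<subseteq> {a \<oplus> f \<otimes> s | a s. a \<in> Idl X \<and> s \<in> carrier A}"
  proof
    fix y assume y: "y \<in> insert f X"
    show "y \<in> {a \<oplus> f \<otimes> s | a s. a \<in> Idl X \<and> s \<in> carrier A}"
    proof (cases "y = f")
      case True
      then show ?thesis using f I.zero_closed by (intro CollectI exI[of _ \<zero>] exI[of _ \<one>] conjI) simp_all
    next
      case False
      then show ?thesis using y f XI X by (intro CollectI exI[of _ y] exI[of _ \<zero>] conjI) auto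
    qed
  qed
  then have "Idl (insert f X) \<subseteq> {a \<oplus> f \<otimes> s | a s. a \<in> Idl X \<and> s \<in> carrier A}"
    unfolding eq[symmetric] by (rule genideal_minimal[OF add_ideals[OF I.is_ideal cgenideal_ideal[OF f]]])
  have sub: "Idl X \<subseteq> Idl (insert f X)" by (rule genideal_minimal[OF J.is_ideal]) (use XJ in blast)
  have "a \<oplus> f \<otimes> s \<in> Idl (insert f X)" if "a \<in> Idl X" "s \<in> carrier A" for a s
    by (rule J.a_closed[OF subsetD[OF sub that(1)] J.I_r_closed[OF subsetD[OF XJ insertI1] that(2)]])
  then have "{a \<oplus> f \<otimes> s | a s. a \<in> Idl X \<and> s \<in> carrier A} \<subseteq> Idl (insert f X)" by blast
  with \<open>Idl (insert f X) \<subseteq> _\<close> show ?thesis by (rule Set.equalityI)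
qed

text \<open>\<open>S/(X, f)\<close> is the quotient of \<open>S/(X)\<close> by the class of \<open>f\<close>.\<close>

lemma (in comm_graded_alg) K2_adjoin:
  assumes X: "X \<subseteq> carrier A" and f: "f \<in> part A d" "1 < d"
    and hom: "\<And>a m. a \<in> Idl X \<Longrightarrow> hcomp A m a \<in> Idl X" and K2: "K2_algebra K (quotient_algebra A (Idl X))"
    and reg: "regular (quotient_algebra A (Idl X)) (Idl X +> f)" and proper: "Idl (insert f X) \<noteq> carrier A"
  shows "K2_algebra K (quotient_algebra A (Idl (insert f X)))" 
    and "\<And>a m. a \<in> Idl (insert f X) \<Longrightarrow> hcomp A m a \<in> Idl (insert f X)"
proof -
  let ?I = "Idl X" and ?J = "Idl (insert f X)"
  have fc: "f \<in> carrier A" by (rule part_carrier[OF f(1)])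
  note J_eq = genideal_insert[OF X fc]
  have giI: "graded_ideal K A ?I" by (intro graded_ideal.intro graded_alg_axioms genideal_ideal X)
  have giJ: "graded_ideal K A ?J" using X fc by (intro graded_ideal.intro graded_alg_axioms genideal_ideal) simp
  interpret I: graded_ideal K A ?I by (rule giI)
  interpret J: graded_ideal K A ?J by (rule giJ)
  have IJ: "?I \<subseteq> ?J"
  proof
    fix a assume a: "a \<in> ?I"
    then have "a = a \<oplus> f \<otimes> \<zero>" using fc I.Icarr by simp
    then show "a \<in> ?J" using a unfolding J_eq by blast
  qed
  show homJ: "hcomp A m a \<in> ?J" if a: "a \<in> ?J" for a m
  proof -
    obtain b s where b: "a = b \<oplus> f \<otimes> s" "b \<in> ?I" "s \<in> carrier A" using a unfolding J_eq by blast
    have "hcomp A m a = hcomp A m b \<oplus> f \<otimes> hcomp A (m - d) s"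
      unfolding b(1) using b(2,3) I.Icarr fc by (simp add: hcomp_add hcomp_mult_left[OF _ f(1)])
    then show ?thesis using hom[OF b(2)] b(3) unfolding J_eq by blast
  qed
  have conn: "connected_graded_algebra K J.Q" by (rule J.Q_connected[OF homJ proper])
  define \<pi> where "\<pi> Y = ?J +> inv_into (carrier A) (\<lambda>a. ?I +> a) Y" for Y
  have pi: "\<pi> (?I +> a) = ?J +> a" if a: "a \<in> carrier A" for a
  proof -
    let ?b = "inv_into (carrier A) (\<lambda>a. ?I +> a) (?I +> a)"
    have b: "?b \<in> carrier A" "?I +> ?b = ?I +> a"
      using inv_into_into[of "?I +> a" "\<lambda>a. ?I +> a" "carrier A"] f_inv_into_f[of "?I +> a" "\<lambda>a. ?I +> a" "carrier A"] a by simp_all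
    then show ?thesis unfolding \<pi>_def J.coset_eq_iff[OF b(1) a] using I.coset_eq_iff[OF b(1) a] IJ by blast
  qed
  show "K2_algebra K J.Q"
  proof (rule K2_hypersurface[OF K2 quotient_commutative[OF giI commutative] conn quotient_commutative[OF giJ commutative] _ _ _ _ _ f(2) reg])
    show "\<pi> \<in> ring_hom I.Q J.Q"
    proof (rule ring_hom_memI)
      show "\<pi> \<one>\<^bsub>I.Q\<^esub> = \<one>\<^bsub>J.Q\<^esub>" by (simp only: I.Q_one J.Q_one pi[OF one_closed])
    qed (auto simp: I.Q_carrier J.Q_carrier pi I.Q_mult I.Q_add J.Q_mult J.Q_add)
    show "\<pi> (c \<odot>\<^bsub>I.Q\<^esub> y) = c \<odot>\<^bsub>J.Q\<^esub> \<pi> y" if "c \<in> carrier K" "y \<in> carrier I.Q" for c y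
      using that by (auto simp: I.Q_carrier pi I.Q_smult J.Q_smult)
    show "\<pi> ` part I.Q m = part J.Q m" for m
      unfolding I.Q_part J.Q_part image_image by (rule image_cong[OF refl pi[OF part_carrier]])
    show "?I +> f \<in> part I.Q d" unfolding I.Q_part using f(1) by (rule imageI)
    show "(\<pi> y = \<zero>\<^bsub>J.Q\<^esub>) = (\<exists>b \<in> carrier I.Q. y = (?I +> f) \<otimes>\<^bsub>I.Q\<^esub> b)" if y: "y \<in> carrier I.Q" for y
    proof -
      obtain a where a: "a \<in> carrier A" "y = ?I +> a" using y unfolding I.Q_carrier by (elim imageE) (rule that)
      have "\<pi> y = \<zero>\<^bsub>J.Q\<^esub> \<longleftrightarrow> a \<in> ?J" unfolding a(2) pi[OF a(1)] by (rule J.Q_zero_iff[OF a(1)])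
      also have "\<dots> \<longleftrightarrow> (\<exists>s \<in> carrier A. a \<oplus> \<ominus> (f \<otimes> s) \<in> ?I)"
      proof
        assume "a \<in> ?J"
        then obtain b s where b: "a = b \<oplus> f \<otimes> s" "b \<in> ?I" "s \<in> carrier A" unfolding J_eq by blast
        have "a \<oplus> \<ominus> (f \<otimes> s) = b" unfolding b(1) using b(2,3) I.Icarr fc by (simp add: a_assoc r_neg)
        then show "\<exists>s \<in> carrier A. a \<oplus> \<ominus> (f \<otimes> s) \<in> ?I" using b(2,3) by blast
      next
        assume "\<exists>s \<in> carrier A. a \<oplus> \<ominus> (f \<otimes> s) \<in> ?I"
        then obtain s where s: "s \<in> carrier A" "a \<oplus> \<ominus> (f \<otimes> s) \<in> ?I" by blast
        have "a = (a \<oplus> \<ominus> (f \<otimes> s)) \<oplus> f \<otimes> s" using a(1) s(1) fc by (simp add: a_assoc l_neg)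
        then show "a \<in> ?J" using s unfolding J_eq by blast
      qed
      also have "\<dots> \<longleftrightarrow> (\<exists>s \<in> carrier A. y = (?I +> f) \<otimes>\<^bsub>I.Q\<^esub> (?I +> s))"
        using a fc by (intro bex_cong refl) (simp add: I.Q_mult I.coset_eq_iff)
      also have "\<dots> \<longleftrightarrow> (\<exists>b \<in> carrier I.Q. y = (?I +> f) \<otimes>\<^bsub>I.Q\<^esub> b)" unfolding I.Q_carrier by blast
      finally show ?thesis .
    qed
  qed
qed

text \<open>The ideals generated by the initial segments of the sequence form a chain of hypersurface quotients
  that starts with \<open>S/(0)\<close>.\<close>

theorem K2_complete_intersection:
  assumes K: "field K" and S: "S = polynomial_algebra K n"
    and deg: "\<And>f. f \<in> set fs \<Longrightarrow> \<exists>e \<ge> 2. f \<in> part S e" and reg: "regular_sequence S fs"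
  shows "K2_algebra K (quotient_algebra S (Idl\<^bsub>S\<^esub> (set fs)))"
proof -
  interpret PR: polynomial_ring K n using K by (rule polynomial_ring.intro)
  interpret S: comm_graded_alg K S unfolding S by unfold_locales (rule PR.S.M_connected, rule PR.S_commutative)
  have "K2_algebra K (quotient_algebra S (Idl\<^bsub>S\<^esub> (set (take i fs)))) \<and>
      (\<forall>a m. a \<in> Idl\<^bsub>S\<^esub> (set (take i fs)) \<longrightarrow> hcomp S m a \<in> Idl\<^bsub>S\<^esub> (set (take i fs)))" if "i \<le> length fs" for i
    using that
  proof (induction i)
    case 0
    show ?case using polynomial_K2[OF K S] by simp
  next
    case (Suc i)
    let ?X = "set (take i fs)"
    have X: "?X \<subseteq> carrier S" "set fs \<subseteq> carrier S" using reg set_take_subset[of i fs] by (auto simp: regular_sequence_def)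
    obtain e where e: "e \<ge> 2" "fs ! i \<in> part S e" using deg[of "fs ! i"] Suc(2) by auto
    have take: "set (take (Suc i) fs) = insert (fs ! i) ?X" using Suc(2) by (simp add: take_Suc_conv_app_nth)
    have "Idl\<^bsub>S\<^esub> (insert (fs ! i) ?X) \<subseteq> Idl\<^bsub>S\<^esub> (set fs)"
      unfolding take[symmetric] by (rule S.subset_Idl_subset[OF X(2) set_take_subset])
    moreover interpret F: ideal "Idl\<^bsub>S\<^esub> (set fs)" S by (rule S.genideal_ideal[OF X(2)])
    have "Idl\<^bsub>S\<^esub> (set fs) \<noteq> carrier S" using reg by (simp add: regular_sequence_def)
    ultimately have proper: "Idl\<^bsub>S\<^esub> (insert (fs ! i) ?X) \<noteq> carrier S" using F.Icarr by blast
    have r: "regular (quotient_algebra S (Idl\<^bsub>S\<^esub> ?X)) (Idl\<^bsub>S\<^esub> ?X +>\<^bsub>S\<^esub> (fs ! i))"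
      using reg Suc(2) by (simp add: regular_sequence_def Let_def)
    have IH: "K2_algebra K (quotient_algebra S (Idl\<^bsub>S\<^esub> ?X))" "\<And>a m. a \<in> Idl\<^bsub>S\<^esub> ?X \<Longrightarrow> hcomp S m a \<in> Idl\<^bsub>S\<^esub> ?X"
      using Suc by auto
    show ?case unfolding take
      using S.K2_adjoin[OF X(1) e(2) _ IH(2,1) r proper] e(1) by simp
  qed
  from this[of "length fs"] show ?thesis by simp
qed

theorem corollary9p2:
  fixes K :: "('k, 'z) ring_scheme"
  assumes "field K"
  shows "(\<forall>(A :: ('k, 'a) graded) g d.
            K2_algebra K A \<and> (commutative_algebra A \<or> graded_commutative_algebra A) \<and>
            d > 1 \<and> g \<in> part A d \<and> regular A g \<longrightarrow>
            K2_algebra K (quotient_algebra A (g <#\<^bsub>A\<^esub> carrier A))) \<and>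
         (\<forall>n fs. let S = polynomial_algebra K n in
            (\<forall>f \<in> set fs. \<exists>e \<ge> 2. f \<in> part S e) \<and> regular_sequence S fs \<longrightarrow>
            K2_algebra K (quotient_algebra S (Idl\<^bsub>S\<^esub> (set fs))))"
  unfolding Let_def
proof (intro conjI allI impI)
  fix A :: "('k, 'a) graded" and g d
  assume "K2_algebra K A \<and> (commutative_algebra A \<or> graded_commutative_algebra A) \<and>
    d > 1 \<and> g \<in> part A d \<and> regular A g"
  then show "K2_algebra K (quotient_algebra A (g <#\<^bsub>A\<^esub> carrier A))" by (elim conjE) (rule K2_quotient)
next
  fix n fs
  assume "(\<forall>f \<in> set fs. \<exists>e \<ge> 2. f \<in> part (polynomial_algebra K n) e) \<and> regular_sequence (polynomial_algebra K n) fs"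
  then show "K2_algebra K (quotient_algebra (polynomial_algebra K n) (Idl\<^bsub>polynomial_algebra K n\<^esub> (set fs)))"
    using K2_complete_intersection[OF assms refl, of fs n] by simp
qed

end
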